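(* Let $A=\Omega\setminus\overline{\omega}$, where $\Omega,\omega\subset\mathbb{R}^2$ are smooth bounded simply connected domains with $\overline{\omega}\subset\Omega$. Fix $\Lambda>0$. There exists $\varepsilon_0=\varepsilon_0(\Lambda)>0$ such that if $0<\varepsilon<\varepsilon_0$, then for any integer $d$ and any $u\in H^1(A;\mathbb{R}^2)$ satisfying $E_\varepsilon(u)\le\Lambda$, $$d-\tfrac12\le \mathrm{abdeg}(u)\le d+\tfrac12\iff d-\tfrac12<\mathrm{abdeg}(u)<d+\tfrac12 .$$
   Context: $a\times b=a_1b_2-a_2b_1$ for $a,b\in\mathbb{R}^2$. The Ginzburg-Landau energy is $E_\varepsilon(u)=\frac12\int_A|\nabla u|^2dx+\frac1{4\varepsilon^2}\int_A(|u|^2-1)^2dx$. Let $V$ be the solution of $\Delta V=0$ in $A$, $V=1$ on $\partial\Omega$, $V=0$ on $\partial\omega$. The approximate bulk degree is $$\mathrm{abdeg}(u)=\frac1{2\pi}\int_A u\times(\partial_{x_1}V\,\partial_{x_2}u-\partial_{x_2}V\,\partial_{x_1}u)\,dx .$$ *)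

theory Defs
  imports "HOL-Analysis.Analysis"
begin

definition partial_deriv :: "'n::finite \<Rightarrow> (real^'n \<Rightarrow> real) \<Rightarrow> real^'n \<Rightarrow> real" where
  "partial_deriv i f x = frechet_derivative f (at x) (axis i 1)"

text \<open>The recursion is the usual C-k notion only when \<open>S\<close> is open.\<close>

primrec Ck_on :: "nat \<Rightarrow> (real^'n::finite) set \<Rightarrow> (real^'n \<Rightarrow> real) \<Rightarrow> bool" where
  "Ck_on 0 S f \<longleftrightarrow> continuous_on S f"
| "Ck_on (Suc k) S f \<longleftrightarrow>
     (\<forall>x\<in>S. f differentiable at x) \<and> (\<forall>i. Ck_on k S (partial_deriv i f))"

definition smooth_on :: "(real^'n::finite) set \<Rightarrow> (real^'n \<Rightarrow> real) \<Rightarrow> bool" where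
  "smooth_on S f \<longleftrightarrow> (\<forall>k. Ck_on k S f)"

definition laplacian :: "(real^'n::finite \<Rightarrow> real) \<Rightarrow> real^'n \<Rightarrow> real" where
  "laplacian f x = (\<Sum>i\<in>UNIV. partial_deriv i (partial_deriv i f) x)"

text \<open>The boundary is locally the zero set of a smooth function with nonvanishing gradient,
  the domain lying on the negative side.\<close>

definition smooth_domain :: "(real^'n::finite) set \<Rightarrow> bool" where
  "smooth_domain S \<longleftrightarrow> open S \<and> connected S \<and> S \<noteq> {} \<and>
     (\<forall>p\<in>frontier S. \<exists>U \<rho>. open U \<and> p \<in> U \<and> smooth_on U \<rho> \<and>
        (\<forall>x\<in>U. \<exists>i. partial_deriv i \<rho> x \<noteq> 0) \<and> S \<inter> U = {x\<in>U. \<rho> x < 0})"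

definition test_function :: "(real^'n::finite) set \<Rightarrow> (real^'n \<Rightarrow> real) \<Rightarrow> bool" where
  "test_function A \<phi> \<longleftrightarrow> smooth_on UNIV \<phi> \<and>
     compact (closure {x. \<phi> x \<noteq> 0}) \<and> closure {x. \<phi> x \<noteq> 0} \<subseteq> A"

definition locally_integrable :: "(real^'n::finite) set \<Rightarrow> (real^'n \<Rightarrow> real) \<Rightarrow> bool" where
  "locally_integrable A f \<longleftrightarrow> (\<forall>K. compact K \<and> K \<subseteq> A \<longrightarrow> set_integrable lebesgue K f)"

definition has_weak_partial ::
    "(real^'n::finite) set \<Rightarrow> 'n \<Rightarrow> (real^'n \<Rightarrow> real) \<Rightarrow> (real^'n \<Rightarrow> real) \<Rightarrow> bool" where
  "has_weak_partial A i f g \<longleftrightarrow> locally_integrable A f \<and> locally_integrable A g \<and>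
     (\<forall>\<phi>. test_function A \<phi> \<longrightarrow>
        (LINT x:A|lebesgue. f x * partial_deriv i \<phi> x) = - (LINT x:A|lebesgue. g x * \<phi> x))"

text \<open>Weak derivatives are unique only up to null sets; this picks a representative.
  It is meaningful only if a weak derivative exists.\<close>

definition weak_partial ::
    "(real^'n::finite) set \<Rightarrow> 'n \<Rightarrow> (real^'n \<Rightarrow> real) \<Rightarrow> real^'n \<Rightarrow> real" where
  "weak_partial A i f = (SOME g. has_weak_partial A i f g)"

definition L2_on :: "(real^'n::finite) set \<Rightarrow> (real^'n \<Rightarrow> real) \<Rightarrow> bool" where
  "L2_on A f \<longleftrightarrow> set_borel_measurable lebesgue A f \<and> set_integrable lebesgue A (\<lambda>x. (f x)\<^sup>2)"

definition H1_on :: "(real^'n::finite) set \<Rightarrow> (real^'n \<Rightarrow> real) \<Rightarrow> bool" where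
  "H1_on A f \<longleftrightarrow> L2_on A f \<and>
     (\<forall>i. (\<exists>g. has_weak_partial A i f g) \<and> L2_on A (weak_partial A i f))"

definition H1_vec_on :: "(real^'n::finite) set \<Rightarrow> (real^'n \<Rightarrow> real^'m::finite) \<Rightarrow> bool" where
  "H1_vec_on A u \<longleftrightarrow> (\<forall>j. H1_on A (\<lambda>x. u x $ j))"

definition weak_partial_vec ::
    "(real^'n::finite) set \<Rightarrow> 'n \<Rightarrow> (real^'n \<Rightarrow> real^'m::finite) \<Rightarrow> real^'n \<Rightarrow> real^'m" where
  "weak_partial_vec A i u x = (\<chi> j. weak_partial A i (\<lambda>y. u y $ j) x)"

text \<open>The energy is valued in the extended nonnegative reals, so that a divergent integral
  is infinite (rather than 0, as for the Bochner integral).\<close>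

definition GL_energy :: "(real^2) set \<Rightarrow> real \<Rightarrow> (real^2 \<Rightarrow> real^2) \<Rightarrow> ennreal" where
  "GL_energy A \<epsilon> u =
     ennreal (1 / 2) *
       (\<integral>\<^sup>+x\<in>A. ennreal (\<Sum>i\<in>UNIV. (norm (weak_partial_vec A i u x))\<^sup>2) \<partial>lebesgue) +
     ennreal (1 / (4 * \<epsilon>\<^sup>2)) *
       (\<integral>\<^sup>+x\<in>A. ennreal (((norm (u x))\<^sup>2 - 1)\<^sup>2) \<partial>lebesgue)"

definition cross2 :: "real^2 \<Rightarrow> real^2 \<Rightarrow> real" where
  "cross2 a b = a $ 1 * b $ 2 - a $ 2 * b $ 1"

definition annulus_potential ::
    "(real^2) set \<Rightarrow> (real^2) set \<Rightarrow> (real^2 \<Rightarrow> real) \<Rightarrow> bool" where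
  "annulus_potential \<Omega> \<omega> V \<longleftrightarrow>
     (let A = \<Omega> - closure \<omega> in
       Ck_on 2 A V \<and> continuous_on (closure A) V \<and>
       (\<forall>x\<in>A. laplacian V x = 0) \<and>
       (\<forall>x\<in>frontier \<Omega>. V x = 1) \<and> (\<forall>x\<in>frontier \<omega>. V x = 0))"

definition abdeg :: "(real^2) set \<Rightarrow> (real^2 \<Rightarrow> real) \<Rightarrow> (real^2 \<Rightarrow> real^2) \<Rightarrow> real" where
  "abdeg A V u = 1 / (2 * pi) *
     (LINT x:A|lebesgue. cross2 (u x)
        (partial_deriv 1 V x *\<^sub>R weak_partial_vec A 2 u x
         - partial_deriv 2 V x *\<^sub>R weak_partial_vec A 1 u x))"

end

theory Submission
  imports Defs
begin

text \<open>
  Since \<open>V\<close> is harmonic, \<open>0 \<le> V \<le> 1\<close>. Replacing \<open>V\<close> by a truncation \<open>\<Psi>\<close> which equals 0 where \<open>V\<close> is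
  close to 0 and 1 where \<open>V\<close> is close to 1 changes \<open>2\<pi> abdeg(u)\<close> only by \<open>sup |\<Psi> - V|\<close> times the Dirichlet
  energy, because \<open>\<integral> \<nabla>\<^sup>\<bottom>R \<cdot> (u \<times> \<nabla>u)\<close> equals up to sign the integral of \<open>2 R\<close> times the Jacobian of \<open>u\<close>.
  As \<open>\<Psi>\<close> is locally constant with integer values off a compact subset \<open>K\<close> of the annulus, the flux
  against \<open>\<nabla>\<Psi>\<close> of \<open>W/|W|\<close> is an integer multiple of \<open>2\<pi>\<close> for each \<open>C\<^sup>1\<close> map \<open>W\<close> without zeros on \<open>K\<close>.

  A map of bounded Dirichlet energy that is nearly of unit modulus in \<open>L\<^sup>2\<close> is close in \<open>L\<^sup>2\<close> to
  such a \<open>W\<close> with modulus uniformly near 1 on \<open>K\<close>, namely a mollification at a scale chosen among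
  finitely many so that little energy lives there. Hence for small \<open>\<epsilon>\<close> the number \<open>2\<pi> abdeg(u)\<close> is
  within distance 2 of \<open>2\<pi>\<int>\<close>. As \<open>2 < \<pi>\<close>, \<open>abdeg(u)\<close> is never a half-integer.
\<close>

section \<open>Continuously differentiable functions on the plane\<close>

text \<open>The obstacle is that the Dirichlet energy is scale invariant in the plane: a map of
  bounded energy may concentrate a fixed amount of it in arbitrarily small discs, and its
  mollification at a prescribed scale can then vanish. What keeps the mollified modulus near 1 on a
  disc of radius \<open>r\<close> is little energy at scales comparable to \<open>r\<close>. Bounded
  energy leaves room for only boundedly many bad scales, so the list of candidates can be fixed
  before \<open>u\<close>, and \<open>\<epsilon>\<close> has to be small only relative to the finest
  candidate. This makes the threshold independent of \<open>u\<close>. The gradient of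
  \<open>V\<close> is controlled on compact subsets of \<open>A\<close> only. Near the boundary
  every comparison must therefore use the values of \<open>V\<close> alone, which the Jacobian
  identity permits. For the same reason the integrand of \<open>abdeg\<close> is treated as possibly
  not integrable; in that case the integral is 0 by convention and \<open>abdeg\<close> is an
  integer anyway.\<close>

text \<open>Generalizes \<open>partial_deriv\<close> to any normed target, since most maps below are
  complex-valued.\<close>

definition pd :: "2 \<Rightarrow> (real^2 \<Rightarrow> 'b::real_normed_vector) \<Rightarrow> real^2 \<Rightarrow> 'b" where
  "pd i f x = frechet_derivative f (at x) (axis i 1)"

definition C1 :: "(real^2 \<Rightarrow> 'b::real_normed_vector) \<Rightarrow> bool" where
  "C1 f \<longleftrightarrow> (\<forall>x. f differentiable (at x)) \<and> (\<forall>i. continuous_on UNIV (pd i f))"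

definition C1c :: "(real^2 \<Rightarrow> 'b::real_normed_vector) \<Rightarrow> bool" where
  "C1c f \<longleftrightarrow> C1 f \<and> bounded {x. f x \<noteq> 0}"

lemma partial_deriv_eq_pd: "partial_deriv i f = pd i f"
  by (simp add: partial_deriv_def pd_def fun_eq_iff)

lemma vec2_decomp: "(v::real^2) = v$1 *\<^sub>R axis 1 1 + v$2 *\<^sub>R axis 2 1"
  by (simp add: vec_eq_iff forall_2 axis_def)

lemma pd_has_derivative: "(f has_derivative D) (at x) \<Longrightarrow> pd i f x = D (axis i 1)"
  unfolding pd_def using frechet_derivative_at by metis

lemma has_derivative_pd:
  assumes "f differentiable (at x)"
  shows "(f has_derivative (\<lambda>v. v$1 *\<^sub>R pd 1 f x + v$2 *\<^sub>R pd 2 f x)) (at x)"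
proof -
  let ?D = "frechet_derivative f (at x)"
  have D: "(f has_derivative ?D) (at x)" using assms frechet_derivative_works by blast
  have l: "linear ?D" using D has_derivative_linear by blast
  have "?D v = v$1 *\<^sub>R pd 1 f x + v$2 *\<^sub>R pd 2 f x" for v
    using arg_cong[OF vec2_decomp[of v], of ?D]
    by (simp only: linear_add[OF l] linear_scale[OF l] pd_def)
  with D show ?thesis by (metis (no_types, lifting) ext)
qed

lemma pd_add:
  "f differentiable (at x) \<Longrightarrow> g differentiable (at x) \<Longrightarrow> pd i (\<lambda>x. f x + g x) x = pd i f x + pd i g x"
  by (subst pd_has_derivative[OF has_derivative_add[OF has_derivative_pd has_derivative_pd]])
    (use exhaust_2[of i] in \<open>auto simp: axis_def\<close>)

lemma pd_cong_nhd:
  assumes "open S" "x \<in> S" "\<And>y. y \<in> S \<Longrightarrow> f y = g y"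
  shows "pd i f x = pd i g x"
proof -
  have "(f has_derivative D) (at x) \<longleftrightarrow> (g has_derivative D) (at x)" for D
    using assms has_derivative_transform_within_open[OF _ assms(1,2)] by metis
  then show ?thesis by (simp add: pd_def frechet_derivative_def)
qed

lemma pd_const [simp]: "pd i (\<lambda>x. c) x = 0"
  by (simp add: pd_def)

lemma C1_diff: "C1 f \<Longrightarrow> f differentiable (at x)" by (simp add: C1_def)

lemma C1_hd: "C1 f \<Longrightarrow> (f has_derivative (\<lambda>v. v$1 *\<^sub>R pd 1 f x + v$2 *\<^sub>R pd 2 f x)) (at x)"
  by (simp add: C1_def has_derivative_pd)

lemma C1_hd_within: "C1 f \<Longrightarrow> (f has_derivative (\<lambda>v. v$1 *\<^sub>R pd 1 f x + v$2 *\<^sub>R pd 2 f x)) (at x within S)"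
  using C1_hd has_derivative_at_withinI by blast

lemma C1_cont: "C1 f \<Longrightarrow> continuous_on S f"
  by (meson C1_def continuous_at_imp_continuous_on differentiable_imp_continuous_within)

lemma C1_cont_pd: "C1 f \<Longrightarrow> continuous_on S (pd i f)"
  unfolding C1_def using continuous_on_subset by blast

lemma C1I:
  fixes f :: "real^2 \<Rightarrow> 'b::real_normed_vector"
  assumes "\<And>x. (f has_derivative D x) (at x)" "\<And>i. continuous_on UNIV (\<lambda>x. D x (axis i 1))"
  shows "C1 f"
proof -
  have "pd i f = (\<lambda>x. D x (axis i 1))" for i
    using pd_has_derivative[OF assms(1)] by auto
  then show ?thesis using assms unfolding C1_def differentiable_def by auto
qed

lemma C1_bounded_linear:
  assumes "bounded_linear L" "C1 f"
  shows "C1 (\<lambda>x. L (f x))" "pd i (\<lambda>x. L (f x)) x = L (pd i f x)"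
proof -
  have h: "((\<lambda>x. L (f x)) has_derivative (\<lambda>v. L (v$1 *\<^sub>R pd 1 f x + v$2 *\<^sub>R pd 2 f x))) (at x)" for x
    using bounded_linear.has_derivative[OF assms(1) C1_hd[OF assms(2)]] .
  have p: "pd i (\<lambda>x. L (f x)) = (\<lambda>x. L (pd i f x))" for i
    using exhaust_2[of i] by (auto simp: fun_eq_iff pd_has_derivative[OF h] axis_def)
  show "pd i (\<lambda>x. L (f x)) x = L (pd i f x)" by (simp add: p)
  show "C1 (\<lambda>x. L (f x))"
    unfolding C1_def p
    using h bounded_linear.continuous_on[OF assms(1) C1_cont_pd[OF assms(2)]]
    by (auto simp: differentiable_def)
qed

lemma C1_bounded_bilinear:
  assumes "bounded_bilinear p" "C1 f" "C1 g"
  shows "C1 (\<lambda>x. p (f x) (g x))"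
    "pd i (\<lambda>x. p (f x) (g x)) x = p (f x) (pd i g x) + p (pd i f x) (g x)"
proof -
  interpret bounded_bilinear p by fact
  have h: "((\<lambda>x. p (f x) (g x)) has_derivative
     (\<lambda>v. p (f x) (v$1 *\<^sub>R pd 1 g x + v$2 *\<^sub>R pd 2 g x) + p (v$1 *\<^sub>R pd 1 f x + v$2 *\<^sub>R pd 2 f x) (g x))) (at x)" for x
    using FDERIV[OF C1_hd[OF assms(2)] C1_hd[OF assms(3)]] .
  have q: "pd i (\<lambda>x. p (f x) (g x)) = (\<lambda>x. p (f x) (pd i g x) + p (pd i f x) (g x))" for i
    using exhaust_2[of i] by (auto simp: fun_eq_iff pd_has_derivative[OF h] axis_def)
  show "pd i (\<lambda>x. p (f x) (g x)) x = p (f x) (pd i g x) + p (pd i f x) (g x)" by (simp add: q)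
  show "C1 (\<lambda>x. p (f x) (g x))"
    unfolding C1_def q
    using h by (auto simp: differentiable_def
      intro!: continuous_on_add continuous_on C1_cont_pd[OF assms(2)] C1_cont_pd[OF assms(3)]
        C1_cont[OF assms(2)] C1_cont[OF assms(3)])
qed

lemma C1_add: "C1 f \<Longrightarrow> C1 g \<Longrightarrow> C1 (\<lambda>x. f x + g x)"
  by (rule C1I[OF has_derivative_add[OF C1_hd C1_hd]])
    (auto intro!: continuous_intros C1_cont_pd)

lemma C1_scale: "C1 f \<Longrightarrow> C1 (\<lambda>x. c *\<^sub>R f x)" "C1 f \<Longrightarrow> pd i (\<lambda>x. c *\<^sub>R f x) x = c *\<^sub>R pd i f x"
  by (rule C1_bounded_linear[OF bounded_linear_scaleR_right], assumption)+

lemma C1_uminus: "C1 f \<Longrightarrow> C1 (\<lambda>x. - f x)" "C1 f \<Longrightarrow> pd i (\<lambda>x. - f x) x = - pd i f x"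
  by (rule C1_bounded_linear[OF bounded_linear_minus[OF bounded_linear_ident]], assumption)+

lemma C1_diff_fun:
  assumes "C1 f" "C1 g"
  shows "C1 (\<lambda>x. f x - g x)" "pd i (\<lambda>x. f x - g x) x = pd i f x - pd i g x"
proof -
  show "C1 (\<lambda>x. f x - g x)" using C1_add[OF assms(1) C1_uminus(1)[OF assms(2)]] by simp
  have "pd i (\<lambda>x. f x + - g x) x = pd i f x + pd i (\<lambda>x. - g x) x"
    by (rule pd_add) (intro C1_diff C1_uminus assms)+
  then show "pd i (\<lambda>x. f x - g x) x = pd i f x - pd i g x"
    by (simp add: C1_uminus(2)[OF assms(2)])
qed

lemma C1c_C1: "C1c f \<Longrightarrow> C1 f" by (simp add: C1c_def)

lemma C1c_bilinear:
  assumes "bounded_bilinear p" "C1 f" "C1 g" "C1c f \<or> C1c g"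
  shows "C1c (\<lambda>x. p (f x) (g x))"
proof -
  interpret bounded_bilinear p by fact
  have "{x. p (f x) (g x) \<noteq> 0} \<subseteq> {x. f x \<noteq> 0}" "{x. p (f x) (g x) \<noteq> 0} \<subseteq> {x. g x \<noteq> 0}"
    by (auto simp: zero_left zero_right)
  from bounded_subset[OF _ this(1)] bounded_subset[OF _ this(2)] have "bounded {x. p (f x) (g x) \<noteq> 0}"
    using assms(4) by (auto simp: C1c_def)
  with C1_bounded_bilinear(1)[OF assms(1-3)] show ?thesis
    unfolding C1c_def by simp
qed

lemma C1cI: "C1 f \<Longrightarrow> bounded S \<Longrightarrow> (\<And>x. f x \<noteq> 0 \<Longrightarrow> x \<in> S) \<Longrightarrow> C1c f"
  unfolding C1c_def by (auto elim: bounded_subset)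

lemma C1c_bounded: "C1c f \<Longrightarrow> bounded {x. f x \<noteq> 0}" by (simp add: C1c_def)

lemma C1c_add: assumes "C1c f" "C1c g" shows "C1c (\<lambda>x. f x + g x)"
  by (rule C1cI[where S="{x. f x \<noteq> 0} \<union> {x. g x \<noteq> 0}"])
    (use assms in \<open>auto simp: C1c_def intro: C1_add\<close>)

lemma C1c_scale: assumes "C1c f" shows "C1c (\<lambda>x. c *\<^sub>R f x)"
  by (rule C1cI[where S="{x. f x \<noteq> 0}"])
    (use assms in \<open>auto simp: C1c_def intro: C1_scale\<close>)

lemma C1c_diff_fun: "C1c f \<Longrightarrow> C1c g \<Longrightarrow> C1c (\<lambda>x. f x - g x)"
  using C1c_add[of f "\<lambda>x. (-1) *\<^sub>R g x"] C1c_scale[of g "-1"] by simp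

lemma pd_zero_outside:
  assumes "closed S" "\<And>x. x \<notin> S \<Longrightarrow> f x = 0" "x \<notin> S"
  shows "pd i f x = 0"
  using pd_cong_nhd[of "- S" x f "\<lambda>_. 0" i] assms by auto

lemma C1c_ball:
  assumes "C1c f"
  obtains R where "R > 0" "\<And>x. norm x \<ge> R \<Longrightarrow> f x = 0" "\<And>x i. norm x \<ge> R \<Longrightarrow> pd i f x = 0"
proof -
  obtain B where B: "B > 0" "\<And>x. f x \<noteq> 0 \<Longrightarrow> norm x \<le> B"
    using assms unfolding C1c_def bounded_pos by auto
  have "pd i f x = 0" if "norm x \<ge> B + 1" for x i
    by (rule pd_zero_outside[of "cball 0 B"]) (use B that in auto)
  moreover have "f x = 0" if "norm x \<ge> B + 1" for x
    using B(2)[of x] that by fastforce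
  ultimately show thesis using B(1) that[of "B+1"] by simp
qed

section \<open>Integrals of compactly supported continuous functions\<close>

lemma cont_compact_supp_integrable:
  fixes f :: "real^2 \<Rightarrow> 'b::{banach,second_countable_topology}"
  assumes "continuous_on UNIV f" "\<And>x. norm x \<ge> R \<Longrightarrow> f x = 0"
  shows "integrable lborel f"
proof -
  have "integrable lborel (\<lambda>x. indicator (cball 0 R) x *\<^sub>R f x)"
    by (rule borel_integrable_compact) (auto intro: continuous_on_subset[OF assms(1)])
  moreover have "(\<lambda>x. indicator (cball 0 R) x *\<^sub>R f x) = f"
    using assms(2) by (auto simp: fun_eq_iff indicator_def)
  ultimately show ?thesis by simp
qed

lemma cont_bounded_supp_integrable:
  fixes f :: "real^2 \<Rightarrow> 'b::{banach,second_countable_topology}"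
  assumes "continuous_on UNIV f" "bounded {x. f x \<noteq> 0}"
  shows "integrable lborel f"
proof -
  obtain B where "\<And>x. f x \<noteq> 0 \<Longrightarrow> norm x \<le> B" using assms(2) unfolding bounded_pos by auto
  then have "f x = 0" if "norm x \<ge> B + 1" for x using that by fastforce
  then show ?thesis using cont_compact_supp_integrable[OF assms(1)] by blast
qed

lemma integrable_translate:
  fixes f :: "real^2 \<Rightarrow> 'b::{banach,second_countable_topology}"
  assumes "integrable lborel f"
  shows "integrable lborel (\<lambda>x. f (z + x))" "(\<integral>x. f (z + x) \<partial>lborel) = (\<integral>x. f x \<partial>lborel)"
proof -
  have m: "f \<in> borel_measurable borel" using borel_measurable_integrable[OF assms] by simp
  have "integrable (distr lborel borel ((+) z)) f" using assms by (simp add: lborel_distr_plus)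
  then show "integrable lborel (\<lambda>x. f (z + x))" by (subst (asm) integrable_distr_eq) (use m in auto)
  have "(\<integral>x. f x \<partial>lborel) = (\<integral>x. f x \<partial>(distr lborel borel ((+) z)))" by (simp add: lborel_distr_plus)
  also have "\<dots> = (\<integral>x. f (z + x) \<partial>lborel)" by (subst integral_distr) (use m in auto)
  finally show "(\<integral>x. f (z + x) \<partial>lborel) = (\<integral>x. f x \<partial>lborel)" ..
qed

lemma nn_integral_translate:
  fixes f :: "real^2 \<Rightarrow> ennreal"
  assumes "f \<in> borel_measurable borel"
  shows "(\<integral>\<^sup>+x. f (z + x) \<partial>lborel) = (\<integral>\<^sup>+x. f x \<partial>lborel)"
proof -
  have "(\<integral>\<^sup>+x. f x \<partial>lborel) = (\<integral>\<^sup>+x. f x \<partial>(distr lborel borel ((+) z)))" by (simp add: lborel_distr_plus)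
  also have "\<dots> = (\<integral>\<^sup>+x. f (z + x) \<partial>lborel)" by (subst nn_integral_distr) (use assms in auto)
  finally show ?thesis ..
qed

section \<open>Uniform differentiability and the Jacobian identity\<close>

text \<open>The mean value inequality on \<open>cball x d0\<close> bounds the Taylor remainder by
  the oscillation of the partial derivatives, and these are uniformly continuous on the larger
  compact ball \<open>?T\<close>. Hence one \<open>d\<close> serves all base points in
  \<open>S\<close>.\<close>

lemma C1_unif:
  fixes f :: "real^2 \<Rightarrow> 'b::real_normed_vector"
  assumes "C1 f" "compact S" "e > 0"
  obtains d where "d > 0" "\<And>x v. x \<in> S \<Longrightarrow> norm v \<le> d \<Longrightarrow>
    norm (f (x + v) - f x - (v$1 *\<^sub>R pd 1 f x + v$2 *\<^sub>R pd 2 f x)) \<le> e * norm v"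
proof -
  obtain B where B: "\<And>x. x \<in> S \<Longrightarrow> norm x \<le> B" using assms(2) compact_imp_bounded bounded_iff by metis
  let ?T = "cball 0 (B + 1) :: (real^2) set"
  have "uniformly_continuous_on ?T (pd i f)" for i
    by (rule compact_uniformly_continuous) (auto simp: C1_cont_pd assms)
  then have "\<exists>d>0. \<forall>x\<in>?T. \<forall>y\<in>?T. dist y x < d \<longrightarrow> dist (pd i f y) (pd i f x) < e/2" for i
    using assms(3) unfolding uniformly_continuous_on_def by (metis half_gt_zero)
  then obtain d where d: "\<And>i. d i > 0" "\<And>i x y. x\<in>?T \<Longrightarrow> y\<in>?T \<Longrightarrow> dist y x < d i \<Longrightarrow> dist (pd i f y) (pd i f x) < e/2"
    by metis
  \<comment> \<open>The cap 1 keeps \<open>cball x d0\<close> inside \<open>?T\<close>, and the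
    halving turns membership in the closed ball into the strict inequalities of uniform
    continuity.\<close>
  define d0 where "d0 = min 1 (min (d 1) (d 2)) / 2"
  show thesis
  proof (rule that)
    show "d0 > 0" using d(1) by (simp add: d0_def)
    fix x v :: "real^2" assume x: "x \<in> S" and v: "norm v \<le> d0"
    let ?S = "cball x d0"
    have sub: "y \<in> ?T" if "y \<in> ?S" for y
    proof -
      have "norm y \<le> norm x + dist y x" using norm_triangle_ineq[of x "y - x"] by (simp add: dist_norm)
      then show ?thesis using B[OF x] that d(1)[of 1] d(1)[of 2] by (auto simp: d0_def dist_commute)
    qed
    let ?D = "\<lambda>y (w::real^2). w$1 *\<^sub>R pd 1 f y + w$2 *\<^sub>R pd 2 f y"
    have seg: "x + t *\<^sub>R ((x + v) - x) \<in> ?S" if t: "t \<in> {0..1}" for t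
    proof -
      have "norm (t *\<^sub>R v) \<le> 1 * d0" using v t by (simp only: norm_scaleR, intro mult_mono) auto
      then show ?thesis by (simp add: dist_norm)
    qed
    have on: "onorm (?D y - ?D x) \<le> e" if y: "y \<in> ?S" for y
    proof (rule onorm_le)
      fix w :: "real^2"
      have dd: "norm (pd i f y - pd i f x) \<le> e/2" for i
      proof -
        have "dist y x < d i" using y d(1)[of 1] d(1)[of 2] exhaust_2[of i] by (auto simp: d0_def dist_commute)
        moreover have "x \<in> ?T" using B[OF x] by simp
        ultimately show ?thesis using d(2)[of x y i] sub[OF y] by (simp add: dist_norm less_imp_le)
      qed
      have "(?D y - ?D x) w = w$1 *\<^sub>R (pd 1 f y - pd 1 f x) + w$2 *\<^sub>R (pd 2 f y - pd 2 f x)"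
        by (simp add: algebra_simps)
      also have "norm \<dots> \<le> \<bar>w$1\<bar> * norm (pd 1 f y - pd 1 f x) + \<bar>w$2\<bar> * norm (pd 2 f y - pd 2 f x)"
        by (metis norm_triangle_ineq norm_scaleR)
      also have "\<dots> \<le> norm w * (e/2) + norm w * (e/2)"
        by (intro add_mono mult_mono component_le_norm_cart dd) auto
      finally show "norm ((?D y - ?D x) w) \<le> e * norm w"
        by (simp add: field_simps)
    qed
    have "x \<in> ?S" using d(1) by (simp add: d0_def less_imp_le)
    from differentiable_bound_linearization[where S="?S" and f'="?D", OF seg C1_hd_within[OF assms(1)] on this]
    have "norm (f (x+v) - f x - ?D x ((x+v) - x)) \<le> norm ((x+v) - x) * e"
      by blast
    then show "norm (f (x + v) - f x - (v$1 *\<^sub>R pd 1 f x + v$2 *\<^sub>R pd 2 f x)) \<le> e * norm v"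
      by (simp add: mult.commute)
  qed
qed

lemma C1_unif_ex:
  fixes f :: "real^2 \<Rightarrow> 'b::real_normed_vector"
  assumes "C1 f" "compact S" "e > 0"
  shows "\<exists>d>0. \<forall>x\<in>S. \<forall>v. norm v \<le> d \<longrightarrow>
    norm (f (x + v) - f x - (v$1 *\<^sub>R pd 1 f x + v$2 *\<^sub>R pd 2 f x)) \<le> e * norm v"
  by (rule C1_unif[OF assms]) blast

lemma C1_tendsto_quotient:
  fixes f :: "real^2 \<Rightarrow> 'b::real_normed_vector"
  assumes "C1 f" "t \<longlonglongrightarrow> 0" "\<And>n. t n \<noteq> 0"
  shows "(\<lambda>n. (1 / t n) *\<^sub>R (f (x + t n *\<^sub>R axis i 1) - f x)) \<longlonglongrightarrow> pd i f x"
proof (rule LIMSEQ_I)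
  fix r :: real assume "r > 0"
  then have "r/2 > 0" by simp
  from C1_unif_ex[OF assms(1) compact_sing[of x] this]
  obtain d where d: "d > 0" "\<And>v. norm v \<le> d \<Longrightarrow>
    norm (f (x + v) - f x - (v$1 *\<^sub>R pd 1 f x + v$2 *\<^sub>R pd 2 f x)) \<le> (r/2) * norm v"
    by blast
  obtain N where N: "\<And>n. n \<ge> N \<Longrightarrow> \<bar>t n\<bar> < d" using LIMSEQ_D[OF assms(2) d(1)] by auto
  have "norm ((1 / t n) *\<^sub>R (f (x + t n *\<^sub>R axis i 1) - f x) - pd i f x) < r" if "n \<ge> N" for n
  proof -
    let ?v = "t n *\<^sub>R axis i (1::real)"
    have nv: "norm ?v = \<bar>t n\<bar>" by (simp add: norm_axis_1)
    have "?v$1 *\<^sub>R pd 1 f x + ?v$2 *\<^sub>R pd 2 f x = t n *\<^sub>R pd i f x"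
      using exhaust_2[of i] by (auto simp: axis_def)
    then have "norm (f (x + ?v) - f x - t n *\<^sub>R pd i f x) \<le> (r/2) * \<bar>t n\<bar>"
      using d(2)[of ?v] N[OF that] nv by auto
    moreover have "(1 / t n) *\<^sub>R (f (x + ?v) - f x) - pd i f x = (1 / t n) *\<^sub>R (f (x + ?v) - f x - t n *\<^sub>R pd i f x)"
      using assms(3)[of n] by (simp add: algebra_simps)
    moreover have "(1 / \<bar>t n\<bar>) * (r/2 * \<bar>t n\<bar>) = r/2" using assms(3)[of n] by simp
    ultimately have "norm ((1 / t n) *\<^sub>R (f (x + ?v) - f x) - pd i f x) \<le> r/2"
      using mult_left_mono[of _ "(r/2) * \<bar>t n\<bar>" "1 / \<bar>t n\<bar>"] by (simp only: norm_scaleR) simp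
    then show ?thesis using \<open>r > 0\<close> by linarith
  qed
  then show "\<exists>no. \<forall>n\<ge>no. norm ((1 / t n) *\<^sub>R (f (x + t n *\<^sub>R axis i 1) - f x) - pd i f x) < r" by blast
qed

lemma C1_lip:
  fixes f :: "real^2 \<Rightarrow> 'b::real_normed_vector"
  assumes "C1 f" "compact S"
  obtains M d where "M > 0" "d > 0" "\<And>x v. x \<in> S \<Longrightarrow> norm v \<le> d \<Longrightarrow> norm (f (x + v) - f x) \<le> M * norm v"
proof -
  have "bounded (pd i f ` S)" for i
    using compact_imp_bounded[OF compact_continuous_image[OF C1_cont_pd[OF assms(1)] assms(2)]] .
  then have "\<exists>B>0. \<forall>x\<in>S. norm (pd i f x) \<le> B" for i
    unfolding bounded_pos by auto
  then obtain B where B: "\<And>i. B i > 0" "\<And>i x. x \<in> S \<Longrightarrow> norm (pd i f x) \<le> B i" by metis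
  obtain d where d: "d > 0" "\<And>x v. x \<in> S \<Longrightarrow> norm v \<le> d \<Longrightarrow>
    norm (f (x + v) - f x - (v$1 *\<^sub>R pd 1 f x + v$2 *\<^sub>R pd 2 f x)) \<le> 1 * norm v"
    using C1_unif_ex[OF assms zero_less_one] by blast
  show thesis
  proof (rule that[of "1 + B 1 + B 2" d])
    show "1 + B 1 + B 2 > 0" using B(1)[of 1] B(1)[of 2] by simp
    fix x v :: "real^2" assume x: "x \<in> S" and v: "norm v \<le> d"
    have "norm (v$1 *\<^sub>R pd 1 f x + v$2 *\<^sub>R pd 2 f x) \<le> \<bar>v$1\<bar> * norm (pd 1 f x) + \<bar>v$2\<bar> * norm (pd 2 f x)"
      by (metis norm_triangle_ineq norm_scaleR)
    also have "\<dots> \<le> norm v * B 1 + norm v * B 2"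
      by (intro add_mono mult_mono component_le_norm_cart B x) auto
    finally have "norm (v$1 *\<^sub>R pd 1 f x + v$2 *\<^sub>R pd 2 f x) \<le> norm v * B 1 + norm v * B 2" .
    moreover have "norm (f (x + v) - f x) \<le> norm (f (x + v) - f x - (v$1 *\<^sub>R pd 1 f x + v$2 *\<^sub>R pd 2 f x)) + norm (v$1 *\<^sub>R pd 1 f x + v$2 *\<^sub>R pd 2 f x)"
      using norm_triangle_ineq[of "f (x + v) - f x - (v$1 *\<^sub>R pd 1 f x + v$2 *\<^sub>R pd 2 f x)" "v$1 *\<^sub>R pd 1 f x + v$2 *\<^sub>R pd 2 f x"] by simp
    ultimately show "norm (f (x + v) - f x) \<le> (1 + B 1 + B 2) * norm v"
      using d(2)[OF x v] by (simp add: algebra_simps)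
  qed (rule d(1))
qed

lemma C1_lip_ex:
  fixes f :: "real^2 \<Rightarrow> 'b::real_normed_vector"
  assumes "C1 f" "compact S"
  shows "\<exists>M>0. \<exists>d>0. \<forall>x\<in>S. \<forall>v. norm v \<le> d \<longrightarrow> norm (f (x + v) - f x) \<le> M * norm v"
  by (rule C1_lip[OF assms]) blast

lemma integrable_indicator_bounded:
  fixes S :: "'a::euclidean_space set"
  assumes "S \<in> sets borel" "bounded S"
  shows "integrable lborel (indicat_real S)"
  using emeasure_bounded_finite[OF assms(2)] assms(1) by (intro integrable_real_indicator) auto

lemma cont_meas:
  fixes f :: "'a::euclidean_space \<Rightarrow> 'b::metric_space"
  shows "continuous_on UNIV f \<Longrightarrow> f \<in> borel_measurable lborel"
  by (simp add: borel_measurable_continuous_onI)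

lemma cont_shift: "continuous_on UNIV f \<Longrightarrow> continuous_on UNIV (\<lambda>x::real^2. f (x + a))"
  by (rule continuous_on_compose2[where t=UNIV and f="\<lambda>x. x + a"]) (auto intro!: continuous_intros)

text \<open>The identity holds exactly for forward and backward difference quotients, by translation
  invariance; hence no second derivatives are needed.\<close>

lemma integral_jacobian_zero:
  fixes f :: "real^2 \<Rightarrow> 'b::euclidean_space" and \<psi> :: "real^2 \<Rightarrow> real"
  assumes "C1 \<psi>" "C1c f"
  shows "(\<integral>x. pd 1 \<psi> x *\<^sub>R pd 2 f x - pd 2 \<psi> x *\<^sub>R pd 1 f x \<partial>lborel) = 0"
proof -
  have f1: "C1 f" using assms(2) by (rule C1c_C1)
  obtain R where R: "R > 0" "\<And>x. norm x \<ge> R \<Longrightarrow> f x = 0" "\<And>x i. norm x \<ge> R \<Longrightarrow> pd i f x = 0"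
    by (rule C1c_ball[OF assms(2)]) blast
  let ?S = "cball 0 (R + 1) :: (real^2) set"
  obtain M1 d1 where M1: "M1 > 0" "d1 > 0" "\<And>x v. x \<in> ?S \<Longrightarrow> norm v \<le> d1 \<Longrightarrow> norm (\<psi> (x + v) - \<psi> x) \<le> M1 * norm v"
    using C1_lip_ex[OF assms(1) compact_cball] by blast
  obtain M2 d2 where M2: "M2 > 0" "d2 > 0" "\<And>x v. x \<in> ?S \<Longrightarrow> norm v \<le> d2 \<Longrightarrow> norm (f (x + v) - f x) \<le> M2 * norm v"
    using C1_lip_ex[OF f1 compact_cball] by blast
  define d where "d = min 1 (min d1 d2)"
  have d: "d > 0" "d \<le> 1" "d \<le> d1" "d \<le> d2" using M1 M2 by (auto simp: d_def)
  define t where "t n = d / real (Suc n)" for n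
  have t: "t n > 0" "t n \<le> d" for n using d(1) by (auto simp: t_def field_simps)
  have t0: "t \<longlonglongrightarrow> 0" unfolding t_def[abs_def]
    using tendsto_mult[OF tendsto_const[of d] LIMSEQ_inverse_real_of_nat] by (simp add: divide_inverse)
  define e where "e i = (axis i 1 :: real^2)" for i
  have ne: "norm (e i) = 1" for i by (simp add: e_def norm_axis_1)
  define A where "A v = (\<integral>x. \<psi> x *\<^sub>R f (x + v) \<partial>lborel)" for v :: "real^2"
  \<comment> \<open>With two forward differences the integral would contain
    \<open>A (s *\<^sub>R e j - s *\<^sub>R e i)\<close>, which is not symmetric in \<open>i\<close>
    and \<open>j\<close>; the backward difference of \<open>f\<close> restores the symmetry.\<close>
  define P where "P i j s x = (\<psi> (x + s *\<^sub>R e i) - \<psi> x) *\<^sub>R (f x - f (x + (- s) *\<^sub>R e j))" for i j and s :: real and x :: "real^2"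
  have intg: "integrable lborel (\<lambda>x. \<psi> (x + a) *\<^sub>R f (x + b))" for a b
  proof (rule cont_compact_supp_integrable[where R="R + norm b"])
    show "continuous_on UNIV (\<lambda>x. \<psi> (x + a) *\<^sub>R f (x + b))"
      by (intro continuous_on_scaleR cont_shift C1_cont assms(1) f1)
    fix x :: "real^2" assume "R + norm b \<le> norm x"
    then have "norm (x + b) \<ge> R" using norm_triangle_ineq4[of "x+b" b] by simp
    then show "\<psi> (x + a) *\<^sub>R f (x + b) = 0" using R(2) by simp
  qed
  have sh: "(\<integral>x. \<psi> (x + a) *\<^sub>R f (x + b) \<partial>lborel) = A (b - a)" for a b
    using integrable_translate(2)[OF intg[of a b], of "-a"] unfolding A_def
    by (simp add: algebra_simps)
  \<comment> \<open>The value is symmetric in \<open>i\<close> and \<open>j\<close>: a discrete form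
    of the cancellation of mixed second derivatives.\<close>
  have PA: "integrable lborel (P i j s)" "(\<integral>x. P i j s x \<partial>lborel) =
     A (- (s *\<^sub>R e i)) - A (- (s *\<^sub>R e i) - s *\<^sub>R e j) - A 0 + A (- (s *\<^sub>R e j))" for i j s
  proof -
    have eq: "P i j s = (\<lambda>x. \<psi> (x + s *\<^sub>R e i) *\<^sub>R f (x + 0) - \<psi> (x + s *\<^sub>R e i) *\<^sub>R f (x + (- s) *\<^sub>R e j)
      - \<psi> (x + 0) *\<^sub>R f (x + 0) + \<psi> (x + 0) *\<^sub>R f (x + (- s) *\<^sub>R e j))"
      by (auto simp: P_def fun_eq_iff algebra_simps)
    show "integrable lborel (P i j s)" unfolding eq
      by (intro Bochner_Integration.integrable_add Bochner_Integration.integrable_diff intg)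
    show "(\<integral>x. P i j s x \<partial>lborel) =
     A (- (s *\<^sub>R e i)) - A (- (s *\<^sub>R e i) - s *\<^sub>R e j) - A 0 + A (- (s *\<^sub>R e j))"
      unfolding eq
      by (subst Bochner_Integration.integral_add Bochner_Integration.integral_diff;
          (intro Bochner_Integration.integrable_diff intg)?)+ (simp only: sh, simp add: minus_diff_commute[of "s *\<^sub>R e i" "s *\<^sub>R e j"])
  qed
  define F where "F n x = (1 / (t n)\<^sup>2) *\<^sub>R (P 1 2 (t n) x - P 2 1 (t n) x)" for n x
  have F0: "(\<integral>x. F n x \<partial>lborel) = 0" for n
  proof -
    have "(\<integral>x. P 1 2 (t n) x \<partial>lborel) = (\<integral>x. P 2 1 (t n) x \<partial>lborel)"
      unfolding PA(2) by (simp add: minus_diff_commute[of "t n *\<^sub>R e 1" "t n *\<^sub>R e 2"])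
    then show ?thesis unfolding F_def using PA(1) by simp
  qed
  have quot: "(\<lambda>n. (1 / (t n)\<^sup>2) *\<^sub>R P i j (t n) x) \<longlonglongrightarrow> pd i \<psi> x *\<^sub>R pd j f x" for i j x
  proof -
    have a: "(\<lambda>n. (1 / t n) *\<^sub>R (\<psi> (x + t n *\<^sub>R e i) - \<psi> x)) \<longlonglongrightarrow> pd i \<psi> x"
      unfolding e_def by (rule C1_tendsto_quotient[OF assms(1) t0]) (use t(1) in \<open>simp add: less_imp_neq[symmetric]\<close>)
    have "(\<lambda>n. - t n) \<longlonglongrightarrow> 0" using tendsto_minus[OF t0] by simp
    then have b: "(\<lambda>n. (1 / (- t n)) *\<^sub>R (f (x + (- t n) *\<^sub>R e j) - f x)) \<longlonglongrightarrow> pd j f x"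
      unfolding e_def by (rule C1_tendsto_quotient[OF f1]) (use t(1) in \<open>simp add: less_imp_neq[symmetric]\<close>)
    have "(1 / (t n)\<^sup>2) *\<^sub>R P i j (t n) x = ((1 / t n) *\<^sub>R (\<psi> (x + t n *\<^sub>R e i) - \<psi> x)) *\<^sub>R ((1 / (- t n)) *\<^sub>R (f (x + (- t n) *\<^sub>R e j) - f x))" for n
      by (simp add: P_def power2_eq_square algebra_simps)
    then show ?thesis using tendsto_scaleR[OF a b] by simp
  qed
  have bd: "norm ((1 / (t n)\<^sup>2) *\<^sub>R P i j (t n) x) \<le> M1 * M2 * indicator ?S x" for n i j x
  proof (cases "x \<in> ?S")
    case True
    have "norm (P i j (t n) x) \<le> (M1 * t n) * (M2 * t n)"
      unfolding P_def norm_scaleR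
    proof (rule mult_mono)
      show "\<bar>\<psi> (x + t n *\<^sub>R e i) - \<psi> x\<bar> \<le> M1 * t n"
        using M1(3)[OF True, of "t n *\<^sub>R e i"] t[of n] d ne by simp
      show "norm (f x - f (x + (- t n) *\<^sub>R e j)) \<le> M2 * t n"
        using M2(3)[OF True, of "(- t n) *\<^sub>R e j"] t[of n] d ne by (simp add: norm_minus_commute)
    qed (use M1 t[of n] in auto)
    then show ?thesis using True t[of n] by (simp add: field_simps power2_eq_square)
  next
    case False
    then have n: "norm x > R + 1" by simp
    have "norm (x + (- t n) *\<^sub>R e j) \<ge> R"
      using n norm_triangle_ineq4[of "x + (- t n) *\<^sub>R e j" "(- t n) *\<^sub>R e j"] t[of n] d ne[of j] by simp
    then have "P i j (t n) x = 0" unfolding P_def using R(2) n by simp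
    then show ?thesis using False by simp
  qed
  have "(\<lambda>n. \<integral>x. F n x \<partial>lborel) \<longlonglongrightarrow> (\<integral>x. pd 1 \<psi> x *\<^sub>R pd 2 f x - pd 2 \<psi> x *\<^sub>R pd 1 f x \<partial>lborel)"
  proof (rule integral_dominated_convergence[where w="\<lambda>x. 2 * (M1 * M2) * indicator ?S x"])
    show "(\<lambda>x. pd 1 \<psi> x *\<^sub>R pd 2 f x - pd 2 \<psi> x *\<^sub>R pd 1 f x) \<in> borel_measurable lborel"
      by (intro cont_meas continuous_intros C1_cont_pd assms(1) f1)
    show "F n \<in> borel_measurable lborel" for n
      unfolding F_def[abs_def] using PA(1) by (auto intro!: borel_measurable_integrable)
    show "integrable lborel (\<lambda>x. 2 * (M1 * M2) * indicator ?S x)"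
      by (intro integrable_mult_right integrable_indicator_bounded) auto
    show "AE x in lborel. (\<lambda>n. F n x) \<longlonglongrightarrow> pd 1 \<psi> x *\<^sub>R pd 2 f x - pd 2 \<psi> x *\<^sub>R pd 1 f x"
      unfolding F_def scaleR_diff_right by (intro AE_I2 tendsto_diff quot)
    show "AE x in lborel. norm (F n x) \<le> 2 * (M1 * M2) * indicator ?S x" for n
    proof (rule AE_I2)
      fix x show "norm (F n x) \<le> 2 * (M1 * M2) * indicator ?S x"
        unfolding F_def scaleR_diff_right
        using norm_triangle_ineq4[of "(1 / (t n)\<^sup>2) *\<^sub>R P 1 2 (t n) x" "(1 / (t n)\<^sup>2) *\<^sub>R P 2 1 (t n) x"]
          bd[where n=n and i=1 and j=2 and x=x] bd[where n=n and i=2 and j=1 and x=x] by linarith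
    qed
  qed
  then have "(\<lambda>n. 0) \<longlonglongrightarrow> (\<integral>x. pd 1 \<psi> x *\<^sub>R pd 2 f x - pd 2 \<psi> x *\<^sub>R pd 1 f x \<partial>lborel)"
    by (simp only: F0)
  then show ?thesis unfolding LIMSEQ_const_iff by (rule sym)
qed

text \<open>The Jacobian identity asks for compact support of \<open>f\<close> only, so a coordinate
  function may serve as its \<open>\<psi>\<close>.\<close>

lemma integral_pd_zero:
  fixes f :: "real^2 \<Rightarrow> 'b::euclidean_space"
  assumes "C1c f"
  shows "(\<integral>x. pd i f x \<partial>lborel) = 0"
proof -
  have c: "C1 (\<lambda>x::real^2. x $ j)" "pd k (\<lambda>x::real^2. x $ j) x = (if k = j then 1 else 0)" for j k x
  proof -
    have h: "((\<lambda>x::real^2. x $ j) has_derivative (\<lambda>v. v $ j)) (at x)" for x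
      by (rule bounded_linear_imp_has_derivative) (rule bounded_linear_vec_nth)
    show "C1 (\<lambda>x::real^2. x $ j)" by (rule C1I[OF h]) auto
    show "pd k (\<lambda>x::real^2. x $ j) x = (if k = j then 1 else 0)"
      by (simp add: pd_has_derivative[OF h] axis_def)
  qed
  show ?thesis
    using integral_jacobian_zero[OF c(1)[of 1] assms] integral_jacobian_zero[OF c(1)[of 2] assms] exhaust_2[of i]
    by (auto simp: c(2))
qed

section \<open>Jensen's inequality and the translation estimate\<close>

text \<open>Nonnegativity of the variance of \<open>norm (f x)\<close> under the probability density
  \<open>k\<close>. That \<open>k * norm f\<close> is integrable follows from s <= 1 + s^2.\<close>

lemma jensen_sq:
  fixes f :: "'a \<Rightarrow> 'b::{banach,second_countable_topology}"
  assumes k: "integrable M k" "\<And>x. k x \<ge> 0" "(\<integral>x. k x \<partial>M) = 1"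
    and f: "f \<in> borel_measurable M" "integrable M (\<lambda>x. k x * (norm (f x))\<^sup>2)"
  shows "(norm (\<integral>x. k x *\<^sub>R f x \<partial>M))\<^sup>2 \<le> (\<integral>x. k x * (norm (f x))\<^sup>2 \<partial>M)"
proof -
  have i1: "integrable M (\<lambda>x. k x * norm (f x))"
  proof (rule Bochner_Integration.integrable_bound[OF Bochner_Integration.integrable_add[OF k(1) f(2)]])
    show "(\<lambda>x. k x * norm (f x)) \<in> borel_measurable M"
      using f(1) borel_measurable_integrable[OF k(1)] by measurable
    show "AE x in M. norm (k x * norm (f x)) \<le> norm (k x + k x * (norm (f x))\<^sup>2)"
    proof (rule AE_I2)
      fix x
      have "norm (f x) \<le> 1 + (norm (f x))\<^sup>2" using sum_power2_ge_zero[of "norm (f x) - 1/2" 0] by (simp add: power2_eq_square algebra_simps) 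
      then have "k x * norm (f x) \<le> k x * (1 + (norm (f x))\<^sup>2)" using k(2) by (rule mult_left_mono)
      then show "norm (k x * norm (f x)) \<le> norm (k x + k x * (norm (f x))\<^sup>2)"
        using k(2)[of x] by (simp add: algebra_simps)
    qed
  qed
  let ?m = "\<integral>x. k x * norm (f x) \<partial>M"
  have "0 \<le> (\<integral>x. k x * (norm (f x) - ?m)\<^sup>2 \<partial>M)"
    by (rule integral_nonneg_AE) (use k in auto)
  also have "\<dots> = (\<integral>x. k x * (norm (f x))\<^sup>2 - 2 * ?m * (k x * norm (f x)) + ?m\<^sup>2 * k x \<partial>M)"
    by (rule Bochner_Integration.integral_cong) (auto simp: power2_eq_square algebra_simps)
  also have "\<dots> = (\<integral>x. k x * (norm (f x))\<^sup>2 \<partial>M) - 2 * ?m * ?m + ?m\<^sup>2 * 1"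
    using i1 f(2) k by simp
  finally have "?m\<^sup>2 \<le> (\<integral>x. k x * (norm (f x))\<^sup>2 \<partial>M)" by (simp add: power2_eq_square)
  moreover have "norm (\<integral>x. k x *\<^sub>R f x \<partial>M) \<le> ?m"
    using integral_norm_bound[of M "\<lambda>x. k x *\<^sub>R f x"] k(2) by simp
  then have "(norm (\<integral>x. k x *\<^sub>R f x \<partial>M))\<^sup>2 \<le> ?m\<^sup>2" by (simp add: power_mono)
  ultimately show ?thesis by simp
qed

text \<open>The squared Frobenius norm of the gradient; its integral \<open>dir\<close> omits the
  factor 1/2 of the energy.\<close>

definition gsq :: "(real^2 \<Rightarrow> 'b::real_normed_vector) \<Rightarrow> real^2 \<Rightarrow> real" where
  "gsq f x = (norm (pd 1 f x))\<^sup>2 + (norm (pd 2 f x))\<^sup>2"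

lemma gsq_cont: "C1 f \<Longrightarrow> continuous_on S (gsq f)"
  unfolding gsq_def[abs_def] by (intro continuous_intros C1_cont_pd)

lemma gsq_nonneg: "gsq f x \<ge> 0" by (simp add: gsq_def)

lemma gradient_norm_sq_le:
  fixes f :: "real^2 \<Rightarrow> 'b::real_normed_vector" and z :: "real^2"
  shows "(norm (z$1 *\<^sub>R pd 1 f x + z$2 *\<^sub>R pd 2 f x))\<^sup>2 \<le> (norm z)\<^sup>2 * gsq f x"
proof -
  let ?a = "norm (pd 1 f x)" and ?b = "norm (pd 2 f x)"
  have "norm (z$1 *\<^sub>R pd 1 f x + z$2 *\<^sub>R pd 2 f x) \<le> \<bar>z$1\<bar> * ?a + \<bar>z$2\<bar> * ?b"
    by (metis norm_triangle_ineq norm_scaleR)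
  then have "(norm (z$1 *\<^sub>R pd 1 f x + z$2 *\<^sub>R pd 2 f x))\<^sup>2 \<le> (\<bar>z$1\<bar> * ?a + \<bar>z$2\<bar> * ?b)\<^sup>2"
    by (simp add: power_mono)
  also have "\<dots> \<le> (\<bar>z$1\<bar>\<^sup>2 + \<bar>z$2\<bar>\<^sup>2) * (?a\<^sup>2 + ?b\<^sup>2)"
  proof -
    have "(A * a + B * b)\<^sup>2 \<le> (A\<^sup>2 + B\<^sup>2) * (a\<^sup>2 + b\<^sup>2)" for A B a b :: real
      using sum_power2_ge_zero[of "A * b - B * a" 0] by (simp add: power2_eq_square algebra_simps)
    then show ?thesis .
  qed
  also have "\<dots> = ((z$1)\<^sup>2 + (z$2)\<^sup>2) * (?a\<^sup>2 + ?b\<^sup>2)" by simp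
  also have "(z$1)\<^sup>2 + (z$2)\<^sup>2 = (norm z)\<^sup>2"
    by (simp add: norm_vec_def L2_set_def sum_2)
  finally show ?thesis by (simp add: gsq_def)
qed

text \<open>The increment is the integral of the directional derivative along the segment from
  \<open>x\<close> to \<open>x + z\<close>. Jensen in the segment parameter, then Tonelli and
  translation invariance in \<open>x\<close>, give the bound.\<close>

lemma nn_translation_estimate:
  fixes f :: "real^2 \<Rightarrow> 'b::euclidean_space"
  assumes "C1 f"
  shows "(\<integral>\<^sup>+x. ennreal ((norm (f (x + z) - f x))\<^sup>2) \<partial>lborel) \<le> ennreal ((norm z)\<^sup>2) * (\<integral>\<^sup>+x. ennreal (gsq f x) \<partial>lborel)"
proof -
  have gm[measurable]: "gsq f \<in> borel_measurable borel" by (intro borel_measurable_continuous_onI gsq_cont assms)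
  have pt: "ennreal ((norm (f (x + z) - f x))\<^sup>2) \<le> (\<integral>\<^sup>+t. indicator {0..1} t * ennreal ((norm z)\<^sup>2 * gsq f (x + t *\<^sub>R z)) \<partial>lborel)" for x
  proof -
    let ?D = "\<lambda>t::real. z$1 *\<^sub>R pd 1 f (x + t *\<^sub>R z) + z$2 *\<^sub>R pd 2 f (x + t *\<^sub>R z)"
    have cD: "continuous_on UNIV ?D"
      by (intro continuous_intros continuous_on_compose2[OF C1_cont_pd[OF assms, of UNIV]]) auto
    have cG: "continuous_on UNIV (\<lambda>t. (norm z)\<^sup>2 * gsq f (x + t *\<^sub>R z))"
      by (intro continuous_intros continuous_on_compose2[OF gsq_cont[OF assms, of UNIV]]) auto
    have c2: "continuous_on {0..1} (\<lambda>t. (norm (?D t))\<^sup>2)"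
      by (intro continuous_on_power continuous_on_norm continuous_on_subset[OF cD]) auto
    have vd: "((\<lambda>t. f (x + t *\<^sub>R z)) has_vector_derivative ?D t) (at t within {0..1})" for t
    proof -
      have l: "((\<lambda>t. x + t *\<^sub>R z) has_derivative (\<lambda>s. s *\<^sub>R z)) (at t within {0..1})"
        by (auto intro!: derivative_eq_intros)
      show ?thesis
        unfolding has_vector_derivative_def
        using has_derivative_compose[OF l C1_hd[OF assms]] by (simp add: algebra_simps)
    qed
    have "(\<integral>t. indicator {0..1} t *\<^sub>R ?D t \<partial>lborel) = f (x + z) - f x"
      using integral_FTC_Icc[of 0 1 "\<lambda>t. f (x + t *\<^sub>R z)" ?D] vd continuous_on_subset[OF cD] by auto
    moreover have "(norm (\<integral>t. indicator {0..1} t *\<^sub>R ?D t \<partial>lborel))\<^sup>2 \<le> (\<integral>t. indicator {0..1} t * (norm (?D t))\<^sup>2 \<partial>lborel)"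
    proof (rule jensen_sq)
      show "integrable lborel (\<lambda>t::real. indicator {0..1} t * (norm (?D t))\<^sup>2)"
        using borel_integrable_compact[OF _ c2] by simp
      show "?D \<in> borel_measurable lborel" using cD by (simp add: borel_measurable_continuous_onI)
    qed auto
    moreover have "(\<integral>t. indicator {0..1} t * (norm (?D t))\<^sup>2 \<partial>lborel) \<le> (\<integral>t. indicator {0..1} t * ((norm z)\<^sup>2 * gsq f (x + t *\<^sub>R z)) \<partial>lborel)"
    proof (rule integral_mono)
      show "integrable lborel (\<lambda>t::real. indicator {0..1} t * (norm (?D t))\<^sup>2)"
        using borel_integrable_compact[OF _ c2] by simp
      show "integrable lborel (\<lambda>t::real. indicator {0..1} t * ((norm z)\<^sup>2 * gsq f (x + t *\<^sub>R z)))"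
        using borel_integrable_compact[of "{0..1}" "\<lambda>t. (norm z)\<^sup>2 * gsq f (x + t *\<^sub>R z)"] continuous_on_subset[OF cG]
        by auto
      show "indicator {0..1} t * (norm (?D t))\<^sup>2 \<le> indicator {0..1} t * ((norm z)\<^sup>2 * gsq f (x + t *\<^sub>R z))" for t :: real
        by (intro mult_left_mono gradient_norm_sq_le) auto
    qed
    ultimately have "ennreal ((norm (f (x + z) - f x))\<^sup>2) \<le> ennreal (\<integral>t. indicator {0..1} t * ((norm z)\<^sup>2 * gsq f (x + t *\<^sub>R z)) \<partial>lborel)"
      by (intro ennreal_leI) simp
    also have "\<dots> = (\<integral>\<^sup>+t. ennreal (indicator {0..1} t * ((norm z)\<^sup>2 * gsq f (x + t *\<^sub>R z))) \<partial>lborel)"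
    proof (rule nn_integral_eq_integral[symmetric])
      show "integrable lborel (\<lambda>t::real. indicator {0..1} t * ((norm z)\<^sup>2 * gsq f (x + t *\<^sub>R z)))"
        using borel_integrable_compact[of "{0..1}" "\<lambda>t. (norm z)\<^sup>2 * gsq f (x + t *\<^sub>R z)"] continuous_on_subset[OF cG]
        by auto
    qed (simp add: gsq_nonneg)
    also have "\<dots> = (\<integral>\<^sup>+t. indicator {0..1} t * ennreal ((norm z)\<^sup>2 * gsq f (x + t *\<^sub>R z)) \<partial>lborel)"
      by (intro nn_integral_cong) (auto simp: indicator_def)
    finally show ?thesis .
  qed
  have "(\<integral>\<^sup>+x. ennreal ((norm (f (x + z) - f x))\<^sup>2) \<partial>lborel) \<le> (\<integral>\<^sup>+x. (\<integral>\<^sup>+t. indicator {0..1} t * ennreal ((norm z)\<^sup>2 * gsq f (x + t *\<^sub>R z)) \<partial>lborel) \<partial>lborel)"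
    by (intro nn_integral_mono pt)
  also have "\<dots> = (\<integral>\<^sup>+t. (\<integral>\<^sup>+x. indicator {0..1} t * ennreal ((norm z)\<^sup>2 * gsq f (x + t *\<^sub>R z)) \<partial>lborel) \<partial>lborel)"
    by (rule lborel_pair.Fubini') measurable
  also have "\<dots> = (\<integral>\<^sup>+t. indicator {0..1::real} t * (ennreal ((norm z)\<^sup>2) * (\<integral>\<^sup>+x. ennreal (gsq f x) \<partial>lborel)) \<partial>lborel)"
  proof (intro nn_integral_cong)
    fix t :: real
    have "(\<integral>\<^sup>+x. ennreal ((norm z)\<^sup>2 * gsq f (x + t *\<^sub>R z)) \<partial>lborel) = (\<integral>\<^sup>+x. ennreal ((norm z)\<^sup>2) * ennreal (gsq f (t *\<^sub>R z + x)) \<partial>lborel)"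
      by (intro nn_integral_cong) (simp add: ennreal_mult gsq_nonneg add.commute)
    also have "\<dots> = ennreal ((norm z)\<^sup>2) * (\<integral>\<^sup>+x. ennreal (gsq f x) \<partial>lborel)"
      by (subst nn_integral_cmult) (auto intro!: arg_cong2[where f="(*)"] nn_integral_translate[of "\<lambda>x. ennreal (gsq f x)"])
    finally show "(\<integral>\<^sup>+x. indicator {0..1} t * ennreal ((norm z)\<^sup>2 * gsq f (x + t *\<^sub>R z)) \<partial>lborel) = indicator {0..1} t * (ennreal ((norm z)\<^sup>2) * (\<integral>\<^sup>+x. ennreal (gsq f x) \<partial>lborel))"
      by (subst nn_integral_cmult) auto
  qed
  also have "\<dots> = ennreal ((norm z)\<^sup>2) * (\<integral>\<^sup>+x. ennreal (gsq f x) \<partial>lborel)"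
    by (subst nn_integral_multc) auto
  finally show ?thesis .
qed

section \<open>Mollification\<close>

text \<open>\<open>E0 0\<close> is the usual flat function exp(-1/t). The powers of 1/t are carried
  along so that the family is closed under differentiation.\<close>

definition E0 :: "nat \<Rightarrow> real \<Rightarrow> real" where
  "E0 n t = (if t \<le> 0 then 0 else exp (- (1/t)) * (1/t)^n)"

text \<open>At 0 the difference quotient is exactly \<open>E0 (Suc n)\<close>, whose limit there is
  0; so one formula covers both sides and the origin.\<close>

lemma E0_deriv: "(E0 n has_real_derivative (E0 (n+2) t - real n * E0 (n+1) t)) (at t)"
proof (cases t "0::real" rule: linorder_cases)
  case less
  have "(E0 n has_real_derivative 0) (at t)"
    by (rule has_field_derivative_transform_within_open[of "\<lambda>t. 0" 0 t "{..<0}"])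
      (use less in \<open>auto simp: E0_def\<close>)
  then show ?thesis using less by (simp add: E0_def)
next
  case greater
  have "((\<lambda>t. exp (- (1/t)) * (1/t)^n) has_real_derivative
     (exp (- (1/t)) * (1/t)^(n+2) - real n * (exp (- (1/t)) * (1/t)^(n+1)))) (at t)"
  proof -
    define u where "u = 1/t"
    have hu: "((\<lambda>t. 1/t) has_real_derivative - (u^2)) (at t)"
      using greater by (auto intro!: derivative_eq_intros simp: u_def power2_eq_square)
    have D1: "((\<lambda>t. exp (- (1/t))) has_real_derivative exp (- u) * u^2) (at t)"
      using DERIV_chain2[OF DERIV_exp DERIV_minus[OF hu]] by (simp add: u_def)
    have D2: "((\<lambda>t. (1/t)^n) has_real_derivative real n * (- (u^2) * u ^ (n - Suc 0))) (at t)"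
      using DERIV_power[OF hu, of n] by (simp add: u_def)
    have "exp (- u) * u^2 * u^n + real n * (- (u^2) * u ^ (n - Suc 0)) * exp (- u)
        = exp (- u) * u^(n+2) - real n * (exp (- u) * u^(n+1))"
      by (cases n) (simp_all add: power2_eq_square algebra_simps)
    then show ?thesis using DERIV_mult[OF D1 D2] by (simp add: u_def)
  qed
  then have "(E0 n has_real_derivative (exp (- (1/t)) * (1/t)^(n+2) - real n * (exp (- (1/t)) * (1/t)^(n+1)))) (at t)"
  proof (rule has_field_derivative_transform_within_open[where S="{0<..}"])
  qed (use greater in \<open>auto simp: E0_def\<close>)
  then show ?thesis using greater by (simp add: E0_def)
next
  case equal
  have lim: "((\<lambda>h. E0 (Suc n) h) \<longlongrightarrow> 0) (at 0)"
    unfolding filterlim_split_at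
  proof (rule filterlim_split_at)
    have "eventually (\<lambda>h. E0 (Suc n) h = 0) (at_left (0::real))"
      by (auto simp: eventually_at_filter E0_def)
    then show "(E0 (Suc n) \<longlongrightarrow> 0) (at_left 0)" by (rule tendsto_eventually)
    have "((\<lambda>h::real. (1/h)^(Suc n) / exp (1/h)) \<longlongrightarrow> 0) (at_right 0)"
      by (rule filterlim_compose[OF tendsto_power_div_exp_0])
        (simp add: divide_inverse filterlim_inverse_at_top_right)
    then show "(E0 (Suc n) \<longlongrightarrow> 0) (at_right 0)"
      by (rule Lim_transform_eventually) (auto simp: eventually_at_filter E0_def exp_minus field_simps)
  qed
  have "(\<lambda>h. (E0 n (0 + h) - E0 n 0) / h) = E0 (Suc n)"
    by (auto simp: fun_eq_iff E0_def)
  then have "(E0 n has_real_derivative 0) (at 0)"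
    unfolding DERIV_def using lim by simp
  then show ?thesis using equal by (simp add: E0_def)
qed

lemma E0_nonneg: "E0 0 t \<ge> 0" by (simp add: E0_def)

lemma E0_le_1: "E0 0 t \<le> 1" by (simp add: E0_def)

text \<open>An algebra of functions containing the bump and closed under partial derivatives: all its
  members are therefore smooth.\<close>

inductive_set bump_algebra :: "real^2 \<Rightarrow> real \<Rightarrow> (real^2 \<Rightarrow> real) set" for a c where
  const: "(\<lambda>x. b) \<in> bump_algebra a c"
| coord: "(\<lambda>x. x $ i) \<in> bump_algebra a c"
| bump: "(\<lambda>x. E0 n (1 - c * ((x$1 - a$1)\<^sup>2 + (x$2 - a$2)\<^sup>2))) \<in> bump_algebra a c"
| add: "f \<in> bump_algebra a c \<Longrightarrow> g \<in> bump_algebra a c \<Longrightarrow> (\<lambda>x. f x + g x) \<in> bump_algebra a c"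
| mult: "f \<in> bump_algebra a c \<Longrightarrow> g \<in> bump_algebra a c \<Longrightarrow> (\<lambda>x. f x * g x) \<in> bump_algebra a c"

text \<open>The chain rule turns a bump generator into bump generators of higher index times a
  linear factor; this is why coordinates and constants are generators too.\<close>

lemma bump_algebra_deriv:
  assumes "f \<in> bump_algebra a c"
  shows "\<exists>g1\<in>bump_algebra a c. \<exists>g2\<in>bump_algebra a c. \<forall>x. (f has_derivative (\<lambda>v. v$1 * g1 x + v$2 * g2 x)) (at x)"
  using assms
proof induction
  case (const b)
  show ?case by (intro bexI[of _ "\<lambda>x. 0"] allI bump_algebra.const) (simp_all add: bump_algebra.const)
next
  case (coord i)
  have h: "((\<lambda>x::real^2. x $ i) has_derivative (\<lambda>v. v $ i)) (at x)" for x
    by (rule bounded_linear_imp_has_derivative) (rule bounded_linear_vec_nth)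
  have "((\<lambda>x::real^2. x $ i) has_derivative (\<lambda>v. v$1 * (if i = 1 then 1 else 0) + v$2 * (if i = 2 then 1 else 0))) (at x)" for x
    using h exhaust_2[of i] by auto
  then show ?case
    by (intro bexI[of _ "\<lambda>x. if i = 1 then 1 else 0"] bexI[of _ "\<lambda>x. if i = 2 then 1 else 0"] allI bump_algebra.const)
next
  case (bump n)
  let ?q = "\<lambda>x::real^2. 1 - c * ((x$1 - a$1)\<^sup>2 + (x$2 - a$2)\<^sup>2)"
  let ?D = "\<lambda>x. E0 (n+2) (?q x) + (- real n) * E0 (n+1) (?q x)"
  have DB: "?D \<in> bump_algebra a c" by (intro bump_algebra.intros)
  have g: "(\<lambda>x. ?D x * (- (2 * c) * (x$i + (- (a$i))))) \<in> bump_algebra a c" for i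
    by (intro bump_algebra.mult[OF DB] bump_algebra.intros)
  have "((\<lambda>x. E0 n (?q x)) has_derivative
      (\<lambda>v. v$1 * (?D x * (- (2 * c) * (x$1 + (- (a$1))))) + v$2 * (?D x * (- (2 * c) * (x$2 + (- (a$2))))))) (at x)" for x
  proof -
    have "(?q has_derivative (\<lambda>v. - (c * (2 * (x$1 - a$1) * v$1 + 2 * (x$2 - a$2) * v$2)))) (at x)"
    proof -
      have c1: "((\<lambda>x::real^2. x $ i) has_derivative (\<lambda>v. v $ i)) (at x)" for i
        by (rule bounded_linear_imp_has_derivative) (rule bounded_linear_vec_nth)
      show ?thesis
        by (auto intro!: derivative_eq_intros c1 simp: algebra_simps)
    qed
    from DERIV_compose_FDERIV[OF E0_deriv[of n "?q x"] this]
    show ?thesis by (rule has_derivative_eq_rhs) (simp add: fun_eq_iff algebra_simps)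
  qed
  then show ?case by (intro bexI[OF _ g] allI)
next
  case (add f g)
  then obtain f1 f2 g1 g2 where *: "f1 \<in> bump_algebra a c" "f2 \<in> bump_algebra a c" "g1 \<in> bump_algebra a c" "g2 \<in> bump_algebra a c"
    and d: "\<And>x. (f has_derivative (\<lambda>v. v$1 * f1 x + v$2 * f2 x)) (at x)" "\<And>x. (g has_derivative (\<lambda>v. v$1 * g1 x + v$2 * g2 x)) (at x)"
    by blast
  have "((\<lambda>x. f x + g x) has_derivative (\<lambda>v. v$1 * (f1 x + g1 x) + v$2 * (f2 x + g2 x))) (at x)" for x
    using has_derivative_add[OF d(1)[of x] d(2)[of x]] by (simp add: algebra_simps)
  then show ?case
    by (intro bexI[OF _ bump_algebra.add[OF *(1,3)]] bexI[OF _ bump_algebra.add[OF *(2,4)]] allI)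
next
  case (mult f g)
  then obtain f1 f2 g1 g2 where *: "f1 \<in> bump_algebra a c" "f2 \<in> bump_algebra a c" "g1 \<in> bump_algebra a c" "g2 \<in> bump_algebra a c"
    and d: "\<And>x. (f has_derivative (\<lambda>v. v$1 * f1 x + v$2 * f2 x)) (at x)" "\<And>x. (g has_derivative (\<lambda>v. v$1 * g1 x + v$2 * g2 x)) (at x)"
    by blast
  have m: "(\<lambda>x. f x * k x + h x * g x) \<in> bump_algebra a c" if "h \<in> bump_algebra a c" "k \<in> bump_algebra a c" for h k
    by (intro bump_algebra.add bump_algebra.mult that mult.hyps)
  have "((\<lambda>x. f x * g x) has_derivative (\<lambda>v. v$1 * (f x * g1 x + f1 x * g x) + v$2 * (f x * g2 x + f2 x * g x))) (at x)" for x
    using has_derivative_mult[OF d(1)[of x] d(2)[of x]] by (simp add: algebra_simps)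
  then show ?case
    by (intro bexI[OF _ m[OF *(1,3)]] bexI[OF _ m[OF *(2,4)]] allI)
qed

lemma bump_algebra_Ck: "f \<in> bump_algebra a c \<Longrightarrow> Ck_on k UNIV f"
proof (induction k arbitrary: f)
  case 0
  then obtain g1 g2 where "\<forall>x. (f has_derivative (\<lambda>v. v$1 * g1 x + v$2 * g2 x)) (at x)"
    using bump_algebra_deriv by blast
  then have "f differentiable_on UNIV" unfolding differentiable_on_def differentiable_def by fastforce
  then show ?case by (simp add: differentiable_imp_continuous_on)
next
  case (Suc k)
  then obtain g1 g2 where g: "g1 \<in> bump_algebra a c" "g2 \<in> bump_algebra a c"
    and d: "\<And>x. (f has_derivative (\<lambda>v. v$1 * g1 x + v$2 * g2 x)) (at x)"
    using bump_algebra_deriv by blast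
  have "partial_deriv 1 f = g1" "partial_deriv 2 f = g2"
    by (simp_all add: fun_eq_iff partial_deriv_eq_pd pd_has_derivative[OF d] axis_def)
  then have "Ck_on k UNIV (partial_deriv i f)" for i using exhaust_2[of i] Suc.IH g by auto
  moreover have "f differentiable at x" for x using d unfolding differentiable_def by blast
  ultimately show ?case by simp
qed

lemma norm2_sq: "(norm (x::real^2))\<^sup>2 = (x$1)\<^sup>2 + (x$2)\<^sup>2"
  by (simp add: norm_vec_def L2_set_def sum_2)

lemma Ck_1_C1: "Ck_on (Suc 0) UNIV f \<Longrightarrow> C1 f"
  by (simp add: C1_def partial_deriv_eq_pd)

definition bump :: "real \<Rightarrow> real^2 \<Rightarrow> real" where
  "bump h x = E0 0 (1 - (norm x)\<^sup>2 / h\<^sup>2)"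

definition kap :: "real \<Rightarrow> real^2 \<Rightarrow> real" where
  "kap h x = bump h x / (\<integral>y. bump h y \<partial>lborel)"

text \<open>As a function of \<open>y\<close>, the reflected and translated bump is a generator
  centred at \<open>x\<close>; the factor \<open>b\<close> leaves room for the normalization in
  \<open>kap\<close>.\<close>

lemma bump_shift_algebra: "(\<lambda>y. b * bump h (x - y)) \<in> bump_algebra x (1 / h\<^sup>2)"
proof -
  have "(\<lambda>y. b * bump h (x - y)) = (\<lambda>y. b * E0 0 (1 - (1 / h\<^sup>2) * ((y$1 - x$1)\<^sup>2 + (y$2 - x$2)\<^sup>2)))"
    by (simp add: fun_eq_iff bump_def norm2_sq power2_commute)
  then show ?thesis by (simp only:) (intro bump_algebra.intros)
qed

lemma bump_uminus: "bump h (- x) = bump h x" by (simp add: bump_def)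

lemma bump_C1: "C1 (bump h)"
  using Ck_1_C1[OF bump_algebra_Ck[OF bump_shift_algebra[of 1 h 0]]] bump_uminus[of h] by simp

lemma bump_nonneg: "bump h x \<ge> 0" by (simp add: bump_def E0_nonneg)

lemma bump_zero: "h > 0 \<Longrightarrow> norm x \<ge> h \<Longrightarrow> bump h x = 0"
proof -
  assume "h > 0" "norm x \<ge> h"
  then have "h\<^sup>2 \<le> (norm x)\<^sup>2" by (simp add: power_mono)
  then have "1 - (norm x)\<^sup>2 / h\<^sup>2 \<le> 0" using \<open>h > 0\<close> by (simp add: field_simps)
  then show "bump h x = 0" by (simp add: bump_def E0_def)
qed

lemma bump_C1c: "h > 0 \<Longrightarrow> C1c (bump h)"
  by (rule C1cI[OF bump_C1 bounded_cball[of 0 h]]) (use bump_zero[of h] in force)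

lemma bump_int: "h > 0 \<Longrightarrow> integrable lborel (bump h)"
  using cont_bounded_supp_integrable[OF C1_cont[OF bump_C1]] bump_C1c C1c_bounded by blast

text \<open>The disc of half the radius suffices: there the bump is at least exp(-4/3) >= 1/5, the
  area is pi * h^2 / 4, and pi > 5/2. The bound is explicit because it fixes the constant 8 of
  \<open>kap_le\<close>, which all later scale estimates inherit.\<close>

lemma bump_integral_lower:
  assumes "h > 0"
  shows "(\<integral>y. bump h y \<partial>lborel) \<ge> h\<^sup>2 / 8"
proof -
  have I: "(\<integral>y. exp (-4/3) * indicator (cball (0::real^2) (h/2)) y \<partial>lborel) \<le> (\<integral>y. bump h y \<partial>lborel)"
  proof (rule integral_mono[OF _ bump_int[OF assms]])
    show "integrable lborel (\<lambda>y::real^2. exp (-4/3) * indicator (cball 0 (h/2)) y :: real)"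
      by (intro integrable_mult_right integrable_indicator_bounded) auto
    fix y :: "real^2"
    show "exp (-4/3) * indicator (cball 0 (h/2)) y \<le> bump h y"
    proof (cases "norm y \<le> h/2")
      case True
      then have "(norm y)\<^sup>2 \<le> (h/2)\<^sup>2" by (simp add: power_mono)
      define Q where "Q = 1 - (norm y)\<^sup>2 / h\<^sup>2"
      have q: "Q \<ge> 3/4" using \<open>(norm y)\<^sup>2 \<le> (h/2)\<^sup>2\<close> assms by (simp add: Q_def field_simps power2_eq_square)
      then have "1 / Q \<le> 1 / (3/4)" by (intro divide_left_mono) auto
      then show ?thesis using q True by (simp add: bump_def E0_def flip: Q_def)
    next
      case False then show ?thesis by (simp add: bump_nonneg)
    qed
  qed
  have M: "measure lborel (cball (0::real^2) (h/2)) = pi * (h/2)\<^sup>2"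
    using content_cball[of "h/2" "0::real^2"] assms by (simp add: unit_ball_vol_2)
  have "exp (-4/3::real) \<ge> 1/5"
  proof -
    have "exp (4/3::real) = exp (1/3) ^ 4" by (simp flip: exp_of_nat_mult)
    also have "exp (1/3::real) \<le> 1 + 1/3 + (1/3)\<^sup>2" by (rule exp_bound) auto
    then have "exp (1/3::real) ^ 4 \<le> (1 + 1/3 + (1/3)\<^sup>2) ^ 4" by (rule power_mono) auto
    also have "\<dots> \<le> (5::real)" by (simp add: power2_eq_square power4_eq_xxxx)
    finally have "exp (4/3::real) \<le> 5" .
    then have "1 / exp (4/3::real) \<ge> 1/5" by (intro divide_left_mono) auto
    then show ?thesis by (simp add: exp_minus inverse_eq_divide)
  qed
  then have "(1/5) * (pi * (h/2)\<^sup>2) \<le> exp (-4/3) * (pi * (h/2)\<^sup>2)" by (intro mult_right_mono) auto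
  also have "exp (-4/3) * (pi * (h/2)\<^sup>2) = (\<integral>y. exp (-4/3) * indicator (cball (0::real^2) (h/2)) y \<partial>lborel)"
    using M by simp
  also note I
  finally have "(1/5) * (pi * (h/2)\<^sup>2) \<le> (\<integral>y. bump h y \<partial>lborel)" .
  moreover have "(1/5) * (pi * (h/2)\<^sup>2) \<ge> h\<^sup>2 / 8"
    using pi_gt3 mult_right_mono[of "5/2" pi "h\<^sup>2"] by (simp add: power2_eq_square field_simps)
  ultimately show ?thesis by linarith
qed

lemma bump_integral_pos: "h > 0 \<Longrightarrow> (\<integral>y. bump h y \<partial>lborel) > 0"
proof -
  assume h: "h > 0"
  then have "h\<^sup>2 / 8 > 0" by simp
  then show "(\<integral>y. bump h y \<partial>lborel) > 0" using bump_integral_lower[OF h] by linarith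
qed

lemma kap_nonneg: "h > 0 \<Longrightarrow> kap h x \<ge> 0"
  using bump_nonneg[of h x] bump_integral_pos[of h] unfolding kap_def
  by (intro divide_nonneg_nonneg) auto

lemma kap_zero: "h > 0 \<Longrightarrow> norm x \<ge> h \<Longrightarrow> kap h x = 0"
  by (simp add: kap_def bump_zero)

lemma kap_uminus: "kap h (- x) = kap h x" by (simp add: kap_def bump_uminus)

lemma kap_le: assumes "h > 0" shows "kap h x \<le> 8 / h\<^sup>2"
proof -
  have "kap h x \<le> 1 / (\<integral>y. bump h y \<partial>lborel)"
    unfolding kap_def using bump_integral_pos[OF assms]
    by (intro divide_right_mono) (auto simp: bump_def[of h x] E0_le_1)
  also have "\<dots> \<le> 1 / (h\<^sup>2 / 8)"
    using bump_integral_lower[OF assms] bump_integral_pos[OF assms] assms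
    by (intro divide_left_mono mult_pos_pos) auto
  finally show ?thesis by simp
qed

lemma kap_C1c: "h > 0 \<Longrightarrow> C1c (kap h)"
  using C1c_scale[OF bump_C1c, of h "1 / (\<integral>y. bump h y \<partial>lborel)"]
  by (simp add: kap_def[abs_def])

lemma kap_cont: "h > 0 \<Longrightarrow> continuous_on S (kap h)"
  using C1_cont[OF C1c_C1[OF kap_C1c]] .

lemma kap_integral: "h > 0 \<Longrightarrow> integrable lborel (kap h)" "h > 0 \<Longrightarrow> (\<integral>x. kap h x \<partial>lborel) = 1"
proof -
  assume h: "h > 0"
  show "integrable lborel (kap h)"
    using cont_bounded_supp_integrable[OF kap_cont C1c_bounded[OF kap_C1c]] h by blast
  have "(\<integral>y. bump h y \<partial>lborel) > 0" using bump_integral_pos[OF h] .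
  then show "(\<integral>x. kap h x \<partial>lborel) = 1" by (simp add: kap_def[abs_def])
qed

text \<open>Here the smoothness of the bump pays off: the translated kernel may be inserted directly
  into \<open>has_weak_partial\<close>.\<close>

lemma kap_test_function:
  assumes "h > 0" "cball x h \<subseteq> A"
  shows "test_function A (\<lambda>y. kap h (x - y))"
proof -
  have "(\<lambda>y. kap h (x - y)) \<in> bump_algebra x (1 / h\<^sup>2)"
    using bump_shift_algebra[of "1 / (\<integral>y. bump h y \<partial>lborel)" h x] by (simp add: kap_def)
  then have "smooth_on UNIV (\<lambda>y. kap h (x - y))"
    by (simp add: smooth_on_def bump_algebra_Ck)
  moreover have "{y. kap h (x - y) \<noteq> 0} \<subseteq> cball x h"
    using kap_zero[OF assms(1)] by (force simp: dist_norm)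
  then have c: "closure {y. kap h (x - y) \<noteq> 0} \<subseteq> cball x h"
    by (simp add: closure_minimal)
  moreover have "compact (closure {y. kap h (x - y) \<noteq> 0})"
    using compact_Int_closed[OF compact_cball closed_closure] c by (metis inf.absorb_iff2)
  ultimately show ?thesis using assms(2) by (auto simp: test_function_def)
qed

section \<open>Convolution with compactly supported kernels\<close>

definition CC :: "(real^2 \<Rightarrow> 'b::real_normed_vector) \<Rightarrow> bool" where
  "CC f \<longleftrightarrow> continuous_on UNIV f \<and> bounded {x. f x \<noteq> 0}"

lemma CC_ball:
  assumes "CC f"
  obtains R where "R > 0" "\<And>x. norm x \<ge> R \<Longrightarrow> f x = 0"
proof -
  obtain B where B: "B > 0" "\<And>x. f x \<noteq> 0 \<Longrightarrow> norm x \<le> B"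
    using assms unfolding CC_def bounded_pos by auto
  have "f x = 0" if "norm x \<ge> B + 1" for x
    using B(2)[of x] that by fastforce
  then show thesis using B(1) that[of "B+1"] by simp
qed

lemma C1c_CC: "C1c f \<Longrightarrow> CC f" by (simp add: CC_def C1c_def C1_cont)

lemma CC_subset: "continuous_on UNIV g \<Longrightarrow> CC f \<Longrightarrow> (\<And>x. f x = 0 \<Longrightarrow> g x = 0) \<Longrightarrow> CC g"
  unfolding CC_def by (auto elim!: bounded_subset)

lemma C1c_pd_CC:
  assumes "C1c f" shows "CC (pd i f)"
proof -
  obtain R where R: "R > 0" "\<And>x. norm x \<ge> R \<Longrightarrow> f x = 0" "\<And>x i. norm x \<ge> R \<Longrightarrow> pd i f x = 0"
    by (rule C1c_ball[OF assms]) blast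
  have "bounded {x. pd i f x \<noteq> 0}"
    by (rule bounded_subset[OF bounded_cball[of 0 R]]) (use R(3) in force)
  then show ?thesis using C1_cont_pd[OF C1c_C1[OF assms]] by (simp add: CC_def)
qed

lemma CC_integrable:
  fixes f :: "real^2 \<Rightarrow> 'b::{banach,second_countable_topology}"
  shows "CC f \<Longrightarrow> integrable lborel f"
  by (simp add: CC_def cont_bounded_supp_integrable)

lemma CC_norm_sq:
  fixes f :: "real^2 \<Rightarrow> 'b::real_normed_vector"
  assumes "CC f" shows "CC (\<lambda>x. (norm (f x))\<^sup>2)"
  by (rule CC_subset[OF _ assms]) (use assms in \<open>auto simp: CC_def intro!: continuous_intros\<close>)

lemma CC_bound:
  fixes k :: "real^2 \<Rightarrow> 'b::real_normed_vector"
  assumes "CC k"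
  obtains M where "M > 0" "\<And>x. norm (k x) \<le> M"
proof -
  obtain R where R: "R > 0" "\<And>x. norm x \<ge> R \<Longrightarrow> k x = 0" by (rule CC_ball[OF assms]) blast
  have "continuous_on (cball 0 R) k" using assms unfolding CC_def by (auto intro: continuous_on_subset)
  then have "bounded (k ` cball 0 R)" using compact_imp_bounded compact_continuous_image compact_cball by metis
  then obtain M where M: "M > 0" "\<And>x. x \<in> cball 0 R \<Longrightarrow> norm (k x) \<le> M" unfolding bounded_pos by auto
  have "norm (k x) \<le> M" for x
    using M R(2)[of x] by (cases "norm x \<le> R") (auto simp: less_imp_le)
  then show thesis using that M(1) by blast
qed

lemma CC_unif:
  fixes k :: "real^2 \<Rightarrow> 'b::real_normed_vector"
  assumes "CC k" "e > 0"
  obtains d where "d > 0" "\<And>x v. norm v < d \<Longrightarrow> norm (k (x + v) - k x) < e"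
proof -
  obtain R where R: "R > 0" "\<And>x. norm x \<ge> R \<Longrightarrow> k x = 0" by (rule CC_ball[OF assms(1)]) blast
  have "uniformly_continuous_on (cball 0 (R+1)) k"
    by (rule compact_uniformly_continuous) (use assms(1) in \<open>auto simp: CC_def intro: continuous_on_subset\<close>)
  then obtain d where d: "d > 0" "\<And>x y. x \<in> cball 0 (R+1) \<Longrightarrow> y \<in> cball 0 (R+1) \<Longrightarrow> dist y x < d \<Longrightarrow> dist (k y) (k x) < e"
    unfolding uniformly_continuous_on_def using assms(2) by metis
  show thesis
  proof (rule that[of "min d 1"])
    fix x v :: "real^2" assume v: "norm v < min d 1"
    have "norm (x + v) \<le> norm x + norm v" "norm x \<le> norm (x + v) + norm v"
      using norm_triangle_ineq[of x v] norm_triangle_ineq4[of "x+v" v] by simp_all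
    \<comment> \<open>Since \<open>v\<close> is shorter than 1, either both points lie in the
      compact ball or both lie where \<open>k\<close> vanishes.\<close>
    then consider "norm x \<le> R + 1" "norm (x + v) \<le> R + 1" | "norm x \<ge> R" "norm (x+v) \<ge> R"
      using v by linarith
    then show "norm (k (x + v) - k x) < e"
    proof cases
      case 1 then show ?thesis using d(2)[of x "x+v", unfolded mem_cball_0] v by (simp add: dist_norm)
    next
      case 2 then show ?thesis using R(2) assms(2) by simp
    qed
  qed (use d in auto)
qed

lemma C1c_unif:
  fixes f :: "real^2 \<Rightarrow> 'b::real_normed_vector"
  assumes "C1c f" "e > 0"
  obtains d where "d > 0" "\<And>x v. norm v \<le> d \<Longrightarrow>
    norm (f (x + v) - f x - (v$1 *\<^sub>R pd 1 f x + v$2 *\<^sub>R pd 2 f x)) \<le> e * norm v"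
proof -
  obtain R where R: "R > 0" "\<And>x. norm x \<ge> R \<Longrightarrow> f x = 0" "\<And>x i. norm x \<ge> R \<Longrightarrow> pd i f x = 0"
    by (rule C1c_ball[OF assms(1)]) blast
  from C1_unif_ex[OF C1c_C1[OF assms(1)] compact_cball[of 0 "R+1"] assms(2)]
  obtain d where d: "d > 0" "\<And>x v. x \<in> cball 0 (R+1) \<Longrightarrow> norm v \<le> d \<Longrightarrow>
    norm (f (x + v) - f x - (v$1 *\<^sub>R pd 1 f x + v$2 *\<^sub>R pd 2 f x)) \<le> e * norm v"
    by blast
  show thesis
  proof (rule that[of "min d 1"])
    fix x v :: "real^2" assume v: "norm v \<le> min d 1"
    show "norm (f (x + v) - f x - (v$1 *\<^sub>R pd 1 f x + v$2 *\<^sub>R pd 2 f x)) \<le> e * norm v"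
    proof (cases "norm x \<le> R + 1")
      case True then show ?thesis using d(2) v by simp
    next
      case False
      then have "norm (x + v) \<ge> R" using norm_triangle_ineq4[of "x+v" v] v by simp
      then show ?thesis using False R assms(2) by simp
    qed
  qed (use d in auto)
qed

definition conv :: "(real^2 \<Rightarrow> real) \<Rightarrow> (real^2 \<Rightarrow> 'b::{banach,second_countable_topology}) \<Rightarrow> real^2 \<Rightarrow> 'b" where
  "conv k f x = (\<integral>y. k (x - y) *\<^sub>R f y \<partial>lborel)"

lemma integrable_bounded_mult:
  fixes f :: "real^2 \<Rightarrow> 'b::{banach,second_countable_topology}" and k :: "real^2 \<Rightarrow> real"
  assumes "k \<in> borel_measurable borel" "\<And>x. \<bar>k x\<bar> \<le> M" "integrable lborel f"
  shows "integrable lborel (\<lambda>y. k y *\<^sub>R f y)"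
proof (rule Bochner_Integration.integrable_bound[OF integrable_mult_right[OF integrable_norm[OF assms(3)], of M]])
  show "(\<lambda>y. k y *\<^sub>R f y) \<in> borel_measurable lborel"
    using assms(1) borel_measurable_integrable[OF assms(3)] by simp
  show "AE x in lborel. norm (k x *\<^sub>R f x) \<le> norm (M * norm (f x))"
  proof (rule AE_I2)
    fix x
    have "\<bar>k x\<bar> * norm (f x) \<le> M * norm (f x)" by (intro mult_right_mono assms) auto
    then show "norm (k x *\<^sub>R f x) \<le> norm (M * norm (f x))" by simp
  qed
qed

lemma CC_reflect_measurable: "CC k \<Longrightarrow> (\<lambda>y. k (x - y)) \<in> borel_measurable borel"
  unfolding CC_def
  by (intro borel_measurable_continuous_onI continuous_on_compose2[of UNIV k UNIV "\<lambda>y. x - y"])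
    (auto intro!: continuous_intros)

lemma conv_integrable:
  fixes f :: "real^2 \<Rightarrow> 'b::{banach,second_countable_topology}"
  assumes "CC k" "integrable lborel f"
  shows "integrable lborel (\<lambda>y. k (x - y) *\<^sub>R f y)"
proof -
  obtain M where "M > 0" "\<And>x. norm (k x) \<le> M" by (rule CC_bound[OF assms(1)]) blast
  then show ?thesis by (intro integrable_bounded_mult[OF CC_reflect_measurable[OF assms(1)] _ assms(2), where M=M]) simp
qed

lemma norm_integral_mult_le:
  fixes f :: "real^2 \<Rightarrow> 'b::{banach,second_countable_topology}" and k :: "real^2 \<Rightarrow> real"
  assumes "integrable lborel f" "integrable lborel (\<lambda>y. k y *\<^sub>R f y)" "\<And>y. \<bar>k y\<bar> \<le> e"
  shows "norm (\<integral>y. k y *\<^sub>R f y \<partial>lborel) \<le> e * (\<integral>y. norm (f y) \<partial>lborel)"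
proof -
  have "norm (\<integral>y. k y *\<^sub>R f y \<partial>lborel) \<le> (\<integral>y. norm (k y *\<^sub>R f y) \<partial>lborel)"
    by (rule integral_norm_bound)
  also have "\<dots> \<le> (\<integral>y. e * norm (f y) \<partial>lborel)"
    by (rule integral_mono[OF integrable_norm[OF assms(2)] integrable_mult_right[OF integrable_norm[OF assms(1)]]])
      (use assms(3) in \<open>simp add: mult_right_mono\<close>)
  also have "\<dots> = e * (\<integral>y. norm (f y) \<partial>lborel)" by simp
  finally show ?thesis .
qed

lemma conv_cont:
  fixes f :: "real^2 \<Rightarrow> 'b::{banach,second_countable_topology}"
  assumes "CC k" "integrable lborel f"
  shows "continuous_on UNIV (conv k f)"
  unfolding continuous_on_iff
proof (intro ballI allI impI)
  fix x :: "real^2" and e :: real assume e: "e > 0"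
  let ?I = "\<integral>y. norm (f y) \<partial>lborel"
  have I: "?I \<ge> 0" by simp
  have "e / (?I + 1) > 0" by (intro divide_pos_pos e) (use I in linarith)
  then obtain d where d: "d > 0" "\<And>x v. norm v < d \<Longrightarrow> norm (k (x + v) - k x) < e / (?I + 1)"
    by (rule CC_unif[OF assms(1)]) blast
  have "dist (conv k f x') (conv k f x) < e" if x': "dist x' x < d" for x'
  proof -
    have k: "\<bar>k (x' - y) - k (x - y)\<bar> \<le> e / (?I + 1)" for y
      using d(2)[of "x' - x" "x - y"] x' by (simp add: dist_norm less_imp_le)
    have int: "integrable lborel (\<lambda>y. k (x - y) *\<^sub>R f y)" for x using conv_integrable[OF assms] .
    have "conv k f x' - conv k f x = (\<integral>y. (k (x' - y) - k (x - y)) *\<^sub>R f y \<partial>lborel)"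
      unfolding conv_def by (subst Bochner_Integration.integral_diff[symmetric]) (auto simp: int algebra_simps)
    also have "norm \<dots> \<le> e / (?I + 1) * ?I"
      by (rule norm_integral_mult_le[OF assms(2) _ k])
        (use Bochner_Integration.integrable_diff[OF int int] in \<open>simp add: algebra_simps\<close>)
    also have "\<dots> < e"
    proof -
      have "e / (J + 1) * J < e" if "J \<ge> 0" for J using e that by (simp add: field_simps)
      then show ?thesis using I .
    qed
    finally show ?thesis by (simp add: dist_norm)
  qed
  with d(1) show "\<exists>d>0. \<forall>x'\<in>UNIV. dist x' x < d \<longrightarrow> dist (conv k f x') (conv k f x) < e" by blast
qed

text \<open>All the derivative falls on the kernel. Its Taylor remainder is at most
  \<open>e / (?I + 1) * norm v\<close> uniformly in the point, and integration against
  \<open>f\<close> costs the L1 norm \<open>?I\<close>. The summand 1 avoids a division by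
  zero.\<close>

lemma conv_has_derivative:
  fixes f :: "real^2 \<Rightarrow> 'b::{banach,second_countable_topology}"
  assumes "C1c k" "integrable lborel f"
  shows "(conv k f has_derivative (\<lambda>v. v$1 *\<^sub>R conv (pd 1 k) f x + v$2 *\<^sub>R conv (pd 2 k) f x)) (at x)"
  unfolding has_derivative_at_alt
proof (intro conjI allI impI)
  show "bounded_linear (\<lambda>v. v $ 1 *\<^sub>R conv (pd 1 k) f x + v $ 2 *\<^sub>R conv (pd 2 k) f x)"
    by (intro bounded_linear_add bounded_linear_scaleR_const bounded_linear_vec_nth)
  fix e :: real assume e: "e > 0"
  let ?I = "\<integral>y. norm (f y) \<partial>lborel"
  have I: "?I \<ge> 0" by simp
  have "e / (?I + 1) > 0" by (intro divide_pos_pos e) (use I in linarith)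
  then obtain d where d: "d > 0" "\<And>x v. norm v \<le> d \<Longrightarrow>
    norm (k (x + v) - k x - (v$1 *\<^sub>R pd 1 k x + v$2 *\<^sub>R pd 2 k x)) \<le> e / (?I + 1) * norm v"
    by (rule C1c_unif[OF assms(1)]) blast
  have "norm (conv k f x' - conv k f x - ((x' - x)$1 *\<^sub>R conv (pd 1 k) f x + (x' - x)$2 *\<^sub>R conv (pd 2 k) f x)) \<le> e * norm (x' - x)"
    if x': "norm (x' - x) < d" for x'
  proof -
    define v where "v = x' - x"
    let ?K = "\<lambda>y. k (x' - y) - k (x - y) - (v$1 * pd 1 k (x - y) + v$2 * pd 2 k (x - y))"
    have k: "\<bar>?K y\<bar> \<le> e / (?I + 1) * norm v" for y
      using d(2)[of v "x - y"] x' by (simp add: v_def)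
    have int: "integrable lborel (\<lambda>y. k (x - y) *\<^sub>R f y)" "integrable lborel (\<lambda>y. pd i k (x - y) *\<^sub>R f y)" for x i
      using conv_integrable[OF _ assms(2)] C1c_CC[OF assms(1)] C1c_pd_CC[OF assms(1)] by auto
    have eq: "?K y *\<^sub>R f y = k (x' - y) *\<^sub>R f y - k (x - y) *\<^sub>R f y - (v$1 *\<^sub>R (pd 1 k (x - y) *\<^sub>R f y) + v$2 *\<^sub>R (pd 2 k (x - y) *\<^sub>R f y))" for y
      by (simp add: algebra_simps)
    have i2: "integrable lborel (\<lambda>y. ?K y *\<^sub>R f y)"
      unfolding eq by (intro Bochner_Integration.integrable_diff Bochner_Integration.integrable_add integrable_scaleR_right int)
    have "conv k f x' - conv k f x - (v$1 *\<^sub>R conv (pd 1 k) f x + v$2 *\<^sub>R conv (pd 2 k) f x) = (\<integral>y. ?K y *\<^sub>R f y \<partial>lborel)"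
      unfolding conv_def eq using int by (simp del: scaleR_scaleR)
    also have "norm \<dots> \<le> (e / (?I + 1) * norm v) * ?I"
      by (rule norm_integral_mult_le[OF assms(2) i2 k])
    also have "\<dots> = (e * norm v) * (?I / (?I + 1))" by simp
    also have "\<dots> \<le> (e * norm v) * 1"
    proof (intro mult_left_mono)
      have "J / (J + 1) \<le> 1" if "J \<ge> 0" for J :: real using that by simp
      then show "?I / (?I + 1) \<le> 1" using I .
    qed (use e in simp)
    finally show ?thesis by (simp add: v_def)
  qed
  with d(1) show "\<exists>d>0. \<forall>y. norm (y - x) < d \<longrightarrow> norm (conv k f y - conv k f x - ((y - x) $ 1 *\<^sub>R conv (pd 1 k) f x + (y - x) $ 2 *\<^sub>R conv (pd 2 k) f x)) \<le> e * norm (y - x)"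
    by blast
qed

lemma conv_C1:
  fixes f :: "real^2 \<Rightarrow> 'b::{banach,second_countable_topology}"
  assumes "C1c k" "integrable lborel f"
  shows "C1 (conv k f)" "pd i (conv k f) x = conv (pd i k) f x"
proof -
  have p: "pd i (conv k f) x = conv (pd i k) f x" for i x
    using exhaust_2[of i] by (auto simp: pd_has_derivative[OF conv_has_derivative[OF assms]] axis_def)
  then show "pd i (conv k f) x = conv (pd i k) f x" .
  have "pd i (conv k f) = conv (pd i k) f" for i using p by auto
  then show "C1 (conv k f)" unfolding C1_def
    using conv_has_derivative[OF assms] conv_cont[OF C1c_pd_CC[OF assms(1)] assms(2)]
    by (auto simp: differentiable_def)
qed

lemma C1_reflect:
  fixes k :: "real^2 \<Rightarrow> 'b::real_normed_vector"
  assumes "C1 k"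
  shows "C1 (\<lambda>y. k (x - y))" "pd i (\<lambda>y. k (x - y)) y = - pd i k (x - y)"
proof -
  have h: "((\<lambda>y. k (x - y)) has_derivative (\<lambda>v. (- v)$1 *\<^sub>R pd 1 k (x - y) + (- v)$2 *\<^sub>R pd 2 k (x - y))) (at y)" for y
    by (rule has_derivative_compose[OF _ C1_hd[OF assms]]) (auto intro!: derivative_eq_intros)
  have p: "pd i (\<lambda>y. k (x - y)) y = - pd i k (x - y)" for i y
    using exhaust_2[of i] by (auto simp: pd_has_derivative[OF h] axis_def)
  then show "pd i (\<lambda>y. k (x - y)) y = - pd i k (x - y)" .
  have "continuous_on UNIV (\<lambda>y. - pd i k (x - y))" for i
    by (intro continuous_intros continuous_on_compose2[OF C1_cont_pd[OF assms, of UNIV]]) auto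
  moreover have "pd i (\<lambda>y. k (x - y)) = (\<lambda>y. - pd i k (x - y))" for i using p by auto
  ultimately show "C1 (\<lambda>y. k (x - y))" unfolding C1_def using h by (auto simp: differentiable_def)
qed

definition mol :: "real \<Rightarrow> (real^2 \<Rightarrow> 'b::{banach,second_countable_topology}) \<Rightarrow> real^2 \<Rightarrow> 'b" where
  "mol h f = conv (kap h) f"

text \<open>Integration by parts: \<open>integral_pd_zero\<close> for the product of the reflected
  kernel and \<open>f\<close> moves the derivative from the kernel to \<open>f\<close>.\<close>

lemma mol_pd:
  fixes f :: "real^2 \<Rightarrow> 'b::euclidean_space"
  assumes "h > 0" "C1c f"
  shows "pd i (mol h f) x = mol h (pd i f) x"
proof -
  let ?k = "\<lambda>y. kap h (x - y)"
  note k = C1_reflect[OF C1c_C1[OF kap_C1c[OF assms(1)]], where x=x]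
  have fi: "integrable lborel f" "integrable lborel (pd i f)"
    using CC_integrable C1c_CC[OF assms(2)] C1c_pd_CC[OF assms(2)] by blast+
  have c: "C1c (\<lambda>y. ?k y *\<^sub>R f y)"
    by (rule C1c_bilinear[OF bounded_bilinear_scaleR k(1) C1c_C1[OF assms(2)]]) (use assms(2) in simp)
  have "pd i (\<lambda>y. ?k y *\<^sub>R f y) y = ?k y *\<^sub>R pd i f y + (- pd i (kap h) (x - y)) *\<^sub>R f y" for y
    using C1_bounded_bilinear(2)[OF bounded_bilinear_scaleR k(1) C1c_C1[OF assms(2)]] k(2) by simp
  then have "(\<integral>y. ?k y *\<^sub>R pd i f y + (- pd i (kap h) (x - y)) *\<^sub>R f y \<partial>lborel) = 0"
    using integral_pd_zero[OF c, of i] by simp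
  then have "(\<integral>y. ?k y *\<^sub>R pd i f y \<partial>lborel) = (\<integral>y. pd i (kap h) (x - y) *\<^sub>R f y \<partial>lborel)"
    using conv_integrable[OF C1c_CC[OF kap_C1c[OF assms(1)]] fi(2)] conv_integrable[OF C1c_pd_CC[OF kap_C1c[OF assms(1)]] fi(1)]
    by simp
  then show ?thesis
    using conv_C1(2)[OF kap_C1c[OF assms(1)] fi(1)] by (simp add: mol_def conv_def)
qed

lemma mol_zero:
  assumes "h > 0" "\<And>y. norm (x - y) < h \<Longrightarrow> f y = 0"
  shows "mol h f x = 0"
proof -
  have "kap h (x - y) *\<^sub>R f y = 0" for y
    using assms(2)[of y] kap_zero[OF assms(1), of "x - y"] by (cases "norm (x - y) < h") auto
  then have "(\<lambda>y. kap h (x - y) *\<^sub>R f y) = (\<lambda>y. 0)" by (rule ext)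
  then show ?thesis by (simp only: mol_def conv_def Bochner_Integration.integral_zero)
qed

lemma mol_bounded_supp:
  assumes "h > 0" "bounded {x. f x \<noteq> 0}"
  shows "bounded {x. mol h f x \<noteq> 0}"
proof -
  obtain B where B: "\<And>x. f x \<noteq> 0 \<Longrightarrow> norm x \<le> B" using assms(2) unfolding bounded_pos by auto
  have "mol h f x = 0" if "norm x > B + h" for x
  proof (rule mol_zero[OF assms(1)])
    fix y assume "norm (x - y) < h"
    then have "norm y > B" using that norm_triangle_ineq4[of "x" "x - y"] norm_triangle_sub[of x y] by simp
    then show "f y = 0" using B[of y] by fastforce
  qed
  then show ?thesis by (intro bounded_subset[OF bounded_cball[of 0 "B+h"]]) force
qed

section \<open>Square-integrable functions of bounded support\<close>

text \<open>Bounded support is included so that such functions are integrable and hence can be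
  convolved.\<close>

definition L2b :: "(real^2 \<Rightarrow> 'b::{banach,second_countable_topology}) \<Rightarrow> bool" where
  "L2b f \<longleftrightarrow> f \<in> borel_measurable borel \<and> bounded {x. f x \<noteq> 0} \<and> integrable lborel (\<lambda>x. (norm (f x))\<^sup>2)"

text \<open>The square of the L2 norm, not the norm itself.\<close>

definition l2 :: "(real^2 \<Rightarrow> 'b::real_normed_vector) \<Rightarrow> real" where
  "l2 f = (\<integral>x. (norm (f x))\<^sup>2 \<partial>lborel)"

lemma l2_nonneg: "l2 f \<ge> 0" by (simp add: l2_def)

lemma CC_L2b:
  fixes f :: "real^2 \<Rightarrow> 'b::{banach,second_countable_topology}"
  shows "CC f \<Longrightarrow> L2b f"
  using CC_integrable[OF CC_norm_sq, of f]
  by (auto simp: L2b_def CC_def borel_measurable_continuous_onI)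

lemma L2b_integrable:
  fixes f :: "real^2 \<Rightarrow> 'b::{banach,second_countable_topology}"
  assumes "L2b f" shows "integrable lborel f"
proof -
  obtain B where B: "\<And>x. f x \<noteq> 0 \<Longrightarrow> norm x \<le> B" using assms unfolding L2b_def bounded_pos by auto
  have "integrable lborel (\<lambda>x. indicat_real (cball 0 B) x + (norm (f x))\<^sup>2)"
    by (intro Bochner_Integration.integrable_add integrable_indicator_bounded) (use assms in \<open>auto simp: L2b_def\<close>)
  then show ?thesis
  proof (rule Bochner_Integration.integrable_bound)
    show "f \<in> borel_measurable lborel" using assms by (simp add: L2b_def)
    show "AE x in lborel. norm (f x) \<le> norm (indicat_real (cball 0 B) x + (norm (f x))\<^sup>2)"
    proof (rule AE_I2)
      fix x
      have "norm (f x) \<le> 1 + (norm (f x))\<^sup>2" using sum_power2_ge_zero[of "norm (f x) - 1/2" 0] by (simp add: power2_eq_square algebra_simps)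
      then show "norm (f x) \<le> norm (indicat_real (cball 0 B) x + (norm (f x))\<^sup>2)"
        using B[of x] by (cases "f x = 0") auto
    qed
  qed
qed

lemma mol_C1:
  fixes f :: "real^2 \<Rightarrow> 'b::{banach,second_countable_topology}"
  assumes "h > 0" "integrable lborel f" shows "C1 (mol h f)"
  unfolding mol_def by (rule conv_C1(1)[OF kap_C1c[OF assms(1)] assms(2)])

lemma mol_C1c:
  fixes f :: "real^2 \<Rightarrow> 'b::{banach,second_countable_topology}"
  assumes "h > 0" "L2b f" shows "C1c (mol h f)"
  using mol_C1[OF assms(1) L2b_integrable[OF assms(2)]] mol_bounded_supp[OF assms(1), of f] assms(2)
  by (simp add: C1c_def L2b_def)

lemma mol_sq_le:
  fixes f :: "real^2 \<Rightarrow> 'b::{banach,second_countable_topology}"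
  assumes "h > 0" "L2b f"
  shows "(norm (mol h f x))\<^sup>2 \<le> (\<integral>y. kap h (x - y) * (norm (f y))\<^sup>2 \<partial>lborel)"
    and "integrable lborel (\<lambda>y. kap h (x - y) * (norm (f y))\<^sup>2)"
proof -
  show i: "integrable lborel (\<lambda>y. kap h (x - y) * (norm (f y))\<^sup>2)"
    using conv_integrable[OF C1c_CC[OF kap_C1c[OF assms(1)]], of "\<lambda>y. (norm (f y))\<^sup>2"] assms(2)
    by (simp add: L2b_def)
  have eq: "kap h (x - y) = kap h (y - x)" for y using kap_uminus[of h "x - y"] by simp
  have t: "integrable lborel (\<lambda>y. kap h (x - y))" "(\<integral>y. kap h (x - y) \<partial>lborel) = 1"
    using integrable_translate[OF kap_integral(1)[OF assms(1)], of "- x"] kap_integral(2)[OF assms(1)]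
    unfolding eq by simp_all
  show "(norm (mol h f x))\<^sup>2 \<le> (\<integral>y. kap h (x - y) * (norm (f y))\<^sup>2 \<partial>lborel)"
    unfolding mol_def conv_def
    by (rule jensen_sq[OF t(1) _ t(2) _ i]) (use assms kap_nonneg in \<open>auto simp: L2b_def\<close>)
qed

text \<open>Jensen and the bound 8 / h^2 on the kernel: at scale \<open>h\<close>, control in L2
  becomes control in the supremum norm.\<close>

lemma mol_pointwise:
  fixes f :: "real^2 \<Rightarrow> 'b::{banach,second_countable_topology}"
  assumes "h > 0" "L2b f"
  shows "(norm (mol h f x))\<^sup>2 \<le> 8 / h\<^sup>2 * l2 f"
proof -
  have "(\<integral>y. kap h (x - y) * (norm (f y))\<^sup>2 \<partial>lborel) \<le> (\<integral>y. 8 / h\<^sup>2 * (norm (f y))\<^sup>2 \<partial>lborel)"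
  proof (rule integral_mono[OF mol_sq_le(2)[OF assms]])
    show "integrable lborel (\<lambda>y. 8 / h\<^sup>2 * (norm (f y))\<^sup>2)" using assms(2) by (simp add: L2b_def)
    show "kap h (x - y) * (norm (f y))\<^sup>2 \<le> 8 / h\<^sup>2 * (norm (f y))\<^sup>2" for y
      by (intro mult_right_mono kap_le assms) simp
  qed
  then show ?thesis using mol_sq_le(1)[OF assms, of x] by (simp add: l2_def)
qed

lemma nn_conv_le:
  fixes F :: "real^2 \<Rightarrow> ennreal"
  assumes "h > 0" "F \<in> borel_measurable borel"
  shows "(\<integral>\<^sup>+x. \<integral>\<^sup>+y. ennreal (kap h (x - y)) * F y \<partial>lborel \<partial>lborel) = (\<integral>\<^sup>+y. F y \<partial>lborel)"
proof -
  note [measurable] = assms(2)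
  have [measurable]: "kap h \<in> borel_measurable borel" using kap_cont[OF assms(1)] by (rule borel_measurable_continuous_onI)
  have "(\<integral>\<^sup>+x. \<integral>\<^sup>+y. ennreal (kap h (x - y)) * F y \<partial>lborel \<partial>lborel) = (\<integral>\<^sup>+y. \<integral>\<^sup>+x. ennreal (kap h (x - y)) * F y \<partial>lborel \<partial>lborel)"
    by (rule lborel_pair.Fubini') measurable
  also have "\<dots> = (\<integral>\<^sup>+y. F y \<partial>lborel)"
  proof (rule nn_integral_cong)
    fix y :: "real^2"
    have "(\<integral>\<^sup>+x. ennreal (kap h (x - y)) \<partial>lborel) = (\<integral>\<^sup>+x. ennreal (kap h x) \<partial>lborel)"
      using nn_integral_translate[of "\<lambda>x. ennreal (kap h x)" "- y"] by simp
    also have "\<dots> = ennreal 1"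
      using nn_integral_eq_integral[OF kap_integral(1)[OF assms(1)]] kap_integral(2)[OF assms(1)] kap_nonneg[OF assms(1)] by simp
    finally show "(\<integral>\<^sup>+x. ennreal (kap h (x - y)) * F y \<partial>lborel) = F y"
      by (subst nn_integral_multc) auto
  qed
  finally show ?thesis .
qed

lemma l2_ennreal:
  fixes f :: "real^2 \<Rightarrow> 'b::{banach,second_countable_topology}"
  assumes "L2b f" shows "(\<integral>\<^sup>+x. ennreal ((norm (f x))\<^sup>2) \<partial>lborel) = ennreal (l2 f)"
  unfolding l2_def by (rule nn_integral_eq_integral) (use assms in \<open>auto simp: L2b_def\<close>)

text \<open>Jensen pointwise, then Tonelli with a kernel of mass 1. Extended nonnegative integrals
  make the exchange free of integrability conditions.\<close>

lemma mol_l2: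
  fixes f :: "real^2 \<Rightarrow> 'b::{banach,second_countable_topology}"
  assumes "h > 0" "L2b f"
  shows "l2 (mol h f) \<le> l2 f"
proof -
  have "ennreal (l2 (mol h f)) = (\<integral>\<^sup>+x. ennreal ((norm (mol h f x))\<^sup>2) \<partial>lborel)"
    by (rule l2_ennreal[symmetric, OF CC_L2b[OF C1c_CC[OF mol_C1c[OF assms]]]])
  also have "\<dots> \<le> (\<integral>\<^sup>+x. \<integral>\<^sup>+y. ennreal (kap h (x - y)) * ennreal ((norm (f y))\<^sup>2) \<partial>lborel \<partial>lborel)"
  proof (rule nn_integral_mono)
    fix x
    have "ennreal ((norm (mol h f x))\<^sup>2) \<le> ennreal (\<integral>y. kap h (x - y) * (norm (f y))\<^sup>2 \<partial>lborel)"
      by (rule ennreal_leI[OF mol_sq_le(1)[OF assms]])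
    also have "\<dots> = (\<integral>\<^sup>+y. ennreal (kap h (x - y) * (norm (f y))\<^sup>2) \<partial>lborel)"
      by (rule nn_integral_eq_integral[symmetric, OF mol_sq_le(2)[OF assms]]) (use kap_nonneg[OF assms(1)] in auto)
    finally show "ennreal ((norm (mol h f x))\<^sup>2) \<le> (\<integral>\<^sup>+y. ennreal (kap h (x - y)) * ennreal ((norm (f y))\<^sup>2) \<partial>lborel)"
      using kap_nonneg[OF assms(1)] by (simp add: ennreal_mult)
  qed
  also have "\<dots> = (\<integral>\<^sup>+y. ennreal ((norm (f y))\<^sup>2) \<partial>lborel)"
  proof (rule nn_conv_le[OF assms(1)])
    have [measurable]: "f \<in> borel_measurable borel" using assms(2) by (simp add: L2b_def)
    show "(\<lambda>y. ennreal ((norm (f y))\<^sup>2)) \<in> borel_measurable borel" by measurable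
  qed
  also have "\<dots> = ennreal (l2 f)" by (rule l2_ennreal[OF assms(2)])
  finally show ?thesis by (simp add: l2_nonneg)
qed

definition dir :: "(real^2 \<Rightarrow> 'b::real_normed_vector) \<Rightarrow> real" where
  "dir f = (\<integral>x. gsq f x \<partial>lborel)"

lemma dir_eq: 
  fixes f :: "real^2 \<Rightarrow> 'b::{banach,second_countable_topology}"
  assumes "C1c f" shows "dir f = l2 (pd 1 f) + l2 (pd 2 f)"
  using CC_integrable[OF CC_norm_sq[OF C1c_pd_CC[OF assms]]] by (simp add: dir_def gsq_def[abs_def] l2_def)

lemma gsq_integrable:
  fixes f :: "real^2 \<Rightarrow> 'b::{banach,second_countable_topology}"
  assumes "C1c f" shows "integrable lborel (gsq f)"
  using CC_integrable[OF CC_norm_sq[OF C1c_pd_CC[OF assms]]] by (simp add: gsq_def[abs_def])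

lemma dir_nonneg: "dir f \<ge> 0" by (simp add: dir_def gsq_nonneg)

lemma mol_dir:
  fixes f :: "real^2 \<Rightarrow> 'b::euclidean_space"
  assumes "h > 0" "C1c f"
  shows "dir (mol h f) \<le> dir f"
proof -
  have e: "pd i (mol h f) = mol h (pd i f)" for i using mol_pd[OF assms] by auto
  show ?thesis
    unfolding dir_eq[OF assms(2)] dir_eq[OF mol_C1c[OF assms(1) CC_L2b[OF C1c_CC[OF assms(2)]]]] e
    by (intro add_mono mol_l2 assms CC_L2b C1c_pd_CC)
qed

text \<open>Jensen against the kernel bounds the error by an average of squared increments with
  shifts shorter than \<open>h\<close>, each controlled by
  \<open>nn_translation_estimate\<close>.\<close>

lemma mol_approx:
  fixes f :: "real^2 \<Rightarrow> 'b::euclidean_space"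
  assumes "h > 0" "C1c f"
  shows "l2 (\<lambda>x. mol h f x - f x) \<le> h\<^sup>2 * dir f"
proof -
  have L: "L2b f" by (rule CC_L2b[OF C1c_CC[OF assms(2)]])
  have [measurable]: "f \<in> borel_measurable borel" using L by (simp add: L2b_def)
  have [measurable]: "kap h \<in> borel_measurable borel" using kap_cont[OF assms(1)] by (rule borel_measurable_continuous_onI)
  have C: "C1c (\<lambda>x. mol h f x - f x)" by (rule C1c_diff_fun[OF mol_C1c[OF assms(1) L] assms(2)])
  have pt: "ennreal ((norm (mol h f x - f x))\<^sup>2) \<le> (\<integral>\<^sup>+z. ennreal (kap h z) * ennreal ((norm (f (x + z) - f x))\<^sup>2) \<partial>lborel)" for x
  proof -
    have i0: "integrable lborel (\<lambda>y. kap h (x - y) *\<^sub>R f y)"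
      by (rule conv_integrable[OF C1c_CC[OF kap_C1c[OF assms(1)]] L2b_integrable[OF L]])
    have m: "kap h (x - (x + z)) = kap h z" for z using kap_uminus[of h z] by simp
    have i1: "integrable lborel (\<lambda>z. kap h z *\<^sub>R f (x + z))" and e1: "mol h f x = (\<integral>z. kap h z *\<^sub>R f (x + z) \<partial>lborel)"
      using integrable_translate[OF i0, of x] unfolding m mol_def conv_def by simp_all
    have e2: "mol h f x - f x = (\<integral>z. kap h z *\<^sub>R (f (x + z) - f x) \<partial>lborel)"
      unfolding e1 using i1 kap_integral[OF assms(1)] by (simp add: scaleR_diff_right)
    have CCk: "CC (\<lambda>z. kap h z * (norm (f (x + z) - f x))\<^sup>2)"
    proof (rule CC_subset[OF _ C1c_CC[OF kap_C1c[OF assms(1)]]])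
      have "continuous_on UNIV (\<lambda>z. f (z + x))" by (intro cont_shift C1_cont C1c_C1 assms)
      then show "continuous_on UNIV (\<lambda>z. kap h z * (norm (f (x + z) - f x))\<^sup>2)"
        by (auto intro!: continuous_intros kap_cont assms simp: add.commute)
    qed auto
    have "(norm (mol h f x - f x))\<^sup>2 \<le> (\<integral>z. kap h z * (norm (f (x + z) - f x))\<^sup>2 \<partial>lborel)"
      unfolding e2 by (rule jensen_sq[OF kap_integral(1)[OF assms(1)] kap_nonneg[OF assms(1)] kap_integral(2)[OF assms(1)] _ CC_integrable[OF CCk]]) measurable
    then have "ennreal ((norm (mol h f x - f x))\<^sup>2) \<le> ennreal (\<integral>z. kap h z * (norm (f (x + z) - f x))\<^sup>2 \<partial>lborel)" by (rule ennreal_leI)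
    also have "\<dots> = (\<integral>\<^sup>+z. ennreal (kap h z * (norm (f (x + z) - f x))\<^sup>2) \<partial>lborel)"
      by (rule nn_integral_eq_integral[symmetric, OF CC_integrable[OF CCk]]) (use kap_nonneg[OF assms(1)] in auto)
    finally show ?thesis using kap_nonneg[OF assms(1)] by (simp add: ennreal_mult)
  qed
  have dd: "(\<integral>\<^sup>+x. ennreal (gsq f x) \<partial>lborel) = ennreal (dir f)"
    unfolding dir_def by (rule nn_integral_eq_integral[OF gsq_integrable[OF assms(2)]]) (simp add: gsq_nonneg)
  have "ennreal (l2 (\<lambda>x. mol h f x - f x)) = (\<integral>\<^sup>+x. ennreal ((norm (mol h f x - f x))\<^sup>2) \<partial>lborel)"
    by (rule l2_ennreal[symmetric, OF CC_L2b[OF C1c_CC[OF C]]])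
  also have "\<dots> \<le> (\<integral>\<^sup>+x. \<integral>\<^sup>+z. ennreal (kap h z) * ennreal ((norm (f (x + z) - f x))\<^sup>2) \<partial>lborel \<partial>lborel)"
    by (rule nn_integral_mono[OF pt])
  also have "\<dots> = (\<integral>\<^sup>+z. \<integral>\<^sup>+x. ennreal (kap h z) * ennreal ((norm (f (x + z) - f x))\<^sup>2) \<partial>lborel \<partial>lborel)"
    by (rule lborel_pair.Fubini') measurable
  also have "\<dots> \<le> (\<integral>\<^sup>+z. ennreal (kap h z) * ennreal (h\<^sup>2 * dir f) \<partial>lborel)"
  proof (rule nn_integral_mono)
    fix z :: "real^2"
    have "(\<integral>\<^sup>+x. ennreal (kap h z) * ennreal ((norm (f (x + z) - f x))\<^sup>2) \<partial>lborel) = ennreal (kap h z) * (\<integral>\<^sup>+x. ennreal ((norm (f (x + z) - f x))\<^sup>2) \<partial>lborel)"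
      by (rule nn_integral_cmult) measurable
    also have "\<dots> \<le> ennreal (kap h z) * ennreal (h\<^sup>2 * dir f)"
    proof (cases "norm z < h")
      case True
      then have "(norm z)\<^sup>2 * dir f \<le> h\<^sup>2 * dir f" by (intro mult_right_mono power_mono dir_nonneg) auto
      then have "ennreal ((norm z)\<^sup>2) * ennreal (dir f) \<le> ennreal (h\<^sup>2 * dir f)"
        by (simp add: dir_nonneg flip: ennreal_mult)
      with nn_translation_estimate[OF C1c_C1[OF assms(2)], of z] dd
      show ?thesis by (intro mult_left_mono) auto
    next
      case False then show ?thesis using kap_zero[OF assms(1), of z] by simp
    qed
    finally show "(\<integral>\<^sup>+x. ennreal (kap h z) * ennreal ((norm (f (x + z) - f x))\<^sup>2) \<partial>lborel) \<le> ennreal (kap h z) * ennreal (h\<^sup>2 * dir f)" .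
  qed
  also have "\<dots> = ennreal (h\<^sup>2 * dir f)"
    using nn_integral_eq_integral[OF kap_integral(1)[OF assms(1)]] kap_integral(2)[OF assms(1)] kap_nonneg[OF assms(1)]
    by (subst nn_integral_multc) auto
  finally show ?thesis by (simp add: dir_nonneg)
qed

section \<open>Density of continuous functions and convergence of mollifications\<close>

text \<open>A Urysohn function between a closed subset and a bounded open superset of nearly the
  same measure; the error lives on the two small differences.\<close>

lemma indicator_L1_dense:
  fixes S :: "(real^2) set"
  assumes "S \<in> sets borel" "bounded S" "e > 0"
  shows "\<exists>g::real^2 \<Rightarrow> real. CC g \<and> (\<integral>x. \<bar>indicat_real S x - g x\<bar> \<partial>lborel) < e"
proof -
  have e2: "e/4 > 0" using assms by simp
  have SL: "S \<in> sets lebesgue" using assms(1) by simp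
  obtain C where C: "closed C" "C \<subseteq> S" "S - C \<in> lmeasurable" "emeasure lebesgue (S - C) < ennreal (e/4)"
    by (rule sets_lebesgue_inner_closed[OF SL e2]) blast
  obtain T where T: "open T" "S \<subseteq> T" "T - S \<in> lmeasurable" "emeasure lebesgue (T - S) < ennreal (e/4)"
    by (rule sets_lebesgue_outer_open[OF SL e2]) blast
  obtain B where B: "\<And>x. x \<in> S \<Longrightarrow> norm x \<le> B" using assms(2) unfolding bounded_iff by auto
  define U where "U = T \<inter> ball 0 (B+1)"
  have oU: "open U" using T(1) by (auto simp: U_def)
  have SU: "S \<subseteq> U" using T(2) B by (force simp: U_def)
  have bU: "bounded U" unfolding U_def by (meson Int_lower2 bounded_ball bounded_subset)
  have "C \<inter> (- U) = {}" using C(2) SU by blast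
  then obtain g :: "real^2 \<Rightarrow> real" where g: "continuous_on UNIV g" "\<And>x. g x \<in> closed_segment 1 0"
      "\<And>x. x \<in> C \<Longrightarrow> g x = 1" "\<And>x. x \<in> - U \<Longrightarrow> g x = 0"
    using Urysohn[OF C(1), of "- U" 1 0] oU by (metis closed_Compl)
  have g01: "0 \<le> g x" "g x \<le> 1" for x using g(2)[of x] by (auto simp: closed_segment_eq_real_ivl)
  have ccg: "CC g"
    unfolding CC_def using g(1) bounded_subset[OF bU, of "{x. g x \<noteq> 0}"] g(4) by auto
  have m: "S - C \<in> sets borel" "U - S \<in> sets borel" using C(1) oU assms(1) by auto
  have b: "bounded (S - C)" "bounded (U - S)" using assms(2) bU by (auto intro: bounded_subset)
  have "(\<integral>x. \<bar>indicat_real S x - g x\<bar> \<partial>lborel) \<le> (\<integral>x. indicat_real (S - C) x + indicat_real (U - S) x \<partial>lborel)"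
  proof (rule integral_mono)
    show "integrable lborel (\<lambda>x. \<bar>indicat_real S x - g x\<bar>)"
      by (intro integrable_abs Bochner_Integration.integrable_diff integrable_indicator_bounded assms CC_integrable ccg)
    show "integrable lborel (\<lambda>x. indicat_real (S - C) x + indicat_real (U - S) x)"
      by (intro Bochner_Integration.integrable_add integrable_indicator_bounded m b)
    show "\<bar>indicat_real S x - g x\<bar> \<le> indicat_real (S - C) x + indicat_real (U - S) x" for x
      using g(3)[of x] g(4)[of x] g01[of x] C(2) SU by (auto simp: indicator_def)
  qed
  also have "\<dots> = measure lborel (S - C) + measure lborel (U - S)"
    using integrable_indicator_bounded[OF m(1) b(1)] integrable_indicator_bounded[OF m(2) b(2)] m
    by simp
  also have "\<dots> \<le> e/4 + e/4"
  proof (rule add_mono)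
    have *: "emeasure lborel (S - C) \<le> ennreal (e/4)" using C(4) m(1) by (simp add: less_imp_le)
    have "emeasure lborel (U - S) = emeasure lebesgue (U - S)" using m(2) by simp
    also have "\<dots> \<le> emeasure lebesgue (T - S)"
      by (rule emeasure_mono) (use T(3) in \<open>auto simp: U_def\<close>)
    finally have **: "emeasure lborel (U - S) \<le> ennreal (e/4)" using T(4) by (simp add: less_imp_le)
    show "measure lborel (S - C) \<le> e/4" "measure lborel (U - S) \<le> e/4"
      using enn2real_mono[OF *] enn2real_mono[OF **] e2 by (simp_all add: measure_def)
  qed
  also have "\<dots> < e" using assms(3) by simp
  finally show ?thesis using ccg by blast
qed

lemma CC_add: "CC f \<Longrightarrow> CC g \<Longrightarrow> CC (\<lambda>x. f x + g x)"
  unfolding CC_def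
  by (auto intro: continuous_intros bounded_subset[of "{x. f x \<noteq> 0} \<union> {x. g x \<noteq> 0}"])

text \<open>Induction over integrable functions. The factor \<open>indicator (cball 0 R)\<close>
  keeps the sets that occur bounded, as \<open>indicator_L1_dense\<close> requires.\<close>

lemma L1_dense:
  fixes f :: "real^2 \<Rightarrow> real"
  assumes "integrable lborel f" "e > 0"
  shows "\<exists>g. CC g \<and> (\<integral>x. \<bar>indicator (cball 0 R) x * f x - g x\<bar> \<partial>lborel) < e"
proof -
  let ?B = "cball 0 R :: (real^2) set"
  have iB: "integrable lborel (\<lambda>x. indicat_real ?B x * f x)" if "integrable lborel f" for f :: "real^2 \<Rightarrow> real"
    using integrable_mult_indicator[OF _ that, of ?B] by simp
  have "\<forall>e>0. \<exists>g. CC g \<and> (\<integral>x. \<bar>indicator ?B x * f x - g x\<bar> \<partial>lborel) < e"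
    using assms(1)
  proof (induction)
    case (base A c)
    show ?case
    proof (intro allI impI)
      fix e :: real assume e: "e > 0"
      have "\<bar>c\<bar> + 1 > 0" by simp
      then have e': "e / (\<bar>c\<bar> + 1) > 0" using e by (intro divide_pos_pos)
      have "?B \<inter> A \<in> sets borel" "bounded (?B \<inter> A)" using base by (auto intro: bounded_subset[OF bounded_cball])
      from indicator_L1_dense[OF this e'] obtain g :: "real^2 \<Rightarrow> real"
        where g: "CC g" "(\<integral>x. \<bar>indicat_real (?B \<inter> A) x - g x\<bar> \<partial>lborel) < e / (\<bar>c\<bar> + 1)" by blast
      have "(\<integral>x. \<bar>indicator ?B x * (indicator A x *\<^sub>R c) - c * g x\<bar> \<partial>lborel) = (\<integral>x. \<bar>c\<bar> * \<bar>indicat_real (?B \<inter> A) x - g x\<bar> \<partial>lborel)"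
        by (intro Bochner_Integration.integral_cong) (auto simp: indicator_def algebra_simps simp flip: abs_mult)
      also have "\<dots> = \<bar>c\<bar> * (\<integral>x. \<bar>indicat_real (?B \<inter> A) x - g x\<bar> \<partial>lborel)" by simp
      also have "\<dots> \<le> \<bar>c\<bar> * (e / (\<bar>c\<bar> + 1))" using g(2) by (intro mult_left_mono) auto
      also have "\<dots> < e" using e by (simp add: field_simps)
      finally have "(\<integral>x. \<bar>indicator ?B x * (indicator A x *\<^sub>R c) - c * g x\<bar> \<partial>lborel) < e" .
      moreover have "CC (\<lambda>x. c * g x)"
        by (rule CC_subset[OF _ g(1)]) (use g(1) in \<open>auto simp: CC_def intro: continuous_intros\<close>)
      ultimately show "\<exists>g. CC g \<and> (\<integral>x. \<bar>indicator ?B x * (indicator A x *\<^sub>R c) - g x\<bar> \<partial>lborel) < e"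
        by (intro exI[of _ "\<lambda>x. c * g x"] conjI)
    qed
  next
    case (add f1 f2)
    show ?case
    proof (intro allI impI)
      fix e :: real assume "e > 0"
      then have "e/2 > 0" by simp
      then obtain g1 g2 where g: "CC g1" "(\<integral>x. \<bar>indicator ?B x * f1 x - g1 x\<bar> \<partial>lborel) < e/2"
         "CC g2" "(\<integral>x. \<bar>indicator ?B x * f2 x - g2 x\<bar> \<partial>lborel) < e/2"
        using add.IH by blast
      have i: "integrable lborel (\<lambda>x. indicator ?B x * f1 x - g1 x)" "integrable lborel (\<lambda>x. indicator ?B x * f2 x - g2 x)"
        by (intro Bochner_Integration.integrable_diff iB add.hyps CC_integrable g)+
      have "(\<integral>x. \<bar>indicator ?B x * (f1 x + f2 x) - (g1 x + g2 x)\<bar> \<partial>lborel)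
        = (\<integral>x. \<bar>(indicator ?B x * f1 x - g1 x) + (indicator ?B x * f2 x - g2 x)\<bar> \<partial>lborel)"
        by (intro Bochner_Integration.integral_cong arg_cong[where f=abs]) (simp_all add: algebra_simps)
      also have "\<dots> \<le> (\<integral>x. \<bar>indicator ?B x * f1 x - g1 x\<bar> + \<bar>indicator ?B x * f2 x - g2 x\<bar> \<partial>lborel)"
        by (intro integral_mono integrable_abs Bochner_Integration.integrable_add i abs_triangle_ineq)
      also have "\<dots> < e" using g i by simp
      finally show "\<exists>g. CC g \<and> (\<integral>x. \<bar>indicator ?B x * (f1 x + f2 x) - g x\<bar> \<partial>lborel) < e"
        using CC_add[OF g(1,3)] by blast
    qed
  next
    case (lim f s)
    show ?case
    proof (intro allI impI)
      fix e :: real assume "e > 0"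
      then have e2: "e/2 > 0" by simp
      have i: "integrable lborel (\<lambda>x. indicator ?B x * s n x - indicator ?B x * f x)" for n
        by (intro Bochner_Integration.integrable_diff iB lim.hyps)
      have "(\<lambda>n. \<integral>x. \<bar>indicator ?B x * s n x - indicator ?B x * f x\<bar> \<partial>lborel) \<longlonglongrightarrow> integral\<^sup>L lborel (\<lambda>x::real^2. 0::real)"
      proof (rule integral_dominated_convergence[where w="\<lambda>x. 3 * norm (f x)"])
        show "AE x in lborel. (\<lambda>n. \<bar>indicator ?B x * s n x - indicator ?B x * f x\<bar>) \<longlonglongrightarrow> 0"
        proof (rule AE_I2)
          fix x :: "real^2"
          have "(\<lambda>n. \<bar>indicator ?B x * s n x - indicator ?B x * f x\<bar>) \<longlonglongrightarrow> \<bar>indicator ?B x * f x - indicator ?B x * f x\<bar>"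
            by (intro tendsto_intros lim.hyps) simp
          then show "(\<lambda>n. \<bar>indicator ?B x * s n x - indicator ?B x * f x\<bar>) \<longlonglongrightarrow> 0" by simp
        qed
        show "AE x in lborel. norm \<bar>indicator ?B x * s n x - indicator ?B x * f x\<bar> \<le> 3 * norm (f x)" for n
        proof (rule AE_I2)
          fix x :: "real^2"
          have "\<bar>s n x - f x\<bar> \<le> 3 * norm (f x)" using lim.hyps(3)[of x n] by simp
          then show "norm \<bar>indicator ?B x * s n x - indicator ?B x * f x\<bar> \<le> 3 * norm (f x)"
            by (auto simp: indicator_def)
        qed
        show "integrable lborel (\<lambda>x. 3 * norm (f x))" using lim.hyps by simp
      qed (use i in \<open>auto intro!: borel_measurable_integrable\<close>)
      then have "(\<lambda>n. \<integral>x. \<bar>indicator ?B x * s n x - indicator ?B x * f x\<bar> \<partial>lborel) \<longlonglongrightarrow> 0" by simp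
      from LIMSEQ_D[OF this e2] obtain n where n: "(\<integral>x. \<bar>indicator ?B x * s n x - indicator ?B x * f x\<bar> \<partial>lborel) < e/2"
        by (auto simp: abs_of_nonneg)
      obtain g where g: "CC g" "(\<integral>x. \<bar>indicator ?B x * s n x - g x\<bar> \<partial>lborel) < e/2"
        using lim.IH e2 by blast
      have j: "integrable lborel (\<lambda>x. indicator ?B x * s n x - g x)"
        by (intro Bochner_Integration.integrable_diff iB lim.hyps CC_integrable g)
      have "(\<integral>x. \<bar>indicator ?B x * f x - g x\<bar> \<partial>lborel) \<le>
         (\<integral>x. \<bar>indicator ?B x * s n x - indicator ?B x * f x\<bar> + \<bar>indicator ?B x * s n x - g x\<bar> \<partial>lborel)"
        by (intro integral_mono integrable_abs Bochner_Integration.integrable_add i j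
            Bochner_Integration.integrable_diff iB lim.hyps CC_integrable g) linarith
      also have "\<dots> < e" using g n i j by simp
      finally show "\<exists>g. CC g \<and> (\<integral>x. \<bar>indicator ?B x * f x - g x\<bar> \<partial>lborel) < e" using g(1) by blast
    qed
  qed
  then show ?thesis using assms(2) by blast
qed

lemma norm_add_sq: "(norm (a + b))\<^sup>2 \<le> 2 * (norm a)\<^sup>2 + 2 * (norm b)\<^sup>2" for a b :: "'b::real_normed_vector"
proof -
  have "(norm (a + b))\<^sup>2 \<le> (norm a + norm b)\<^sup>2" by (intro power_mono norm_triangle_ineq) simp
  also have "\<dots> \<le> 2 * (norm a)\<^sup>2 + 2 * (norm b)\<^sup>2"
    using sum_power2_ge_zero[of "norm a - norm b" 0] by (simp add: power2_eq_square algebra_simps)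
  finally show ?thesis .
qed

lemma L2b_add:
  fixes f g :: "real^2 \<Rightarrow> 'b::{banach,second_countable_topology}"
  assumes "L2b f" "L2b g"
  shows "L2b (\<lambda>x. f x + g x)" "l2 (\<lambda>x. f x + g x) \<le> 2 * l2 f + 2 * l2 g"
proof -
  have [measurable]: "f \<in> borel_measurable borel" "g \<in> borel_measurable borel" using assms by (auto simp: L2b_def)
  have i: "integrable lborel (\<lambda>x. 2 * (norm (f x))\<^sup>2 + 2 * (norm (g x))\<^sup>2)"
    using assms by (simp add: L2b_def)
  have j: "integrable lborel (\<lambda>x. (norm (f x + g x))\<^sup>2)"
  proof (rule Bochner_Integration.integrable_bound[OF i])
    show "AE x in lborel. norm ((norm (f x + g x))\<^sup>2) \<le> norm (2 * (norm (f x))\<^sup>2 + 2 * (norm (g x))\<^sup>2)"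
      using norm_add_sq by (auto intro!: AE_I2 order_trans[OF norm_add_sq])
  qed measurable
  have "bounded ({x. f x \<noteq> 0} \<union> {x. g x \<noteq> 0})" using assms by (simp add: L2b_def)
  then have "bounded {x. f x + g x \<noteq> 0}" by (rule bounded_subset) auto
  then show "L2b (\<lambda>x. f x + g x)" using j by (simp add: L2b_def)
  have "l2 (\<lambda>x. f x + g x) \<le> (\<integral>x. 2 * (norm (f x))\<^sup>2 + 2 * (norm (g x))\<^sup>2 \<partial>lborel)"
    unfolding l2_def by (rule integral_mono[OF j i norm_add_sq])
  also have "\<dots> = 2 * l2 f + 2 * l2 g" using assms by (simp add: l2_def L2b_def)
  finally show "l2 (\<lambda>x. f x + g x) \<le> 2 * l2 f + 2 * l2 g" .
qed

lemma L2b_scale: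
  fixes f :: "real^2 \<Rightarrow> 'b::{banach,second_countable_topology}"
  assumes "L2b f" shows "L2b (\<lambda>x. c *\<^sub>R f x)" "l2 (\<lambda>x. c *\<^sub>R f x) = c\<^sup>2 * l2 f"
proof -
  show "L2b (\<lambda>x. c *\<^sub>R f x)"
    using assms bounded_subset[of "{x. f x \<noteq> 0}" "{x. c *\<^sub>R f x \<noteq> 0}"]
    by (auto simp: L2b_def power_mult_distrib)
  show "l2 (\<lambda>x. c *\<^sub>R f x) = c\<^sup>2 * l2 f" by (simp add: l2_def power_mult_distrib)
qed

lemma L2b_diff:
  fixes f g :: "real^2 \<Rightarrow> 'b::{banach,second_countable_topology}"
  assumes "L2b f" "L2b g"
  shows "L2b (\<lambda>x. f x - g x)" "l2 (\<lambda>x. f x - g x) \<le> 2 * l2 f + 2 * l2 g"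
  using L2b_add[OF assms(1) L2b_scale(1)[OF assms(2), of "-1"]] L2b_scale(2)[OF assms(2), of "-1"] by simp_all

text \<open>Truncating \<open>f\<close> at a height \<open>N\<close> costs little in L2 by dominated
  convergence. For functions bounded by \<open>N\<close>, the squared difference is at most 2 * N
  times the difference, so approximation in L1 to within \<open>e / (8 * real N)\<close>
  suffices.\<close>

lemma L2_dense:
  fixes f :: "real^2 \<Rightarrow> real"
  assumes "L2b f" "e > 0"
  shows "\<exists>g. CC g \<and> l2 (\<lambda>x. f x - g x) < e"
proof -
  obtain R where R: "\<And>x. f x \<noteq> 0 \<Longrightarrow> norm x \<le> R" using assms(1) unfolding L2b_def bounded_pos by auto
  have [measurable]: "f \<in> borel_measurable borel" using assms by (auto simp: L2b_def)
  have fi: "integrable lborel f" by (rule L2b_integrable[OF assms(1)])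
  define F where "F N x = max (- real N) (min (real N) (f x))" for N x
  have Fm[measurable]: "F N \<in> borel_measurable borel" for N unfolding F_def[abs_def] by measurable
  have Fle: "\<bar>F N x\<bar> \<le> \<bar>f x\<bar>" "\<bar>F N x\<bar> \<le> real N" "\<bar>f x - F N x\<bar> \<le> \<bar>f x\<bar>" for N x unfolding F_def by auto
  have F0: "F N x = 0" if "norm x > R" for N x using R[of x] that by (force simp: F_def)
  have Fi: "integrable lborel (F N)" for N
    by (rule Bochner_Integration.integrable_bound[OF fi]) (use Fle in auto)
  have lim: "(\<lambda>N. l2 (\<lambda>x. f x - F N x)) \<longlonglongrightarrow> integral\<^sup>L lborel (\<lambda>x::real^2. 0::real)"
    unfolding l2_def
  proof (rule integral_dominated_convergence[where w="\<lambda>x. (norm (f x))\<^sup>2"])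
    show "integrable lborel (\<lambda>x. (norm (f x))\<^sup>2)" using assms by (simp add: L2b_def)
    show "AE x in lborel. (\<lambda>N. (norm (f x - F N x))\<^sup>2) \<longlonglongrightarrow> 0"
    proof (rule AE_I2)
      fix x
      obtain N0 :: nat where "\<bar>f x\<bar> \<le> real N0" using real_arch_simple by blast
      then have "F N x = f x" if "N \<ge> N0" for N using that unfolding F_def by (auto simp: max_def min_def)
      then have "\<forall>\<^sub>F N in sequentially. (norm (f x - F N x))\<^sup>2 = 0"
        by (intro eventually_sequentiallyI[of N0]) simp
      then show "(\<lambda>N. (norm (f x - F N x))\<^sup>2) \<longlonglongrightarrow> 0" by (rule tendsto_eventually)
    qed
    show "AE x in lborel. norm ((norm (f x - F N x))\<^sup>2) \<le> (norm (f x))\<^sup>2" for N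
    proof (rule AE_I2)
      fix x
      have "(norm (f x - F N x))\<^sup>2 \<le> (norm (f x))\<^sup>2" using Fle(3)[where N=N and x=x] by (intro power_mono) auto
      then show "norm ((norm (f x - F N x))\<^sup>2) \<le> (norm (f x))\<^sup>2" by simp
    qed
  qed measurable
  have e4: "e/4 > 0" using assms by simp
  have "(\<lambda>N. l2 (\<lambda>x. f x - F N x)) \<longlonglongrightarrow> 0" using lim by simp
  from LIMSEQ_D[OF this e4] obtain N0 where N0: "\<And>N. N \<ge> N0 \<Longrightarrow> norm (l2 (\<lambda>x. f x - F N x) - 0) < e/4"
    by blast
  define N where "N = max 1 N0"
  have N: "N \<ge> 1" "l2 (\<lambda>x. f x - F N x) < e/4"
    using N0[of N] by (auto simp: N_def abs_less_iff)
  have "e / (8 * real N) > 0" using assms N by simp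
  from L1_dense[OF Fi[of N] this, of R] obtain g0 where g0: "CC g0"
    "(\<integral>x. \<bar>indicator (cball 0 R) x * F N x - g0 x\<bar> \<partial>lborel) < e / (8 * real N)" by blast
  have iF: "indicator (cball 0 R) x * F N x = F N x" for x using F0[of x N] by (auto simp: indicator_def)
  define g where "g x = max (- real N) (min (real N) (g0 x))" for x
  have cg: "CC g"
    by (rule CC_subset[OF _ g0(1)]) (use g0(1) in \<open>auto simp: CC_def g_def[abs_def] intro!: continuous_intros\<close>)
  have pt: "(norm (F N x - g x))\<^sup>2 \<le> 2 * real N * \<bar>F N x - g0 x\<bar>" for x
  proof -
    have "\<bar>F N x - g x\<bar> \<le> 2 * real N" "\<bar>F N x - g x\<bar> \<le> \<bar>F N x - g0 x\<bar>"
      using Fle(2)[where N=N and x=x] unfolding g_def by auto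
    then have "\<bar>F N x - g x\<bar> * \<bar>F N x - g x\<bar> \<le> (2 * real N) * \<bar>F N x - g0 x\<bar>" by (intro mult_mono) auto
    then show ?thesis by (simp add: power2_eq_square)
  qed
  have LF: "L2b (F N)"
    unfolding L2b_def
  proof (intro conjI Fm)
    show "bounded {x. F N x \<noteq> 0}" by (rule bounded_subset[OF bounded_cball[of 0 R]]) (use F0 in force)
    show "integrable lborel (\<lambda>x. (norm (F N x))\<^sup>2)"
      by (rule Bochner_Integration.integrable_bound[of _ "\<lambda>x. (norm (f x))\<^sup>2"])
        (use assms Fle in \<open>auto simp: L2b_def intro!: AE_I2 power_mono simp flip: abs_le_square_iff\<close>)
  qed
  have j: "integrable lborel (\<lambda>x. \<bar>F N x - g0 x\<bar>)"
    by (intro integrable_abs Bochner_Integration.integrable_diff Fi CC_integrable g0)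
  have "l2 (\<lambda>x. F N x - g x) \<le> (\<integral>x. 2 * real N * \<bar>F N x - g0 x\<bar> \<partial>lborel)"
    unfolding l2_def
    by (rule integral_mono[OF _ _ pt]) (use L2b_diff(1)[OF LF CC_L2b[OF cg]] j in \<open>auto simp: L2b_def\<close>)
  also have "\<dots> \<le> 2 * real N * (e / (8 * real N))"
    using g0(2) N(1) unfolding iF by (simp only: integral_mult_right_zero, intro mult_left_mono) auto
  also have "\<dots> = e/4" using N(1) by simp
  finally have 2: "l2 (\<lambda>x. F N x - g x) \<le> e/4" .
  have "l2 (\<lambda>x. (f x - F N x) + (F N x - g x)) \<le> 2 * l2 (\<lambda>x. f x - F N x) + 2 * l2 (\<lambda>x. F N x - g x)"
    by (intro L2b_add(2) L2b_diff(1) assms LF CC_L2b cg)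
  then have "l2 (\<lambda>x. f x - g x) < e" using 2 N(2) by simp
  with cg show ?thesis by blast
qed

lemma mol_diff:
  fixes f g :: "real^2 \<Rightarrow> 'b::{banach,second_countable_topology}"
  assumes "h > 0" "integrable lborel f" "integrable lborel g"
  shows "mol h (\<lambda>x. f x - g x) x = mol h f x - mol h g x"
  unfolding mol_def conv_def
  using conv_integrable[OF C1c_CC[OF kap_C1c[OF assms(1)]] assms(2)] conv_integrable[OF C1c_CC[OF kap_C1c[OF assms(1)]] assms(3)]
  by (simp add: scaleR_diff_right)

lemma mol_uniform:
  fixes g :: "real^2 \<Rightarrow> 'b::{banach,second_countable_topology}"
  assumes "h > 0" "integrable lborel g" "\<And>y. norm (y - x) < h \<Longrightarrow> norm (g y - g x) \<le> e"
  shows "norm (mol h g x - g x) \<le> e"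
proof -
  have eq: "kap h (x - y) = kap h (y - x)" for y using kap_uminus[of h "x - y"] by simp
  have t: "integrable lborel (\<lambda>y. kap h (x - y))" "(\<integral>y. kap h (x - y) \<partial>lborel) = 1"
    using integrable_translate[OF kap_integral(1)[OF assms(1)], of "- x"] kap_integral(2)[OF assms(1)]
    unfolding eq by simp_all
  have i: "integrable lborel (\<lambda>y. kap h (x - y) *\<^sub>R g y)"
    by (rule conv_integrable[OF C1c_CC[OF kap_C1c[OF assms(1)]] assms(2)])
  have i2: "integrable lborel (\<lambda>y. kap h (x - y) *\<^sub>R (g y - g x))"
    using i t by (simp add: scaleR_diff_right)
  have "mol h g x - g x = (\<integral>y. kap h (x - y) *\<^sub>R (g y - g x) \<partial>lborel)"
    unfolding mol_def conv_def using i t by (simp add: scaleR_diff_right)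
  also have "norm \<dots> \<le> (\<integral>y. norm (kap h (x - y) *\<^sub>R (g y - g x)) \<partial>lborel)" by (rule integral_norm_bound)
  also have "\<dots> \<le> (\<integral>y. kap h (x - y) * e \<partial>lborel)"
  proof (rule integral_mono[OF integrable_norm[OF i2]])
    show "integrable lborel (\<lambda>y. kap h (x - y) * e)" using t by simp
    fix y
    show "norm (kap h (x - y) *\<^sub>R (g y - g x)) \<le> kap h (x - y) * e"
      using assms(3)[of y] kap_zero[OF assms(1), of "x - y"] kap_nonneg[OF assms(1), of "x - y"]
      by (cases "norm (y - x) < h") (auto simp: norm_minus_commute intro: mult_left_mono)
  qed
  also have "\<dots> = e" using t by simp
  finally show ?thesis .
qed

text \<open>For a continuous \<open>g\<close> of compact support the convergence is uniform on a
  fixed ball. It carries over to \<open>f\<close> because mollification does not increase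
  \<open>l2\<close>.\<close>

lemma mol_tendsto_L2_real:
  fixes f :: "real^2 \<Rightarrow> real"
  assumes "L2b f" "e > 0"
  shows "\<exists>d>0. \<forall>h. 0 < h \<and> h < d \<longrightarrow> l2 (\<lambda>x. mol h f x - f x) < e"
proof -
  \<comment> \<open>Two uses of the inequality with factor 2 and the contraction property weigh this
    error by 8 and the mollification error e/6 of \<open>g\<close> by 2: 8/12 + 2/6 = 1.\<close>
  have "e/12 > 0" using assms by simp
  then obtain g where g: "CC g" "l2 (\<lambda>x. f x - g x) < e/12" using L2_dense[OF assms(1)] by blast
  obtain R where R: "R > 0" "\<And>x. norm x \<ge> R \<Longrightarrow> g x = 0" by (rule CC_ball[OF g(1)]) blast
  define c where "c = measure lborel (cball (0::real^2) (R + 1))"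
  have c0: "c \<ge> 0" by (simp add: c_def)
  define e' where "e' = sqrt (e / (8 * (c + 1)))"
  have q: "e / (8 * (c + 1)) > 0" using assms(2) c0 by (intro divide_pos_pos) auto
  have e': "e' > 0" using q by (simp add: e'_def)
  have "e'\<^sup>2 * c = e / 8 * (c / (c + 1))" using q by (simp add: e'_def)
  also have "\<dots> \<le> e / 8 * 1" using assms(2) c0 by (intro mult_left_mono) auto
  finally have e'2: "e'\<^sup>2 * c < e/6" using assms(2) by simp
  obtain d where d: "d > 0" "\<And>x v. norm v < d \<Longrightarrow> norm (g (x + v) - g x) < e'" by (rule CC_unif[OF g(1) e']) blast
  have Lg: "L2b g" by (rule CC_L2b[OF g(1)])
  have Ld: "L2b (\<lambda>x. f x - g x)" by (rule L2b_diff(1)[OF assms(1) Lg])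
  note fi = L2b_integrable[OF assms(1)] and gi = L2b_integrable[OF Lg]
  have "l2 (\<lambda>x. mol h f x - f x) < e" if h: "0 < h" "h < min d 1" for h
  proof -
    have Cm: "L2b (mol h F)" if "L2b F" for F :: "real^2 \<Rightarrow> real" by (rule CC_L2b[OF C1c_CC[OF mol_C1c[OF h(1) that]]])
    have LL: "L2b (\<lambda>x. mol h g x - g x)" by (rule L2b_diff(1)[OF Cm[OF Lg] Lg])
    have pt: "(norm (mol h g x - g x))\<^sup>2 \<le> e'\<^sup>2 * indicator (cball 0 (R+1)) x" for x
    proof (cases "norm x \<le> R + 1")
      case True
      have "norm (mol h g x - g x) \<le> e'"
      proof (rule mol_uniform[OF h(1) gi])
        fix y assume "norm (y - x) < h" then show "norm (g y - g x) \<le> e'" using d(2)[of "y - x" x] h by (simp add: less_imp_le)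
      qed
      then have "(norm (mol h g x - g x))\<^sup>2 \<le> e'\<^sup>2" by (rule power_mono) simp
      then show ?thesis using True by simp
    next
      case False
      have "mol h g x = 0"
      proof (rule mol_zero[OF h(1)])
        fix y assume "norm (x - y) < h"
        then have "norm y \<ge> R" using False h norm_triangle_sub[of x y] by simp
        then show "g y = 0" by (rule R(2))
      qed
      then show ?thesis using R(2)[of x] False by simp
    qed
    have "l2 (\<lambda>x. mol h g x - g x) \<le> (\<integral>x. e'\<^sup>2 * indicator (cball (0::real^2) (R+1)) x \<partial>lborel)"
      unfolding l2_def
    proof (rule integral_mono[OF _ _ pt])
      show "integrable lborel (\<lambda>x. (norm (mol h g x - g x))\<^sup>2)" using LL by (simp add: L2b_def)
      show "integrable lborel (\<lambda>x. e'\<^sup>2 * indicat_real (cball (0::real^2) (R + 1)) x)"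
        by (intro integrable_mult_right integrable_indicator_bounded) auto
    qed
    also have "\<dots> = e'\<^sup>2 * c" by (simp add: c_def)
    finally have 1: "l2 (\<lambda>x. mol h g x - g x) < e/6" using e'2 by simp
    have "mol h f x - f x = (mol h (\<lambda>x. f x - g x) x - (f x - g x)) + (mol h g x - g x)" for x
      using mol_diff[OF h(1) fi gi, of x] by simp
    then have "l2 (\<lambda>x. mol h f x - f x) = l2 (\<lambda>x. (mol h (\<lambda>x. f x - g x) x - (f x - g x)) + (mol h g x - g x))"
      by (simp only:)
    also have "\<dots> \<le> 2 * l2 (\<lambda>x. mol h (\<lambda>x. f x - g x) x - (f x - g x)) + 2 * l2 (\<lambda>x. mol h g x - g x)"
      by (intro L2b_add(2) L2b_diff(1)[OF Cm[OF Ld] Ld] LL)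
    also have "l2 (\<lambda>x. mol h (\<lambda>x. f x - g x) x - (f x - g x)) \<le> 2 * l2 (mol h (\<lambda>x. f x - g x)) + 2 * l2 (\<lambda>x. f x - g x)"
      by (intro L2b_diff(2) Cm Ld)
    also have "\<dots> \<le> 2 * l2 (\<lambda>x. f x - g x) + 2 * l2 (\<lambda>x. f x - g x)"
      using mol_l2[OF h(1) Ld] by simp
    finally show ?thesis using g(2) 1 by simp
  qed
  with d(1) show ?thesis by (intro exI[of _ "min d 1"]) auto
qed

lemma mol_Re: "h > 0 \<Longrightarrow> integrable lborel f \<Longrightarrow> Re (mol h f x) = mol h (\<lambda>y. Re (f y)) x"
  using integral_bounded_linear[OF bounded_linear_Re conv_integrable[OF C1c_CC[OF kap_C1c]], of h f x]
  by (simp add: mol_def conv_def)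

lemma mol_Im: "h > 0 \<Longrightarrow> integrable lborel f \<Longrightarrow> Im (mol h f x) = mol h (\<lambda>y. Im (f y)) x"
  using integral_bounded_linear[OF bounded_linear_Im conv_integrable[OF C1c_CC[OF kap_C1c]], of h f x]
  by (simp add: mol_def conv_def)

lemma L2b_Re_Im:
  fixes f :: "real^2 \<Rightarrow> complex"
  assumes "L2b f"
  shows "L2b (\<lambda>x. Re (f x))" "L2b (\<lambda>x. Im (f x))" "l2 f = l2 (\<lambda>x. Re (f x)) + l2 (\<lambda>x. Im (f x))"
proof -
  have [measurable]: "f \<in> borel_measurable borel" using assms by (auto simp: L2b_def)
  have b: "bounded {x. Re (f x) \<noteq> 0}" "bounded {x. Im (f x) \<noteq> 0}"
    using assms unfolding L2b_def by (auto elim!: bounded_subset)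
  have i: "integrable lborel (\<lambda>x. (norm (Re (f x)))\<^sup>2)" "integrable lborel (\<lambda>x. (norm (Im (f x)))\<^sup>2)"
    by (rule Bochner_Integration.integrable_bound[of _ "\<lambda>x. (norm (f x))\<^sup>2"];
      (use assms in \<open>auto simp: L2b_def cmod_power2\<close>))+
  show "L2b (\<lambda>x. Re (f x))" "L2b (\<lambda>x. Im (f x))" using b i by (auto simp: L2b_def)
  show "l2 f = l2 (\<lambda>x. Re (f x)) + l2 (\<lambda>x. Im (f x))"
    unfolding l2_def cmod_power2 using i by simp
qed

lemma mol_tendsto_L2:
  fixes f :: "real^2 \<Rightarrow> complex"
  assumes "L2b f" "e > 0"
  shows "\<exists>d>0. \<forall>h. 0 < h \<and> h < d \<longrightarrow> l2 (\<lambda>x. mol h f x - f x) < e"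
proof -
  have "e/2 > 0" using assms by simp
  obtain d1 where d1: "d1 > 0" "\<And>h. 0 < h \<Longrightarrow> h < d1 \<Longrightarrow> l2 (\<lambda>x. mol h (\<lambda>y. Re (f y)) x - Re (f x)) < e/2"
    using mol_tendsto_L2_real[OF L2b_Re_Im(1)[OF assms(1)] \<open>e/2 > 0\<close>] by blast
  obtain d2 where d2: "d2 > 0" "\<And>h. 0 < h \<Longrightarrow> h < d2 \<Longrightarrow> l2 (\<lambda>x. mol h (\<lambda>y. Im (f y)) x - Im (f x)) < e/2"
    using mol_tendsto_L2_real[OF L2b_Re_Im(2)[OF assms(1)] \<open>e/2 > 0\<close>] by blast
  have "l2 (\<lambda>x. mol h f x - f x) < e" if h: "0 < h" "h < min d1 d2" for h
  proof -
    have "L2b (\<lambda>x. mol h f x - f x)"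
      by (rule L2b_diff(1)[OF CC_L2b[OF C1c_CC[OF mol_C1c[OF h(1) assms(1)]]] assms(1)])
    from L2b_Re_Im(3)[OF this] show ?thesis
      using d1(2)[of h] d2(2)[of h] h by (simp add: mol_Re mol_Im L2b_integrable[OF assms(1)])
  qed
  with d1(1) d2(1) show ?thesis by (intro exI[of _ "min d1 d2"]) auto
qed

section \<open>Integrality of the weighted degree\<close>

definition nbhd :: "(real^2) set \<Rightarrow> real \<Rightarrow> (real^2) set" where
  "nbhd K r = (\<Union>x\<in>K. cball x r)"

lemma nbhd_compact: assumes "compact K" shows "compact (nbhd K r)"
proof -
  have "nbhd K r = (\<lambda>(x,y). x + y) ` (K \<times> cball 0 r)"
  proof (intro equalityI subsetI)
    fix z assume "z \<in> nbhd K r"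
    then obtain x where x: "x \<in> K" "dist x z \<le> r" by (auto simp: nbhd_def)
    then have "z = (\<lambda>(x,y). x + y) (x, z - x)" "(x, z - x) \<in> K \<times> cball 0 r" by (auto simp: dist_norm norm_minus_commute)
    then show "z \<in> (\<lambda>(x,y). x + y) ` (K \<times> cball 0 r)" by (rule image_eqI)
  next
    fix z assume "z \<in> (\<lambda>(x,y). x + y) ` (K \<times> cball 0 r)"
    then obtain x y where "x \<in> K" "norm y \<le> r" "z = x + y" by auto
    then show "z \<in> nbhd K r" unfolding nbhd_def by (intro UN_I[of x]) (simp_all add: dist_norm)
  qed
  moreover have "compact ((\<lambda>(x,y). x + y) ` (K \<times> cball 0 r))"
    by (rule compact_continuous_image)
      (auto intro!: compact_Times assms continuous_intros simp: case_prod_unfold)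
  ultimately show ?thesis by simp
qed

lemma nbhd_nbhd: "y \<in> nbhd K r \<Longrightarrow> dist y z \<le> s \<Longrightarrow> z \<in> nbhd K (r + s)"
  unfolding nbhd_def by clarsimp (meson add_mono dist_triangle order_trans)

text \<open>The indicator of the neighbourhood of radius 2\<rho>, mollified at scale \<rho>: within
  \<rho> of \<open>K\<close> the kernel sees only the value 1, beyond 3\<rho> only the value
  0.\<close>

lemma cutoff_exists:
  assumes "compact K" "open A" "K \<subseteq> A"
  obtains \<zeta> :: "real^2 \<Rightarrow> real" and \<rho> where "\<rho> > 0" "C1c \<zeta>" "\<And>x. x \<in> nbhd K \<rho> \<Longrightarrow> \<zeta> x = 1"
    "\<And>x. \<bar>\<zeta> x\<bar> \<le> 1" "nbhd K (3 * \<rho>) \<subseteq> A" "\<And>x. x \<notin> nbhd K (3 * \<rho>) \<Longrightarrow> \<zeta> x = 0"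
proof -
  obtain e where e: "e > 0" "nbhd K e \<subseteq> A"
    unfolding nbhd_def by (rule compact_subset_open_imp_cball_epsilon_subset[OF assms]) blast
  define \<rho> where "\<rho> = e/3"
  have \<rho>: "\<rho> > 0" "nbhd K (3 * \<rho>) \<subseteq> A" using e by (auto simp: \<rho>_def)
  define I where "I = indicat_real (nbhd K (2*\<rho>))"
  have c: "compact (nbhd K (2*\<rho>))" by (rule nbhd_compact[OF assms(1)])
  have m: "nbhd K (2*\<rho>) \<in> sets borel" using compact_imp_closed[OF c] by simp
  have ii: "integrable lborel I" unfolding I_def
    by (rule integrable_indicator_bounded[OF m compact_imp_bounded[OF c]])
  have sq: "(norm (I x))\<^sup>2 = I x" for x by (simp add: I_def indicator_def)
  have bi: "bounded {x. I x \<noteq> 0}" by (rule bounded_subset[OF compact_imp_bounded[OF c]]) (auto simp: I_def indicator_def)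
  have L: "L2b I" unfolding L2b_def sq using ii bi borel_measurable_integrable[OF ii] by simp
  show thesis
  proof (rule that[of \<rho> "mol \<rho> I"])
    show "\<rho> > 0" by (rule \<rho>)
    show "C1c (mol \<rho> I)" by (rule mol_C1c[OF \<rho>(1) L])
    show "nbhd K (3 * \<rho>) \<subseteq> A" by (rule \<rho>)
    show "mol \<rho> I x = 1" if "x \<in> nbhd K \<rho>" for x
    proof -
      have I1: "I y = 1" if "norm (y - x) \<le> \<rho>" for y
        using nbhd_nbhd[OF \<open>x \<in> nbhd K \<rho>\<close>, of y \<rho>] that by (simp add: I_def dist_norm norm_minus_commute)
      have "norm (mol \<rho> I x - I x) \<le> 0"
        by (rule mol_uniform[OF \<rho>(1) ii]) (use I1 \<rho>(1) in simp)
      then show ?thesis using I1[of x] \<rho>(1) by simp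
    qed
    show "mol \<rho> I x = 0" if "x \<notin> nbhd K (3 * \<rho>)" for x
    proof (rule mol_zero[OF \<rho>(1)])
      fix y assume y: "norm (x - y) < \<rho>"
      have "y \<notin> nbhd K (2*\<rho>)"
      proof
        assume "y \<in> nbhd K (2*\<rho>)"
        from nbhd_nbhd[OF this, of x \<rho>] y that show False by (simp add: dist_norm norm_minus_commute)
      qed
      then show "I y = 0" by (simp add: I_def)
    qed
    show "\<bar>mol \<rho> I x\<bar> \<le> 1" for x
    proof -
      have eq: "kap \<rho> (x - y) = kap \<rho> (y - x)" for y using kap_uminus[of \<rho> "x - y"] by simp
      have t: "integrable lborel (\<lambda>y. kap \<rho> (x - y))" "(\<integral>y. kap \<rho> (x - y) \<partial>lborel) = 1"
        using integrable_translate[OF kap_integral(1)[OF \<rho>(1)], of "- x"] kap_integral(2)[OF \<rho>(1)]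
        unfolding eq by simp_all
      have "(\<integral>y. kap \<rho> (x - y) * I y \<partial>lborel) \<le> (\<integral>y. kap \<rho> (x - y) \<partial>lborel)"
        by (rule integral_mono[OF _ t(1)])
          (use conv_integrable[OF C1c_CC[OF kap_C1c[OF \<rho>(1)]] ii, of x] kap_nonneg[OF \<rho>(1)] in \<open>auto simp: I_def indicator_def\<close>)
      moreover have "(\<integral>y. kap \<rho> (x - y) * I y \<partial>lborel) \<ge> 0"
        by (rule integral_nonneg_AE) (use kap_nonneg[OF \<rho>(1)] in \<open>auto simp: I_def indicator_def\<close>)
      ultimately show ?thesis using t by (simp add: mol_def conv_def)
    qed
  qed
qed

section \<open>Phase differences along a grid\<close>

text \<open>The phase difference is the imaginary part of Ln (1 + z), where \<open>z\<close> is the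
  relative increment of \<open>W\<close>. Both Ln (1 + z) - z and the deviation of \<open>z\<close>
  from its linear part are small compared with \<open>h\<close>, uniformly because the modulus of
  \<open>W\<close> has a positive minimum on \<open>S\<close>.\<close>

lemma Arg_quotient_expansion:
  fixes W :: "real^2 \<Rightarrow> complex"
  assumes "C1 W" "compact S" "\<And>x. x \<in> S \<Longrightarrow> W x \<noteq> 0" "e > 0"
  obtains d where "d > 0" "\<And>p h i. p \<in> S \<Longrightarrow> 0 < h \<Longrightarrow> h < d \<Longrightarrow>
     W (p + h *\<^sub>R axis i 1) \<noteq> 0 \<and> \<bar>Arg (W (p + h *\<^sub>R axis i 1) / W p) - h * Im (pd i W p / W p)\<bar> \<le> e * h"
proof (cases "S = {}")
  case True then show thesis using that[of 1] by simp
next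
  case False
  have "\<exists>x\<in>S. \<forall>y\<in>S. norm (W x) \<le> norm (W y)"
    by (rule continuous_attains_inf[OF assms(2) False]) (intro continuous_intros C1_cont assms)
  then obtain x0 where x0: "x0 \<in> S" "\<And>y. y \<in> S \<Longrightarrow> norm (W x0) \<le> norm (W y)" by blast
  define m where "m = norm (W x0)"
  have m: "m > 0" "\<And>y. y \<in> S \<Longrightarrow> m \<le> norm (W y)" using x0 assms(3) by (auto simp: m_def)
  obtain M d1 where M: "M > 0" "d1 > 0" "\<And>x v. x \<in> S \<Longrightarrow> norm v \<le> d1 \<Longrightarrow> norm (W (x + v) - W x) \<le> M * norm v"
    using C1_lip_ex[OF assms(1,2)] by blast
  have "e * m / 2 > 0" using assms(4) m by simp
  from C1_unif_ex[OF assms(1,2) this] obtain d2 where d2: "d2 > 0" "\<And>x v. x \<in> S \<Longrightarrow> norm v \<le> d2 \<Longrightarrow>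
    norm (W (x + v) - W x - (v$1 *\<^sub>R pd 1 W x + v$2 *\<^sub>R pd 2 W x)) \<le> e * m / 2 * norm v" by blast
  define C where "C = M / m"
  have C: "C > 0" using M m by (simp add: C_def)
  \<comment> \<open>\<open>1 / (2 * C)\<close> makes the relative increment at most 1/2, away from
    the singularity of the logarithm; \<open>e / (4 * C\<^sup>2)\<close> makes the quadratic error
    of the logarithm at most e/2 * h.\<close>
  define d where "d = min (min d1 d2) (min (1 / (2 * C)) (e / (4 * C\<^sup>2)))"
  have d: "d > 0" "d \<le> d1" "d \<le> d2" "d \<le> 1 / (2 * C)" "d \<le> e / (4 * C\<^sup>2)"
    using M(2) d2(1) C assms(4) by (auto simp: d_def)
  show thesis
  proof (rule that[OF d(1)])
    fix p :: "real^2" and h :: real and i :: 2 assume p: "p \<in> S" and h: "0 < h" "h < d"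
    let ?v = "h *\<^sub>R axis i (1::real)"
    have nv: "norm ?v = h" using h by (simp add: norm_axis_1)
    have Wp: "norm (W p) \<ge> m" "W p \<noteq> 0" using m(2)[OF p] assms(3)[OF p] by auto
    define z where "z = (W (p + ?v) - W p) / W p"
    have q: "W (p + ?v) / W p = 1 + z" using Wp by (simp add: z_def field_simps)
    have "norm (W (p + ?v) - W p) \<le> M * h" using M(3)[OF p, of ?v] nv h d by simp
    then have "norm z \<le> (M * h) / m" unfolding z_def norm_divide using Wp m(1) M h by (intro frac_le) auto
    then have z: "norm z \<le> C * h" by (simp add: C_def)
    also have "C * h \<le> C * (1 / (2 * C))" using h d C by (intro mult_left_mono) auto
    also have "\<dots> = 1/2" using C by simp
    finally have z2: "norm z \<le> 1/2" .
    have nz: "1 + z \<noteq> 0"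
    proof
      assume "1 + z = 0" then have "z = - 1" by (simp add: add_eq_0_iff)
      with z2 show False by simp
    qed
    have "norm (Ln (1 + z) - z) \<le> (norm z)\<^sup>2 / (1 - norm z)" by (rule Ln_approx_linear) (use z2 in linarith)
    also have "\<dots> \<le> (norm z)\<^sup>2 / (1/2)" using z2 by (intro divide_left_mono) auto
    also have "\<dots> \<le> 2 * (C * h)\<^sup>2" using power_mono[OF z, of 2] by simp
    also have "\<dots> = (2 * C\<^sup>2 * h) * h" by (simp add: power2_eq_square)
    also have "\<dots> \<le> (2 * C\<^sup>2 * (e / (4 * C\<^sup>2))) * h" using h d C by (intro mult_right_mono mult_left_mono) auto
    also have "\<dots> = e/2 * h" using C by simp
    finally have 1: "norm (Ln (1 + z) - z) \<le> e/2 * h" .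
    have "?v$1 *\<^sub>R pd 1 W p + ?v$2 *\<^sub>R pd 2 W p = h *\<^sub>R pd i W p"
      using exhaust_2[of i] by (auto simp: axis_def)
    then have "norm (W (p + ?v) - W p - h *\<^sub>R pd i W p) \<le> e * m / 2 * h" using d2(2)[OF p, of ?v] nv h d by simp
    then have "norm (W (p + ?v) - W p - h *\<^sub>R pd i W p) / norm (W p) \<le> (e * m / 2 * h) / m"
      using Wp m(1) assms(4) h by (intro frac_le) auto
    moreover have "z - h *\<^sub>R (pd i W p / W p) = (W (p + ?v) - W p - h *\<^sub>R pd i W p) / W p"
      by (simp add: z_def diff_divide_distrib scaleR_conv_of_real)
    ultimately have 2: "norm (z - h *\<^sub>R (pd i W p / W p)) \<le> e/2 * h" using m(1) by (simp add: norm_divide)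
    have "Arg (W (p + ?v) / W p) - h * Im (pd i W p / W p) = Im (Ln (1 + z) - z) + Im (z - h *\<^sub>R (pd i W p / W p))"
      unfolding q using Arg_eq_Im_Ln[OF nz] by simp
    then have "\<bar>Arg (W (p + ?v) / W p) - h * Im (pd i W p / W p)\<bar> \<le> e/2 * h + e/2 * h"
      using 1 2 abs_Im_le_cmod[of "Ln (1 + z) - z"] abs_Im_le_cmod[of "z - h *\<^sub>R (pd i W p / W p)"] by linarith
    moreover have "W (p + ?v) \<noteq> 0" using q nz Wp by auto
    ultimately show "W (p + ?v) \<noteq> 0 \<and> \<bar>Arg (W (p + ?v) / W p) - h * Im (pd i W p / W p)\<bar> \<le> e * h" by simp
  qed
qed

lemma Arg_quotient_expansion_ex:
  fixes W :: "real^2 \<Rightarrow> complex"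
  assumes "C1 W" "compact S" "\<And>x. x \<in> S \<Longrightarrow> W x \<noteq> 0" "e > 0"
  shows "\<exists>d>0. \<forall>p\<in>S. \<forall>h i. 0 < h \<longrightarrow> h < d \<longrightarrow>
     W (p + h *\<^sub>R axis i 1) \<noteq> 0 \<and> \<bar>Arg (W (p + h *\<^sub>R axis i 1) / W p) - h * Im (pd i W p / W p)\<bar> \<le> e * h"
  by (rule Arg_quotient_expansion[OF assms]) blast+

text \<open>\<open>Im (pd i W x / W x)\<close> is the derivative of a local phase of
  \<open>W\<close>, so this is the flux density of W/|W| against the gradient of \<psi>. At a zero
  of \<open>W\<close> the quotients are 0 by convention.\<close>

definition jint :: "(real^2 \<Rightarrow> real) \<Rightarrow> (real^2 \<Rightarrow> complex) \<Rightarrow> real^2 \<Rightarrow> real" where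
  "jint \<psi> W x = pd 1 \<psi> x * Im (pd 2 W x / W x) - pd 2 \<psi> x * Im (pd 1 W x / W x)"

lemma constant_off_support:
  fixes \<psi> :: "real^2 \<Rightarrow> real"
  assumes "C1 \<psi>" "\<And>x i. x \<in> cball p r \<Longrightarrow> pd i \<psi> x = 0" "q \<in> cball p r" "r \<ge> 0"
  shows "\<psi> q = \<psi> p"
proof -
  have "\<exists>c. \<forall>x\<in>cball p r. \<psi> x = c"
  proof (rule has_derivative_zero_constant)
    fix x assume "x \<in> cball p r"
    then show "(\<psi> has_derivative (\<lambda>h. 0)) (at x within cball p r)"
      using C1_hd_within[OF assms(1), of x "cball p r"] assms(2) by simp
  qed simp
  then show ?thesis using assms(3,4) by auto
qed

lemma cis_eq_1: "cis x = 1 \<Longrightarrow> \<exists>n::int. x = 2 * pi * of_int n"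
proof -
  assume "cis x = 1"
  then have "cos x = 1" by (metis Re_complex_of_real cis.sel(1) of_real_1)
  then show ?thesis unfolding cos_one_2pi_int by (auto simp: mult_ac)
qed

text \<open>The terms are phase differences along two paths from \<open>z1\<close> to
  \<open>z3\<close>, over \<open>z2\<close> and over \<open>z4\<close>. Under \<open>cis\<close>
  they become quotients of \<open>sgn\<close> values that cancel.\<close>

lemma circulation_2pi_int:
  assumes "z1 \<noteq> 0" "z2 \<noteq> 0" "z3 \<noteq> 0" "z4 \<noteq> 0"
  shows "\<exists>n::int. Arg (z2/z1) + Arg (z3/z2) - Arg (z3/z4) - Arg (z4/z1) = 2 * pi * of_int n"
proof (rule cis_eq_1)
  have s: "cis (Arg (a/b)) = sgn a / sgn b" if "a \<noteq> 0" "b \<noteq> 0" for a b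
    using that by (simp add: cis_Arg sgn_eq norm_divide)
  have n: "sgn z1 \<noteq> 0" "sgn z2 \<noteq> 0" "sgn z3 \<noteq> 0" "sgn z4 \<noteq> 0" using assms by (simp_all add: sgn_zero_iff)
  have "cis (Arg (z2/z1) + Arg (z3/z2) - Arg (z3/z4) - Arg (z4/z1)) =
      cis (Arg (z2/z1)) * cis (Arg (z3/z2)) / cis (Arg (z3/z4)) / cis (Arg (z4/z1))"
    by (simp only: cis_mult cis_divide)
  also have "\<dots> = 1" using n by (simp add: s assms field_simps)
  finally show "cis (Arg (z2/z1) + Arg (z3/z2) - Arg (z3/z4) - Arg (z4/z1)) = 1" .
qed

lemma sum_closed_2pi_int:
  assumes "finite I" "\<And>i. i \<in> I \<Longrightarrow> \<exists>n::int. f i = 2 * pi * of_int n"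
  shows "\<exists>n::int. sum f I = 2 * pi * of_int n"
  using assms
proof (induction I rule: finite_induct)
  case empty show ?case by (intro exI[of _ 0]) simp
next
  case (insert x F)
  then obtain m n where "f x = 2 * pi * of_int m" "sum f F = 2 * pi * of_int n" by blast
  then have "sum f (insert x F) = 2 * pi * of_int (m + n)" using insert by (simp add: algebra_simps)
  then show ?case by blast
qed

definition gridpt :: "real \<Rightarrow> real \<Rightarrow> nat \<Rightarrow> nat \<Rightarrow> real^2" where
  "gridpt R h i j = vector [real i * h - R, real j * h - R]"

lemma gridpt_step: "gridpt R h (Suc i) j = gridpt R h i j + h *\<^sub>R axis 1 1" "gridpt R h i (Suc j) = gridpt R h i j + h *\<^sub>R axis 2 1"
  by (simp_all add: gridpt_def vec_eq_iff forall_2 axis_def algebra_simps)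

text \<open>Half-open, so that the cells of a grid tile the square without overlap.\<close>

definition cell :: "real \<Rightarrow> real^2 \<Rightarrow> (real^2) set" where
  "cell h p = {x. p$1 \<le> x$1 \<and> x$1 < p$1 + h \<and> p$2 \<le> x$2 \<and> x$2 < p$2 + h}"

lemma cell_sets: "cell h p \<in> sets borel"
  unfolding cell_def by measurable

lemma cell_measure: assumes "h > 0" shows "emeasure lborel (cell h p) = ennreal (h\<^sup>2)"
proof -
  let ?q = "p + vector [h, h] :: real^2"
  have q: "?q $ 1 = p$1 + h" "?q $ 2 = p$2 + h" by simp_all
  have B: "(Basis :: (real^2) set) = {axis 1 1, axis 2 1}"
    by (auto simp: Basis_vec_def UNIV_2)
  have "axis 1 (1::real) \<noteq> (axis 2 1 :: real^2)" by (simp add: axis_eq_axis)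
  then have *: "(\<Prod>b\<in>Basis. (vector [h, h] :: real^2) \<bullet> b) = h\<^sup>2"
    unfolding B by (simp add: inner_axis power2_eq_square)
  have le: "p \<bullet> b \<le> ?q \<bullet> b" if "b \<in> Basis" for b
    using that assms unfolding B by (auto simp: inner_axis)
  have "emeasure lborel (box p ?q) = ennreal (h\<^sup>2)" "emeasure lborel (cbox p ?q) = ennreal (h\<^sup>2)"
    using le by (simp_all add: emeasure_lborel_box_eq emeasure_lborel_cbox_eq * )
  moreover have "box p ?q \<subseteq> cell h p" "cell h p \<subseteq> cbox p ?q"
    by (auto simp: cell_def mem_box_cart forall_2)
  then have "emeasure lborel (box p ?q) \<le> emeasure lborel (cell h p)" "emeasure lborel (cell h p) \<le> emeasure lborel (cbox p ?q)"
    using cell_sets by (auto intro!: emeasure_mono)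
  ultimately show ?thesis by simp
qed

lemma cell_norm: "x \<in> cell h p \<Longrightarrow> norm (x - p) \<le> 2 * h"
proof -
  assume "x \<in> cell h p"
  then have "\<bar>(x - p)$1\<bar> \<le> h" "\<bar>(x - p)$2\<bar> \<le> h" by (auto simp: cell_def)
  moreover have "norm (x - p) \<le> \<bar>(x - p)$1\<bar> + \<bar>(x - p)$2\<bar>"
    using norm_le_l1_cart[of "x - p"] by (simp add: sum_2)
  ultimately show ?thesis by linarith
qed

text \<open>The only cell that contains \<open>x\<close> has the index floor ((x$k + R) / h) in
  direction \<open>k\<close>; by \<open>real M * h = 2 * R\<close> it is one of the first
  \<open>M\<close>.\<close>

lemma grid_cover:
  assumes "h > 0" "real M * h = 2 * R" "norm x < R"
  shows "(\<Sum>i<M. \<Sum>j<M. indicat_real (cell h (gridpt R h i j)) x) = 1"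
proof -
  have ind: "indicat_real (cell h (gridpt R h i j)) x =
     (if i = nat \<lfloor>(x$1 + R)/h\<rfloor> then 1 else 0) * (if j = nat \<lfloor>(x$2 + R)/h\<rfloor> then 1 else 0)" for i j
  proof -
    have pos: "(x$k + R)/h \<ge> 0" for k
      using component_le_norm_cart[of x k] assms by (intro divide_nonneg_pos) linarith+
    have e: "(i = nat \<lfloor>(x$k + R)/h\<rfloor>) = (real i * h - R \<le> x$k \<and> x$k < real i * h - R + h)" for i k
    proof -
      have "(i = nat \<lfloor>(x$k + R)/h\<rfloor>) = (int i = \<lfloor>(x$k + R)/h\<rfloor>)" using pos[of k] by (auto simp: le_floor_iff)
      also have "\<dots> = (real i \<le> (x$k + R)/h \<and> (x$k + R)/h < real i + 1)" unfolding eq_commute[of "int i"] floor_eq_iff by simp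
      also have "\<dots> = (real i * h - R \<le> x$k \<and> x$k < real i * h - R + h)" using assms(1) by (simp add: field_simps)
      finally show ?thesis .
    qed
    show ?thesis unfolding e by (auto simp: cell_def gridpt_def indicator_def)
  qed
  have r: "nat \<lfloor>(x$k + R)/h\<rfloor> < M" for k
  proof -
    have a: "\<bar>x$k\<bar> < R" using component_le_norm_cart[of x k] assms(3) by linarith
    then have "(x$k + R)/h < real M" using assms(1,2) by (simp add: field_simps)
    moreover have "(x$k + R)/h \<ge> 0" using a assms by (intro divide_nonneg_pos) linarith+
    ultimately show ?thesis by (simp add: nat_less_iff floor_less_iff)
  qed
  show ?thesis unfolding ind by (simp add: sum_product[symmetric] sum.delta' r)
qed

text \<open>On a grid of width \<open>h\<close>, the circulations of the phase of \<open>W\<close> around the cells are integer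
  multiples of \<open>2\<pi>\<close> and vanish near \<open>K\<close>, while \<open>\<psi>\<close> is an integer elsewhere. Summation by parts thus
  makes a Riemann sum of the integral an element of \<open>2\<pi>\<int>\<close> up to an error that vanishes with \<open>h\<close>.\<close>

lemma degree_integrality:
  fixes \<psi> :: "real^2 \<Rightarrow> real" and W :: "real^2 \<Rightarrow> complex"
  assumes \<psi>: "C1c \<psi>" and W: "C1 W" and K: "compact K" and W0: "\<And>x. x \<in> K \<Longrightarrow> W x \<noteq> 0"
    and off: "\<And>x. x \<notin> K \<Longrightarrow> \<psi> x \<in> \<int>" "\<And>x i. x \<notin> K \<Longrightarrow> pd i \<psi> x = 0"
  shows "\<exists>k::int. (\<integral>x. jint \<psi> W x \<partial>lborel) = 2 * pi * of_int k"
proof -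
  let ?G = "jint \<psi> W"
  have oW: "open {x. W x \<noteq> 0}"
    using open_Collect_neq[OF C1_cont[OF W, of UNIV] continuous_on_const[of UNIV 0]] .
  obtain \<rho>0 where r0: "\<rho>0 > 0" "nbhd K \<rho>0 \<subseteq> {x. W x \<noteq> 0}"
    unfolding nbhd_def by (rule compact_subset_open_imp_cball_epsilon_subset[OF K oW]) (use W0 in auto)
  define \<rho> where "\<rho> = \<rho>0 / 2"
  have \<rho>: "\<rho> > 0" using r0 by (simp add: \<rho>_def)
  define S where "S = nbhd K (2 * \<rho>)"
  have S: "compact S" "\<And>x. x \<in> S \<Longrightarrow> W x \<noteq> 0" using nbhd_compact[OF K] r0 by (auto simp: S_def \<rho>_def)
  \<comment> \<open>One grid step from \<open>S1\<close> stays in \<open>S\<close>, where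
    \<open>W\<close> has no zeros; one grid step from a point outside \<open>S1\<close> avoids
    \<open>K\<close>, so that \<psi> is constant along it.\<close>
  define S1 where "S1 = nbhd K \<rho>"
  have SS: "x + v \<in> S" if "x \<in> S1" "norm v \<le> \<rho>" for x v
    using nbhd_nbhd[of x K \<rho> "x+v" \<rho>] that by (simp add: S_def S1_def dist_norm)
  have KS1: "K \<subseteq> S1" using \<rho> by (force simp: S1_def nbhd_def)
  have S1S: "S1 \<subseteq> S" using SS[of _ 0] \<rho> by auto
  have offS: "pd i \<psi> y = 0" if "p \<notin> S1" "dist p y \<le> \<rho>" for p y i
    using that off(2)[of y i] by (force simp: S1_def nbhd_def dist_commute)
  \<comment> \<open>The zeros of \<open>W\<close> lie outside \<open>K\<close>, where the integrand
    vanishes identically; the two open sets cover the plane.\<close>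
  have contG: "continuous_on UNIV ?G"
  proof -
    have U: "UNIV = {x. W x \<noteq> 0} \<union> (- K)" using W0 by auto
    have "continuous_on {x. W x \<noteq> 0} ?G"
      unfolding jint_def[abs_def] by (intro continuous_intros C1_cont_pd C1c_C1[OF \<psi>] W C1_cont) auto
    moreover have "continuous_on (- K) ?G"
      by (rule continuous_on_eq[OF continuous_on_const[of _ 0]]) (simp add: jint_def off)
    ultimately show ?thesis unfolding U
      by (intro continuous_on_open_Un oW) (use compact_imp_closed[OF K] in auto)
  qed
  have G0: "?G x = 0" if "x \<notin> K" for x using off(2)[OF that] by (simp add: jint_def)
  have CG: "CC ?G" unfolding CC_def
    using contG bounded_subset[OF compact_imp_bounded[OF K], of "{x. ?G x \<noteq> 0}"] G0 by auto
  obtain R1 where R1: "R1 > 0" "\<And>x. norm x \<ge> R1 \<Longrightarrow> \<psi> x = 0" "\<And>x i. norm x \<ge> R1 \<Longrightarrow> pd i \<psi> x = 0"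
    by (rule C1c_ball[OF \<psi>]) blast
  define R where "R = R1 + 1"
  have R: "R > 1" using R1 by (simp add: R_def)
  obtain M1 where M1: "M1 > 0" "\<And>x. norm (pd 1 \<psi> x) \<le> M1" by (rule CC_bound[OF C1c_pd_CC[OF \<psi>, of 1]]) blast
  obtain M2 where M2: "M2 > 0" "\<And>x. norm (pd 2 \<psi> x) \<le> M2" by (rule CC_bound[OF C1c_pd_CC[OF \<psi>, of 2]]) blast
  define b where "b i x = Im (pd i W x / W x)" for i x
  have bc: "continuous_on S (b i)" for i
    unfolding b_def[abs_def] by (intro continuous_intros C1_cont_pd W C1_cont) (use S in auto)
  have "\<exists>M>0. \<forall>x\<in>S. norm (b i x) \<le> M" for i
    using compact_imp_bounded[OF compact_continuous_image[OF bc S(1)]] unfolding bounded_pos by auto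
  then obtain B where B: "\<And>i. B i > 0" "\<And>i x. x \<in> S \<Longrightarrow> norm (b i x) \<le> B i" by metis
  define M where "M = M1 + M2 + B 1 + B 2 + 1"
  have M: "M > 0" "\<bar>pd i \<psi> x\<bar> \<le> M" "y \<in> S \<Longrightarrow> \<bar>b i y\<bar> \<le> M" "M \<ge> 1" for i x y
    using M1(1) M2(1) M1(2)[of x] M2(2)[of x] B(1)[of 1] B(1)[of 2] B(2)[of y 1] B(2)[of y 2] exhaust_2[of i]
    by (auto simp: M_def)
  have approx: "\<exists>k::int. \<bar>(\<integral>x. ?G x \<partial>lborel) - 2 * pi * of_int k\<bar> \<le> (1 + 8 * M) * (2 * R)\<^sup>2 * e" if e: "0 < e" "e < 1" for e
  proof -
    obtain d1 where d1: "d1 > 0" "\<And>p h i. p \<in> S \<Longrightarrow> 0 < h \<Longrightarrow> h < d1 \<Longrightarrow>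
       W (p + h *\<^sub>R axis i 1) \<noteq> 0 \<and> \<bar>Arg (W (p + h *\<^sub>R axis i 1) / W p) - h * Im (pd i W p / W p)\<bar> \<le> e * h"
      using Arg_quotient_expansion_ex[OF W S e(1)] by blast
    obtain d2 where d2: "d2 > 0" "\<And>x v. norm v \<le> d2 \<Longrightarrow>
      norm (\<psi> (x + v) - \<psi> x - (v$1 *\<^sub>R pd 1 \<psi> x + v$2 *\<^sub>R pd 2 \<psi> x)) \<le> e * norm v"
      by (rule C1c_unif[OF \<psi> e(1)]) blast
    obtain d3 where d3: "d3 > 0" "\<And>x v. norm v < d3 \<Longrightarrow> norm (?G (x + v) - ?G x) < e" by (rule CC_unif[OF CG e(1)]) blast
    have "\<exists>d>0. \<forall>x\<in>S. \<forall>y\<in>S. dist y x < d \<longrightarrow> dist (b i y) (b i x) < e" for i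
      using compact_uniformly_continuous[OF bc S(1), of i] e(1) unfolding uniformly_continuous_on_def by blast
    note ex4 = this
    define d4 where "d4 i = (SOME d. d > 0 \<and> (\<forall>x\<in>S. \<forall>y\<in>S. dist y x < d \<longrightarrow> dist (b i y) (b i x) < e))" for i
    have d4: "d4 i > 0" "x \<in> S \<Longrightarrow> y \<in> S \<Longrightarrow> dist y x < d4 i \<Longrightarrow> dist (b i y) (b i x) < e" for i x y
    proof -
      have P: "d4 i > 0 \<and> (\<forall>x\<in>S. \<forall>y\<in>S. dist y x < d4 i \<longrightarrow> dist (b i y) (b i x) < e)"
        unfolding d4_def by (rule someI_ex[OF ex4])
      then show "d4 i > 0" by (rule conjunct1)
      show "dist (b i y) (b i x) < e" if "x \<in> S" "y \<in> S" "dist y x < d4 i"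
        using P[THEN conjunct2, rule_format, OF that] .
    qed
    \<comment> \<open>\<open>d3/2\<close> compensates the diameter bound 2h of a cell,
      \<open>\<rho>\<close> keeps a grid step within \<open>S\<close>, and
      \<open>1 / (4 * (M + 1))\<close> makes the four phase differences around a cell near
      \<open>K\<close> add up to less than 1.\<close>
    define ds where "ds = {d1, d2, d3/2, d4 1, d4 2, \<rho>, 1 / (4 * (M + 1)), 1}"
    define d where "d = Min ds"
    have ds: "finite ds" "ds \<noteq> {}" by (simp_all add: ds_def)
    have "\<forall>x\<in>ds. 0 < x" using d1(1) d2(1) d3(1) d4(1) \<rho> M(1) unfolding ds_def by simp
    then have d0: "d > 0" unfolding d_def using ds by (simp add: Min_gr_iff)
    have d_le: "d \<le> x" if "x \<in> ds" for x unfolding d_def using ds(1) that by (rule Min_le)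
    have d: "d > 0" "d \<le> d1" "d \<le> d2" "d \<le> d3/2" "d \<le> d4 1" "d \<le> d4 2" "d \<le> \<rho>" "d \<le> 1 / (4 * (M + 1))" "d \<le> 1"
      by (rule d0) (rule d_le, simp add: ds_def)+
    obtain N0 :: nat where N0: "R / d < real N0" using reals_Archimedean2 by blast
    have "R / d > 0" using R d by simp
    then have N0p: "real N0 > 0" using N0 by linarith
    define h where "h = R / real N0"
    define N where "N = 2 * N0"
    have h: "h > 0" "h < d" using R N0 N0p d by (auto simp: h_def field_simps)
    have Nh: "real N * h = 2 * R" using N0p by (simp add: N_def h_def)
    \<comment> \<open>Grid points may hit zeros of \<open>W\<close>. Replacing the value there by 1
      keeps every circulation an integer multiple of 2\<pi> and changes nothing on
      \<open>S\<close>.\<close>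
    define V where "V x = (if W x = 0 then 1 else W x)" for x
    have V: "V x \<noteq> 0" for x by (simp add: V_def)
    let ?e1 = "axis 1 1 :: real^2" and ?e2 = "axis 2 1 :: real^2"
    define a where "a i x = Arg (V (x + h *\<^sub>R axis i 1) / V x)" for i x
    have a_b: "\<bar>a i x - h * b i x\<bar> \<le> e * h" if "x \<in> S" for i x
      using d1(2)[OF that h(1), of i] h d S(2)[OF that] by (simp add: a_def b_def V_def)
    have a_le: "\<bar>a i x\<bar> \<le> (M + 1) * h" if "x \<in> S" for i x
    proof -
      have "\<bar>h * b i x\<bar> \<le> h * M" using M(3)[OF that, of i] h by (simp add: abs_mult)
      moreover have "e * h \<le> 1 * h" using e h by (intro mult_right_mono) auto
      ultimately show ?thesis using a_b[OF that, of i] by (simp add: algebra_simps)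
    qed
    define circ where "circ x = a 1 x + a 2 (x + h *\<^sub>R ?e1) - a 1 (x + h *\<^sub>R ?e2) - a 2 x" for x
    have circ_int: "\<exists>n::int. circ x = 2 * pi * of_int n" for x
    proof -
      have "x + h *\<^sub>R ?e1 + h *\<^sub>R ?e2 = x + h *\<^sub>R ?e2 + h *\<^sub>R ?e1" by simp
      then show ?thesis unfolding circ_def a_def using circulation_2pi_int[OF V V V V] by metis
    qed
    have steps: "x + h *\<^sub>R axis i 1 \<in> S" if "x \<in> S1" for x i
      by (rule SS[OF that]) (use h d in \<open>simp add: norm_axis_1\<close>)
    \<comment> \<open>A multiple of 2\<pi> of absolute value below 1 is 0.\<close>
    have circ0: "circ x = 0" if "x \<in> S1" for x
    proof -
      have "\<bar>circ x\<bar> \<le> 4 * ((M + 1) * h)"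
        using a_le[of x 1] a_le[of x 2] a_le[of "x + h *\<^sub>R ?e1" 2] a_le[of "x + h *\<^sub>R ?e2" 1] steps[OF that] that S1S
        unfolding circ_def by fastforce
      also have "\<dots> < 4 * ((M + 1) * (1 / (4 * (M + 1))))" using h d M by (intro mult_strict_left_mono) auto
      also have "\<dots> = 1" using M by simp
      finally have "\<bar>circ x\<bar> < 1" .
      moreover obtain n :: int where n: "circ x = 2 * pi * of_int n" using circ_int by blast
      have "n = 0"
      proof (rule ccontr)
        assume "n \<noteq> 0"
        then have "\<bar>real_of_int n\<bar> \<ge> 1" by linarith
        then have "2 * pi * 1 \<le> \<bar>circ x\<bar>" unfolding n abs_mult using pi_gt_zero by (intro mult_mono) auto
        then show False using \<open>\<bar>circ x\<bar> < 1\<close> pi_gt3 by linarith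
      qed
      then show ?thesis using n by simp
    qed
    define D where "D x = (\<psi> (x + h *\<^sub>R ?e1) - \<psi> x) * a 2 (x + h *\<^sub>R ?e1) - (\<psi> (x + h *\<^sub>R ?e2) - \<psi> x) * a 1 (x + h *\<^sub>R ?e2)" for x
    \<comment> \<open>\<open>T\<close> is the circulation weighted edge by edge. Summed over the
      grid it telescopes to 0, as \<psi> vanishes on the outer edges; so the sum of \<open>D\<close>
      is minus the sum of \<psi> * circ, whose terms all lie in 2\<pi> times the integers.\<close>
    define T where "T x = \<psi> x * a 1 x + \<psi> (x + h *\<^sub>R ?e1) * a 2 (x + h *\<^sub>R ?e1) - \<psi> (x + h *\<^sub>R ?e2) * a 1 (x + h *\<^sub>R ?e2) - \<psi> x * a 2 x" for x
    have TD: "T x = \<psi> x * circ x + D x" for x by (simp add: T_def D_def circ_def algebra_simps)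
    let ?p = "gridpt R h"
    have edge: "\<psi> (?p i j) = 0" if "i = 0 \<or> i = N \<or> j = 0 \<or> j = N" for i j
    proof (rule R1(2))
      have c: "(?p i j)$1 = real i * h - R" "(?p i j)$2 = real j * h - R" by (simp_all add: gridpt_def)
      have "\<bar>(?p i j)$1\<bar> = R \<or> \<bar>(?p i j)$2\<bar> = R" unfolding c using that Nh R by auto
      then have "norm (?p i j) \<ge> R" using component_le_norm_cart[of "?p i j" 1] component_le_norm_cart[of "?p i j" 2] by auto
      then show "R1 \<le> norm (?p i j)" by (simp add: R_def)
    qed
    have sumT: "(\<Sum>i<N. \<Sum>j<N. T (?p i j)) = 0"
    proof -
      define \<alpha> where "\<alpha> i j = \<psi> (?p i j) * a 1 (?p i j)" for i j
      define \<beta> where "\<beta> i j = \<psi> (?p i j) * a 2 (?p i j)" for i j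
      have T: "T (?p i j) = (\<alpha> i j - \<alpha> i (Suc j)) + (\<beta> (Suc i) j - \<beta> i j)" for i j
        by (simp add: T_def \<alpha>_def \<beta>_def gridpt_step)
      have 1: "(\<Sum>j<N. \<alpha> i j - \<alpha> i (Suc j)) = 0" for i
        unfolding sum_lessThan_telescope' using edge by (simp add: \<alpha>_def)
      have 2: "(\<Sum>i<N. \<beta> (Suc i) j - \<beta> i j) = 0" for j
        using sum_lessThan_telescope[of "\<lambda>i. \<beta> i j" N] edge by (simp add: \<beta>_def)
      have "(\<Sum>i<N. \<Sum>j<N. \<beta> (Suc i) j - \<beta> i j) = (\<Sum>j<N. \<Sum>i<N. \<beta> (Suc i) j - \<beta> i j)" by (rule sum.swap)
      then show ?thesis unfolding T sum.distrib using 1 2 by simp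
    qed
    have \<psi>circ: "\<exists>n::int. \<psi> x * circ x = 2 * pi * of_int n" for x
    proof (cases "x \<in> S1")
      case True then show ?thesis using circ0 by (intro exI[of _ 0]) simp
    next
      case False
      then have "\<psi> x \<in> \<int>" using off(1) KS1 by blast
      then obtain m where m: "\<psi> x = of_int m" by (auto elim: Ints_cases)
      obtain n where n: "circ x = 2 * pi * of_int n" using circ_int by blast
      have "\<psi> x * circ x = 2 * pi * of_int (m * n)" by (simp add: m n)
      then show ?thesis by blast
    qed
    have "\<exists>n::int. (\<Sum>i<N. \<Sum>j<N. \<psi> (?p i j) * circ (?p i j)) = 2 * pi * of_int n"
      by (intro sum_closed_2pi_int \<psi>circ) auto
    then obtain k :: int where k: "(\<Sum>i<N. \<Sum>j<N. \<psi> (?p i j) * circ (?p i j)) = 2 * pi * of_int k" by blast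
    have sumD: "(\<Sum>i<N. \<Sum>j<N. D (?p i j)) = 2 * pi * of_int (- k)"
      using sumT k unfolding TD sum.distrib by simp
    \<comment> \<open>On \<open>S1\<close> the leading terms of the first-order expansions of \<psi>
      and of the phase multiply to h^2 times the integrand; elsewhere both sides vanish.\<close>
    have DG: "\<bar>D x - h\<^sup>2 * ?G x\<bar> \<le> 8 * M * e * h\<^sup>2" for x
    proof (cases "x \<in> S1")
      case True
      have dpsi: "\<bar>\<psi> (x + h *\<^sub>R axis i 1) - \<psi> x - h * pd i \<psi> x\<bar> \<le> e * h" for i
      proof -
        let ?v = "h *\<^sub>R axis i (1::real)"
        have nv: "norm ?v = h" using h by (simp add: norm_axis_1)
        have "?v$1 *\<^sub>R pd 1 \<psi> x + ?v$2 *\<^sub>R pd 2 \<psi> x = h * pd i \<psi> x"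
          using exhaust_2[of i] by (auto simp: axis_def)
        then show ?thesis using d2(2)[of ?v x] nv h d by simp
      qed
      have main: "\<bar>(\<psi> (x + h *\<^sub>R axis i 1) - \<psi> x) * a j (x + h *\<^sub>R axis i 1) - h\<^sup>2 * (pd i \<psi> x * b j x)\<bar> \<le> 4 * M * e * h\<^sup>2" for i j
      proof -
        let ?y = "x + h *\<^sub>R axis i (1::real)"
        have y: "?y \<in> S" by (rule steps[OF True])
        have "dist ?y x < d4 j" using h d exhaust_2[of j] by (auto simp: dist_norm norm_axis_1)
        then have "\<bar>b j ?y - b j x\<bar> \<le> e" using d4(2)[of x ?y j] True S1S y by (auto simp: dist_norm)
        then have "\<bar>h * b j ?y - h * b j x\<bar> \<le> h * e" using h by (simp flip: right_diff_distrib add: abs_mult)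
        with a_b[OF y, of j] have aj: "\<bar>a j ?y - h * b j x\<bar> \<le> 2 * e * h" by (simp add: algebra_simps)
        have "(\<psi> ?y - \<psi> x) * a j ?y - h\<^sup>2 * (pd i \<psi> x * b j x) = (\<psi> ?y - \<psi> x - h * pd i \<psi> x) * a j ?y + h * pd i \<psi> x * (a j ?y - h * b j x)"
          by (simp add: power2_eq_square algebra_simps)
        also have "\<bar>\<dots>\<bar> \<le> \<bar>\<psi> ?y - \<psi> x - h * pd i \<psi> x\<bar> * \<bar>a j ?y\<bar> + (h * \<bar>pd i \<psi> x\<bar>) * \<bar>a j ?y - h * b j x\<bar>"
          using h by (intro order_trans[OF abs_triangle_ineq]) (simp add: abs_mult)
        also have "\<dots> \<le> (e * h) * ((M + 1) * h) + (h * M) * (2 * e * h)"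
          using h e M by (intro add_mono mult_mono dpsi a_le[OF y] aj) auto
        also have "\<dots> = (3 * M + 1) * e * h\<^sup>2" by (simp add: power2_eq_square algebra_simps)
        also have "\<dots> \<le> (4 * M) * e * h\<^sup>2" using e M by (intro mult_right_mono) auto
        finally show ?thesis .
      qed
      have "D x - h\<^sup>2 * ?G x = ((\<psi> (x + h *\<^sub>R ?e1) - \<psi> x) * a 2 (x + h *\<^sub>R ?e1) - h\<^sup>2 * (pd 1 \<psi> x * b 2 x))
         - ((\<psi> (x + h *\<^sub>R ?e2) - \<psi> x) * a 1 (x + h *\<^sub>R ?e2) - h\<^sup>2 * (pd 2 \<psi> x * b 1 x))"
        by (simp add: D_def jint_def b_def algebra_simps)
      then show ?thesis using main[of 1 2] main[of 2 1] by linarith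
    next
      case False
      have "\<psi> (x + h *\<^sub>R axis i 1) = \<psi> x" for i
        by (rule constant_off_support[OF C1c_C1[OF \<psi>], of x \<rho>]) (use offS[OF False] h d \<rho> in \<open>auto simp: dist_norm norm_axis_1\<close>)
      then have "D x = 0" by (simp add: D_def)
      moreover have "?G x = 0" using G0 False KS1 by blast
      ultimately show ?thesis using e M by simp
    qed
    let ?C = "\<lambda>i j. cell h (?p i j)"
    have Gi: "integrable lborel (\<lambda>x. indicat_real (?C i j) x * ?G x)" for i j
      using integrable_mult_indicator[OF _ CC_integrable[OF CG], of "?C i j"] cell_sets by simp
    have mC: "measure lborel (?C i j) = h\<^sup>2" for i j using cell_measure[OF h(1)] by (simp add: measure_def)
    have indi: "integrable lborel (\<lambda>x. indicat_real (?C i j) x)" for i j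
      using cell_measure[OF h(1)] cell_sets by (intro integrable_real_indicator) auto
    have Ci: "integrable lborel (\<lambda>x. indicat_real (?C i j) x * c)" for i j c
      by (rule integrable_mult_left) (rule indi)
    have cover: "?G x = (\<Sum>i<N. \<Sum>j<N. indicat_real (?C i j) x * ?G x)" for x
    proof (cases "norm x < R")
      case True
      have "(\<Sum>i<N. \<Sum>j<N. indicat_real (?C i j) x * ?G x) = (\<Sum>i<N. \<Sum>j<N. indicat_real (?C i j) x) * ?G x"
        by (simp add: sum_distrib_right)
      then show ?thesis using grid_cover[OF h(1) Nh True] by simp
    next
      case False
      then have "?G x = 0" using R1(3)[of x] by (simp add: jint_def R_def)
      then show ?thesis by simp
    qed
    have cellG: "\<bar>(\<integral>x. indicat_real (?C i j) x * ?G x \<partial>lborel) - h\<^sup>2 * ?G (?p i j)\<bar> \<le> e * h\<^sup>2" for i j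
    proof -
      let ?F = "\<lambda>x. indicat_real (?C i j) x * ?G x - indicat_real (?C i j) x * ?G (?p i j)"
      have "(\<integral>x. indicat_real (?C i j) x * ?G (?p i j) \<partial>lborel) = h\<^sup>2 * ?G (?p i j)"
        using mC[of i j] cell_sets by simp
      then have eq: "(\<integral>x. indicat_real (?C i j) x * ?G x \<partial>lborel) - h\<^sup>2 * ?G (?p i j) = (\<integral>x. ?F x \<partial>lborel)"
        using Bochner_Integration.integral_diff[OF Gi Ci, of i j i j "?G (?p i j)"] by (simp only:)
      have "\<bar>\<integral>x. ?F x \<partial>lborel\<bar> \<le> (\<integral>x. \<bar>?F x\<bar> \<partial>lborel)"
        by (rule integral_abs_bound)
      also have "\<dots> \<le> (\<integral>x. e * indicat_real (?C i j) x \<partial>lborel)"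
      proof (rule integral_mono)
        show "integrable lborel (\<lambda>x. \<bar>indicat_real (?C i j) x * ?G x - indicat_real (?C i j) x * ?G (?p i j)\<bar>)"
          by (intro integrable_abs Bochner_Integration.integrable_diff Gi Ci)
        show "integrable lborel (\<lambda>x. e * indicat_real (?C i j) x)" by (rule integrable_mult_right) (rule indi)
        fix x
        show "\<bar>indicat_real (?C i j) x * ?G x - indicat_real (?C i j) x * ?G (?p i j)\<bar> \<le> e * indicat_real (?C i j) x"
        proof (cases "x \<in> ?C i j")
          case True
          have "norm (x - ?p i j) < d3" using cell_norm[OF True] h d by simp
          then show ?thesis using d3(2)[of "x - ?p i j" "?p i j"] True by simp
        qed simp
      qed
      also have "\<dots> = e * h\<^sup>2" using mC[of i j] cell_sets by simp
      finally show ?thesis unfolding eq .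
    qed
    have s1: "(\<integral>x. (\<Sum>j<N. indicat_real (?C i j) x * ?G x) \<partial>lborel) = (\<Sum>j<N. \<integral>x. indicat_real (?C i j) x * ?G x \<partial>lborel)" for i
      by (rule Bochner_Integration.integral_sum) (rule Gi)
    have s2: "integrable lborel (\<lambda>x. \<Sum>j<N. indicat_real (?C i j) x * ?G x)" for i
      by (rule Bochner_Integration.integrable_sum) (rule Gi)
    have "(\<integral>x. ?G x \<partial>lborel) = (\<integral>x. (\<Sum>i<N. \<Sum>j<N. indicat_real (?C i j) x * ?G x) \<partial>lborel)"
      by (rule Bochner_Integration.integral_cong[OF refl cover])
    also have "\<dots> = (\<Sum>i<N. \<Sum>j<N. \<integral>x. indicat_real (?C i j) x * ?G x \<partial>lborel)"
      unfolding s1[symmetric] by (rule Bochner_Integration.integral_sum) (rule s2)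
    finally have IG: "(\<integral>x. ?G x \<partial>lborel) = (\<Sum>i<N. \<Sum>j<N. \<integral>x. indicat_real (?C i j) x * ?G x \<partial>lborel)" .
    have "\<bar>(\<integral>x. ?G x \<partial>lborel) - 2 * pi * of_int (- k)\<bar>
      = \<bar>\<Sum>i<N. \<Sum>j<N. ((\<integral>x. indicat_real (?C i j) x * ?G x \<partial>lborel) - D (?p i j))\<bar>"
      unfolding IG sumD[symmetric] by (simp add: sum_subtractf)
    also have "\<dots> \<le> (\<Sum>i<N. \<Sum>j<N. \<bar>(\<integral>x. indicat_real (?C i j) x * ?G x \<partial>lborel) - D (?p i j)\<bar>)"
      by (intro order_trans[OF sum_abs] sum_mono sum_abs)
    also have "\<dots> \<le> (\<Sum>i<N. \<Sum>j<N. (1 + 8 * M) * e * h\<^sup>2)"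
    proof (intro sum_mono)
      fix i j
      have "\<bar>(\<integral>x. indicat_real (?C i j) x * ?G x \<partial>lborel) - D (?p i j)\<bar> \<le> e * h\<^sup>2 + 8 * M * e * h\<^sup>2"
        using cellG[of i j] DG[of "?p i j"] by linarith
      then show "\<bar>(\<integral>x. indicat_real (?C i j) x * ?G x \<partial>lborel) - D (?p i j)\<bar> \<le> (1 + 8 * M) * e * h\<^sup>2"
        by (simp add: algebra_simps)
    qed
    also have "\<dots> = (1 + 8 * M) * e * (real N * h)\<^sup>2" by (simp add: power2_eq_square)
    also have "\<dots> = (1 + 8 * M) * (2 * R)\<^sup>2 * e" unfolding Nh by simp
    finally show ?thesis by blast
  qed
  define x0 where "x0 = (\<integral>x. ?G x \<partial>lborel) / (2 * pi)"
  \<comment> \<open>The integers are closed, so approximation by integers to any accuracy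
    suffices.\<close>
  have "x0 \<in> \<int>"
  proof (rule iffD1[OF closed_approachable[OF closed_Ints]], intro allI impI)
    fix r :: real assume r: "r > 0"
    define C where "C = (1 + 8 * M) * (2 * R)\<^sup>2"
    have C: "C > 0" using M R by (simp add: C_def)
    define e where "e = min (1/2) (r / C)"
    have e: "0 < e" "e < 1" "C * e \<le> r" using r C by (auto simp: e_def min_def field_simps)
    from approx[OF e(1,2)] obtain k :: int where k: "\<bar>(\<integral>x. ?G x \<partial>lborel) - 2 * pi * of_int k\<bar> \<le> C * e" by (auto simp: C_def)
    have "\<bar>x0 - of_int k\<bar> = \<bar>(\<integral>x. ?G x \<partial>lborel) - 2 * pi * of_int k\<bar> / (2 * pi)"
    proof -
      have "x0 - of_int k = ((\<integral>x. ?G x \<partial>lborel) - 2 * pi * of_int k) / (2 * pi)" by (simp add: x0_def field_simps)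
      then show ?thesis by (simp add: abs_divide)
    qed
    also have "\<dots> \<le> r / (2 * pi)" using k e by (intro divide_right_mono) auto
    also have "\<dots> < r / 1" using r pi_gt3 by (intro divide_strict_left_mono) auto
    finally show "\<exists>y\<in>\<int>. dist y x0 < r" by (intro bexI[of _ "of_int k"]) (auto simp: dist_real_def abs_minus_commute)
  qed
  then obtain k :: int where "x0 = of_int k" by (auto elim: Ints_cases)
  then have "(\<integral>x. ?G x \<partial>lborel) = 2 * pi * of_int k" by (simp add: x0_def field_simps)
  then show ?thesis by blast
qed

section \<open>Maps of nearly unit modulus\<close>

text \<open>The cross product of the plane, with vectors read as complex numbers.\<close>

definition cr :: "complex \<Rightarrow> complex \<Rightarrow> real" where "cr a b = Im (cnj a * b)"

lemma bounded_bilinear_cr: "bounded_bilinear cr"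
proof
  show "\<exists>K. \<forall>a b. norm (cr a b) \<le> norm a * norm b * K"
    by (rule exI[of _ 1]) (metis abs_Im_le_cmod cr_def complex_mod_cnj mult.right_neutral norm_mult real_norm_def)
qed (auto simp: cr_def algebra_simps)

lemma cr_abs_le: "\<bar>cr a b\<bar> \<le> norm a * norm b"
  by (metis abs_Im_le_cmod cr_def complex_mod_cnj norm_mult)

text \<open>With \<open>V\<close> in place of \<psi>, this is the integrand of \<open>abdeg\<close>
  up to the factor 1/(2\<pi>).\<close>

definition bform :: "(real^2 \<Rightarrow> real) \<Rightarrow> (real^2 \<Rightarrow> complex) \<Rightarrow> real^2 \<Rightarrow> real" where
  "bform \<psi> U x = pd 1 \<psi> x * cr (U x) (pd 2 U x) - pd 2 \<psi> x * cr (U x) (pd 1 U x)"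

lemma cr_cont: "continuous_on S f \<Longrightarrow> continuous_on S g \<Longrightarrow> continuous_on S (\<lambda>x. cr (f x) (g x))"
  unfolding cr_def by (intro continuous_intros)

lemma bform_CC:
  assumes "C1c \<psi>" "C1 U" shows "CC (bform \<psi> U)"
proof -
  obtain R where R: "R > 0" "\<And>x. norm x \<ge> R \<Longrightarrow> \<psi> x = 0" "\<And>x i. norm x \<ge> R \<Longrightarrow> pd i \<psi> x = 0"
    by (rule C1c_ball[OF assms(1)]) blast
  have "continuous_on UNIV (bform \<psi> U)"
    unfolding bform_def[abs_def]
    by (intro continuous_intros cr_cont C1_cont_pd C1_cont C1c_C1[OF assms(1)] assms(2))
  moreover have "bounded {x. bform \<psi> U x \<noteq> 0}"
  proof (rule bounded_subset[OF bounded_cball[of 0 R]], rule subsetI)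
    fix x assume "x \<in> {x. bform \<psi> U x \<noteq> 0}"
    then have "\<not> R \<le> norm x" using R(3)[of x] by (auto simp: bform_def)
    then show "x \<in> cball 0 R" by simp
  qed
  ultimately show ?thesis by (simp add: CC_def)
qed

section \<open>Penalized energies and the choice of a scale\<close>

lemma parallelogram_half: "(norm ((1/2) *\<^sub>R (a + b)))\<^sup>2 + (norm (a - b))\<^sup>2 / 4 = (norm a)\<^sup>2 / 2 + (norm b)\<^sup>2 / 2"
  for a b :: "'b::real_inner"
  by (simp add: power2_norm_eq_inner inner_simps inner_commute field_simps)

lemma l2_parallelogram:
  fixes f g :: "real^2 \<Rightarrow> 'b::euclidean_space"
  assumes "CC f" "CC g"
  shows "l2 (\<lambda>x. (1/2) *\<^sub>R (f x + g x)) + l2 (\<lambda>x. f x - g x) / 4 = l2 f / 2 + l2 g / 2"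
proof -
  have L: "L2b f" "L2b g" using assms CC_L2b by auto
  have i: "integrable lborel (\<lambda>x. (norm (f x))\<^sup>2)" "integrable lborel (\<lambda>x. (norm (g x))\<^sup>2)"
    "integrable lborel (\<lambda>x. (norm (f x - g x))\<^sup>2)" "integrable lborel (\<lambda>x. (norm ((1/2) *\<^sub>R (f x + g x)))\<^sup>2)"
    using L L2b_diff(1)[OF L] L2b_scale(1)[OF L2b_add(1)[OF L], of "1/2"] unfolding L2b_def by blast+
  have "(\<integral>x. (norm ((1/2) *\<^sub>R (f x + g x)))\<^sup>2 + (norm (f x - g x))\<^sup>2 / 4 \<partial>lborel) =
      (\<integral>x. (norm (f x))\<^sup>2 / 2 + (norm (g x))\<^sup>2 / 2 \<partial>lborel)"
    by (simp only: parallelogram_half)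
  moreover have "(\<integral>x. (norm ((1/2) *\<^sub>R (f x + g x)))\<^sup>2 + (norm (f x - g x))\<^sup>2 / 4 \<partial>lborel) =
      (\<integral>x. (norm ((1/2) *\<^sub>R (f x + g x)))\<^sup>2 \<partial>lborel) + (\<integral>x. (norm (f x - g x))\<^sup>2 / 4 \<partial>lborel)"
    by (rule Bochner_Integration.integral_add[OF i(4)]) (intro integrable_divide i)
  moreover have "(\<integral>x. (norm (f x))\<^sup>2 / 2 + (norm (g x))\<^sup>2 / 2 \<partial>lborel) = (\<integral>x. (norm (f x))\<^sup>2 / 2 \<partial>lborel) + (\<integral>x. (norm (g x))\<^sup>2 / 2 \<partial>lborel)"
    by (rule Bochner_Integration.integral_add) (intro integrable_divide i)+
  ultimately show ?thesis by (simp only: l2_def integral_divide_zero)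
qed

lemma dir_parallelogram:
  fixes f g :: "real^2 \<Rightarrow> 'b::euclidean_space"
  assumes "C1c f" "C1c g"
  shows "dir (\<lambda>x. (1/2) *\<^sub>R (f x + g x)) + dir (\<lambda>x. f x - g x) / 4 = dir f / 2 + dir g / 2"
proof -
  note C = C1c_add[OF assms] C1c_diff_fun[OF assms]
  have "pd i (\<lambda>x. (1/2) *\<^sub>R (f x + g x)) = (\<lambda>x. (1/2) *\<^sub>R (pd i f x + pd i g x))"
    "pd i (\<lambda>x. f x - g x) = (\<lambda>x. pd i f x - pd i g x)" for i
    using C1_scale(2)[OF C1_add[OF C1c_C1[OF assms(1)] C1c_C1[OF assms(2)]], of i "1/2"]
      pd_add[OF C1_diff[OF C1c_C1[OF assms(1)]] C1_diff[OF C1c_C1[OF assms(2)]]]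
      C1_diff_fun(2)[OF C1c_C1[OF assms(1)] C1c_C1[OF assms(2)]] by (auto simp: fun_eq_iff)
  then show ?thesis
    using l2_parallelogram[OF C1c_pd_CC[OF assms(1), of 1] C1c_pd_CC[OF assms(2), of 1]]
      l2_parallelogram[OF C1c_pd_CC[OF assms(1), of 2] C1c_pd_CC[OF assms(2), of 2]]
    by (simp only: dir_eq[OF assms(1)] dir_eq[OF assms(2)] dir_eq[OF C(2)] dir_eq[OF C1c_scale[OF C(1)]]) argo
qed

text \<open>A Moreau-type regularization of the Dirichlet energy: details of \<open>U\<close> finer
  than \<open>h\<close> are cheap to smooth away, so the infimum \<open>Fmin U h\<close> is roughly
  the energy that \<open>U\<close> carries at scales above \<open>h\<close>.\<close>

definition Fen :: "(real^2 \<Rightarrow> complex) \<Rightarrow> real \<Rightarrow> (real^2 \<Rightarrow> complex) \<Rightarrow> real" where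
  "Fen U h w = dir w + l2 (\<lambda>x. w x - U x) / h\<^sup>2"

definition Fmin :: "(real^2 \<Rightarrow> complex) \<Rightarrow> real \<Rightarrow> real" where
  "Fmin U h = (INF w\<in>{w. C1c w}. Fen U h w)"

lemma Fen_nonneg: "Fen U h w \<ge> 0" by (simp add: Fen_def dir_nonneg l2_nonneg)

lemma Fmin_le: "C1c w \<Longrightarrow> Fmin U h \<le> Fen U h w"
  unfolding Fmin_def by (rule cINF_lower) (auto intro!: bdd_belowI2[of _ 0] Fen_nonneg)

lemma Fmin_nonneg: "C1c U \<Longrightarrow> Fmin U h \<ge> 0"
  unfolding Fmin_def by (rule cINF_greatest) (auto intro: Fen_nonneg)

lemma Fmin_approx:
  assumes "C1c U" "e > 0"
  shows "\<exists>w. C1c w \<and> Fen U h w < Fmin U h + e"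
proof -
  have "(INF w\<in>{w. C1c w}. Fen U h w) < Fmin U h + e" using assms by (simp add: Fmin_def)
  then show ?thesis
    by (subst (asm) cINF_less_iff) (use assms(1) in \<open>auto intro!: bdd_belowI2[of _ 0] Fen_nonneg\<close>)
qed

lemma Fmin_le_dir: "C1c U \<Longrightarrow> Fmin U h \<le> dir U"
  using Fmin_le[of U U h] by (simp add: Fen_def l2_def)

lemma Fen_mono: assumes "0 < h'" "h' \<le> h" shows "Fen U h w \<le> Fen U h' w"
proof -
  have "l2 (\<lambda>x. w x - U x) / h\<^sup>2 \<le> l2 (\<lambda>x. w x - U x) / h'\<^sup>2"
    using assms by (intro divide_left_mono l2_nonneg power_mono mult_pos_pos) auto
  then show ?thesis by (simp add: Fen_def)
qed

text \<open>The midpoint of \<open>a\<close> and \<open>b\<close> competes in \<open>Fmin\<close>,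
  and by the parallelogram law its energy undercuts the mean of the two by at least a quarter of the
  energy of a - b.\<close>

lemma Fen_convex:
  assumes "C1c U" "C1c a" "C1c b"
  shows "dir (\<lambda>x. a x - b x) \<le> 2 * (Fen U h a + Fen U h b - 2 * Fmin U h)"
proof -
  let ?m = "\<lambda>x. (1/2) *\<^sub>R (a x + b x)"
  have C: "C1c ?m" by (intro C1c_scale C1c_add assms)
  have "?m x - U x = (1/2) *\<^sub>R ((a x - U x) + (b x - U x))" for x
  proof -
    have "U x = (1/2) *\<^sub>R U x + (1/2) *\<^sub>R U x" by (simp flip: scaleR_add_left)
    then show ?thesis by (simp add: algebra_simps)
  qed
  then have "l2 (\<lambda>x. ?m x - U x) = l2 (\<lambda>x. (1/2) *\<^sub>R ((a x - U x) + (b x - U x)))" by (simp only:)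
  also have "\<dots> \<le> l2 (\<lambda>x. a x - U x) / 2 + l2 (\<lambda>x. b x - U x) / 2"
    using l2_parallelogram[OF C1c_CC[OF C1c_diff_fun[OF assms(2,1)]] C1c_CC[OF C1c_diff_fun[OF assms(3,1)]]]
      l2_nonneg[of "\<lambda>x. (a x - U x) - (b x - U x)"] by linarith
  finally have "l2 (\<lambda>x. ?m x - U x) / h\<^sup>2 \<le> (l2 (\<lambda>x. a x - U x) / 2 + l2 (\<lambda>x. b x - U x) / 2) / h\<^sup>2"
    by (rule divide_right_mono) simp
  then have "Fen U h ?m + dir (\<lambda>x. a x - b x) / 4 \<le> Fen U h a / 2 + Fen U h b / 2"
    using dir_parallelogram[OF assms(2,3)] unfolding Fen_def by (simp add: add_divide_distrib)
  moreover have "Fmin U h \<le> Fen U h ?m" by (rule Fmin_le[OF C])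
  moreover have "D \<le> 2 * (A + B - 2 * m)" if "x + D / 4 \<le> A / 2 + B / 2" "m \<le> x" for A B D m x :: real
    using that by simp
  ultimately show ?thesis by blast
qed

text \<open>Mollification does not increase \<open>dir\<close> and moves \<open>w\<close> by at most
  (\<tau> * h)^2 * dir w in \<open>l2\<close>. Splitting the square of the sum with weights 1 +
  \<tau> and 1 + 1/\<tau> keeps the loss of order \<tau>.\<close>

lemma Fen_mol:
  assumes "C1c U" "C1c w" "h > 0" "0 < \<tau>" "\<tau> < 1"
  shows "Fen U h (mol (\<tau> * h) w) \<le> (1 + 2 * \<tau>) * Fen U h w"
proof -
  let ?s = "\<tau> * h"
  have s: "?s > 0" using assms by simp
  have Lw: "L2b w" by (rule CC_L2b[OF C1c_CC[OF assms(2)]])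
  have Cm: "C1c (mol ?s w)" by (rule mol_C1c[OF s Lw])
  let ?a = "\<lambda>x. w x - U x" and ?b = "\<lambda>x. mol ?s w x - w x"
  have La: "L2b ?a" "L2b ?b" by (intro CC_L2b C1c_CC C1c_diff_fun assms Cm)+
  have Li: "L2b (\<lambda>x. mol ?s w x - U x)" by (intro CC_L2b C1c_CC C1c_diff_fun assms Cm)
  have pt: "(norm (mol ?s w x - U x))\<^sup>2 \<le> (1 + \<tau>) * (norm (?a x))\<^sup>2 + (1 + 1/\<tau>) * (norm (?b x))\<^sup>2" for x
  proof -
    have e: "mol ?s w x - U x = ?a x + ?b x" by simp
    have "(norm (?a x + ?b x))\<^sup>2 \<le> (norm (?a x) + norm (?b x))\<^sup>2" by (intro power_mono norm_triangle_ineq) simp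
    also have "\<dots> \<le> (1 + \<tau>) * (norm (?a x))\<^sup>2 + (1 + 1/\<tau>) * (norm (?b x))\<^sup>2"
    proof -
      have "(A + B)\<^sup>2 \<le> (1 + \<tau>) * A\<^sup>2 + (1 + 1/\<tau>) * B\<^sup>2" for A B :: real
      proof -
        have "0 \<le> (\<tau> * A - B)\<^sup>2 / \<tau>" using assms by simp
        also have "\<dots> = \<tau> * A\<^sup>2 - 2 * A * B + B\<^sup>2 / \<tau>"
          using assms by (simp add: power2_eq_square field_simps)
        finally show ?thesis by (simp add: power2_eq_square algebra_simps)
      qed
      then show ?thesis .
    qed
    finally show ?thesis unfolding e .
  qed
  have "l2 (\<lambda>x. mol ?s w x - U x) \<le> (\<integral>x. (1 + \<tau>) * (norm (?a x))\<^sup>2 + (1 + 1/\<tau>) * (norm (?b x))\<^sup>2 \<partial>lborel)"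
    unfolding l2_def by (rule integral_mono[OF _ _ pt]) (use La Li in \<open>auto simp: L2b_def\<close>)
  also have "\<dots> = (1 + \<tau>) * l2 ?a + (1 + 1/\<tau>) * l2 ?b"
    using La by (simp add: L2b_def l2_def)
  also have "\<dots> \<le> (1 + \<tau>) * l2 ?a + (1 + 1/\<tau>) * (?s\<^sup>2 * dir w)"
    using mol_approx[OF s assms(2)] assms by (intro add_left_mono mult_left_mono) auto
  finally have "l2 (\<lambda>x. mol ?s w x - U x) / h\<^sup>2 \<le> ((1 + \<tau>) * l2 ?a + (1 + 1/\<tau>) * (?s\<^sup>2 * dir w)) / h\<^sup>2"
    by (rule divide_right_mono) simp
  also have "\<dots> = (1 + \<tau>) * (l2 ?a / h\<^sup>2) + (\<tau>\<^sup>2 + \<tau>) * dir w"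
    using assms by (simp add: field_simps power2_eq_square)
  also have "\<dots> \<le> (1 + 2 * \<tau>) * (l2 ?a / h\<^sup>2) + (2 * \<tau>) * dir w"
    using assms dir_nonneg[of w] l2_nonneg[of ?a] by (intro add_mono mult_right_mono) (auto simp: power2_eq_square mult_left_le)
  finally have "Fen U h (mol ?s w) \<le> dir (mol ?s w) + (1 + 2 * \<tau>) * (l2 ?a / h\<^sup>2) + (2 * \<tau>) * dir w"
    by (simp add: Fen_def)
  also have "\<dots> \<le> (1 + 2 * \<tau>) * Fen U h w"
    using mol_dir[OF s assms(2)] by (simp add: Fen_def algebra_simps)
  finally show ?thesis .
qed

lemma mol_gsq_le:
  fixes f :: "real^2 \<Rightarrow> complex"
  assumes "h > 0" "C1c f"
  shows "gsq (mol h f) x \<le> 8 / h\<^sup>2 * dir f"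
proof -
  have e: "pd i (mol h f) x = mol h (pd i f) x" for i by (rule mol_pd[OF assms])
  show ?thesis unfolding gsq_def e dir_eq[OF assms(2)]
    using mol_pointwise[OF assms(1) CC_L2b[OF C1c_pd_CC[OF assms(2), of 1]], of x]
      mol_pointwise[OF assms(1) CC_L2b[OF C1c_pd_CC[OF assms(2), of 2]], of x]
    by (simp add: distrib_left)
qed

text \<open>The minimal energies \<open>Fmin U (h i)\<close> increase as the scale decreases and are bounded by \<open>\<Lambda>\<close>, so
  two consecutive scales have nearly equal minimal energy. By convexity the corresponding
  near-minimizers then have close gradients, which excludes energy concentration in between.
  The map \<open>w\<close> is the mollification of the near-minimizer at the coarser scale.\<close>

lemma scale_selection:
  fixes U :: "real^2 \<Rightarrow> complex"
  assumes U: "C1c U" "dir U \<le> \<Lambda>" and \<tau>: "0 < \<tau>" "\<tau> < 1" and h0: "h0 > 0" and N: "\<Lambda> < real N * \<tau>"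
  shows "\<exists>i<N. \<exists>v w. C1c v \<and> C1c w \<and> dir v \<le> \<Lambda> + 1 \<and>
    l2 (\<lambda>x. v x - U x) \<le> (h0 * \<tau>^(3 * Suc i))\<^sup>2 * (\<Lambda> + 1) \<and>
    dir (\<lambda>x. v x - w x) \<le> 10 * (\<Lambda> + 1) * \<tau> \<and>
    (\<forall>x. gsq w x \<le> 8 / (\<tau> * (h0 * \<tau>^(3 * i)))\<^sup>2 * (\<Lambda> + 1))"
proof -
  \<comment> \<open>Consecutive scales differ by \<tau>^3, so that the radius \<tau>^2 * h i used
    later leaves a factor \<tau> on either side: to \<open>h (Suc i)\<close> below and to \<tau> * h
    i above.\<close>
  define h where "h i = h0 * \<tau>^(3 * i)" for i
  have h: "h i > 0" for i using h0 \<tau> by (simp add: h_def)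
  have hS: "h (Suc i) \<le> h i" for i
    unfolding h_def using h0 \<tau> by (intro mult_left_mono power_decreasing) auto
  define m where "m i = Fmin U (h i)" for i
  have m0: "m i \<ge> 0" "m i \<le> \<Lambda>" for i
    using Fmin_nonneg[OF U(1)] Fmin_le_dir[OF U(1), of "h i"] U(2) by (auto simp: m_def)
  \<comment> \<open>Otherwise the telescoping sum of the increments would exceed \<Lambda>, which
    bounds all minimal energies.\<close>
  have "\<exists>i<N. m (Suc i) - m i \<le> \<tau>"
  proof (rule ccontr)
    assume "\<not> ?thesis"
    then have "m (Suc i) - m i \<ge> \<tau>" if "i < N" for i using that by (auto simp: not_le less_imp_le)
    then have "(\<Sum>i<N. \<tau>) \<le> (\<Sum>i<N. m (Suc i) - m i)" by (intro sum_mono) auto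
    also have "\<dots> = m N - m 0" by (rule sum_lessThan_telescope)
    finally have "real N * \<tau> \<le> m N - m 0" by simp
    then show False using m0[of N] m0[of 0] N by linarith
  qed
  then obtain i where i: "i < N" "m (Suc i) - m i \<le> \<tau>" by blast
  from Fmin_approx[OF U(1) \<tau>(1), of "h (Suc i)"]
  obtain v where v: "C1c v" "Fen U (h (Suc i)) v < m (Suc i) + \<tau>" unfolding m_def[symmetric] by blast
  from Fmin_approx[OF U(1) \<tau>(1), of "h i"]
  obtain w0 where w0: "C1c w0" "Fen U (h i) w0 < m i + \<tau>" unfolding m_def[symmetric] by blast
  have q: "l2 f / (h j)\<^sup>2 \<ge> 0" for f :: "real^2 \<Rightarrow> complex" and j by (simp add: l2_nonneg)
  define w where "w = mol (\<tau> * h i) w0"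
  have s: "\<tau> * h i > 0" using \<tau> h by simp
  have w: "C1c w" unfolding w_def by (rule mol_C1c[OF s CC_L2b[OF C1c_CC[OF w0(1)]]])
  have Fv: "Fen U (h (Suc i)) v \<le> \<Lambda> + 1" using v(2) m0[of "Suc i"] \<tau> by linarith
  have dv: "dir v \<le> \<Lambda> + 1" using Fv q[where f="\<lambda>x. v x - U x" and j="Suc i"] unfolding Fen_def by linarith
  have lv: "l2 (\<lambda>x. v x - U x) \<le> (h (Suc i))\<^sup>2 * (\<Lambda> + 1)"
  proof -
    have "l2 (\<lambda>x. v x - U x) / (h (Suc i))\<^sup>2 \<le> \<Lambda> + 1" using Fv dir_nonneg[of v] unfolding Fen_def by linarith
    then show ?thesis using h[of "Suc i"] by (simp add: field_simps)
  qed
  have dw0: "dir w0 \<le> \<Lambda> + 1"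
    using w0(2) m0[of i] \<tau> q[where f="\<lambda>x. w0 x - U x" and j=i] unfolding Fen_def by linarith
  have "Fen U (h i) w \<le> (1 + 2 * \<tau>) * Fen U (h i) w0" unfolding w_def by (rule Fen_mol[OF U(1) w0(1) h \<tau>])
  also have "\<dots> \<le> (1 + 2 * \<tau>) * (m i + \<tau>)" using w0(2) \<tau> by (intro mult_left_mono) auto
  also have "\<dots> = m i + \<tau> + 2 * \<tau> * (m i + \<tau>)" by (simp add: algebra_simps)
  also have "\<dots> \<le> m i + \<tau> + 2 * \<tau> * (\<Lambda> + 1)" using m0[of i] \<tau> by (intro add_left_mono mult_left_mono) auto
  finally have Fw: "Fen U (h i) w \<le> m i + \<tau> + 2 * \<tau> * (\<Lambda> + 1)" .
  \<comment> \<open>The near-minimizer of the finer scale is nearly optimal at the coarser one too: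
    a larger \<open>h\<close> weakens the penalty, and the two minima differ by at most
    \<tau>.\<close>
  have Fv2: "Fen U (h i) v \<le> m (Suc i) + \<tau>"
    using Fen_mono[OF h[of "Suc i"] hS[of i], of U v] v(2) by linarith
  have "dir (\<lambda>x. v x - w x) \<le> 2 * (Fen U (h i) v + Fen U (h i) w - 2 * m i)"
    unfolding m_def by (rule Fen_convex[OF U(1) v(1) w])
  also have "\<dots> \<le> 2 * (3 * \<tau> + 2 * \<tau> * (\<Lambda> + 1))"
  proof -
    have "2 * (A + B - 2 * m) \<le> 2 * (3 * \<tau> + c)" if "B \<le> m + \<tau> + c" "A \<le> m' + \<tau>" "m' - m \<le> \<tau>" for A B m m' c :: real
      using that by simp
    from this[OF Fw Fv2 i(2)] show ?thesis .
  qed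
  also have "\<dots> \<le> 10 * (\<Lambda> + 1) * \<tau>"
  proof -
    have "\<Lambda> * \<tau> \<ge> 0" using m0[of 0] \<tau> by (intro mult_nonneg_nonneg) auto
    then show ?thesis by (simp add: algebra_simps)
  qed
  finally have D: "dir (\<lambda>x. v x - w x) \<le> 10 * (\<Lambda> + 1) * \<tau>" .
  have G: "gsq w x \<le> 8 / (\<tau> * h i)\<^sup>2 * (\<Lambda> + 1)" for x
  proof -
    have "gsq w x \<le> 8 / (\<tau> * h i)\<^sup>2 * dir w0" unfolding w_def by (rule mol_gsq_le[OF s w0(1)])
    also have "\<dots> \<le> 8 / (\<tau> * h i)\<^sup>2 * (\<Lambda> + 1)" by (intro mult_left_mono dw0) simp
    finally show ?thesis .
  qed
  show ?thesis
    by (intro exI[of _ i] exI[of _ v] exI[of _ w] conjI allI i(1) v(1) w dv lv[unfolded h_def] D G[unfolded h_def])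
qed

section \<open>The modulus of the mollified map\<close>

lemma gsq_lipschitz:
  fixes f :: "real^2 \<Rightarrow> complex"
  assumes "C1 f" "\<And>x. gsq f x \<le> B\<^sup>2" "B \<ge> 0"
  shows "norm (f y - f x) \<le> B * norm (y - x)"
proof (rule differentiable_bound[of UNIV])
  fix x :: "real^2"
  show "(f has_derivative (\<lambda>v. v$1 *\<^sub>R pd 1 f x + v$2 *\<^sub>R pd 2 f x)) (at x within UNIV)" using C1_hd[OF assms(1)] by simp
  show "onorm (\<lambda>v::real^2. v$1 *\<^sub>R pd 1 f x + v$2 *\<^sub>R pd 2 f x) \<le> B"
  proof (rule onorm_le)
    fix v :: "real^2"
    have "(norm (v$1 *\<^sub>R pd 1 f x + v$2 *\<^sub>R pd 2 f x))\<^sup>2 \<le> (norm v)\<^sup>2 * gsq f x" by (rule gradient_norm_sq_le)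
    also have "\<dots> \<le> (norm v)\<^sup>2 * B\<^sup>2" by (intro mult_left_mono assms) simp
    finally have "(norm (v$1 *\<^sub>R pd 1 f x + v$2 *\<^sub>R pd 2 f x))\<^sup>2 \<le> (B * norm v)\<^sup>2" by (simp add: power_mult_distrib mult.commute)
    then show "norm (v$1 *\<^sub>R pd 1 f x + v$2 *\<^sub>R pd 2 f x) \<le> B * norm v"
      by (rule power2_le_imp_le) (use assms(3) in simp)
  qed
qed auto

text \<open>Treating the two squares jointly saves the factor 2 that separate bounds would
  cost.\<close>

lemma mol_sup_sq:
  fixes f :: "real^2 \<Rightarrow> 'b::{banach,second_countable_topology}"
  assumes "h > 0" "CC f" "CC g" "\<And>y. (norm (f y))\<^sup>2 + (norm (g y))\<^sup>2 \<le> M"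
  shows "(norm (mol h f x))\<^sup>2 + (norm (mol h g x))\<^sup>2 \<le> M"
proof -
  note L = CC_L2b[OF assms(2)] CC_L2b[OF assms(3)]
  have eq: "kap h (x - y) = kap h (y - x)" for y using kap_uminus[of h "x - y"] by simp
  have t: "integrable lborel (\<lambda>y. kap h (x - y))" "(\<integral>y. kap h (x - y) \<partial>lborel) = 1"
    using integrable_translate[OF kap_integral(1)[OF assms(1)], of "- x"] kap_integral(2)[OF assms(1)]
    unfolding eq by simp_all
  have "(norm (mol h f x))\<^sup>2 + (norm (mol h g x))\<^sup>2 \<le> (\<integral>y. kap h (x - y) * (norm (f y))\<^sup>2 \<partial>lborel) + (\<integral>y. kap h (x - y) * (norm (g y))\<^sup>2 \<partial>lborel)"
    by (intro add_mono mol_sq_le(1) assms(1) L)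
  also have "\<dots> = (\<integral>y. kap h (x - y) * (norm (f y))\<^sup>2 + kap h (x - y) * (norm (g y))\<^sup>2 \<partial>lborel)"
    by (rule Bochner_Integration.integral_add[symmetric]) (intro mol_sq_le(2) assms(1) L)+
  also have "\<dots> \<le> (\<integral>y. kap h (x - y) * M \<partial>lborel)"
  proof (rule integral_mono)
    show "integrable lborel (\<lambda>y. kap h (x - y) * (norm (f y))\<^sup>2 + kap h (x - y) * (norm (g y))\<^sup>2)"
      by (intro Bochner_Integration.integrable_add mol_sq_le(2) assms(1) L)
    show "integrable lborel (\<lambda>y. kap h (x - y) * M)" using t by simp
    show "kap h (x - y) * (norm (f y))\<^sup>2 + kap h (x - y) * (norm (g y))\<^sup>2 \<le> kap h (x - y) * M" for y
      using mult_left_mono[OF assms(4)[of y] kap_nonneg[OF assms(1), of "x - y"]] by (simp add: distrib_left)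
  qed
  also have "\<dots> = M" using t by simp
  finally show ?thesis .
qed

text \<open>Suppose the modulus at \<open>x0\<close> is off by more than 2\<mu>, where \<mu> = sqrt
  (200 * L * \<tau>). The mollified map is Lipschitz with constant \<mu> / r, so the modulus is off
  by \<mu> on all of \<open>cball x0 r\<close>, and the squared defect has integral at least \<mu>^2
  * pi * r^2 there. Comparison with \<open>w\<close>, \<open>v\<close> and \<open>U\<close> bounds
  that integral by a smaller multiple of L * \<tau> * r^2.\<close>

lemma mollified_modulus:
  fixes U v w :: "real^2 \<Rightarrow> complex"
  assumes C: "C1c U" "C1c v" "C1c w" and r: "r > 0" and L: "L \<ge> 1" and \<tau>: "0 < \<tau>" "\<tau> < 1"
    and vU: "l2 (\<lambda>x. v x - U x) \<le> \<tau>\<^sup>2 * r\<^sup>2 * L"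
    and vw: "dir (\<lambda>x. v x - w x) \<le> 10 * L * \<tau>"
    and gw: "\<And>x. gsq w x \<le> 8 * L * \<tau>\<^sup>2 / r\<^sup>2"
    and S: "compact S" "cball x0 r \<subseteq> S" "(\<integral>x. indicator S x * (1 - norm (U x))\<^sup>2 \<partial>lborel) \<le> \<tau> * r\<^sup>2"
  shows "\<bar>1 - norm (mol r v x0)\<bar> \<le> 2 * sqrt (200 * L * \<tau>)"
proof (rule ccontr)
  define f where "f x = v x - w x" for x
  have Cf: "C1c f" unfolding f_def[abs_def] by (intro C1c_diff_fun C)
  note L2 = CC_L2b[OF C1c_CC[OF C(2)]] CC_L2b[OF C1c_CC[OF C(3)]] CC_L2b[OF C1c_CC[OF Cf]]
  let ?W = "mol r v"
  have CW: "C1c ?W" by (rule mol_C1c[OF r L2(1)])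
  \<comment> \<open>200 exceeds the constant 176, which arises twice below: in the gradient bound of
    \<open>?W\<close> and in the upper bound of the integral.\<close>
  define \<mu> where "\<mu> = sqrt (200 * L * \<tau>)"
  have \<mu>: "\<mu> > 0" "\<mu>\<^sup>2 = 200 * L * \<tau>" using L \<tau> by (simp_all add: \<mu>_def)
  have \<tau>2: "\<tau>\<^sup>2 \<le> \<tau>" using \<tau> by (simp add: power2_eq_square mult_left_le)
  have L\<tau>: "L * \<tau>\<^sup>2 \<le> L * \<tau>" using \<tau>2 L by (intro mult_left_mono) auto
  \<comment> \<open>The gradient of \<open>w\<close> is pointwise of order \<tau> / r already. That
    of \<open>f\<close> is small only in L2; mollification at scale \<open>r\<close> turns this into
    a pointwise bound of order sqrt \<tau> / r, up to constants depending on
    \<open>L\<close>.\<close>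
  have gW: "gsq ?W x \<le> (\<mu> / r)\<^sup>2" for x
  proof -
    have e: "pd i ?W x = mol r (pd i w) x + mol r (pd i f) x" for i
    proof -
      have "pd i f = (\<lambda>x. pd i v x - pd i w x)"
        unfolding f_def[abs_def] using C1_diff_fun(2)[OF C1c_C1[OF C(2)] C1c_C1[OF C(3)]] by auto
      then have "mol r (pd i f) x = mol r (pd i v) x - mol r (pd i w) x"
        using mol_diff[OF r CC_integrable[OF C1c_pd_CC[OF C(2)]] CC_integrable[OF C1c_pd_CC[OF C(3)]], of i i x] by simp
      then show ?thesis using mol_pd[OF r C(2)] by simp
    qed
    have "gsq ?W x \<le> (2 * (norm (mol r (pd 1 w) x))\<^sup>2 + 2 * (norm (mol r (pd 1 f) x))\<^sup>2) + (2 * (norm (mol r (pd 2 w) x))\<^sup>2 + 2 * (norm (mol r (pd 2 f) x))\<^sup>2)"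
      unfolding gsq_def e by (intro add_mono norm_add_sq)
    also have "\<dots> = 2 * ((norm (mol r (pd 1 w) x))\<^sup>2 + (norm (mol r (pd 2 w) x))\<^sup>2) + 2 * ((norm (mol r (pd 1 f) x))\<^sup>2 + (norm (mol r (pd 2 f) x))\<^sup>2)"
      by simp
    also have "\<dots> \<le> 2 * (8 * L * \<tau>\<^sup>2 / r\<^sup>2) + 2 * (8 / r\<^sup>2 * dir f)"
    proof (intro add_mono mult_left_mono)
      show "(norm (mol r (pd 1 w) x))\<^sup>2 + (norm (mol r (pd 2 w) x))\<^sup>2 \<le> 8 * L * \<tau>\<^sup>2 / r\<^sup>2"
        by (rule mol_sup_sq[OF r C1c_pd_CC[OF C(3)] C1c_pd_CC[OF C(3)]]) (use gw in \<open>simp add: gsq_def\<close>)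
      show "(norm (mol r (pd 1 f) x))\<^sup>2 + (norm (mol r (pd 2 f) x))\<^sup>2 \<le> 8 / r\<^sup>2 * dir f"
        using mol_gsq_le[OF r Cf, of x] mol_pd[OF r Cf] by (simp add: gsq_def)
    qed auto
    also have "\<dots> \<le> 2 * (8 * L * \<tau> / r\<^sup>2) + 2 * (8 / r\<^sup>2 * (10 * L * \<tau>))"
      using vw \<tau>2 L unfolding f_def[symmetric] by (intro add_mono mult_left_mono divide_right_mono) auto
    also have "\<dots> \<le> (\<mu> / r)\<^sup>2"
    proof -
      have "2 * (8 * L * \<tau> / r\<^sup>2) + 2 * (8 / r\<^sup>2 * (10 * L * \<tau>)) = 176 * (L * \<tau>) / r\<^sup>2" by (simp add: field_simps)
      also have "\<dots> \<le> 200 * (L * \<tau>) / r\<^sup>2" using L \<tau> by (intro divide_right_mono mult_right_mono) auto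
      finally show ?thesis using \<mu> by (simp add: power_divide mult.assoc)
    qed
    finally show ?thesis .
  qed
  define \<kappa> where "\<kappa> = \<bar>1 - norm (?W x0)\<bar>"
  assume "\<not> \<bar>1 - norm (mol r v x0)\<bar> \<le> 2 * sqrt (200 * L * \<tau>)"
  then have \<kappa>: "\<kappa> > 2 * \<mu>" by (simp add: \<kappa>_def \<mu>_def)
  let ?b = "cball x0 r"
  have low: "\<mu>\<^sup>2 \<le> (1 - norm (?W y))\<^sup>2" if "y \<in> ?b" for y
  proof -
    have "norm (?W y - ?W x0) \<le> (\<mu> / r) * norm (y - x0)"
      by (rule gsq_lipschitz[OF C1c_C1[OF CW] gW]) (use \<mu> r in auto)
    also have "\<dots> \<le> (\<mu> / r) * r" using that \<mu> r by (intro mult_left_mono) (auto simp: dist_norm norm_minus_commute)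
    finally have "norm (?W y - ?W x0) \<le> \<mu>" using r by simp
    then have "\<bar>norm (?W y) - norm (?W x0)\<bar> \<le> \<mu>" using norm_triangle_ineq3 order_trans by blast
    then have "\<mu> \<le> \<bar>1 - norm (?W y)\<bar>" using \<kappa> unfolding \<kappa>_def by linarith
    then show ?thesis using \<mu>(1) by (metis abs_le_square_iff abs_of_pos)
  qed
  define wB where "wB = sqrt (8 * L) * \<tau> / r"
  have wB: "wB \<ge> 0" "wB\<^sup>2 = 8 * L * \<tau>\<^sup>2 / r\<^sup>2" "(wB * r)\<^sup>2 = 8 * L * \<tau>\<^sup>2"
    using L \<tau> r by (simp_all add: wB_def power_divide power_mult_distrib)
  have wl: "(norm (mol r w y - w y))\<^sup>2 \<le> 8 * L * \<tau>\<^sup>2" for y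
  proof -
    have "norm (mol r w y - w y) \<le> wB * r"
    proof (rule mol_uniform[OF r L2b_integrable[OF L2(2)]])
      fix z assume z: "norm (z - y) < r"
      have "norm (w z - w y) \<le> wB * norm (z - y)"
        by (rule gsq_lipschitz[OF C1c_C1[OF C(3)] _ wB(1)]) (use gw wB(2) in simp)
      also have "\<dots> \<le> wB * r" using z wB(1) by (intro mult_left_mono) auto
      finally show "norm (w z - w y) \<le> wB * r" .
    qed
    then have "(norm (mol r w y - w y))\<^sup>2 \<le> (wB * r)\<^sup>2" by (intro power_mono) auto
    then show ?thesis using wB(3) by simp
  qed
  \<comment> \<open>The mollification error of v = w + f is split: the part from \<open>w\<close> is
    controlled pointwise by its Lipschitz bound, the part from \<open>f\<close> only in L2 through
    its Dirichlet energy.\<close>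
  have up: "(1 - norm (?W y))\<^sup>2 \<le> 4 * (1 - norm (U y))\<^sup>2 + 4 * (norm (v y - U y))\<^sup>2 + 32 * L * \<tau>\<^sup>2 + 4 * (norm (mol r f y - f y))\<^sup>2" for y
  proof -
    have "mol r f y = mol r v y - mol r w y"
      unfolding f_def[abs_def] by (rule mol_diff[OF r L2b_integrable[OF L2(1)] L2b_integrable[OF L2(2)]])
    then have "?W y - v y = (mol r w y - w y) + (mol r f y - f y)" by (simp add: f_def)
    then have "norm (?W y - v y) \<le> norm (mol r w y - w y) + norm (mol r f y - f y)" using norm_triangle_ineq by simp
    moreover have "\<bar>norm (?W y) - norm (v y)\<bar> \<le> norm (?W y - v y)" "\<bar>norm (v y) - norm (U y)\<bar> \<le> norm (v y - U y)"
      by (rule norm_triangle_ineq3)+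
    ultimately have "\<bar>1 - norm (?W y)\<bar> \<le> \<bar>1 - norm (U y)\<bar> + norm (v y - U y) + norm (mol r w y - w y) + norm (mol r f y - f y)"
      by linarith
    then have "(\<bar>1 - norm (?W y)\<bar>)\<^sup>2 \<le> (\<bar>1 - norm (U y)\<bar> + norm (v y - U y) + norm (mol r w y - w y) + norm (mol r f y - f y))\<^sup>2"
      by (rule power_mono) simp
    also have "\<dots> \<le> 4 * (\<bar>1 - norm (U y)\<bar>)\<^sup>2 + 4 * (norm (v y - U y))\<^sup>2 + 4 * (norm (mol r w y - w y))\<^sup>2 + 4 * (norm (mol r f y - f y))\<^sup>2"
    proof -
      have "(a + b + c + d)\<^sup>2 \<le> 4 * a\<^sup>2 + 4 * b\<^sup>2 + 4 * c\<^sup>2 + 4 * d\<^sup>2" for a b c d :: real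
      proof -
        have "0 \<le> (a - b)\<^sup>2 + (a - c)\<^sup>2 + (a - d)\<^sup>2 + (b - c)\<^sup>2 + (b - d)\<^sup>2 + (c - d)\<^sup>2" by simp
        also have "\<dots> = 4 * a\<^sup>2 + 4 * b\<^sup>2 + 4 * c\<^sup>2 + 4 * d\<^sup>2 - (a + b + c + d)\<^sup>2"
          by (simp add: power2_eq_square algebra_simps)
        finally show ?thesis by simp
      qed
      then show ?thesis .
    qed
    finally show ?thesis using wl[of y] by simp
  qed
  define I where "I x = indicat_real S x * (1 - norm (U x))\<^sup>2" for x
  have Ii: "integrable lborel I"
  proof -
    have "continuous_on S (\<lambda>x. (1 - norm (U x))\<^sup>2)" by (intro continuous_intros C1_cont C1c_C1 C)
    then show ?thesis
      unfolding I_def[abs_def] using borel_integrable_compact[OF S(1), of "\<lambda>x. (1 - norm (U x))\<^sup>2"] by simp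
  qed
  have i1: "integrable lborel (\<lambda>y. (norm (v y - U y))\<^sup>2)" "integrable lborel (\<lambda>y. (norm (mol r f y - f y))\<^sup>2)"
    using CC_integrable[OF CC_norm_sq[OF C1c_CC[OF C1c_diff_fun[OF C(2,1)]]]]
      CC_integrable[OF CC_norm_sq[OF C1c_CC[OF C1c_diff_fun[OF mol_C1c[OF r L2(3)] Cf]]]] by auto
  have ib: "integrable lborel (indicat_real ?b)" by (rule integrable_indicator_bounded) auto
  define P where "P y = 4 * I y + 4 * (norm (v y - U y))\<^sup>2 + 32 * L * \<tau>\<^sup>2 * indicat_real ?b y + 4 * (norm (mol r f y - f y))\<^sup>2" for y
  have "(\<integral>y. \<mu>\<^sup>2 * indicat_real ?b y \<partial>lborel) \<le> (\<integral>y. P y \<partial>lborel)"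
  proof (rule integral_mono)
    show "integrable lborel (\<lambda>y. \<mu>\<^sup>2 * indicat_real ?b y)" using ib by (intro integrable_mult_right)
    show "integrable lborel P" unfolding P_def[abs_def]
      by (intro Bochner_Integration.integrable_add integrable_mult_right Ii i1 ib)
    fix y
    show "\<mu>\<^sup>2 * indicat_real ?b y \<le> P y"
    proof (cases "y \<in> ?b")
      case True
      then have "I y = (1 - norm (U y))\<^sup>2" using S(2) by (auto simp: I_def)
      then show ?thesis using low[OF True] up[of y] True by (simp add: P_def)
    next
      case False
      have "I y \<ge> 0" by (simp add: I_def)
      then show ?thesis using False by (simp add: P_def)
    qed
  qed
  also have "(\<integral>y. P y \<partial>lborel) = 4 * (\<integral>y. I y \<partial>lborel) + 4 * l2 (\<lambda>x. v x - U x) + 32 * L * \<tau>\<^sup>2 * measure lborel ?b + 4 * l2 (\<lambda>x. mol r f x - f x)"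
    unfolding P_def using Ii i1 ib by (simp add: l2_def)
  also have "\<dots> \<le> 4 * (\<tau> * r\<^sup>2) + 4 * (\<tau>\<^sup>2 * r\<^sup>2 * L) + 32 * L * \<tau>\<^sup>2 * measure lborel ?b + 4 * (r\<^sup>2 * (10 * L * \<tau>))"
  proof (intro add_mono mult_left_mono vU order_refl)
    show "(\<integral>y. I y \<partial>lborel) \<le> \<tau> * r\<^sup>2" using S(3) by (simp add: I_def)
    have "l2 (\<lambda>x. mol r f x - f x) \<le> r\<^sup>2 * dir f" by (rule mol_approx[OF r Cf])
    also have "\<dots> \<le> r\<^sup>2 * (10 * L * \<tau>)" using vw unfolding f_def[symmetric] by (intro mult_left_mono) auto
    finally show "l2 (\<lambda>x. mol r f x - f x) \<le> r\<^sup>2 * (10 * L * \<tau>)" .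
  qed (use L in auto)
  also have "measure lborel ?b = pi * r\<^sup>2" using content_cball[of r x0] r by (simp add: unit_ball_vol_2)
  finally have "\<mu>\<^sup>2 * (pi * r\<^sup>2) \<le> 4 * (\<tau> * r\<^sup>2) + 4 * (\<tau>\<^sup>2 * r\<^sup>2 * L) + 32 * L * \<tau>\<^sup>2 * (pi * r\<^sup>2) + 4 * (r\<^sup>2 * (10 * L * \<tau>))"
    using content_cball[of r x0] r by (simp add: unit_ball_vol_2)
  also have "\<dots> = r\<^sup>2 * (4 * \<tau> + 4 * (L * \<tau>\<^sup>2) + 32 * pi * (L * \<tau>\<^sup>2) + 40 * (L * \<tau>))" by (simp add: algebra_simps)
  also have "\<dots> \<le> r\<^sup>2 * (4 * (L * \<tau>) + 4 * (L * \<tau>) + 32 * 4 * (L * \<tau>) + 40 * (L * \<tau>))"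
  proof -
    have "0 \<le> L * \<tau>\<^sup>2" "\<tau> \<le> L * \<tau>" using L \<tau> by (auto simp: mult_le_cancel_right1)
    then show ?thesis using L\<tau> L \<tau> pi_less_4 by (intro mult_left_mono add_mono mult_mono) auto
  qed
  also have "\<dots> = r\<^sup>2 * (176 * (L * \<tau>))" by simp
  finally have "200 * L * \<tau> * (pi * r\<^sup>2) \<le> r\<^sup>2 * (176 * (L * \<tau>))" using \<mu>(2) by simp
  moreover have "r\<^sup>2 * (176 * (L * \<tau>)) < 200 * L * \<tau> * (pi * r\<^sup>2)"
  proof -
    have p: "L * \<tau> * r\<^sup>2 > 0" using L \<tau> r by (intro mult_pos_pos) auto
    have "176 * (L * \<tau> * r\<^sup>2) < (200 * pi) * (L * \<tau> * r\<^sup>2)" using p pi_gt3 by (intro mult_strict_right_mono) auto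
    then show ?thesis by (simp add: mult_ac)
  qed
  ultimately show False by linarith
qed

section \<open>Comparing fluxes and near-integrality\<close>

text \<open>Up to the Jacobian of \<psi> and q = cr W (U - W), which integrates to 0, the difference
  of the integrands contains U - W undifferentiated. Hence closeness of \<open>U\<close> and
  \<open>W\<close> in L2 suffices although their gradients need not be close; \<open>t\<close> is
  the parameter of Young's inequality.\<close>

lemma bform_diff_integral:
  fixes U W :: "real^2 \<Rightarrow> complex"
  assumes \<psi>: "C1c \<psi>" and U: "C1c U" and W: "C1c W" and P: "\<And>x i. \<bar>pd i \<psi> x\<bar> \<le> P" and t: "t > 0"
  shows "\<bar>(\<integral>x. bform \<psi> U x \<partial>lborel) - (\<integral>x. bform \<psi> W x \<partial>lborel)\<bar> \<le> P * (2 / t * l2 (\<lambda>x. W x - U x) + t / 2 * (dir U + dir W))"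
proof -
  have P0: "P \<ge> 0" using P[of 1 0] by linarith
  define q where "q x = cr (W x) (U x - W x)" for x
  have CUW: "C1c (\<lambda>x. U x - W x)" by (rule C1c_diff_fun[OF U W])
  have Cq: "C1c q" unfolding q_def[abs_def]
    by (rule C1c_bilinear[OF bounded_bilinear_cr C1c_C1[OF W] C1c_C1[OF CUW]]) (use W in simp)
  have pq: "pd i q x = cr (W x) (pd i U x - pd i W x) + cr (pd i W x) (U x - W x)" for i x
    unfolding q_def[abs_def] using C1_bounded_bilinear(2)[OF bounded_bilinear_cr C1c_C1[OF W] C1c_C1[OF CUW]]
      C1_diff_fun(2)[OF C1c_C1[OF U] C1c_C1[OF W]] by simp
  have J: "(\<integral>x. pd 1 \<psi> x *\<^sub>R pd 2 q x - pd 2 \<psi> x *\<^sub>R pd 1 q x \<partial>lborel) = 0"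
    by (rule integral_jacobian_zero[OF C1c_C1[OF \<psi>] Cq])
  define E where "E x = pd 1 \<psi> x * cr (U x - W x) (pd 2 U x + pd 2 W x) - pd 2 \<psi> x * cr (U x - W x) (pd 1 U x + pd 1 W x)" for x
  have eq: "bform \<psi> U x - bform \<psi> W x = E x + (pd 1 \<psi> x *\<^sub>R pd 2 q x - pd 2 \<psi> x *\<^sub>R pd 1 q x)" for x
    by (simp add: bform_def E_def pq cr_def algebra_simps)
  have iB: "integrable lborel (bform \<psi> U)" "integrable lborel (bform \<psi> W)"
    by (intro CC_integrable bform_CC \<psi> C1c_C1 U W)+
  have iJ: "integrable lborel (\<lambda>x. pd 1 \<psi> x *\<^sub>R pd 2 q x - pd 2 \<psi> x *\<^sub>R pd 1 q x)"
  proof (rule CC_integrable)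
    have "bounded {x. q x \<noteq> 0}" using Cq by (simp add: C1c_def)
    obtain R where R: "R > 0" "\<And>x. norm x \<ge> R \<Longrightarrow> q x = 0" "\<And>x i. norm x \<ge> R \<Longrightarrow> pd i q x = 0"
      by (rule C1c_ball[OF Cq]) blast
    have "{x. pd 1 \<psi> x *\<^sub>R pd 2 q x - pd 2 \<psi> x *\<^sub>R pd 1 q x \<noteq> 0} \<subseteq> cball 0 R"
    proof
      fix x assume "x \<in> {x. pd 1 \<psi> x *\<^sub>R pd 2 q x - pd 2 \<psi> x *\<^sub>R pd 1 q x \<noteq> 0}"
      then have "\<not> R \<le> norm x" using R(3)[of x] by auto
      then show "x \<in> cball 0 R" by simp
    qed
    then show "CC (\<lambda>x. pd 1 \<psi> x *\<^sub>R pd 2 q x - pd 2 \<psi> x *\<^sub>R pd 1 q x)"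
      unfolding CC_def using bounded_subset[OF bounded_cball]
      by (auto intro!: continuous_intros C1_cont_pd C1c_C1 \<psi> Cq)
  qed
  have iE: "integrable lborel E"
  proof -
    have "E = (\<lambda>x. bform \<psi> U x - bform \<psi> W x - (pd 1 \<psi> x *\<^sub>R pd 2 q x - pd 2 \<psi> x *\<^sub>R pd 1 q x))" using eq by (simp add: fun_eq_iff)
    then show ?thesis using iB iJ by simp
  qed
  have "(\<integral>x. bform \<psi> U x \<partial>lborel) - (\<integral>x. bform \<psi> W x \<partial>lborel) = (\<integral>x. E x + (pd 1 \<psi> x *\<^sub>R pd 2 q x - pd 2 \<psi> x *\<^sub>R pd 1 q x) \<partial>lborel)"
    unfolding eq[symmetric] using iB by simp
  also have "\<dots> = (\<integral>x. E x \<partial>lborel)"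
    using Bochner_Integration.integral_add[OF iE iJ] J by (simp only: add_0_right)
  finally have main: "(\<integral>x. bform \<psi> U x \<partial>lborel) - (\<integral>x. bform \<psi> W x \<partial>lborel) = (\<integral>x. E x \<partial>lborel)" .
  define Q where "Q x = P * (2 / t * (norm (W x - U x))\<^sup>2 + t / 2 * (gsq U x + gsq W x))" for x
  have iQ: "integrable lborel Q" unfolding Q_def[abs_def]
    by (intro integrable_mult_right Bochner_Integration.integrable_add gsq_integrable U W
        CC_integrable[OF CC_norm_sq] C1c_CC C1c_diff_fun)
  have EQ: "\<bar>E x\<bar> \<le> Q x" for x
  proof -
    have tr: "\<bar>cr (U x - W x) (a + b)\<bar> \<le> norm (W x - U x) * norm a + norm (W x - U x) * norm b" for a b
      using cr_abs_le[of "U x - W x" "a + b"] norm_triangle_ineq[of a b]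
        mult_left_mono[OF norm_triangle_ineq[of a b], of "norm (W x - U x)"]
      by (simp add: norm_minus_commute distrib_left)
    have am: "a * b \<le> a\<^sup>2 / (2 * t) + t / 2 * b\<^sup>2" for a b :: real
    proof -
      have "0 \<le> (a - t * b)\<^sup>2 / (2 * t)" using t by simp
      also have "\<dots> = a\<^sup>2 / (2 * t) + t / 2 * b\<^sup>2 - a * b" using t by (simp add: power2_eq_square field_simps)
      finally show ?thesis by simp
    qed
    let ?n = "norm (W x - U x)"
    have "\<bar>E x\<bar> \<le> \<bar>pd 1 \<psi> x\<bar> * \<bar>cr (U x - W x) (pd 2 U x + pd 2 W x)\<bar> + \<bar>pd 2 \<psi> x\<bar> * \<bar>cr (U x - W x) (pd 1 U x + pd 1 W x)\<bar>"
      unfolding E_def by (rule order_trans[OF abs_triangle_ineq4]) (simp add: abs_mult)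
    also have "\<dots> \<le> P * (?n * norm (pd 2 U x) + ?n * norm (pd 2 W x)) + P * (?n * norm (pd 1 U x) + ?n * norm (pd 1 W x))"
      using P0 by (intro add_mono mult_mono P tr) auto
    also have "\<dots> = P * (?n * norm (pd 2 U x) + ?n * norm (pd 2 W x) + (?n * norm (pd 1 U x) + ?n * norm (pd 1 W x)))"
      by (simp add: distrib_left)
    also have "\<dots> \<le> P * (((?n\<^sup>2 / (2 * t) + t / 2 * (norm (pd 2 U x))\<^sup>2) + (?n\<^sup>2 / (2 * t) + t / 2 * (norm (pd 2 W x))\<^sup>2))
        + ((?n\<^sup>2 / (2 * t) + t / 2 * (norm (pd 1 U x))\<^sup>2) + (?n\<^sup>2 / (2 * t) + t / 2 * (norm (pd 1 W x))\<^sup>2)))"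
      using P0 by (intro mult_left_mono add_mono am)
    also have "\<dots> = Q x" by (simp add: Q_def gsq_def algebra_simps add_divide_distrib)
    finally show ?thesis .
  qed
  have "\<bar>\<integral>x. E x \<partial>lborel\<bar> \<le> (\<integral>x. \<bar>E x\<bar> \<partial>lborel)" by (rule integral_abs_bound)
  also have "\<dots> \<le> (\<integral>x. Q x \<partial>lborel)" by (rule integral_mono[OF integrable_abs[OF iE] iQ EQ])
  also have "\<dots> = P * (2 / t * l2 (\<lambda>x. W x - U x) + t / 2 * (dir U + dir W))"
  proof -
    have i: "integrable lborel (\<lambda>x. (norm (W x - U x))\<^sup>2)"
      by (intro CC_integrable[OF CC_norm_sq] C1c_CC C1c_diff_fun U W)
    show ?thesis unfolding Q_def l2_def dir_def using i gsq_integrable[OF U] gsq_integrable[OF W] by simp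
  qed
  finally show ?thesis unfolding main .
qed

lemma jint_bform:
  assumes "W x \<noteq> 0" shows "jint \<psi> W x = bform \<psi> W x / (norm (W x))\<^sup>2"
proof -
  have "Im (z / W x) = cr (W x) z / (norm (W x))\<^sup>2" for z
    using complex_div_cnj[of z "W x"] by (simp add: cr_def mult.commute Im_divide_of_real del: Im_complex_div_gt_0 flip: of_real_power)
  then show ?thesis by (simp add: jint_def bform_def diff_divide_distrib)
qed

text \<open>The integrands differ by the relative factor (n^2 - 1) / n^2 with n = |W|. On
  \<open>K\<close> the numerator is at most 5/2 * \<kappa>, since n <= 3/2; one factor
  \<open>n\<close> cancels against \<open>bform\<close> and the other costs 2, as n >= 1/2.\<close>

lemma bform_normalize:
  fixes W :: "real^2 \<Rightarrow> complex"
  assumes \<psi>: "C1c \<psi>" and W: "C1c W" and P: "\<And>x i. \<bar>pd i \<psi> x\<bar> \<le> P" and K: "compact K"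
    and off: "\<And>x i. x \<notin> K \<Longrightarrow> pd i \<psi> x = 0" and \<kappa>: "\<kappa> \<le> 1/2" "\<And>x. x \<in> K \<Longrightarrow> \<bar>1 - norm (W x)\<bar> \<le> \<kappa>" "\<kappa> \<ge> 0"
  shows "\<bar>(\<integral>x. bform \<psi> W x \<partial>lborel) - (\<integral>x. jint \<psi> W x \<partial>lborel)\<bar> \<le> 5 * \<kappa> * P * (measure lborel K + dir W)"
proof -
  have P0: "P \<ge> 0" using P[of 1 0] by linarith
  have nz: "W x \<noteq> 0" "norm (W x) \<ge> 1/2" "norm (W x) \<le> 3/2" if "x \<in> K" for x
    using \<kappa>(1) \<kappa>(2)[OF that] by (auto simp: abs_le_iff)
  have iB: "integrable lborel (bform \<psi> W)" by (intro CC_integrable bform_CC \<psi> C1c_C1 W)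
  have Bz: "bform \<psi> W x = 0" "jint \<psi> W x = 0" if "x \<notin> K" for x using off[OF that] by (simp_all add: bform_def jint_def)
  have iJ: "integrable lborel (jint \<psi> W)"
  proof -
    have "integrable lborel (\<lambda>x. indicator K x *\<^sub>R jint \<psi> W x)"
    proof (rule borel_integrable_compact[OF K])
      show "continuous_on K (jint \<psi> W)"
        unfolding jint_def[abs_def] using nz(1)
        by (intro continuous_intros C1_cont_pd C1_cont C1c_C1 \<psi> W) auto
    qed
    moreover have "(\<lambda>x. indicator K x *\<^sub>R jint \<psi> W x) = jint \<psi> W" using Bz by (auto simp: fun_eq_iff indicator_def)
    ultimately show ?thesis by simp
  qed
  have bK: "bounded K" "K \<in> sets borel" using compact_imp_bounded[OF K] compact_imp_closed[OF K] by auto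
  have iK: "integrable lborel (indicat_real K)" by (rule integrable_indicator_bounded[OF bK(2,1)])
  define Q where "Q x = 5 * \<kappa> * P * (indicat_real K x + gsq W x)" for x
  have iQ: "integrable lborel Q" unfolding Q_def[abs_def]
    by (intro integrable_mult_right Bochner_Integration.integrable_add iK gsq_integrable W)
  have pt: "\<bar>bform \<psi> W x - jint \<psi> W x\<bar> \<le> Q x" for x
  proof (cases "x \<in> K")
    case False
    then show ?thesis using Bz[OF False] P0 \<kappa> gsq_nonneg[of W x] by (simp add: Q_def)
  next
    case True
    let ?n = "norm (W x)" and ?a = "norm (pd 1 W x)" and ?b = "norm (pd 2 W x)"
    note n = nz[OF True]
    have "\<bar>bform \<psi> W x\<bar> \<le> \<bar>pd 1 \<psi> x\<bar> * \<bar>cr (W x) (pd 2 W x)\<bar> + \<bar>pd 2 \<psi> x\<bar> * \<bar>cr (W x) (pd 1 W x)\<bar>"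
      unfolding bform_def by (rule order_trans[OF abs_triangle_ineq4]) (simp add: abs_mult)
    also have "\<dots> \<le> P * (?n * ?b) + P * (?n * ?a)" using P0 by (intro add_mono mult_mono P cr_abs_le) auto
    finally have b: "\<bar>bform \<psi> W x\<bar> \<le> P * ?n * (?a + ?b)" by (simp add: algebra_simps)
    have "bform \<psi> W x - jint \<psi> W x = bform \<psi> W x * ((?n\<^sup>2 - 1) / ?n\<^sup>2)"
      using n by (simp add: jint_bform diff_divide_distrib right_diff_distrib)
    then have "\<bar>bform \<psi> W x - jint \<psi> W x\<bar> = \<bar>bform \<psi> W x\<bar> * (\<bar>?n\<^sup>2 - 1\<bar> / ?n\<^sup>2)" by (simp add: abs_mult)
    also have "\<dots> \<le> (P * ?n * (?a + ?b)) * ((\<kappa> * (5/2)) / ?n\<^sup>2)"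
    proof (intro mult_mono b divide_right_mono)
      have "?n\<^sup>2 - 1 = - ((1 - ?n) * (?n + 1))" by (simp add: power2_eq_square algebra_simps)
      then have "\<bar>?n\<^sup>2 - 1\<bar> = \<bar>1 - ?n\<bar> * \<bar>?n + 1\<bar>" by (simp only: abs_minus_cancel abs_mult)
      also have "\<dots> \<le> \<kappa> * (5/2)" using n \<kappa>(3) \<kappa>(2)[OF True] by (intro mult_mono) auto
      finally show "\<bar>?n\<^sup>2 - 1\<bar> \<le> \<kappa> * (5/2)" .
    qed (use P0 n in auto)
    also have "\<dots> = (5/2 * \<kappa> * P * (?a + ?b)) * (1 / ?n)" using n by (simp add: power2_eq_square field_simps)
    also have "\<dots> \<le> (5/2 * \<kappa> * P * (?a + ?b)) * 2"
      using n P0 \<kappa>(3) by (intro mult_left_mono) (auto simp: field_simps)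
    also have "\<dots> = (5 * \<kappa> * P) * (?a + ?b)" by simp
    also have "\<dots> \<le> (5 * \<kappa> * P) * (1 + gsq W x)"
    proof (rule mult_left_mono)
      have "0 \<le> (?a - 1/2)\<^sup>2 + (?b - 1/2)\<^sup>2" by simp
      also have "\<dots> = gsq W x - (?a + ?b) + 1/2" by (simp add: gsq_def power2_eq_square algebra_simps)
      finally show "?a + ?b \<le> 1 + gsq W x" by simp
    qed (use P0 \<kappa>(3) in simp)
    finally show ?thesis using True by (simp add: Q_def)
  qed
  have "\<bar>(\<integral>x. bform \<psi> W x \<partial>lborel) - (\<integral>x. jint \<psi> W x \<partial>lborel)\<bar> = \<bar>\<integral>x. bform \<psi> W x - jint \<psi> W x \<partial>lborel\<bar>"
    using iB iJ by simp
  also have "\<dots> \<le> (\<integral>x. \<bar>bform \<psi> W x - jint \<psi> W x\<bar> \<partial>lborel)" by (rule integral_abs_bound)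
  also have "\<dots> \<le> (\<integral>x. Q x \<partial>lborel)"
    by (rule integral_mono[OF integrable_abs[OF Bochner_Integration.integrable_diff[OF iB iJ]] iQ pt])
  also have "\<dots> = 5 * \<kappa> * P * (measure lborel K + dir W)"
    unfolding Q_def using iK gsq_integrable[OF W] bK by (simp add: dir_def)
  finally show ?thesis .
qed

text \<open>Half of \<eta> pays for replacing \<open>U\<close> by the mollified map
  \<open>W\<close>, the other half for normalizing \<open>W\<close>; for the normalized map the flux
  is exactly an integer multiple of 2\<pi>. All constants are fixed before \<open>U\<close>,
  although the selected scale depends on \<open>U\<close>.\<close>

lemma near_integer_flux:
  fixes \<psi> :: "real^2 \<Rightarrow> real"
  assumes \<psi>: "C1c \<psi>" and K: "compact K"
    and off: "\<And>x. x \<notin> K \<Longrightarrow> \<psi> x \<in> \<int>" "\<And>x i. x \<notin> K \<Longrightarrow> pd i \<psi> x = 0"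
    and pos: "\<rho> > 0" "\<Lambda> > 0" "\<eta> > 0"
  shows "\<exists>\<sigma>>0. \<forall>U::real^2 \<Rightarrow> complex. C1c U \<and> dir U \<le> \<Lambda> \<and>
     (\<integral>x. indicator (nbhd K \<rho>) x * (1 - norm (U x))\<^sup>2 \<partial>lborel) \<le> \<sigma> \<longrightarrow>
     (\<exists>k::int. \<bar>(\<integral>x. bform \<psi> U x \<partial>lborel) - 2 * pi * of_int k\<bar> \<le> \<eta>)"
proof -
  obtain P1 where P1: "P1 > 0" "\<And>x. norm (pd 1 \<psi> x) \<le> P1" by (rule CC_bound[OF C1c_pd_CC[OF \<psi>, of 1]]) blast
  obtain P2 where P2: "P2 > 0" "\<And>x. norm (pd 2 \<psi> x) \<le> P2" by (rule CC_bound[OF C1c_pd_CC[OF \<psi>, of 2]]) blast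
  define P where "P = P1 + P2"
  have P: "P > 0" "\<And>x i. \<bar>pd i \<psi> x\<bar> \<le> P"
  proof -
    show "P > 0" using P1 P2 by (simp add: P_def)
    show "\<bar>pd i \<psi> x\<bar> \<le> P" for x i using P1(1) P2(1) P1(2)[of x] P2(2)[of x] exhaust_2[of i] by (auto simp: P_def)
  qed
  define L where "L = \<Lambda> + 1"
  have L: "L \<ge> 1" "L > 0" using pos by (simp_all add: L_def)
  define c1 where "c1 = 5 * P * (measure lborel K + L)"
  have c1: "c1 > 0" using P(1) L by (simp add: c1_def add_nonneg_pos)
  define \<kappa> where "\<kappa> = min (1/2) (\<eta> / (2 * c1))"
  have \<kappa>: "\<kappa> > 0" "\<kappa> \<le> 1/2" "c1 * \<kappa> \<le> \<eta> / 2"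
  proof -
    show "\<kappa> > 0" "\<kappa> \<le> 1/2" using c1 pos by (auto simp: \<kappa>_def)
    have "c1 * \<kappa> \<le> c1 * (\<eta> / (2 * c1))" using c1 by (intro mult_left_mono) (auto simp: \<kappa>_def)
    then show "c1 * \<kappa> \<le> \<eta> / 2" using c1 by simp
  qed
  \<comment> \<open>The second entry gives 2 * sqrt (200 * L * \<tau>) <= \<kappa>, as
    \<open>mollified_modulus\<close> requires. The third gives 9 * P * L * \<tau> <= \<eta> / 2,
    where 9 = 8 + 1 collects the two terms of \<open>bform_diff_integral\<close> at t =
    \<tau>.\<close>
  define ds where "ds = {1/2, \<kappa>\<^sup>2 / (800 * L), \<eta> / (18 * P * L)}"
  define \<tau> where "\<tau> = Min ds"
  have fds: "finite ds" "ds \<noteq> {}" by (simp_all add: ds_def)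
  have "\<forall>x\<in>ds. 0 < x" using \<kappa>(1) L P(1) pos unfolding ds_def by simp
  then have \<tau>0: "\<tau> > 0" unfolding \<tau>_def using fds by (simp add: Min_gr_iff)
  have tle: "\<tau> \<le> x" if "x \<in> ds" for x unfolding \<tau>_def using fds(1) that by (rule Min_le)
  have \<tau>: "\<tau> \<le> 1/2" "\<tau> \<le> \<kappa>\<^sup>2 / (800 * L)" "\<tau> \<le> \<eta> / (18 * P * L)" by (rule tle, simp add: ds_def)+
  have \<tau>1: "\<tau> < 1" using \<tau>(1) by simp
  have k2: "2 * sqrt (200 * L * \<tau>) \<le> \<kappa>"
  proof -
    have "200 * L * \<tau> \<le> 200 * L * (\<kappa>\<^sup>2 / (800 * L))" using \<tau>(2) L by (intro mult_left_mono) auto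
    also have "\<dots> = (\<kappa> / 2)\<^sup>2" using L by (simp add: power_divide)
    finally have "sqrt (200 * L * \<tau>) \<le> \<kappa> / 2" using \<kappa>(1) by (intro real_le_lsqrt) (use L \<tau>0 in auto)
    then show ?thesis by simp
  qed
  have e9: "9 * P * L * \<tau> \<le> \<eta> / 2"
  proof -
    have "9 * P * L * \<tau> \<le> 9 * P * L * (\<eta> / (18 * P * L))" using \<tau>(3) P(1) L by (intro mult_left_mono) auto
    then show ?thesis using P(1) L by simp
  qed
  define h0 where "h0 = min 1 \<rho>"
  have h0: "h0 > 0" "h0 \<le> 1" "h0 \<le> \<rho>" using pos by (auto simp: h0_def)
  obtain N :: nat where N: "\<Lambda> / \<tau> < real N" using reals_Archimedean2 by blast
  then have N': "\<Lambda> < real N * \<tau>" using \<tau>0 by (simp add: field_simps)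
  \<comment> \<open>Built from a lower bound for the radii of all candidate scales, so that \<sigma>
    <= \<tau> * r^2 whichever index is selected.\<close>
  define \<sigma> where "\<sigma> = \<tau> * (\<tau>\<^sup>2 * (h0 * \<tau>^(3*N)))\<^sup>2"
  have \<sigma>: "\<sigma> > 0" using \<tau>0 h0 by (simp add: \<sigma>_def)
  show ?thesis
  proof (intro exI[of _ \<sigma>] conjI \<sigma> allI impI)
    fix U :: "real^2 \<Rightarrow> complex"
    assume "C1c U \<and> dir U \<le> \<Lambda> \<and> (\<integral>x. indicator (nbhd K \<rho>) x * (1 - norm (U x))\<^sup>2 \<partial>lborel) \<le> \<sigma>"
    then have U: "C1c U" "dir U \<le> \<Lambda>" "(\<integral>x. indicator (nbhd K \<rho>) x * (1 - norm (U x))\<^sup>2 \<partial>lborel) \<le> \<sigma>" by auto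
    from scale_selection[OF U(1,2) \<tau>0 \<tau>1 h0(1) N'] obtain i v w where i: "i < N" and v: "C1c v" and w: "C1c w"
      and dv: "dir v \<le> \<Lambda> + 1" and vU: "l2 (\<lambda>x. v x - U x) \<le> (h0 * \<tau>^(3 * Suc i))\<^sup>2 * (\<Lambda> + 1)"
      and vw: "dir (\<lambda>x. v x - w x) \<le> 10 * (\<Lambda> + 1) * \<tau>"
      and gw: "\<And>x. gsq w x \<le> 8 / (\<tau> * (h0 * \<tau>^(3 * i)))\<^sup>2 * (\<Lambda> + 1)" by blast
    define h where "h = h0 * \<tau>^(3*i)"
    \<comment> \<open>A factor \<tau> above the finer scale, at which \<open>v\<close> is close to
      \<open>U\<close>, and a factor \<tau> below \<tau> * h, the scale at which \<open>w\<close> is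
      smooth.\<close>
    define r where "r = \<tau>\<^sup>2 * h"
    have h: "h > 0" "h \<le> h0"
    proof -
      show "h > 0" using h0 \<tau>0 by (simp add: h_def)
      have "h0 * \<tau>^(3*i) \<le> h0 * 1" using h0 \<tau>0 \<tau>1 by (intro mult_left_mono power_le_one) auto
      then show "h \<le> h0" by (simp add: h_def)
    qed
    have t2: "\<tau>\<^sup>2 \<le> 1" using \<tau>0 \<tau>1 by (simp add: power_le_one)
    have r: "r > 0" "r \<le> \<rho>" "r \<le> \<tau>\<^sup>2"
    proof -
      show "r > 0" using h \<tau>0 by (simp add: r_def)
      have "r \<le> 1 * h" unfolding r_def using h t2 by (intro mult_right_mono) auto
      then show "r \<le> \<rho>" using h h0 by linarith
      have "r \<le> \<tau>\<^sup>2 * 1" unfolding r_def using h h0 by (intro mult_left_mono) auto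
      then show "r \<le> \<tau>\<^sup>2" by simp
    qed
    have hS: "h0 * \<tau>^(3 * Suc i) = \<tau> * r" by (simp add: r_def h_def power_add power2_eq_square power3_eq_cube)
    have vU': "l2 (\<lambda>x. v x - U x) \<le> \<tau>\<^sup>2 * r\<^sup>2 * L"
      using vU unfolding hS L_def by (simp add: power_mult_distrib)
    have gw': "gsq w x \<le> 8 * L * \<tau>\<^sup>2 / r\<^sup>2" for x
    proof -
      have "8 / (\<tau> * h)\<^sup>2 * L = 8 * L * \<tau>\<^sup>2 / r\<^sup>2" using \<tau>0 h(1) by (simp add: r_def field_simps power2_eq_square)
      then show ?thesis using gw[of x] unfolding h_def L_def by simp
    qed
    have \<sigma>r: "\<sigma> \<le> \<tau> * r\<^sup>2"
    proof -
      have "\<tau>^(3*N) \<le> \<tau>^(3*i)" using i \<tau>0 \<tau>1 by (intro power_decreasing) auto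
      then have "\<tau>\<^sup>2 * (h0 * \<tau>^(3*N)) \<le> r" unfolding r_def h_def using h0 by (intro mult_left_mono) auto
      then have "(\<tau>\<^sup>2 * (h0 * \<tau>^(3*N)))\<^sup>2 \<le> r\<^sup>2" using h0 \<tau>0 by (intro power_mono) auto
      then show ?thesis unfolding \<sigma>_def using \<tau>0 by (intro mult_left_mono) auto
    qed
    define W where "W = mol r v"
    have W: "C1c W" unfolding W_def by (rule mol_C1c[OF r(1) CC_L2b[OF C1c_CC[OF v]]])
    have mod: "\<bar>1 - norm (W x)\<bar> \<le> \<kappa>" if "x \<in> K" for x
    proof -
      have "\<bar>1 - norm (W x)\<bar> \<le> 2 * sqrt (200 * L * \<tau>)"
        unfolding W_def
      proof (rule mollified_modulus[OF U(1) v w r(1) L(1) \<tau>0 \<tau>1 vU' _ gw' nbhd_compact[OF K]])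
        show "dir (\<lambda>x. v x - w x) \<le> 10 * L * \<tau>" using vw by (simp add: L_def)
        show "cball x r \<subseteq> nbhd K \<rho>" using that r(2) by (force simp: nbhd_def)
        show "(\<integral>x. indicator (nbhd K \<rho>) x * (1 - norm (U x))\<^sup>2 \<partial>lborel) \<le> \<tau> * r\<^sup>2" using U(3) \<sigma>r by simp
      qed
      then show ?thesis using k2 by linarith
    qed
    have W0: "W x \<noteq> 0" if "x \<in> K" for x using mod[OF that] \<kappa>(2) by auto
    obtain k :: int where k: "(\<integral>x. jint \<psi> W x \<partial>lborel) = 2 * pi * of_int k"
      using degree_integrality[OF \<psi> C1c_C1[OF W] K W0 off] by blast
    have dW: "dir W \<le> L" using mol_dir[OF r(1) v] dv unfolding W_def L_def by linarith
    have lW: "l2 (\<lambda>x. W x - U x) \<le> 4 * L * \<tau>\<^sup>2"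
    proof -
      have "l2 (\<lambda>x. (W x - v x) + (v x - U x)) \<le> 2 * l2 (\<lambda>x. W x - v x) + 2 * l2 (\<lambda>x. v x - U x)"
        by (intro L2b_add CC_L2b C1c_CC C1c_diff_fun W v U)
      also have "\<dots> \<le> 2 * (r\<^sup>2 * L) + 2 * (\<tau>\<^sup>2 * r\<^sup>2 * L)"
      proof (intro add_mono mult_left_mono vU')
        have "l2 (\<lambda>x. W x - v x) \<le> r\<^sup>2 * dir v" unfolding W_def by (rule mol_approx[OF r(1) v])
        also have "\<dots> \<le> r\<^sup>2 * L" using dv by (intro mult_left_mono) (auto simp: L_def)
        finally show "l2 (\<lambda>x. W x - v x) \<le> r\<^sup>2 * L" .
      qed auto
      also have "\<dots> \<le> 2 * (\<tau>\<^sup>2 * L) + 2 * (1 * \<tau>\<^sup>2 * L)"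
      proof -
        have "r\<^sup>2 \<le> r * 1" unfolding power2_eq_square using r t2 by (intro mult_left_mono) auto
        then have "r\<^sup>2 \<le> \<tau>\<^sup>2" using r by simp
        then show ?thesis using t2 L by (intro add_mono mult_left_mono mult_right_mono mult_mono) auto
      qed
      finally show ?thesis by (simp add: mult_ac)
    qed
    have "\<bar>(\<integral>x. bform \<psi> U x \<partial>lborel) - (\<integral>x. bform \<psi> W x \<partial>lborel)\<bar> \<le> P * (2 / \<tau> * l2 (\<lambda>x. W x - U x) + \<tau> / 2 * (dir U + dir W))"
      by (rule bform_diff_integral[OF \<psi> U(1) W P(2) \<tau>0])
    also have "\<dots> \<le> P * (2 / \<tau> * (4 * L * \<tau>\<^sup>2) + \<tau> / 2 * (L + L))"
      using P(1) \<tau>0 lW dW U(2) by (intro mult_left_mono add_mono) (auto simp: L_def)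
    also have "\<dots> = 9 * P * L * \<tau>" using \<tau>0 by (simp add: power2_eq_square algebra_simps)
    finally have 1: "\<bar>(\<integral>x. bform \<psi> U x \<partial>lborel) - (\<integral>x. bform \<psi> W x \<partial>lborel)\<bar> \<le> \<eta> / 2" using e9 by linarith
    have "\<bar>(\<integral>x. bform \<psi> W x \<partial>lborel) - (\<integral>x. jint \<psi> W x \<partial>lborel)\<bar> \<le> 5 * \<kappa> * P * (measure lborel K + dir W)"
      by (rule bform_normalize[OF \<psi> W P(2) K off(2) \<kappa>(2) mod]) (use \<kappa>(1) in auto)
    also have "\<dots> \<le> 5 * \<kappa> * P * (measure lborel K + L)" using dW \<kappa>(1) P(1) by (intro mult_left_mono) auto
    also have "\<dots> = c1 * \<kappa>" by (simp add: c1_def)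
    finally have 2: "\<bar>(\<integral>x. bform \<psi> W x \<partial>lborel) - (\<integral>x. jint \<psi> W x \<partial>lborel)\<bar> \<le> \<eta> / 2" using \<kappa>(3) by linarith
    show "\<exists>k::int. \<bar>(\<integral>x. bform \<psi> U x \<partial>lborel) - 2 * pi * of_int k\<bar> \<le> \<eta>"
      by (rule exI[of _ k]) (use 1 2 k in linarith)
  qed
qed

section \<open>The potential and its truncations\<close>

lemma line_deriv:
  fixes f :: "real^2 \<Rightarrow> real"
  assumes "(f has_derivative D) (at (p + t *\<^sub>R axis i 1))"
  shows "((\<lambda>t. f (p + t *\<^sub>R axis i 1)) has_real_derivative D (axis i 1)) (at t)"
proof -
  have l: "((\<lambda>t. p + t *\<^sub>R axis i (1::real)) has_derivative (\<lambda>s. s *\<^sub>R axis i 1)) (at t)"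
    by (auto intro!: derivative_eq_intros)
  have "((\<lambda>t. f (p + t *\<^sub>R axis i 1)) has_derivative (\<lambda>s. D (s *\<^sub>R axis i 1))) (at t)"
    using has_derivative_compose[OF l assms] .
  moreover have "D (s *\<^sub>R axis i 1) = s * D (axis i 1)" for s
    using linear_scale[OF has_derivative_linear[OF assms], of s "axis i 1"] by simp
  ultimately show ?thesis by (simp add: has_field_derivative_def mult.commute[of _ "D _"])
qed

text \<open>At the maximum g' vanishes, and its positive derivative makes it positive just to the
  right; by the mean value theorem \<open>g\<close> then rises above g 0.\<close>

lemma not_local_max_if_second_deriv_pos:
  fixes g g' :: "real \<Rightarrow> real"
  assumes "d > 0" "\<And>t. \<bar>t\<bar> < d \<Longrightarrow> (g has_real_derivative g' t) (at t)"
    and "(g' has_real_derivative c) (at 0)" "c > 0" "\<And>t. \<bar>t\<bar> < d \<Longrightarrow> g t \<le> g 0"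
  shows False
proof -
  have g0: "g' 0 = 0"
    by (rule DERIV_local_max[of g "g' 0" 0 d]) (use assms in auto)
  obtain e where e: "e > 0" "\<And>h. 0 < h \<Longrightarrow> h < e \<Longrightarrow> g' 0 < g' (0 + h)"
    using DERIV_pos_inc_right[OF assms(3,4)] by blast
  define s where "s = min d e / 2"
  have s: "0 < s" "s < d" "s < e" using assms(1) e(1) by (auto simp: s_def)
  have "\<exists>z. 0 < z \<and> z < s \<and> g s - g 0 = (s - 0) * g' z"
    by (rule MVT2[OF s(1)]) (use assms(2) s in auto)
  then obtain z where z: "0 < z" "z < s" "g s - g 0 = s * g' z" by auto
  have "g' z > 0" using e(2)[of z] z s g0 by simp
  then have "s * g' z > 0" using s by simp
  then show False using z(3) assms(5)[of s] s by simp
qed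

text \<open>Adding \<eta> |y|^2 raises the Laplacian to 4 * \<eta>. If the perturbed function had
  its maximum inside, one of the two pure second derivatives there would be positive. First
  derivatives enter as explicit functions, so that the statement applies to \<open>V\<close> and to
  its negative alike.\<close>

lemma weak_maximum_principle:
  fixes V V1 V2 :: "real^2 \<Rightarrow> real"
  assumes A: "open A" "bounded A" and cont: "continuous_on (closure A) V"
    and d: "\<And>x. x \<in> A \<Longrightarrow> (V has_derivative (\<lambda>v. v$1 * V1 x + v$2 * V2 x)) (at x)"
    and d1: "\<And>x. x \<in> A \<Longrightarrow> (V1 has_derivative D1 x) (at x)" and d2: "\<And>x. x \<in> A \<Longrightarrow> (V2 has_derivative D2 x) (at x)"
    and lap: "\<And>x. x \<in> A \<Longrightarrow> D1 x (axis 1 1) + D2 x (axis 2 1) = 0"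
    and bd: "\<And>x. x \<in> closure A \<Longrightarrow> x \<notin> A \<Longrightarrow> V x \<le> c" and x: "x \<in> A"
  shows "V x \<le> c"
proof (rule ccontr)
  assume "\<not> V x \<le> c"
  then have gt: "V x > c" by simp
  obtain B where B: "B > 0" "\<And>y. y \<in> closure A \<Longrightarrow> norm y \<le> B"
    using bounded_closure[OF A(2)] unfolding bounded_pos by blast
  \<comment> \<open>Half of the admissible size: the perturbation on the closure is at most half of
    V x - c, so boundary points stay below the value at \<open>x\<close>.\<close>
  define \<eta> where "\<eta> = (V x - c) / (2 * B\<^sup>2)"
  have \<eta>: "\<eta> > 0" "\<eta> * B\<^sup>2 < V x - c" using gt B by (auto simp: \<eta>_def)
  define f where "f y = V y + \<eta> * ((y$1)\<^sup>2 + (y$2)\<^sup>2)" for y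
  have "\<exists>p\<in>closure A. \<forall>y\<in>closure A. f y \<le> f p"
    by (rule continuous_attains_sup)
      (use A x closure_subset in \<open>auto simp: f_def[abs_def] compact_closure intro!: continuous_intros cont\<close>)
  then obtain p where p: "p \<in> closure A" "\<And>y. y \<in> closure A \<Longrightarrow> f y \<le> f p" by blast
  have "p \<in> A"
  proof (rule ccontr)
    assume "p \<notin> A"
    have "f p \<le> c + \<eta> * B\<^sup>2"
    proof -
      have "(p$1)\<^sup>2 + (p$2)\<^sup>2 \<le> B\<^sup>2" using B(2)[OF p(1)] by (simp flip: norm2_sq add: power_mono)
      then show ?thesis unfolding f_def using bd[OF p(1) \<open>p \<notin> A\<close>] \<eta>(1) by (intro add_mono mult_left_mono) auto
    qed
    moreover have "f x \<ge> V x" using \<eta>(1) by (simp add: f_def)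
    ultimately show False using p(2)[of x] x closure_subset \<eta>(2) by fastforce
  qed
  obtain d where dd: "d > 0" "ball p d \<subseteq> A" using A(1) \<open>p \<in> A\<close> open_contains_ball by blast
  have inA: "p + t *\<^sub>R axis i 1 \<in> A" if "\<bar>t\<bar> < d" for t i
    using dd(2) that by (auto simp: dist_norm norm_axis_1 subset_iff)
  have c: "((\<lambda>x::real^2. x $ i) has_derivative (\<lambda>v. v $ i)) (at x)" for i x
    by (rule bounded_linear_imp_has_derivative) (rule bounded_linear_vec_nth)
  define f' where "f' i y = (if i = 1 then V1 y else V2 y) + 2 * \<eta> * y$i" for i :: 2 and y :: "real^2"
  define Di where "Di i v = (if i = 1 then D1 p v else D2 p v) + 2 * \<eta> * v$i" for i :: 2 and v :: "real^2"
  have hd1: "(f has_derivative (\<lambda>v. v$1 * f' 1 y + v$2 * f' 2 y)) (at y)" if "y \<in> A" for y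
    unfolding f_def[abs_def]
    by (rule derivative_eq_intros d[OF that] c refl | simp add: f'_def fun_eq_iff algebra_simps)+
  have hd2: "(f' i has_derivative Di i) (at p)" for i
    using has_derivative_add[OF d1[OF \<open>p \<in> A\<close>] has_derivative_mult_right[OF c[of i p], of "2 * \<eta>"]]
      has_derivative_add[OF d2[OF \<open>p \<in> A\<close>] has_derivative_mult_right[OF c[of i p], of "2 * \<eta>"]]
    by (cases "i = 1") (simp_all add: f'_def[abs_def] Di_def[abs_def])
  have "Di 1 (axis 1 1) + Di 2 (axis 2 1) = 4 * \<eta>" using lap[OF \<open>p \<in> A\<close>] by (simp add: Di_def axis_def)
  then have "Di 1 (axis 1 1) > 0 \<or> Di 2 (axis 2 1) > 0" using \<eta>(1) by linarith
  then obtain i where i: "Di i (axis i 1) > 0" by blast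
  have v: "(axis i (1::real) :: real^2)$1 * f' 1 y + (axis i 1 :: real^2)$2 * f' 2 y = f' i y" for y
    using exhaust_2[of i] by (auto simp: axis_def)
  show False
  proof (rule not_local_max_if_second_deriv_pos[OF dd(1), of "\<lambda>t. f (p + t *\<^sub>R axis i 1)" "\<lambda>t. f' i (p + t *\<^sub>R axis i 1)" "Di i (axis i 1)"])
    show "((\<lambda>t. f (p + t *\<^sub>R axis i 1)) has_real_derivative f' i (p + t *\<^sub>R axis i 1)) (at t)" if "\<bar>t\<bar> < d" for t
      using line_deriv[OF hd1[OF inA[OF that, of i]]] unfolding v .
    show "((\<lambda>t. f' i (p + t *\<^sub>R axis i 1)) has_real_derivative Di i (axis i 1)) (at 0)"
      by (rule line_deriv) (simp add: hd2)
    show "f (p + t *\<^sub>R axis i 1) \<le> f (p + 0 *\<^sub>R axis i 1)" if "\<bar>t\<bar> < d" for t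
      using p(2) inA[OF that, of i] closure_subset by auto
  qed (rule i)
qed

section \<open>Truncation of the unit interval\<close>

definition pospart_sq :: "real \<Rightarrow> real" where "pospart_sq s = (max 0 s)\<^sup>2"

lemma pospart_sq_deriv: "(pospart_sq has_real_derivative 2 * max 0 s) (at s)"
proof (cases s "0::real" rule: linorder_cases)
  case less
  have "(pospart_sq has_real_derivative 0) (at s)"
    by (rule has_field_derivative_transform_within_open[of "\<lambda>t. 0" 0 s "{..<0}"])
      (use less in \<open>auto simp: pospart_sq_def\<close>)
  then show ?thesis using less by simp
next
  case greater
  have "((\<lambda>t::real. t\<^sup>2) has_real_derivative 2 * s) (at s)" by (auto intro!: derivative_eq_intros)
  then have "(pospart_sq has_real_derivative 2 * s) (at s)"
    by (rule has_field_derivative_transform_within_open[where S="{0<..}"])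
      (use greater in \<open>auto simp: pospart_sq_def\<close>)
  then show ?thesis using greater by simp
next
  case equal
  have "(\<lambda>h. (pospart_sq (0 + h) - pospart_sq 0) / h) = (\<lambda>h. max 0 h)"
    by (auto simp: fun_eq_iff pospart_sq_def max_def power2_eq_square)
  moreover have "((\<lambda>h::real. max 0 h) \<longlongrightarrow> max 0 0) (at 0)" by (intro tendsto_intros)
  ultimately show ?thesis using equal unfolding DERIV_def by simp
qed

text \<open>A \<open>C\<^sup>1\<close> truncation that is 0 below \<open>a\<close> and 1 above \<open>1 - a\<close>, built so that its derivative is the
  trapezoid \<open>chi'\<close>.\<close>

definition chi :: "real \<Rightarrow> real \<Rightarrow> real" where
  "chi a t = (pospart_sq (t - a) - pospart_sq (t - 2*a) - pospart_sq (t - 1 + 2*a) + pospart_sq (t - 1 + a)) / (2 * a * (1 - 3*a))"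

text \<open>The trapezoid has parallel sides 1 - 2*a and 1 - 4*a, so unit area forces the plateau
  height 1 / (1 - 3*a).\<close>

definition chi' :: "real \<Rightarrow> real \<Rightarrow> real" where
  "chi' a t = (max 0 (t - a) - max 0 (t - 2*a) - max 0 (t - 1 + 2*a) + max 0 (t - 1 + a)) / (a * (1 - 3*a))"

lemma chi_deriv: "(chi a has_real_derivative chi' a t) (at t)"
proof -
  have *: "((\<lambda>t. pospart_sq (g t)) has_real_derivative 2 * max 0 (g t)) (at t)"
    if "(g has_real_derivative 1) (at t)" for g
    using DERIV_chain2[OF pospart_sq_deriv that] by simp
  have d: "((\<lambda>t. t - a) has_real_derivative 1) (at t)" "((\<lambda>t. t - 2*a) has_real_derivative 1) (at t)"
    "((\<lambda>t. t - 1 + 2*a) has_real_derivative 1) (at t)" "((\<lambda>t. t - 1 + a) has_real_derivative 1) (at t)"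
    by (auto intro!: derivative_eq_intros)
  have e: "(2 * x - 2 * y - 2 * z + 2 * w) / (2 * a * c) = (x - y - z + w) / (a * c)" for x y z w c :: real
  proof -
    have "2 * x - 2 * y - 2 * z + 2 * w = 2 * (x - y - z + w)" "2 * a * c = 2 * (a * c)" by simp_all
    then show ?thesis by (simp only: mult_divide_mult_cancel_left zero_neq_numeral not_False_eq_True)
  qed
  show ?thesis unfolding chi_def[abs_def] chi'_def e[symmetric]
    by (intro DERIV_cdivide DERIV_add DERIV_diff * d)
qed

lemma chi'_cont: "continuous_on UNIV (chi' a)"
  unfolding chi'_def[abs_def] by (simp only: divide_inverse) (intro continuous_intros)

text \<open>The bound 1/6 keeps the two ramps disjoint and 1 - 3*a at least 1/2, which gives
  \<open>chi'\<close> at most 2.\<close>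

context
  fixes a :: real assumes a: "0 < a" "a \<le> 1/6"
begin

lemma chi_low: "t \<le> a \<Longrightarrow> chi a t = 0" "t \<le> a \<Longrightarrow> chi' a t = 0"
  using a by (simp_all add: chi_def chi'_def pospart_sq_def)

lemma chi_high: "t \<ge> 1 - a \<Longrightarrow> chi a t = 1" "t \<ge> 1 - a \<Longrightarrow> chi' a t = 0"
proof -
  assume t: "t \<ge> 1 - a"
  have m: "max 0 (t - a) = t - a" "max 0 (t - 2*a) = t - 2*a" "max 0 (t - 1 + 2*a) = t - 1 + 2*a" "max 0 (t - 1 + a) = t - 1 + a"
    using a t by auto
  have "(t - a)\<^sup>2 - (t - 2*a)\<^sup>2 - (t - 1 + 2*a)\<^sup>2 + (t - 1 + a)\<^sup>2 = 2 * a * (1 - 3*a)"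
    by (simp add: power2_eq_square algebra_simps)
  then show "chi a t = 1" "chi' a t = 0" using a by (simp_all add: chi_def chi'_def pospart_sq_def m)
qed

lemma chi'_mid: "2 * a \<le> t \<Longrightarrow> t \<le> 1 - 2*a \<Longrightarrow> chi' a t = 1 / (1 - 3*a)"
  using a by (simp add: chi'_def)

lemma chi'_bound: "0 \<le> chi' a t" "chi' a t \<le> 2"
proof -
  define n where "n = max 0 (t - a) - max 0 (t - 2*a) - max 0 (t - 1 + 2*a) + max 0 (t - 1 + a)"
  have n: "0 \<le> n" "n \<le> a" unfolding n_def using a by (auto simp: max_def)
  show "0 \<le> chi' a t" unfolding chi'_def n_def[symmetric] using n a by simp
  have "n / (a * (1 - 3*a)) \<le> a / (a * (1 - 3*a))" using n a by (intro divide_right_mono) auto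
  also have "\<dots> = 1 / (1 - 3*a)" using a by simp
  also have "\<dots> \<le> 1 / (1/2)" using a by (intro divide_left_mono) auto
  finally show "chi' a t \<le> 2" unfolding chi'_def n_def[symmetric] by simp
qed

text \<open>After multiplication by 1 - 3*a, the two ramps lower the value by at most 3/2 * a each,
  and rescaling \<open>t\<close> raises the difference by at most 3*a. Dividing by 1 - 3*a >= 1/2
  doubles 3*a.\<close>

lemma chi_near_id: assumes t: "0 \<le> t" "t \<le> 1" shows "\<bar>chi a t - t\<bar> \<le> 6 * a"
proof -
  define f where "f s = (pospart_sq (s - a) - pospart_sq (s - 2*a)) / (2*a)" for s
  define g where "g = (pospart_sq (t - 1 + 2*a) - pospart_sq (t - 1 + a)) / (2*a)"
  have f: "t - 3/2 * a \<le> f t" "f t \<le> t"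
  proof -
    consider "t \<le> a" | "a < t" "t \<le> 2*a" | "2*a < t" by linarith
    then have "t - 3/2 * a \<le> f t \<and> f t \<le> t"
    proof cases
      case 1 then show ?thesis using t a by (simp add: f_def pospart_sq_def)
    next
      case 2
      have "f t = (t - a)\<^sup>2 / (2*a)" using 2 by (simp add: f_def pospart_sq_def)
      moreover have "(t - a)\<^sup>2 / (2*a) \<ge> t - 3/2 * a"
      proof -
        have "0 \<le> (t - 2*a)\<^sup>2 / (2*a)" using a by simp
        also have "\<dots> = (t - a)\<^sup>2 / (2*a) - (t - 3/2 * a)" using a by (simp add: power2_eq_square field_simps)
        finally show ?thesis by simp
      qed
      moreover have "(t - a)\<^sup>2 / (2*a) \<le> t"
      proof -
        have "(t - a)\<^sup>2 \<le> (t - a) * a" unfolding power2_eq_square using 2 by (intro mult_left_mono) auto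
        also have "\<dots> \<le> t * (2*a)" using 2 a t by (intro mult_mono) auto
        finally show ?thesis using a by (simp add: field_simps)
      qed
      ultimately show ?thesis by simp
    next
      case 3
      have "f t = ((t - a)\<^sup>2 - (t - 2*a)\<^sup>2) / (2*a)" using 3 a by (simp add: f_def pospart_sq_def)
      also have "\<dots> = t - 3/2 * a" using a by (simp add: power2_eq_square field_simps)
      finally show ?thesis using a by simp
    qed
    then show "t - 3/2 * a \<le> f t" "f t \<le> t" by auto
  qed
  have g: "0 \<le> g" "g \<le> 3/2 * a"
  proof -
    have "(max 0 (t - 1 + a))\<^sup>2 \<le> (max 0 (t - 1 + 2*a))\<^sup>2" using a by (intro power_mono) auto
    then show "0 \<le> g" using a by (simp add: g_def pospart_sq_def)
    have "(max 0 (t - 1 + 2*a))\<^sup>2 - (max 0 (t - 1 + a))\<^sup>2 \<le> 3 * a\<^sup>2"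
    proof -
      consider "t - 1 + a \<ge> 0" | "t - 1 + a < 0" "t - 1 + 2*a \<ge> 0" | "t - 1 + 2*a < 0" by linarith
      then show ?thesis
      proof cases
        case 1
        have "(t - 1 + 2*a)\<^sup>2 - (t - 1 + a)\<^sup>2 = a * (2 * (t - 1) + 3 * a)" by (simp add: power2_eq_square algebra_simps)
        also have "\<dots> \<le> a * (3 * a)" using a t by (intro mult_left_mono) auto
        finally show ?thesis using 1 a by (simp add: power2_eq_square)
      next
        case 2
        have "(t - 1 + 2*a)\<^sup>2 \<le> a\<^sup>2" using 2 by (intro power_mono) auto
        moreover have "a\<^sup>2 \<ge> 0" by simp
        ultimately have "(t - 1 + 2*a)\<^sup>2 \<le> 3 * a\<^sup>2" by linarith
        then show ?thesis using 2 by simp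
      next
        case 3 then show ?thesis using a by simp
      qed
    qed
    then have "g \<le> (3 * a\<^sup>2) / (2 * a)" unfolding g_def pospart_sq_def using a by (intro divide_right_mono) auto
    then show "g \<le> 3/2 * a" using a by (simp add: power2_eq_square)
  qed
  have q: "(1 - 3*a) * chi a t = f t - g" using a by (simp add: chi_def f_def g_def field_simps)
  have b: "(1 - 3*a) \<ge> 1/2" using a by simp
  have "(1 - 3*a) * (chi a t - t) = f t - g - t + 3 * a * t" using q by (simp add: algebra_simps)
  moreover have "0 \<le> a * t" "a * t \<le> a" using a t by (simp_all add: mult_left_le)
  ultimately have "\<bar>(1 - 3*a) * (chi a t - t)\<bar> \<le> 3 * a" using f g by linarith
  moreover have "\<bar>(1 - 3*a) * (chi a t - t)\<bar> \<ge> 1/2 * \<bar>chi a t - t\<bar>"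
    unfolding abs_mult using b by (intro mult_right_mono) auto
  ultimately have "1/2 * \<bar>chi a t - t\<bar> \<le> 3 * a" by (rule order_trans[rotated])
  then show ?thesis by simp
qed

end

section \<open>The truncated potential on the annulus\<close>

locale annulus =
  fixes \<Omega> \<omega> A :: "(real^2) set" and V :: "real^2 \<Rightarrow> real"
  assumes oO: "open \<Omega>" and bO: "bounded \<Omega>" and oo: "open \<omega>" and sub: "closure \<omega> \<subseteq> \<Omega>" and A_def: "A = \<Omega> - closure \<omega>"
    and pot: "annulus_potential \<Omega> \<omega> V"
begin

lemma oA: "open A" unfolding A_def using oO by (intro open_Diff) auto
lemma bA: "bounded A" unfolding A_def using bO by (rule bounded_subset) auto
lemma A_borel: "A \<in> sets borel" using oA by simp

lemma V_diff: "x \<in> A \<Longrightarrow> V differentiable at x"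
  and V_diff2: "x \<in> A \<Longrightarrow> pd i V differentiable at x"
  and V_cont: "continuous_on (closure A) V"
  and V_lap: "x \<in> A \<Longrightarrow> pd 1 (pd 1 V) x + pd 2 (pd 2 V) x = 0"
  and V_outer: "x \<in> frontier \<Omega> \<Longrightarrow> V x = 1"
  and V_inner: "x \<in> frontier \<omega> \<Longrightarrow> V x = 0"
  using pot unfolding annulus_potential_def Let_def A_def[symmetric] numeral_2_eq_2 laplacian_def
  by (auto simp: partial_deriv_eq_pd sum_2)

lemma closure_A: "closure A \<subseteq> closure \<Omega>" unfolding A_def by (rule closure_mono) auto

lemma inner_boundary: "x \<in> closure A \<Longrightarrow> x \<in> closure \<omega> \<Longrightarrow> x \<in> frontier \<omega>"
proof -
  assume x: "x \<in> closure A" "x \<in> closure \<omega>"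
  have "\<omega> \<inter> A = {}" using closure_subset[of \<omega>] by (auto simp: A_def)
  then have "\<omega> \<inter> closure A = {}" using open_Int_closure_eq_empty[OF oo] by blast
  then show ?thesis using x oo by (auto simp: frontier_def interior_open)
qed

lemma outer_boundary: "x \<in> closure A \<Longrightarrow> x \<notin> \<Omega> \<Longrightarrow> x \<in> frontier \<Omega>"
  using closure_A oO by (auto simp: frontier_def interior_open)

lemma boundary_cases: "x \<in> closure A \<Longrightarrow> x \<notin> A \<Longrightarrow> V x = 0 \<or> V x = 1"
  using inner_boundary[of x] outer_boundary[of x] V_outer V_inner by (auto simp: A_def)

lemma V_hd: "x \<in> A \<Longrightarrow> (V has_derivative (\<lambda>v. v$1 * pd 1 V x + v$2 * pd 2 V x)) (at x)"
  using has_derivative_pd[OF V_diff] by simp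

lemma pdV_hd: "x \<in> A \<Longrightarrow> (pd i V has_derivative (\<lambda>v. v$1 * pd 1 (pd i V) x + v$2 * pd 2 (pd i V) x)) (at x)"
  using has_derivative_pd[OF V_diff2] by simp

lemma pdV_cont: "continuous_on A (pd i V)"
  by (intro differentiable_imp_continuous_on) (simp add: differentiable_on_def V_diff2 differentiable_at_withinI)

lemma V_le_1: assumes "x \<in> A" shows "V x \<le> 1"
proof (rule weak_maximum_principle[OF oA bA V_cont V_hd pdV_hd pdV_hd _ _ assms])
  show "(axis 1 1 :: real^2)$1 * pd 1 (pd 1 V) x + (axis 1 1 :: real^2)$2 * pd 2 (pd 1 V) x + ((axis 2 1 :: real^2)$1 * pd 1 (pd 2 V) x + (axis 2 1 :: real^2)$2 * pd 2 (pd 2 V) x) = 0" if "x \<in> A" for x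
    using V_lap[OF that] by (simp add: axis_def)
  show "V x \<le> 1" if "x \<in> closure A" "x \<notin> A" for x using boundary_cases[OF that] by auto
qed

lemma V_ge_0: assumes "x \<in> A" shows "V x \<ge> 0"
proof -
  have "- V x \<le> 0"
  proof (rule weak_maximum_principle[where ?V1.0="\<lambda>x. - pd 1 V x" and ?V2.0="\<lambda>x. - pd 2 V x"
      and ?D1.0="\<lambda>x v. - (v$1 * pd 1 (pd 1 V) x + v$2 * pd 2 (pd 1 V) x)"
      and ?D2.0="\<lambda>x v. - (v$1 * pd 1 (pd 2 V) x + v$2 * pd 2 (pd 2 V) x)", OF oA bA _ _ _ _ _ _ assms])
    show "continuous_on (closure A) (\<lambda>x. - V x)" by (intro continuous_intros V_cont)
    show "((\<lambda>x. - V x) has_derivative (\<lambda>v. v $ 1 * - pd 1 V x + v $ 2 * - pd 2 V x)) (at x)" if "x \<in> A" for x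
      using has_derivative_minus[OF V_hd[OF that]] by simp
    show "((\<lambda>x. - pd 1 V x) has_derivative (\<lambda>v. - (v$1 * pd 1 (pd 1 V) x + v$2 * pd 2 (pd 1 V) x))) (at x)" if "x \<in> A" for x
      by (rule has_derivative_minus[OF pdV_hd[OF that]])
    show "((\<lambda>x. - pd 2 V x) has_derivative (\<lambda>v. - (v$1 * pd 1 (pd 2 V) x + v$2 * pd 2 (pd 2 V) x))) (at x)" if "x \<in> A" for x
      by (rule has_derivative_minus[OF pdV_hd[OF that]])
    show "- ((axis 1 1 :: real^2)$1 * pd 1 (pd 1 V) x + (axis 1 1 :: real^2)$2 * pd 2 (pd 1 V) x) + - ((axis 2 1 :: real^2)$1 * pd 1 (pd 2 V) x + (axis 2 1 :: real^2)$2 * pd 2 (pd 2 V) x) = 0" if "x \<in> A" for x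
      using V_lap[OF that] by (simp add: axis_def)
    show "- V x \<le> 0" if "x \<in> closure A" "x \<notin> A" for x using boundary_cases[OF that] by auto
  qed
  then show ?thesis by simp
qed

text \<open>The weak maximum principle does not exclude that \<open>V\<close> takes the value 0 or 1
  inside \<open>A\<close>. Such a point is an extremum, so the gradient vanishes; this settles the
  points where the truncated derivative does not tend to 1.\<close>

lemma grad_zero_extremal: assumes "x \<in> A" "V x = 0 \<or> V x = 1" shows "pd i V x = 0"
proof -
  have "(\<lambda>v::real^2. v$1 * pd 1 V x + v$2 * pd 2 V x) = (\<lambda>v. 0)"
    by (rule differential_zero_maxmin[OF assms(1) oA V_hd[OF assms(1)]]) (use assms V_le_1 V_ge_0 in auto)
  from fun_cong[OF this, of "axis i 1"] show ?thesis using exhaust_2[of i] by (auto simp: axis_def)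
qed

definition Kset :: "real \<Rightarrow> (real^2) set" where "Kset a = {x\<in>A. a \<le> V x \<and> V x \<le> 1 - a}"

text \<open>Using \<open>1 - chi\<close> with the value 1 on the hole yields compact support. The
  price is a minus sign in the flux compared with \<open>V\<close>.\<close>

definition Psi :: "real \<Rightarrow> real^2 \<Rightarrow> real" where
  "Psi a x = (if x \<in> A then 1 - chi a (V x) else if x \<in> closure \<omega> then 1 else 0)"

definition dPsi :: "real \<Rightarrow> 2 \<Rightarrow> real^2 \<Rightarrow> real" where
  "dPsi a i x = (if x \<in> A then - (chi' a (V x) * pd i V x) else 0)"

text \<open>The boundary values 0 and 1 lie outside the interval from a to 1 - a, so passing to the
  closure of \<open>A\<close> adds no points.\<close>

lemma Kset_compact: assumes "a > 0" shows "compact (Kset a)"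
proof -
  have "Kset a = closure A \<inter> V -` {a..1-a}"
  proof (intro equalityI subsetI)
    fix x assume x: "x \<in> closure A \<inter> V -` {a..1-a}"
    have "x \<in> A"
    proof (rule ccontr)
      assume "x \<notin> A"
      then show False using boundary_cases[of x] x assms by auto
    qed
    then show "x \<in> Kset a" using x by (simp add: Kset_def)
  qed (use closure_subset in \<open>auto simp: Kset_def\<close>)
  moreover have "closed (closure A \<inter> V -` {a..1-a})"
    by (rule continuous_closed_preimage[OF V_cont]) auto
  ultimately have "closed (Kset a)" by simp
  moreover have "bounded (Kset a)" by (rule bounded_subset[OF bA]) (auto simp: Kset_def)
  ultimately show ?thesis by (simp add: compact_eq_bounded_closed)
qed

lemma Kset_sub: "Kset a \<subseteq> A" by (auto simp: Kset_def)

context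
  fixes a :: real assumes a: "0 < a" "a \<le> 1/6"
begin

lemma Psi_int: "x \<notin> Kset a \<Longrightarrow> Psi a x \<in> \<int>"
  using chi_low(1)[OF a, of "V x"] chi_high(1)[OF a, of "V x"] by (auto simp: Psi_def Kset_def)

lemma dPsi_zero: "x \<notin> Kset a \<Longrightarrow> dPsi a i x = 0"
  using chi_low(2)[OF a, of "V x"] chi_high(2)[OF a, of "V x"] by (auto simp: dPsi_def Kset_def)

text \<open>Continuity up to the boundary puts \<open>V\<close> below \<open>a\<close> near the hole
  and above \<open>1 - a\<close> near the outer boundary. The truncation is flat there, whatever the
  gradient of \<open>V\<close> does.\<close>

lemma Psi_locally_const:
  assumes x: "x \<notin> A"
  shows "\<exists>U c. open U \<and> x \<in> U \<and> (\<forall>y\<in>U. Psi a y = c)"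
proof (cases "x \<in> closure \<omega>")
  case True
  have "\<exists>U. open U \<and> x \<in> U \<and> (\<forall>y\<in>U\<inter>A. V y < a)"
  proof (cases "x \<in> closure A")
    case True
    have "V x = 0" using V_inner[OF inner_boundary[OF True \<open>x \<in> closure \<omega>\<close>]] .
    then obtain d where d: "d > 0" "\<And>y. y \<in> closure A \<Longrightarrow> dist y x < d \<Longrightarrow> dist (V y) (V x) < a"
      using V_cont True a(1) unfolding continuous_on_iff by metis
    show ?thesis using d \<open>V x = 0\<close> closure_subset[of A]
      by (intro exI[of _ "ball x d"]) (auto simp: dist_commute dist_real_def subset_iff abs_less_iff)
  next
    case False
    then show ?thesis using closure_subset[of A] by (intro exI[of _ "- closure A"]) auto
  qed
  then obtain U where U: "open U" "x \<in> U" "\<And>y. y \<in> U \<Longrightarrow> y \<in> A \<Longrightarrow> V y < a" by blast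
  have "Psi a y = 1" if "y \<in> U \<inter> \<Omega>" for y
  proof (cases "y \<in> A")
    case True
    then show ?thesis using U(3)[of y] that chi_low(1)[OF a, of "V y"] by (simp add: Psi_def)
  next
    case False
    then have "y \<in> closure \<omega>" using that unfolding A_def by blast
    then show ?thesis using False by (simp add: Psi_def)
  qed
  then show ?thesis using U oO True sub by (intro exI[of _ "U \<inter> \<Omega>"] exI[of _ 1]) auto
next
  case False
  then have nO: "x \<notin> \<Omega>" using x by (auto simp: A_def)
  have "\<exists>U. open U \<and> x \<in> U \<and> (\<forall>y\<in>U\<inter>A. V y > 1 - a)"
  proof (cases "x \<in> closure A")
    case True
    have "V x = 1" using V_outer[OF outer_boundary[OF True nO]] .
    then obtain d where d: "d > 0" "\<And>y. y \<in> closure A \<Longrightarrow> dist y x < d \<Longrightarrow> dist (V y) (V x) < a"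
      using V_cont True a(1) unfolding continuous_on_iff by metis
    show ?thesis using d \<open>V x = 1\<close> closure_subset[of A]
      by (intro exI[of _ "ball x d"]) (fastforce simp: dist_commute dist_real_def subset_iff abs_less_iff)
  next
    case False
    then show ?thesis using closure_subset[of A] by (intro exI[of _ "- closure A"]) auto
  qed
  then obtain U where U: "open U" "x \<in> U" "\<And>y. y \<in> U \<Longrightarrow> y \<in> A \<Longrightarrow> V y > 1 - a" by blast
  have "Psi a y = 0" if "y \<in> U \<inter> - closure \<omega>" for y
    using U(3)[of y] that chi_high(1)[OF a, of "V y"] by (auto simp: Psi_def)
  then show ?thesis using U False by (intro exI[of _ "U \<inter> - closure \<omega>"] exI[of _ 0]) auto
qed

lemma Psi_hd: "(Psi a has_derivative (\<lambda>v. v$1 * dPsi a 1 x + v$2 * dPsi a 2 x)) (at x)"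
proof (cases "x \<in> A")
  case True
  have "((\<lambda>x. 1 - chi a (V x)) has_derivative (\<lambda>v. - ((v$1 * pd 1 V x + v$2 * pd 2 V x) * chi' a (V x)))) (at x)"
    using has_derivative_diff[OF has_derivative_const[of 1] DERIV_compose_FDERIV[OF chi_deriv V_hd[OF True]]] by simp
  then have "(Psi a has_derivative (\<lambda>v. - ((v$1 * pd 1 V x + v$2 * pd 2 V x) * chi' a (V x)))) (at x)"
    by (rule has_derivative_transform_within_open[OF _ oA True]) (simp add: Psi_def)
  then show ?thesis by (rule has_derivative_eq_rhs) (simp add: fun_eq_iff dPsi_def True algebra_simps)
next
  case False
  obtain U c where U: "open U" "x \<in> U" "\<And>y. y \<in> U \<Longrightarrow> Psi a y = c" using Psi_locally_const[OF False] by blast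
  have "(Psi a has_derivative (\<lambda>v. 0)) (at x)"
    by (rule has_derivative_transform_within_open[OF has_derivative_const[of c] U(1,2)]) (simp add: U(3))
  then show ?thesis using False by (simp add: dPsi_def)
qed

lemma Psi_pd: "pd i (Psi a) x = dPsi a i x"
  using exhaust_2[of i] by (auto simp: pd_has_derivative[OF Psi_hd] axis_def)

lemma dPsi_cont: "continuous_on UNIV (dPsi a i)"
proof -
  have V: "continuous_on A V" using V_cont closure_subset continuous_on_subset by blast
  have "continuous_on A (\<lambda>x. - (chi' a (V x) * pd i V x))"
    by (intro continuous_intros continuous_on_compose2[OF chi'_cont V] pdV_cont) auto
  then have 1: "continuous_on A (dPsi a i)" by (rule continuous_on_eq) (simp add: dPsi_def)
  have 2: "continuous_on (- Kset a) (dPsi a i)"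
    by (rule continuous_on_eq[OF continuous_on_const[of _ 0]]) (simp add: dPsi_zero)
  have U: "UNIV = A \<union> - Kset a" using Kset_sub by auto
  show ?thesis unfolding U
    by (rule continuous_on_open_Un[OF oA _ 1 2]) (use compact_imp_closed[OF Kset_compact[OF a(1)]] in auto)
qed

lemma Psi_C1c: "C1c (Psi a)"
proof (rule C1cI[OF _ bO])
  show "C1 (Psi a)"
    unfolding C1_def using Psi_hd dPsi_cont by (auto simp: differentiable_def Psi_pd[abs_def])
  show "x \<in> \<Omega>" if "Psi a x \<noteq> 0" for x
  proof -
    have "x \<in> A \<or> x \<in> closure \<omega>" using that by (auto simp: Psi_def split: if_splits)
    then show ?thesis using sub unfolding A_def by blast
  qed
qed

end

lemma Psi_diff_bound:
  assumes "0 < b" "b \<le> a" "a \<le> 1/6"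
  shows "\<bar>Psi b x - Psi a x\<bar> \<le> 12 * a"
proof (cases "x \<in> A")
  case True
  have "\<bar>chi b (V x) - V x\<bar> \<le> 6 * b" "\<bar>chi a (V x) - V x\<bar> \<le> 6 * a"
    using assms V_ge_0[OF True] V_le_1[OF True] by (auto intro!: chi_near_id)
  then show ?thesis using assms True by (simp add: Psi_def)
next
  case False then show ?thesis using assms by (simp add: Psi_def)
qed

end

section \<open>The flux of a Sobolev map\<close>

lemma two_jacobian_le_gsq: "\<bar>2 * (Re a * Im b - Re b * Im a)\<bar> \<le> (norm a)\<^sup>2 + (norm b)\<^sup>2" for a b :: complex
proof -
  have "0 \<le> (Re a - Im b)\<^sup>2 + (Re b + Im a)\<^sup>2" "0 \<le> (Re a + Im b)\<^sup>2 + (Re b - Im a)\<^sup>2" by simp_all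
  then show ?thesis unfolding cmod_power2 abs_le_iff by (simp add: power2_eq_square algebra_simps)
qed

text \<open>Integration by parts turns \<open>bform R w\<close> into \<open>R\<close> times the Jacobian. The bound involves \<open>R\<close> but not
  its gradient, so that no control of the gradient of the potential near the boundary is needed.\<close>

lemma bform_jacobian_bound:
  fixes w :: "real^2 \<Rightarrow> complex"
  assumes R: "C1c R" and w: "C1c w" and S: "\<And>x. \<bar>R x\<bar> \<le> S" and K: "K \<in> sets borel" "\<And>x. x \<notin> K \<Longrightarrow> R x = 0"
  shows "\<bar>\<integral>x. bform R w x \<partial>lborel\<bar> \<le> S * (\<integral>x. indicator K x * gsq w x \<partial>lborel)"
proof -
  have S0: "S \<ge> 0" using S[of 0] by linarith
  define p where "p x = Re (w x)" for x
  define q where "q x = Im (w x)" for x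
  have p: "C1 p" "pd i p x = Re (pd i w x)" and q: "C1 q" "pd i q x = Im (pd i w x)" for i x
    unfolding p_def[abs_def] q_def[abs_def]
    using C1_bounded_linear[OF bounded_linear_Re C1c_C1[OF w]] C1_bounded_linear[OF bounded_linear_Im C1c_C1[OF w]] by auto
  note R1 = C1c_C1[OF R]
  have RR: "C1c (\<lambda>x. R x * f x)" "pd i (\<lambda>x. R x * f x) x = R x * pd i f x + pd i R x * f x" if "C1 f" for f i x
    using C1c_bilinear[OF bounded_bilinear_mult R1 that] R C1_bounded_bilinear(2)[OF bounded_bilinear_mult R1 that] by auto
  \<comment> \<open>The Jacobian of \<open>f\<close> and R * g, hence of integral 0; the product
    rule produces R times a Jacobian plus terms with the gradient of \<open>R\<close>.\<close>
  define T where "T f g x = pd 1 f x * pd 2 (\<lambda>x. R x * g x) x - pd 2 f x * pd 1 (\<lambda>x. R x * g x) x" for f g x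
  have T: "(\<integral>x. T f g x \<partial>lborel) = 0" "integrable lborel (T f g)" if fg: "C1 f" "C1 g" for f g
  proof -
    show "(\<integral>x. T f g x \<partial>lborel) = 0"
      using integral_jacobian_zero[OF fg(1) RR(1)[OF fg(2)]] by (simp add: T_def)
    obtain B where B: "B > 0" "\<And>x. norm x \<ge> B \<Longrightarrow> R x * g x = 0" "\<And>x i. norm x \<ge> B \<Longrightarrow> pd i (\<lambda>x. R x * g x) x = 0"
      by (rule C1c_ball[OF RR(1)[OF fg(2)]]) blast
    show "integrable lborel (T f g)"
    proof (rule cont_compact_supp_integrable[of _ B])
      show "continuous_on UNIV (T f g)" unfolding T_def[abs_def]
        by (intro continuous_intros C1_cont_pd fg C1c_C1[OF RR(1)[OF fg(2)]])
      show "T f g x = 0" if "B \<le> norm x" for x using B(3)[OF that] by (simp add: T_def)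
    qed
  qed
  define J where "J x = 2 * (pd 1 p x * pd 2 q x - pd 2 p x * pd 1 q x)" for x
  have Jle: "\<bar>J x\<bar> \<le> gsq w x" for x
    unfolding J_def p q gsq_def by (rule two_jacobian_le_gsq)
  \<comment> \<open>Antisymmetrizing in \<open>p\<close> and \<open>q\<close> recovers
    \<open>bform\<close> from the gradient terms and doubles the Jacobian.\<close>
  have eq: "bform R w x = T p q x - T q p x - R x * J x" for x
    unfolding bform_def T_def J_def RR(2)[OF p(1)] RR(2)[OF q(1)]
    by (simp add: cr_def p(2) q(2)) (simp add: p_def q_def algebra_simps)
  have iB: "integrable lborel (bform R w)" by (intro CC_integrable bform_CC R C1c_C1 w)
  have iRJ: "integrable lborel (\<lambda>x. R x * J x)"
  proof -
    have "(\<lambda>x. R x * J x) = (\<lambda>x. T p q x - T q p x - bform R w x)" using eq by (simp add: fun_eq_iff)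
    then show ?thesis using T(2)[OF p(1) q(1)] T(2)[OF q(1) p(1)] iB by simp
  qed
  have ig: "integrable lborel (\<lambda>x. indicator K x * gsq w x)"
    using integrable_mult_indicator[OF _ gsq_integrable[OF w], of K] K(1) by simp
  have "(\<integral>x. bform R w x \<partial>lborel) = - (\<integral>x. R x * J x \<partial>lborel)"
    unfolding eq using T[OF p(1) q(1)] T[OF q(1) p(1)] iRJ by simp
  then have "\<bar>\<integral>x. bform R w x \<partial>lborel\<bar> = \<bar>\<integral>x. R x * J x \<partial>lborel\<bar>" by simp
  also have "\<dots> \<le> (\<integral>x. \<bar>R x * J x\<bar> \<partial>lborel)" by (rule integral_abs_bound)
  also have "\<dots> \<le> (\<integral>x. S * (indicator K x * gsq w x) \<partial>lborel)"
  proof (rule integral_mono[OF integrable_abs[OF iRJ] integrable_mult_right[OF ig]])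
    fix x
    show "\<bar>R x * J x\<bar> \<le> S * (indicator K x * gsq w x)"
    proof (cases "x \<in> K")
      case True
      then show ?thesis using mult_mono[OF S[of x] Jle[of x] S0] by (simp add: abs_mult)
    qed (simp add: K(2))
  qed
  also have "\<dots> = S * (\<integral>x. indicator K x * gsq w x \<partial>lborel)" by simp
  finally show ?thesis .
qed

section \<open>The flux of an L2 map with L2 weak gradient\<close>

lemma cr_alt: "cr a b = Re a * Im b - Im a * Re b" by (simp add: cr_def)

lemma cr_integrable:
  fixes f g :: "real^2 \<Rightarrow> complex" and k :: "real^2 \<Rightarrow> real"
  assumes "L2b f" "L2b g" "k \<in> borel_measurable borel" "\<And>x. \<bar>k x\<bar> \<le> M"
  shows "integrable lborel (\<lambda>x. k x * cr (f x) (g x))"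
proof -
  have [measurable]: "f \<in> borel_measurable borel" "g \<in> borel_measurable borel" "k \<in> borel_measurable borel"
    using assms by (auto simp: L2b_def)
  have i: "integrable lborel (\<lambda>x. M * ((norm (f x))\<^sup>2 + (norm (g x))\<^sup>2))"
    using assms by (simp add: L2b_def)
  show ?thesis
  proof (rule Bochner_Integration.integrable_bound[OF i])
    show "(\<lambda>x. k x * cr (f x) (g x)) \<in> borel_measurable lborel" unfolding cr_alt by measurable
    show "AE x in lborel. norm (k x * cr (f x) (g x)) \<le> norm (M * ((norm (f x))\<^sup>2 + (norm (g x))\<^sup>2))"
    proof (rule AE_I2)
      fix x
      have M: "M \<ge> 0" using assms(4)[of x] by linarith
      have "\<bar>cr (f x) (g x)\<bar> \<le> norm (f x) * norm (g x)" by (rule cr_abs_le)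
      also have "\<dots> \<le> (norm (f x))\<^sup>2 + (norm (g x))\<^sup>2"
      proof -
        have "0 \<le> (norm (f x) - norm (g x))\<^sup>2 + (norm (f x))\<^sup>2 + (norm (g x))\<^sup>2" by simp
        then show ?thesis by (simp add: power2_eq_square algebra_simps)
      qed
      finally have "\<bar>k x\<bar> * \<bar>cr (f x) (g x)\<bar> \<le> M * ((norm (f x))\<^sup>2 + (norm (g x))\<^sup>2)"
        using assms(4)[of x] M by (intro mult_mono) auto
      then show "norm (k x * cr (f x) (g x)) \<le> norm (M * ((norm (f x))\<^sup>2 + (norm (g x))\<^sup>2))"
        using M by (simp add: abs_mult)
    qed
  qed
qed

text \<open>Bilinearity puts one difference into each product, and Young's inequality with parameter
  \<open>t\<close> separates it from the remaining factor.\<close>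

lemma cr_L2_estimate:
  fixes a b a' b' :: "real^2 \<Rightarrow> complex" and k :: "real^2 \<Rightarrow> real"
  assumes L: "L2b a" "L2b b" "L2b a'" "L2b b'" and k: "k \<in> borel_measurable borel" "\<And>x. \<bar>k x\<bar> \<le> M" and t: "t > 0"
  shows "\<bar>(\<integral>x. k x * cr (a' x) (b' x) \<partial>lborel) - (\<integral>x. k x * cr (a x) (b x) \<partial>lborel)\<bar>
     \<le> M * ((l2 (\<lambda>x. a' x - a x) + l2 (\<lambda>x. b' x - b x)) / (2 * t) + t / 2 * (l2 a + l2 b'))"
proof -
  have M: "M \<ge> 0" using k(2)[of 0] by linarith
  have i: "integrable lborel (\<lambda>x. k x * cr (a' x) (b' x))" "integrable lborel (\<lambda>x. k x * cr (a x) (b x))"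
    by (rule cr_integrable[OF L(3,4) k], rule cr_integrable[OF L(1,2) k])
  have s: "integrable lborel (\<lambda>x. (norm (a' x - a x))\<^sup>2)" "integrable lborel (\<lambda>x. (norm (b' x - b x))\<^sup>2)"
    "integrable lborel (\<lambda>x. (norm (a x))\<^sup>2)" "integrable lborel (\<lambda>x. (norm (b' x))\<^sup>2)"
    using L2b_diff(1)[OF L(3,1)] L2b_diff(1)[OF L(4,2)] L unfolding L2b_def by blast+
  define Q where "Q x = M * (((norm (a' x - a x))\<^sup>2 + (norm (b' x - b x))\<^sup>2) / (2 * t) + t / 2 * ((norm (a x))\<^sup>2 + (norm (b' x))\<^sup>2))" for x
  have iQ: "integrable lborel Q" unfolding Q_def[abs_def]
    by (intro integrable_mult_right Bochner_Integration.integrable_add integrable_divide s)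
  have am: "x * y \<le> x\<^sup>2 / (2 * t) + t / 2 * y\<^sup>2" for x y :: real
  proof -
    have "0 \<le> (x - t * y)\<^sup>2 / (2 * t)" using t by simp
    also have "\<dots> = x\<^sup>2 / (2 * t) + t / 2 * y\<^sup>2 - x * y" using t by (simp add: power2_eq_square field_simps)
    finally show ?thesis by simp
  qed
  have pt: "\<bar>k x * cr (a' x) (b' x) - k x * cr (a x) (b x)\<bar> \<le> Q x" for x
  proof -
    have "cr (a' x) (b' x) - cr (a x) (b x) = cr (a' x - a x) (b' x) + cr (a x) (b' x - b x)"
      by (simp add: cr_def algebra_simps)
    then have "\<bar>cr (a' x) (b' x) - cr (a x) (b x)\<bar> \<le> norm (a' x - a x) * norm (b' x) + norm (b' x - b x) * norm (a x)"
      using cr_abs_le[of "a' x - a x" "b' x"] cr_abs_le[of "a x" "b' x - b x"]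
      by (simp add: mult.commute[of "norm (a x)"])
    also have "\<dots> \<le> ((norm (a' x - a x))\<^sup>2 / (2 * t) + t / 2 * (norm (b' x))\<^sup>2) + ((norm (b' x - b x))\<^sup>2 / (2 * t) + t / 2 * (norm (a x))\<^sup>2)"
      by (intro add_mono am)
    also have "\<dots> = ((norm (a' x - a x))\<^sup>2 + (norm (b' x - b x))\<^sup>2) / (2 * t) + t / 2 * ((norm (a x))\<^sup>2 + (norm (b' x))\<^sup>2)"
      by (simp add: add_divide_distrib algebra_simps)
    finally have "\<bar>k x\<bar> * \<bar>cr (a' x) (b' x) - cr (a x) (b x)\<bar> \<le> Q x"
      unfolding Q_def using k(2)[of x] M by (intro mult_mono) auto
    then show ?thesis by (simp add: abs_mult[symmetric] right_diff_distrib)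
  qed
  have "\<bar>(\<integral>x. k x * cr (a' x) (b' x) \<partial>lborel) - (\<integral>x. k x * cr (a x) (b x) \<partial>lborel)\<bar> = \<bar>\<integral>x. k x * cr (a' x) (b' x) - k x * cr (a x) (b x) \<partial>lborel\<bar>"
    using i by simp
  also have "\<dots> \<le> (\<integral>x. \<bar>k x * cr (a' x) (b' x) - k x * cr (a x) (b x)\<bar> \<partial>lborel)" by (rule integral_abs_bound)
  also have "\<dots> \<le> (\<integral>x. Q x \<partial>lborel)"
    by (rule integral_mono[OF integrable_abs[OF Bochner_Integration.integrable_diff[OF i]] iQ pt])
  also have "\<dots> = M * ((l2 (\<lambda>x. a' x - a x) + l2 (\<lambda>x. b' x - b x)) / (2 * t) + t / 2 * (l2 a + l2 b'))"
    unfolding Q_def l2_def using s by simp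
  finally show ?thesis .
qed

text \<open>The integral of \<open>bform\<close> with a candidate weak gradient \<open>g\<close> in
  place of the classical one.\<close>

definition flux :: "(real^2 \<Rightarrow> real) \<Rightarrow> (real^2 \<Rightarrow> complex) \<Rightarrow> (2 \<Rightarrow> real^2 \<Rightarrow> complex) \<Rightarrow> real" where
  "flux \<psi> f g = (\<integral>x. pd 1 \<psi> x * cr (f x) (g 2 x) - pd 2 \<psi> x * cr (f x) (g 1 x) \<partial>lborel)"

text \<open>The axiom \<open>weak\<close> is the weak derivative tested against translated kernels
  only. The two functions live on the whole plane, but nothing relates them at points closer to the
  complement of \<open>A\<close> than the kernel radius.\<close>

locale mollifiable =
  fixes A :: "(real^2) set" and f :: "real^2 \<Rightarrow> complex" and g :: "2 \<Rightarrow> real^2 \<Rightarrow> complex"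
  assumes oA: "open A" and f: "L2b f" and g: "\<And>i. L2b (g i)"
    and weak: "\<And>h x i. 0 < h \<Longrightarrow> cball x h \<subseteq> A \<Longrightarrow> conv (pd i (kap h)) f x = mol h (g i) x"
begin

lemma pd_mol: "0 < h \<Longrightarrow> cball x h \<subseteq> A \<Longrightarrow> pd i (mol h f) x = mol h (g i) x"
  using conv_C1(2)[OF kap_C1c L2b_integrable[OF f]] weak by (simp add: mol_def)

lemma small_cballs:
  assumes "compact K" "K \<subseteq> A"
  obtains d where "d > 0" "\<And>h x. 0 < h \<Longrightarrow> h < d \<Longrightarrow> x \<in> K \<Longrightarrow> cball x h \<subseteq> A"
proof -
  obtain e where "e > 0" "(\<Union>x\<in>K. cball x e) \<subseteq> A"
    by (rule compact_subset_open_imp_cball_epsilon_subset[OF assms(1) oA assms(2)]) blast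
  then show thesis by (intro that[of e]) force+
qed

text \<open>Near the support of the gradient of \<psi>, the gradient of the mollified map is the
  mollified weak gradient. Everything then reduces to convergence in L2 under a bilinear
  form.\<close>

lemma flux_limit:
  assumes \<psi>: "C1c \<psi>" and K: "compact K" "K \<subseteq> A" "\<And>x i. x \<notin> K \<Longrightarrow> pd i \<psi> x = 0" and e: "e > 0"
  shows "\<exists>d>0. \<forall>h. 0 < h \<and> h < d \<longrightarrow> \<bar>(\<integral>x. bform \<psi> (mol h f) x \<partial>lborel) - flux \<psi> f g\<bar> \<le> e"
proof -
  obtain P1 where P1: "P1 > 0" "\<And>x. norm (pd 1 \<psi> x) \<le> P1" by (rule CC_bound[OF C1c_pd_CC[OF \<psi>, of 1]]) blast
  obtain P2 where P2: "P2 > 0" "\<And>x. norm (pd 2 \<psi> x) \<le> P2" by (rule CC_bound[OF C1c_pd_CC[OF \<psi>, of 2]]) blast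
  define P where "P = P1 + P2"
  have P0: "P > 0" using P1 P2 by (simp add: P_def)
  have P: "\<bar>pd i \<psi> x\<bar> \<le> P" for x i using P1(1) P2(1) P1(2)[of x] P2(2)[of x] exhaust_2[of i] by (auto simp: P_def)
  have pm: "pd i \<psi> \<in> borel_measurable borel" for i
    by (intro borel_measurable_continuous_onI C1_cont_pd C1c_C1[OF \<psi>])
  define E where "E = l2 f + l2 (g 1) + l2 (g 2) + 1"
  have E: "E > 0" "l2 f + l2 (g i) \<le> E" for i
    using l2_nonneg[of f] l2_nonneg[of "g 1"] l2_nonneg[of "g 2"] exhaust_2[of i] by (auto simp: E_def)
  \<comment> \<open>With this \<open>t\<close> and the \<open>s\<close> that follows, both terms of
    \<open>cr_L2_estimate\<close> are at most e/4.\<close>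
  define t where "t = e / (2 * P * E)"
  have t: "t > 0" using e P0 E by (simp add: t_def)
  define s where "s = e * t / (4 * P)"
  have s: "s > 0" using e t P0 by (simp add: s_def)
  obtain d0 where d0: "d0 > 0" "\<And>h. 0 < h \<Longrightarrow> h < d0 \<Longrightarrow> l2 (\<lambda>x. mol h f x - f x) < s"
    using mol_tendsto_L2[OF f s] by blast
  obtain d1 where d1: "d1 > 0" "\<And>h. 0 < h \<Longrightarrow> h < d1 \<Longrightarrow> l2 (\<lambda>x. mol h (g 1) x - g 1 x) < s"
    using mol_tendsto_L2[OF g s] by blast
  obtain d2 where d2: "d2 > 0" "\<And>h. 0 < h \<Longrightarrow> h < d2 \<Longrightarrow> l2 (\<lambda>x. mol h (g 2) x - g 2 x) < s"
    using mol_tendsto_L2[OF g s] by blast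
  obtain d3 where d3: "d3 > 0" "\<And>h x. 0 < h \<Longrightarrow> h < d3 \<Longrightarrow> x \<in> K \<Longrightarrow> cball x h \<subseteq> A" by (rule small_cballs[OF K(1,2)]) blast
  have "\<bar>(\<integral>x. bform \<psi> (mol h f) x \<partial>lborel) - flux \<psi> f g\<bar> \<le> e" if h: "0 < h" "h < min (min d0 d1) (min d2 d3)" for h
  proof -
    have hh: "h < d0" "h < d1" "h < d2" "h < d3" using h by auto
    have Lm: "L2b (mol h F)" if "L2b F" for F :: "real^2 \<Rightarrow> complex"
      by (rule CC_L2b[OF C1c_CC[OF mol_C1c[OF h(1) that]]])
    have "bform \<psi> (mol h f) x = pd 1 \<psi> x * cr (mol h f x) (mol h (g 2) x) - pd 2 \<psi> x * cr (mol h f x) (mol h (g 1) x)" for x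
    proof (cases "x \<in> K")
      case True
      then show ?thesis using pd_mol[OF h(1) d3(2)[OF h(1) hh(4) True]] by (simp add: bform_def)
    next
      case False then show ?thesis using K(3)[OF False] by (simp add: bform_def)
    qed
    then have "(\<integral>x. bform \<psi> (mol h f) x \<partial>lborel) = (\<integral>x. pd 1 \<psi> x * cr (mol h f x) (mol h (g 2) x) - pd 2 \<psi> x * cr (mol h f x) (mol h (g 1) x) \<partial>lborel)"
      by (simp only:)
    also have "\<dots> = (\<integral>x. pd 1 \<psi> x * cr (mol h f x) (mol h (g 2) x) \<partial>lborel) - (\<integral>x. pd 2 \<psi> x * cr (mol h f x) (mol h (g 1) x) \<partial>lborel)"
      by (intro Bochner_Integration.integral_diff cr_integrable[OF _ _ pm P] Lm f g)
    finally have 1: "(\<integral>x. bform \<psi> (mol h f) x \<partial>lborel) = (\<integral>x. pd 1 \<psi> x * cr (mol h f x) (mol h (g 2) x) \<partial>lborel) - (\<integral>x. pd 2 \<psi> x * cr (mol h f x) (mol h (g 1) x) \<partial>lborel)" .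
    have 2: "flux \<psi> f g = (\<integral>x. pd 1 \<psi> x * cr (f x) (g 2 x) \<partial>lborel) - (\<integral>x. pd 2 \<psi> x * cr (f x) (g 1 x) \<partial>lborel)"
      unfolding flux_def by (intro Bochner_Integration.integral_diff cr_integrable[OF _ _ pm P] f g)
    have est: "\<bar>(\<integral>x. pd i \<psi> x * cr (mol h f x) (mol h (g j) x) \<partial>lborel) - (\<integral>x. pd i \<psi> x * cr (f x) (g j x) \<partial>lborel)\<bar> \<le> e / 2" for i j
    proof -
      have gj: "l2 (\<lambda>x. mol h (g j) x - g j x) \<le> s" using d1(2)[OF h(1) hh(2)] d2(2)[OF h(1) hh(3)] exhaust_2[of j] by auto
      have "\<bar>(\<integral>x. pd i \<psi> x * cr (mol h f x) (mol h (g j) x) \<partial>lborel) - (\<integral>x. pd i \<psi> x * cr (f x) (g j x) \<partial>lborel)\<bar>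
        \<le> P * ((l2 (\<lambda>x. mol h f x - f x) + l2 (\<lambda>x. mol h (g j) x - g j x)) / (2 * t) + t / 2 * (l2 f + l2 (mol h (g j))))"
        by (rule cr_L2_estimate[OF f g Lm[OF f] Lm[OF g] pm P t])
      also have "\<dots> \<le> P * ((s + s) / (2 * t) + t / 2 * E)"
        using P0 t d0(2)[OF h(1) hh(1)] gj mol_l2[OF h(1) g[of j]] E(2)[of j]
        by (intro mult_left_mono add_mono divide_right_mono) auto
      also have "\<dots> = e / 2" using P0 t E e by (simp add: s_def field_simps) (simp add: t_def field_simps)
      finally show ?thesis .
    qed
    show ?thesis unfolding 1 2 using est[of 1 2] est[of 2 1] by linarith
  qed
  with d0(1) d1(1) d2(1) d3(1) show ?thesis by (intro exI[of _ "min (min d0 d1) (min d2 d3)"]) auto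
qed

text \<open>The Jacobian bound for mollifications, passed to the limit. It survives for weak
  gradients because it involves the supremum of \<open>R\<close> and not its gradient.\<close>

lemma flux_bound:
  assumes R: "C1c R" and K: "compact K" "K \<subseteq> A" "\<And>x. x \<notin> K \<Longrightarrow> R x = 0" and S: "\<And>x. \<bar>R x\<bar> \<le> S"
  shows "\<bar>flux R f g\<bar> \<le> S * (l2 (g 1) + l2 (g 2))"
proof (rule field_le_epsilon)
  fix e :: real assume e: "e > 0"
  have S0: "S \<ge> 0" using S[of 0] by linarith
  have z: "pd i R x = 0" if "x \<notin> K" for x i
    by (rule pd_zero_outside[OF compact_imp_closed[OF K(1)] K(3) that])
  obtain d where d: "d > 0" "\<And>h. 0 < h \<Longrightarrow> h < d \<Longrightarrow> \<bar>(\<integral>x. bform R (mol h f) x \<partial>lborel) - flux R f g\<bar> \<le> e"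
    using flux_limit[OF R K(1,2) z e] by blast
  obtain d3 where d3: "d3 > 0" "\<And>h x. 0 < h \<Longrightarrow> h < d3 \<Longrightarrow> x \<in> K \<Longrightarrow> cball x h \<subseteq> A" by (rule small_cballs[OF K(1,2)]) blast
  define h where "h = min d d3 / 2"
  have h: "0 < h" "h < d" "h < d3" using d(1) d3(1) by (auto simp: h_def)
  have Kb: "K \<in> sets borel" using compact_imp_closed[OF K(1)] by simp
  have Lg: "L2b (mol h (g i))" for i by (rule CC_L2b[OF C1c_CC[OF mol_C1c[OF h(1) g]]])
  have sq: "integrable lborel (\<lambda>x. (norm (mol h (g i) x))\<^sup>2)" for i using Lg[of i] by (simp add: L2b_def)
  have "\<bar>\<integral>x. bform R (mol h f) x \<partial>lborel\<bar> \<le> S * (\<integral>x. indicator K x * gsq (mol h f) x \<partial>lborel)"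
    by (rule bform_jacobian_bound[OF R mol_C1c[OF h(1) f] S Kb K(3)])
  also have "\<dots> \<le> S * (\<integral>x. (norm (mol h (g 1) x))\<^sup>2 + (norm (mol h (g 2) x))\<^sup>2 \<partial>lborel)"
  proof (intro mult_left_mono S0 integral_mono)
    show "integrable lborel (\<lambda>x. indicator K x * gsq (mol h f) x)"
      using integrable_mult_indicator[OF _ gsq_integrable[OF mol_C1c[OF h(1) f]], of K] Kb by simp
    show "integrable lborel (\<lambda>x. (norm (mol h (g 1) x))\<^sup>2 + (norm (mol h (g 2) x))\<^sup>2)"
      by (intro Bochner_Integration.integrable_add sq)
    show "indicator K x * gsq (mol h f) x \<le> (norm (mol h (g 1) x))\<^sup>2 + (norm (mol h (g 2) x))\<^sup>2" for x
      using pd_mol[OF h(1) d3(2)[OF h(1,3)], of x] by (auto simp: gsq_def indicator_def)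
  qed
  also have "(\<integral>x. (norm (mol h (g 1) x))\<^sup>2 + (norm (mol h (g 2) x))\<^sup>2 \<partial>lborel) = l2 (mol h (g 1)) + l2 (mol h (g 2))"
    unfolding l2_def by (intro Bochner_Integration.integral_add sq)
  also have "S * (l2 (mol h (g 1)) + l2 (mol h (g 2))) \<le> S * (l2 (g 1) + l2 (g 2))"
    by (intro mult_left_mono S0 add_mono mol_l2 h g)
  finally show "\<bar>flux R f g\<bar> \<le> S * (l2 (g 1) + l2 (g 2)) + e" using d(2)[OF h(1,2)] by linarith
qed

end

section \<open>Borel representatives of Sobolev functions\<close>

text \<open>The Sobolev function is Lebesgue measurable on \<open>A\<close> and matters only almost
  everywhere, whereas convolution and Tonelli above work with Borel functions on the plane. The
  representatives are extended by 0; the last conjunct is the definition of the weak derivative with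
  a translated kernel as test function.\<close>

lemma H1_borel_representative:
  fixes v :: "real^2 \<Rightarrow> real"
  assumes A: "open A" "bounded A" and v: "H1_on A v"
  shows "\<exists>F G. L2b F \<and> (\<forall>i. L2b (G i)) \<and> (\<forall>x. x \<notin> A \<longrightarrow> F x = 0 \<and> (\<forall>i. G i x = 0)) \<and>
    (AE x in lebesgue. x \<in> A \<longrightarrow> F x = v x) \<and> (\<forall>i. AE x in lebesgue. x \<in> A \<longrightarrow> G i x = weak_partial A i v x) \<and>
    (\<forall>h x i. 0 < h \<longrightarrow> cball x h \<subseteq> A \<longrightarrow> conv (pd i (kap h)) F x = mol h (G i) x)"
proof -
  have Ab: "A \<in> sets borel" using A(1) by simp
  have rep: "\<exists>F. L2b F \<and> (\<forall>x. x \<notin> A \<longrightarrow> F x = 0) \<and> (AE x in lebesgue. x \<in> A \<longrightarrow> F x = u x)" if u: "L2_on A u" for u :: "real^2 \<Rightarrow> real"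
  proof -
    have m: "(\<lambda>x. indicator A x *\<^sub>R u x) \<in> borel_measurable lebesgue"
      using u by (simp add: L2_on_def set_borel_measurable_def)
    from completion_ex_borel_measurable_real[OF m] obtain u' where u': "u' \<in> borel_measurable lborel" "AE x in lborel. indicator A x *\<^sub>R u x = u' x" by blast
    define F where "F x = indicator A x * u' x" for x
    have Fm: "F \<in> borel_measurable borel" unfolding F_def[abs_def] using u'(1) Ab by simp
    have ae: "AE x in lebesgue. indicator A x *\<^sub>R u x = u' x" using AE_completion[OF u'(2)] .
    have aeF: "AE x in lebesgue. x \<in> A \<longrightarrow> F x = u x" using ae by eventually_elim (auto simp: F_def)
    have "integrable lebesgue (\<lambda>x. indicator A x *\<^sub>R (u x)\<^sup>2)" using u by (simp add: L2_on_def set_integrable_def)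
    moreover have "AE x in lebesgue. indicator A x *\<^sub>R (u x)\<^sup>2 = (norm (F x))\<^sup>2"
      using aeF by eventually_elim (auto simp: F_def indicator_def)
    moreover have Fm2: "(\<lambda>x. (norm (F x))\<^sup>2) \<in> borel_measurable lborel" using Fm by simp
    ultimately have "integrable lebesgue (\<lambda>x. (norm (F x))\<^sup>2)"
      by (subst integrable_cong_AE[symmetric, of "\<lambda>x. indicator A x *\<^sub>R (u x)\<^sup>2"])
        (auto intro: borel_measurable_integrable measurable_completion)
    then have "integrable lborel (\<lambda>x. (norm (F x))\<^sup>2)" using integrable_completion[OF Fm2] by simp
    moreover have "bounded {x. F x \<noteq> 0}" by (rule bounded_subset[OF A(2)]) (auto simp: F_def indicator_def)
    ultimately have "L2b F" using Fm by (simp add: L2b_def)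
    then show ?thesis using aeF by (intro exI[of _ F]) (auto simp: F_def)
  qed
  have L: "L2_on A v" "\<And>i. L2_on A (weak_partial A i v)" and ex: "\<And>i. \<exists>g. has_weak_partial A i v g"
    using v by (auto simp: H1_on_def)
  have wp: "has_weak_partial A i v (weak_partial A i v)" for i
    unfolding weak_partial_def using someI_ex[OF ex] .
  obtain F where F: "L2b F" "\<And>x. x \<notin> A \<Longrightarrow> F x = 0" "AE x in lebesgue. x \<in> A \<longrightarrow> F x = v x" using rep[OF L(1)] by blast
  have "\<forall>i. \<exists>G. L2b G \<and> (\<forall>x. x \<notin> A \<longrightarrow> G x = 0) \<and> (AE x in lebesgue. x \<in> A \<longrightarrow> G x = weak_partial A i v x)"
    using rep[OF L(2)] by blast
  from choice[OF this] obtain G where G: "\<And>i. L2b (G i)" "\<And>i x. x \<notin> A \<Longrightarrow> G i x = 0" "\<And>i. AE x in lebesgue. x \<in> A \<longrightarrow> G i x = weak_partial A i v x" by blast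
  \<comment> \<open>As the representative vanishes outside \<open>A\<close>, the restricted Lebesgue
    integrals of the definition become plain convolution integrals.\<close>
  have conv: "(LINT y:A|lebesgue. u y * k y) = (\<integral>y. k y *\<^sub>R H y \<partial>lborel)"
    if u: "L2_on A u" and H: "L2b H" "\<And>x. x \<notin> A \<Longrightarrow> H x = 0" "AE x in lebesgue. x \<in> A \<longrightarrow> H x = u x" and k: "k \<in> borel_measurable borel"
    for u H k :: "real^2 \<Rightarrow> real"
  proof -
    have m: "(\<lambda>x. indicator A x *\<^sub>R u x) \<in> borel_measurable lebesgue"
      using u by (simp add: L2_on_def set_borel_measurable_def)
    have km: "k \<in> borel_measurable lebesgue" using k by (intro measurable_completion) simp
    have Hm: "H \<in> borel_measurable borel" using H(1) by (simp add: L2b_def)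
    have bm: "(\<lambda>y. k y *\<^sub>R H y) \<in> borel_measurable lborel" using k Hm by simp
    have "(LINT y:A|lebesgue. u y * k y) = (\<integral>y. (indicator A y *\<^sub>R u y) * k y \<partial>lebesgue)"
      unfolding set_lebesgue_integral_def by (intro Bochner_Integration.integral_cong) auto
    also have "\<dots> = (\<integral>y. k y *\<^sub>R H y \<partial>lebesgue)"
    proof (rule integral_cong_AE)
      show "(\<lambda>y. indicator A y *\<^sub>R u y * k y) \<in> borel_measurable lebesgue" using m km by (rule borel_measurable_times)
      show "(\<lambda>y. k y *\<^sub>R H y) \<in> borel_measurable lebesgue" using bm by (rule measurable_completion)
      show "AE y in lebesgue. indicator A y *\<^sub>R u y * k y = k y *\<^sub>R H y"
        using H(3)
      proof eventually_elim
        case (elim y) then show ?case using H(2)[of y] by (cases "y \<in> A") auto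
      qed
    qed
    also have "\<dots> = (\<integral>y. k y *\<^sub>R H y \<partial>lborel)" by (rule integral_completion[OF bm])
    finally show ?thesis .
  qed
  have weak: "conv (pd i (kap h)) F x = mol h (G i) x" if h: "0 < h" and c: "cball x h \<subseteq> A" for h x i
  proof -
    let ?\<phi> = "\<lambda>y. kap h (x - y)"
    have "test_function A ?\<phi>" by (rule kap_test_function[OF h c])
    then have e: "(LINT y:A|lebesgue. v y * partial_deriv i ?\<phi> y) = - (LINT y:A|lebesgue. weak_partial A i v y * ?\<phi> y)"
      using wp[of i] by (simp add: has_weak_partial_def)
    have pk: "partial_deriv i ?\<phi> y = - pd i (kap h) (x - y)" for y
      unfolding partial_deriv_eq_pd by (rule C1_reflect(2)[OF C1c_C1[OF kap_C1c[OF h]]])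
    have m1: "(\<lambda>y. - pd i (kap h) (x - y)) \<in> borel_measurable borel"
      using CC_reflect_measurable[OF C1c_pd_CC[OF kap_C1c[OF h]], of i x] by simp
    have m2: "?\<phi> \<in> borel_measurable borel" by (rule CC_reflect_measurable[OF C1c_CC[OF kap_C1c[OF h]]])
    have "(\<integral>y. (- pd i (kap h) (x - y)) *\<^sub>R F y \<partial>lborel) = - (\<integral>y. ?\<phi> y *\<^sub>R G i y \<partial>lborel)"
    proof -
      have "(LINT y:A|lebesgue. v y * (- pd i (kap h) (x - y))) = (\<integral>y. (- pd i (kap h) (x - y)) *\<^sub>R F y \<partial>lborel)"
        by (rule conv[OF L(1) F m1])
      moreover have "(LINT y:A|lebesgue. weak_partial A i v y * ?\<phi> y) = (\<integral>y. ?\<phi> y *\<^sub>R G i y \<partial>lborel)"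
        by (rule conv[OF L(2) G m2])
      ultimately show ?thesis using e unfolding pk by (simp only:)
    qed
    then show ?thesis by (simp add: conv_def mol_def)
  qed
  show ?thesis
    by (intro exI[of _ F] exI[of _ G] conjI allI impI F G weak)
qed

lemma L2b_Complex:
  assumes "L2b F1" "L2b F2"
  shows "L2b (\<lambda>x. Complex (F1 x) (F2 x))"
proof -
  have [measurable]: "F1 \<in> borel_measurable borel" "F2 \<in> borel_measurable borel" using assms by (auto simp: L2b_def)
  have "(\<lambda>x. Complex (F1 x) (F2 x)) \<in> borel_measurable borel" unfolding Complex_eq by measurable
  moreover have "bounded ({x. F1 x \<noteq> 0} \<union> {x. F2 x \<noteq> 0})" using assms by (simp add: L2b_def)
  then have "bounded {x. Complex (F1 x) (F2 x) \<noteq> 0}"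
    by (rule bounded_subset) (auto simp: complex_eq_iff)
  moreover have "integrable lborel (\<lambda>x. (norm (Complex (F1 x) (F2 x)))\<^sup>2)"
    using assms by (simp add: cmod_power2 L2b_def)
  ultimately show ?thesis by (simp add: L2b_def)
qed

lemma conv_Complex:
  assumes "CC k" "integrable lborel f"
  shows "conv k f x = Complex (conv k (\<lambda>y. Re (f y)) x) (conv k (\<lambda>y. Im (f y)) x)"
  using integral_bounded_linear[OF bounded_linear_Re conv_integrable[OF assms], of x]
    integral_bounded_linear[OF bounded_linear_Im conv_integrable[OF assms], of x]
  by (simp add: conv_def complex_eq_iff)

lemma nn_lebesgue_to_lborel:
  fixes H :: "real^2 \<Rightarrow> ennreal"
  assumes "H \<in> borel_measurable borel" "AE x in lebesgue. H x = h x * indicator A x"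
  shows "(\<integral>\<^sup>+x. H x \<partial>lborel) = (\<integral>\<^sup>+x\<in>A. h x \<partial>lebesgue)"
proof -
  have "(\<integral>\<^sup>+x. H x \<partial>lborel) = (\<integral>\<^sup>+x. H x \<partial>lebesgue)"
    using assms(1) by (intro nn_integral_completion[symmetric])
  also have "\<dots> = (\<integral>\<^sup>+x\<in>A. h x \<partial>lebesgue)" by (rule nn_integral_cong_AE[OF assms(2)])
  finally show ?thesis .
qed

lemma ennreal_scale_le:
  assumes "ennreal c * I \<le> ennreal L" "c > 0" "L \<ge> 0"
  shows "I \<le> ennreal (L / c)"
proof -
  have "I = ennreal (1 / c) * (ennreal c * I)"
    using assms(2) by (simp flip: mult.assoc ennreal_mult)
  also have "\<dots> \<le> ennreal (1 / c) * ennreal L" by (intro mult_left_mono assms(1)) simp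
  also have "\<dots> = ennreal (L / c)" using assms by (simp flip: ennreal_mult)
  finally show ?thesis .
qed

section \<open>The approximate bulk degree as a limit of truncated fluxes\<close>

context annulus
begin

text \<open>The integrand of 2\<pi> times \<open>abdeg\<close> in complex notation. No bound on the
  gradient of \<open>V\<close> near the boundary is at hand, so its integrability is left to a case
  distinction.\<close>

definition Phi :: "(real^2 \<Rightarrow> complex) \<Rightarrow> (2 \<Rightarrow> real^2 \<Rightarrow> complex) \<Rightarrow> real^2 \<Rightarrow> real" where
  "Phi f g x = indicator A x * (pd 1 V x * cr (f x) (g 2 x) - pd 2 V x * cr (f x) (g 1 x))"

lemma pdV_measurable: "(\<lambda>x. indicator A x * pd i V x) \<in> borel_measurable borel"
  using borel_measurable_continuous_on_indicator[OF A_borel pdV_cont[of i]] by simp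

text \<open>Finiteness of the extended-valued energy makes the potential term integrable. The
  factors 2 and 4 * \<epsilon>^2 undo the coefficients 1/2 and 1 / (4 * \<epsilon>^2) of the
  energy.\<close>

lemma complex_representative:
  fixes u :: "real^2 \<Rightarrow> real^2"
  assumes u: "H1_vec_on A u" and E: "GL_energy A \<epsilon> u \<le> ennreal \<Lambda>" and pos: "\<epsilon> > 0" "\<Lambda> > 0"
  shows "\<exists>f g. mollifiable A f g \<and> (\<forall>x. x \<notin> A \<longrightarrow> f x = 0) \<and> l2 (g 1) + l2 (g 2) \<le> 2 * \<Lambda> \<and>
    integrable lborel (\<lambda>x. indicator A x * ((norm (f x))\<^sup>2 - 1)\<^sup>2) \<and>
    (\<integral>x. indicator A x * ((norm (f x))\<^sup>2 - 1)\<^sup>2 \<partial>lborel) \<le> 4 * \<epsilon>\<^sup>2 * \<Lambda> \<and>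
    abdeg A V u = 1 / (2 * pi) * (\<integral>x. Phi f g x \<partial>lborel)"
proof -
  have h: "H1_on A (\<lambda>x. u x $ j)" for j using u by (simp add: H1_vec_on_def)
  obtain F1 G1 where FG1: "L2b F1" "\<And>i. L2b (G1 i)" "\<And>x. x \<notin> A \<Longrightarrow> F1 x = 0" "\<And>x i. x \<notin> A \<Longrightarrow> G1 i x = 0"
    and ae1: "AE x in lebesgue. x \<in> A \<longrightarrow> F1 x = u x $ 1" "\<And>i. AE x in lebesgue. x \<in> A \<longrightarrow> G1 i x = weak_partial A i (\<lambda>x. u x $ 1) x"
    and wk1: "\<And>h x i. 0 < h \<Longrightarrow> cball x h \<subseteq> A \<Longrightarrow> conv (pd i (kap h)) F1 x = mol h (G1 i) x"
    using H1_borel_representative[OF oA bA h[of 1]] by blast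
  obtain F2 G2 where FG2: "L2b F2" "\<And>i. L2b (G2 i)" "\<And>x. x \<notin> A \<Longrightarrow> F2 x = 0" "\<And>x i. x \<notin> A \<Longrightarrow> G2 i x = 0"
    and ae2: "AE x in lebesgue. x \<in> A \<longrightarrow> F2 x = u x $ 2" "\<And>i. AE x in lebesgue. x \<in> A \<longrightarrow> G2 i x = weak_partial A i (\<lambda>x. u x $ 2) x"
    and wk2: "\<And>h x i. 0 < h \<Longrightarrow> cball x h \<subseteq> A \<Longrightarrow> conv (pd i (kap h)) F2 x = mol h (G2 i) x"
    using H1_borel_representative[OF oA bA h[of 2]] by blast
  define f where "f x = Complex (F1 x) (F2 x)" for x
  define g where "g i x = Complex (G1 i x) (G2 i x)" for i x
  have Lf: "L2b f" unfolding f_def[abs_def] by (rule L2b_Complex[OF FG1(1) FG2(1)])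
  have Lg: "L2b (g i)" for i unfolding g_def[abs_def] by (rule L2b_Complex[OF FG1(2) FG2(2)])
  have moll: "mollifiable A f g"
  proof
    show "open A" by (rule oA)
    show "L2b f" "L2b (g i)" for i by (rule Lf, rule Lg)
    show "conv (pd i (kap h)) f x = mol h (g i) x" if hx: "0 < h" "cball x h \<subseteq> A" for h x i
      unfolding mol_def conv_Complex[OF C1c_pd_CC[OF kap_C1c[OF hx(1)]] L2b_integrable[OF Lf]]
        conv_Complex[OF C1c_CC[OF kap_C1c[OF hx(1)]] L2b_integrable[OF Lg]]
      using wk1[OF hx, of i] wk2[OF hx, of i] by (simp add: f_def g_def mol_def)
  qed
  have [measurable]: "f \<in> borel_measurable borel" "g i \<in> borel_measurable borel"
    "F1 \<in> borel_measurable borel" "F2 \<in> borel_measurable borel" "G1 i \<in> borel_measurable borel" "G2 i \<in> borel_measurable borel" for i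
    using Lf Lg FG1 FG2 by (auto simp: L2b_def)
  have [measurable]: "A \<in> sets borel" by (rule A_borel)
  let ?I1 = "\<integral>\<^sup>+x\<in>A. ennreal (\<Sum>i\<in>UNIV. (norm (weak_partial_vec A i u x))\<^sup>2) \<partial>lebesgue"
  let ?I2 = "\<integral>\<^sup>+x\<in>A. ennreal (((norm (u x))\<^sup>2 - 1)\<^sup>2) \<partial>lebesgue"
  have "ennreal (1/2) * ?I1 \<le> GL_energy A \<epsilon> u" "ennreal (1 / (4 * \<epsilon>\<^sup>2)) * ?I2 \<le> GL_energy A \<epsilon> u"
    unfolding GL_energy_def by (simp_all add: add_increasing add_increasing2)
  then have "ennreal (1/2) * ?I1 \<le> ennreal \<Lambda>" "ennreal (1 / (4 * \<epsilon>\<^sup>2)) * ?I2 \<le> ennreal \<Lambda>" using E by auto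
  then have I1: "?I1 \<le> ennreal (\<Lambda> / (1/2))" and I2: "?I2 \<le> ennreal (\<Lambda> / (1 / (4 * \<epsilon>\<^sup>2)))"
    by (intro ennreal_scale_le; use pos in simp)+
  have "ennreal (l2 (g 1) + l2 (g 2)) = (\<integral>\<^sup>+x. ennreal ((norm (g 1 x))\<^sup>2) \<partial>lborel) + (\<integral>\<^sup>+x. ennreal ((norm (g 2 x))\<^sup>2) \<partial>lborel)"
    unfolding l2_ennreal[OF Lg] by (simp add: l2_nonneg)
  also have "\<dots> = (\<integral>\<^sup>+x. ennreal ((norm (g 1 x))\<^sup>2) + ennreal ((norm (g 2 x))\<^sup>2) \<partial>lborel)"
    by (rule nn_integral_add[symmetric]) measurable
  also have "\<dots> = ?I1"
  proof (rule nn_lebesgue_to_lborel)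
    show "AE x in lebesgue. ennreal ((norm (g 1 x))\<^sup>2) + ennreal ((norm (g 2 x))\<^sup>2) = ennreal (\<Sum>i\<in>UNIV. (norm (weak_partial_vec A i u x))\<^sup>2) * indicator A x"
      using ae1(2)[of 1] ae1(2)[of 2] ae2(2)[of 1] ae2(2)[of 2]
    proof eventually_elim
      case (elim x)
      show ?case
      proof (cases "x \<in> A")
        case True
        then show ?thesis using elim
          by (simp add: sum_2 norm2_sq weak_partial_vec_def g_def cmod_power2)
      next
        case False
        then show ?thesis using FG1(4) FG2(4) by (simp add: g_def cmod_power2)
      qed
    qed
  qed measurable
  finally have "ennreal (l2 (g 1) + l2 (g 2)) \<le> ennreal (\<Lambda> / (1/2))" using I1 by simp
  then have e1: "l2 (g 1) + l2 (g 2) \<le> 2 * \<Lambda>" using pos by (simp add: mult.commute)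
  define Q where "Q x = indicator A x * ((norm (f x))\<^sup>2 - 1)\<^sup>2" for x
  have Qm: "Q \<in> borel_measurable borel" unfolding Q_def[abs_def] by measurable
  have "(\<integral>\<^sup>+x. ennreal (Q x) \<partial>lborel) = ?I2"
  proof (rule nn_lebesgue_to_lborel)
    show "AE x in lebesgue. ennreal (Q x) = ennreal (((norm (u x))\<^sup>2 - 1)\<^sup>2) * indicator A x"
      using ae1(1) ae2(1)
      by eventually_elim (auto simp: Q_def indicator_def f_def cmod_power2 norm2_sq)
  qed (use Qm in measurable)
  then have Q2: "(\<integral>\<^sup>+x. ennreal (Q x) \<partial>lborel) \<le> ennreal (4 * \<epsilon>\<^sup>2 * \<Lambda>)" using I2 by (simp add: mult.commute)
  have Qi: "integrable lborel Q"
  proof (rule integrableI_nonneg)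
    show "Q \<in> borel_measurable lborel" using Qm by simp
    show "AE x in lborel. 0 \<le> Q x" by (simp add: Q_def)
    show "(\<integral>\<^sup>+x. ennreal (Q x) \<partial>lborel) < \<infinity>" using Q2 by (rule le_less_trans) simp
  qed
  have Q3: "(\<integral>\<^sup>+x. ennreal (Q x) \<partial>lborel) = ennreal (\<integral>x. Q x \<partial>lborel)"
    by (rule nn_integral_eq_integral[OF Qi]) (simp add: Q_def)
  have "ennreal (\<integral>x. Q x \<partial>lborel) \<le> ennreal (4 * \<epsilon>\<^sup>2 * \<Lambda>)"
    using Q2 unfolding Q3 .
  then have e2: "(\<integral>x. Q x \<partial>lborel) \<le> 4 * \<epsilon>\<^sup>2 * \<Lambda>" using pos by simp
  have Phim: "Phi f g \<in> borel_measurable borel"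
  proof -
    have "Phi f g = (\<lambda>x. (indicator A x * pd 1 V x) * cr (f x) (g 2 x) - (indicator A x * pd 2 V x) * cr (f x) (g 1 x))"
      by (simp add: Phi_def fun_eq_iff algebra_simps)
    then show ?thesis unfolding cr_alt using pdV_measurable[of 1] pdV_measurable[of 2] by simp
  qed
  have wm: "(\<lambda>x. indicator A x *\<^sub>R v x) \<in> borel_measurable lebesgue" if "L2_on A v" for v :: "real^2 \<Rightarrow> real"
    using that by (simp add: L2_on_def set_borel_measurable_def)
  define U where "U j x = indicator A x *\<^sub>R (u x $ j)" for j x
  define W where "W i j x = indicator A x *\<^sub>R weak_partial A i (\<lambda>x. u x $ j) x" for i j x
  have Um: "U j \<in> borel_measurable lebesgue" and Wm: "W i j \<in> borel_measurable lebesgue" for i j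
    using h[of j] wm unfolding U_def[abs_def] W_def[abs_def] H1_on_def by blast+
  have pm: "(\<lambda>x. indicator A x * pd i V x) \<in> borel_measurable lebesgue" for i
    using pdV_measurable[of i] by (intro measurable_completion) simp
  let ?X = "\<lambda>x. indicator A x *\<^sub>R cross2 (u x) (partial_deriv 1 V x *\<^sub>R weak_partial_vec A 2 u x - partial_deriv 2 V x *\<^sub>R weak_partial_vec A 1 u x)"
  have Xeq: "?X x = U 1 x * ((indicator A x * pd 1 V x) * W 2 2 x - (indicator A x * pd 2 V x) * W 1 2 x)
      - U 2 x * ((indicator A x * pd 1 V x) * W 2 1 x - (indicator A x * pd 2 V x) * W 1 1 x)" for x
    by (auto simp: indicator_def U_def W_def cross2_def weak_partial_vec_def partial_deriv_eq_pd)
  have Xm: "?X \<in> borel_measurable lebesgue" unfolding Xeq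
    by (intro borel_measurable_diff borel_measurable_times Um Wm pm)
  have "(\<integral>x. ?X x \<partial>lebesgue) = (\<integral>x. Phi f g x \<partial>lebesgue)"
  proof (rule integral_cong_AE[OF Xm])
    show "Phi f g \<in> borel_measurable lebesgue" using Phim by (intro measurable_completion) simp
    show "AE x in lebesgue. ?X x = Phi f g x"
      using ae1(1) ae2(1) ae1(2)[of 1] ae1(2)[of 2] ae2(2)[of 1] ae2(2)[of 2]
      by eventually_elim (auto simp: indicator_def Phi_def cross2_def weak_partial_vec_def partial_deriv_eq_pd f_def g_def cr_alt algebra_simps)
  qed
  also have "\<dots> = (\<integral>x. Phi f g x \<partial>lborel)" by (rule integral_completion) (use Phim in simp)
  finally have "abdeg A V u = 1 / (2 * pi) * (\<integral>x. Phi f g x \<partial>lborel)"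
    by (simp add: abdeg_def set_lebesgue_integral_def)
  moreover have "f x = 0" if "x \<notin> A" for x using FG1(3)[OF that] FG2(3)[OF that] by (simp add: f_def complex_eq_iff)
  ultimately show ?thesis
    using moll e1 Qi e2 unfolding Q_def[abs_def] by blast
qed

text \<open>\<open>flux_bound\<close> compares the truncations at levels \<open>a\<close> and b <= a
  with an error that does not depend on \<open>b\<close>. As b tends to 0, the flux at level
  \<open>b\<close> tends to minus the integral of \<open>Phi\<close> by dominated convergence, since
  \<open>chi'\<close> is bounded by 2.\<close>

lemma flux_Psi_near_bulk:
  assumes moll: "mollifiable A f g" and a: "0 < a" "a \<le> 1/6" and int: "integrable lborel (Phi f g)"
  shows "\<bar>(\<integral>x. Phi f g x \<partial>lborel) + flux (Psi a) f g\<bar> \<le> 12 * a * (l2 (g 1) + l2 (g 2))"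
proof -
  interpret mollifiable A f g by fact
  have step: "\<bar>flux (Psi b) f g - flux (Psi a) f g\<bar> \<le> 12 * a * (l2 (g 1) + l2 (g 2))" if b: "0 < b" "b \<le> a" for b
  proof -
    have b6: "b \<le> 1/6" using b a by simp
    note Cb = Psi_C1c[OF b(1) b6] and Ca = Psi_C1c[OF a]
    let ?R = "\<lambda>x. Psi b x - Psi a x"
    have C: "C1c ?R" by (rule C1c_diff_fun[OF Cb Ca])
    \<comment> \<open>Below \<open>b\<close> and above \<open>1 - b\<close> both truncations have
      reached the same constant, because b <= a.\<close>
    have z: "?R x = 0" if "x \<notin> Kset b" for x
      using that b a chi_low(1)[OF b(1) b6, of "V x"] chi_high(1)[OF b(1) b6, of "V x"]
        chi_low(1)[OF a, of "V x"] chi_high(1)[OF a, of "V x"]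
      by (auto simp: Psi_def Kset_def)
    have "\<bar>flux ?R f g\<bar> \<le> 12 * a * (l2 (g 1) + l2 (g 2))"
      by (rule flux_bound[OF C Kset_compact[OF b(1)] Kset_sub z Psi_diff_bound[OF b a(2)]])
    moreover have "flux ?R f g = flux (Psi b) f g - flux (Psi a) f g"
    proof -
      have i: "integrable lborel (\<lambda>x. pd i \<psi> x * cr (f x) (g j x))" if \<psi>: "C1c \<psi>" for \<psi> i j
      proof -
        obtain M where "M > 0" "\<And>x. norm (pd i \<psi> x) \<le> M" by (rule CC_bound[OF C1c_pd_CC[OF \<psi>, of i]]) blast
        then show ?thesis
          by (intro cr_integrable[OF f g, where M=M] borel_measurable_continuous_onI C1_cont_pd C1c_C1[OF \<psi>]) simp
      qed
      have pR: "pd i ?R x = pd i (Psi b) x - pd i (Psi a) x" for i x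
        by (rule C1_diff_fun(2)[OF C1c_C1[OF Cb] C1c_C1[OF Ca]])
      show ?thesis unfolding flux_def pR left_diff_distrib using i[OF Cb] i[OF Ca] by simp
    qed
    ultimately show ?thesis by simp
  qed
  define b where "b n = a / real (Suc n)" for n
  have b: "0 < b n" "b n \<le> a" for n using a by (auto simp: b_def field_simps)
  have b0: "b \<longlonglongrightarrow> 0" unfolding b_def[abs_def]
    using tendsto_mult[OF tendsto_const[of a] LIMSEQ_inverse_real_of_nat] by (simp add: divide_inverse)
  have fl: "flux (Psi (b n)) f g = (\<integral>x. - (chi' (b n) (V x) * Phi f g x) \<partial>lborel)" for n
  proof -
    have b6: "b n \<le> 1/6" using b(2)[of n] a by simp
    have "pd 1 (Psi (b n)) x * cr (f x) (g 2 x) - pd 2 (Psi (b n)) x * cr (f x) (g 1 x) = - (chi' (b n) (V x) * Phi f g x)" for x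
      unfolding Psi_pd[OF b(1) b6] by (simp add: dPsi_def Phi_def algebra_simps)
    then show ?thesis by (simp only: flux_def)
  qed
  have "(\<lambda>n. \<integral>x. - (chi' (b n) (V x) * Phi f g x) \<partial>lborel) \<longlonglongrightarrow> (\<integral>x. - Phi f g x \<partial>lborel)"
  proof (rule integral_dominated_convergence[where w="\<lambda>x. 2 * norm (Phi f g x)"])
    show "(\<lambda>x. - Phi f g x) \<in> borel_measurable lborel" using int by (auto intro: borel_measurable_integrable)
    show "integrable lborel (\<lambda>x. 2 * norm (Phi f g x))" using int by simp
    have m: "(\<lambda>x. - (chi' (b n) (V x) * Phi f g x)) = (\<lambda>x. pd 1 (Psi (b n)) x * cr (f x) (g 2 x) - pd 2 (Psi (b n)) x * cr (f x) (g 1 x))" for n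
    proof -
      have b6: "b n \<le> 1/6" using b(2)[of n] a by simp
      show ?thesis unfolding Psi_pd[OF b(1) b6] by (auto simp: fun_eq_iff dPsi_def Phi_def algebra_simps)
    qed
    show "(\<lambda>x. - (chi' (b n) (V x) * Phi f g x)) \<in> borel_measurable lborel" for n
    proof -
      have b6: "b n \<le> 1/6" using b(2)[of n] a by simp
      have [measurable]: "f \<in> borel_measurable borel" "g i \<in> borel_measurable borel" for i using f g by (auto simp: L2b_def)
      have [measurable]: "pd i (Psi (b n)) \<in> borel_measurable borel" for i
        by (intro borel_measurable_continuous_onI C1_cont_pd C1c_C1[OF Psi_C1c[OF b(1) b6]])
      show ?thesis unfolding m cr_alt by measurable
    qed
    show "AE x in lborel. norm (- (chi' (b n) (V x) * Phi f g x)) \<le> 2 * norm (Phi f g x)" for n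
    proof (rule AE_I2)
      fix x
      have b6: "b n \<le> 1/6" using b(2)[of n] a by simp
      have "chi' (b n) (V x) * \<bar>Phi f g x\<bar> \<le> 2 * \<bar>Phi f g x\<bar>" using chi'_bound(2)[OF b(1) b6] by (intro mult_right_mono) auto
      then show "norm (- (chi' (b n) (V x) * Phi f g x)) \<le> 2 * norm (Phi f g x)"
        using chi'_bound(1)[OF b(1) b6, of "V x"] by (simp add: abs_mult)
    qed
    show "AE x in lborel. (\<lambda>n. - (chi' (b n) (V x) * Phi f g x)) \<longlonglongrightarrow> - Phi f g x"
    proof (rule AE_I2)
      fix x
      show "(\<lambda>n. - (chi' (b n) (V x) * Phi f g x)) \<longlonglongrightarrow> - Phi f g x"
      \<comment> \<open>Where \<open>V\<close> is strictly between 0 and 1 the factor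
        \<open>chi'\<close> tends to 1; at the remaining points of \<open>A\<close> the gradient of
        \<open>V\<close>, and with it \<open>Phi\<close>, is 0.\<close>
      proof (cases "x \<in> A \<and> V x \<noteq> 0 \<and> V x \<noteq> 1")
        case False
        then have "Phi f g x = 0"
          using grad_zero_extremal[of x 1] grad_zero_extremal[of x 2] by (cases "x \<in> A") (auto simp: Phi_def)
        then show ?thesis by simp
      next
        case True
        then have V: "0 < V x" "V x < 1" using V_ge_0[of x] V_le_1[of x] by auto
        define m where "m = min (V x) (1 - V x) / 2"
        have m: "m > 0" using V by (simp add: m_def)
        have "\<forall>\<^sub>F n in sequentially. b n < m" using order_tendstoD(2)[OF b0 m] .
        then have ev: "\<forall>\<^sub>F n in sequentially. 1 / (1 - 3 * b n) = chi' (b n) (V x)"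
        proof eventually_elim
          case (elim n)
          have "2 * b n \<le> V x" "V x \<le> 1 - 2 * b n" using elim by (auto simp: m_def min_def split: if_splits)
          then show ?case using chi'_mid[OF b(1)[of n], of "V x"] b(2)[of n] a by simp
        qed
        have "(\<lambda>n. 1 / (1 - 3 * b n)) \<longlonglongrightarrow> 1 / (1 - 3 * 0)" by (intro tendsto_intros b0) simp
        then have "(\<lambda>n. chi' (b n) (V x)) \<longlonglongrightarrow> 1" using Lim_transform_eventually[OF _ ev] by simp
        from tendsto_minus[OF tendsto_mult[OF this tendsto_const[of "Phi f g x"]]] show ?thesis by simp
      qed
    qed
  qed
  then have lim: "(\<lambda>n. flux (Psi (b n)) f g - flux (Psi a) f g) \<longlonglongrightarrow> - (\<integral>x. Phi f g x \<partial>lborel) - flux (Psi a) f g"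
    unfolding fl[symmetric] by (intro tendsto_intros) simp
  have "\<bar>- (\<integral>x. Phi f g x \<partial>lborel) - flux (Psi a) f g\<bar> \<le> 12 * a * (l2 (g 1) + l2 (g 2))"
    by (rule LIMSEQ_le_const2[OF tendsto_rabs[OF lim]]) (use step[OF b] in blast)
  then show ?thesis by (simp add: abs_minus_commute) 
qed

end

section \<open>Avoiding half-integers\<close>

text \<open>At a half-integer the quantity in the assumption is an odd multiple of \<pi>, hence of
  absolute value at least \<pi> > 2.\<close>

lemma half_integer_excluded:
  fixes x :: real and k d :: int
  assumes "\<bar>2 * pi * x + 2 * pi * of_int k\<bar> \<le> 2"
  shows "x \<noteq> of_int d - 1/2" "x \<noteq> of_int d + 1/2"
proof -
  have *: False if "x = of_int m + 1/2" for m :: int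
  proof -
    have "2 * pi * x + 2 * pi * of_int k = pi * (2 * of_int (m + k) + 1)" using that by (simp add: algebra_simps)
    also have "\<bar>\<dots>\<bar> = pi * \<bar>2 * of_int (m + k) + 1\<bar>" by (simp add: abs_mult)
    also have "\<dots> \<ge> pi * 1"
    proof (rule mult_left_mono)
      have "\<bar>2 * (m + k) + 1\<bar> \<ge> 1" by presburger
      then have "\<bar>real_of_int (2 * (m + k) + 1)\<bar> \<ge> 1" by linarith
      then show "1 \<le> \<bar>2 * real_of_int (m + k) + 1\<bar>" by simp
    qed simp
    finally show False using assms pi_gt3 by linarith
  qed
  show "x \<noteq> of_int d + 1/2" using *[of d] by blast
  show "x \<noteq> of_int d - 1/2" using *[of "d - 1"] by auto
qed

context annulus
begin

text \<open>The error 2 is the sum of 1/2 for truncating \<open>V\<close> at level \<open>a\<close>,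
  1/2 for passing from the Sobolev map to a mollification, and 1 for
  \<open>near_integer_flux\<close>.\<close>

lemma abdeg_near_integer:
  assumes \<Lambda>: "\<Lambda> > 0"
  shows "\<exists>\<epsilon>0>0. \<forall>\<epsilon> u. 0 < \<epsilon> \<and> \<epsilon> < \<epsilon>0 \<and> H1_vec_on A u \<and> GL_energy A \<epsilon> u \<le> ennreal \<Lambda> \<longrightarrow>
     (\<exists>k::int. \<bar>2 * pi * abdeg A V u + 2 * pi * of_int k\<bar> \<le> 2)"
proof -
  \<comment> \<open>The weak gradient contributes at most 2 * \<Lambda>, so the truncation error is
    at most 24 * a * \<Lambda> <= 1/2.\<close>
  define a where "a = min (1/6) (1 / (48 * \<Lambda>))"
  have a: "0 < a" "a \<le> 1/6" "a \<le> 1 / (48 * \<Lambda>)" using \<Lambda> by (auto simp: a_def)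
  have a12: "12 * a * (2 * \<Lambda>) \<le> 1/2"
  proof -
    have "24 * \<Lambda> * a \<le> 24 * \<Lambda> * (1 / (48 * \<Lambda>))" using a \<Lambda> by (intro mult_left_mono) auto
    also have "\<dots> = 1 / 2" using \<Lambda> by simp
    finally show ?thesis by (simp add: mult_ac)
  qed
  let ?K = "Kset a" and ?\<psi> = "Psi a"
  note K = Kset_compact[OF a(1)] and C\<psi> = Psi_C1c[OF a(1,2)]
  have pz: "pd i ?\<psi> x = 0" if "x \<notin> ?K" for x i using dPsi_zero[OF a(1,2) that] Psi_pd[OF a(1,2)] by simp
  obtain \<zeta> :: "real^2 \<Rightarrow> real" and \<rho> where \<rho>: "\<rho> > 0" and \<zeta>: "C1c \<zeta>" "\<And>x. x \<in> nbhd ?K \<rho> \<Longrightarrow> \<zeta> x = 1"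
    "\<And>x. \<bar>\<zeta> x\<bar> \<le> 1" and N3: "nbhd ?K (3 * \<rho>) \<subseteq> A" and \<zeta>0: "\<And>x. x \<notin> nbhd ?K (3 * \<rho>) \<Longrightarrow> \<zeta> x = 0"
    by (rule cutoff_exists[OF K oA Kset_sub]) blast
  have cN: "compact (nbhd ?K r)" for r by (rule nbhd_compact[OF K])
  obtain Z1 where Z1: "Z1 > 0" "\<And>x. norm (pd 1 \<zeta> x) \<le> Z1" by (rule CC_bound[OF C1c_pd_CC[OF \<zeta>(1), of 1]]) blast
  obtain Z2 where Z2: "Z2 > 0" "\<And>x. norm (pd 2 \<zeta> x) \<le> Z2" by (rule CC_bound[OF C1c_pd_CC[OF \<zeta>(1), of 2]]) blast
  define Z where "Z = Z1\<^sup>2 + Z2\<^sup>2"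
  have Z: "Z \<ge> 0" "(pd 1 \<zeta> x)\<^sup>2 + (pd 2 \<zeta> x)\<^sup>2 \<le> Z" for x
  proof -
    have "\<bar>pd 1 \<zeta> x\<bar>\<^sup>2 \<le> Z1\<^sup>2" "\<bar>pd 2 \<zeta> x\<bar>\<^sup>2 \<le> Z2\<^sup>2" using Z1(2)[of x] Z2(2)[of x] by (intro power_mono; simp)+
    then show "(pd 1 \<zeta> x)\<^sup>2 + (pd 2 \<zeta> x)\<^sup>2 \<le> Z" by (simp add: Z_def)
  qed (simp add: Z_def)
  \<comment> \<open>Bounds the Dirichlet energy of the cut-off mollification: 4 * \<Lambda> stems
    from the weak gradient, the rest from the gradient of \<zeta> times the bound on
    \<open>l2 f\<close>.\<close>
  define \<Lambda>' where "\<Lambda>' = 4 * \<Lambda> + 2 * Z * (2 * measure lborel A + 4 * \<Lambda>)"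
  have \<Lambda>': "\<Lambda>' > 0" using \<Lambda> Z(1) by (auto simp: \<Lambda>'_def intro!: add_pos_nonneg mult_nonneg_nonneg add_nonneg_nonneg)
  obtain \<sigma> where \<sigma>: "\<sigma> > 0" and near: "\<And>U::real^2 \<Rightarrow> complex. C1c U \<Longrightarrow> dir U \<le> \<Lambda>' \<Longrightarrow>
     (\<integral>x. indicator (nbhd ?K \<rho>) x * (1 - norm (U x))\<^sup>2 \<partial>lborel) \<le> \<sigma> \<Longrightarrow>
     (\<exists>k::int. \<bar>(\<integral>x. bform ?\<psi> U x \<partial>lborel) - 2 * pi * of_int k\<bar> \<le> 1)"
    using near_integer_flux[OF C\<psi> K Psi_int[OF a(1,2)] pz \<rho> \<Lambda>' zero_less_one] by blast
  \<comment> \<open>The 16 lets the potential term use at most half of \<sigma> and leaves the other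
    half to the mollification error. The cap 1 frees the bound on \<open>l2 f\<close> from
    \<epsilon>.\<close>
  define \<epsilon>0 where "\<epsilon>0 = min 1 (sqrt (\<sigma> / (16 * \<Lambda>)))"
  have \<epsilon>0: "\<epsilon>0 > 0" using \<sigma> \<Lambda> by (simp add: \<epsilon>0_def)
  show ?thesis
  proof (intro exI[of _ \<epsilon>0] conjI \<epsilon>0 allI impI)
    fix \<epsilon> and u :: "real^2 \<Rightarrow> real^2"
    assume "0 < \<epsilon> \<and> \<epsilon> < \<epsilon>0 \<and> H1_vec_on A u \<and> GL_energy A \<epsilon> u \<le> ennreal \<Lambda>"
    then have eps: "0 < \<epsilon>" "\<epsilon> < \<epsilon>0" and u: "H1_vec_on A u" "GL_energy A \<epsilon> u \<le> ennreal \<Lambda>" by auto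
    have eps1: "\<epsilon>\<^sup>2 \<le> 1" "\<epsilon>\<^sup>2 * (16 * \<Lambda>) \<le> \<sigma>"
    proof -
      show "\<epsilon>\<^sup>2 \<le> 1" using eps by (intro power_le_one) (auto simp: \<epsilon>0_def)
      have "\<epsilon>\<^sup>2 \<le> (sqrt (\<sigma> / (16 * \<Lambda>)))\<^sup>2" using eps by (intro power_mono) (auto simp: \<epsilon>0_def)
      also have "\<dots> = \<sigma> / (16 * \<Lambda>)" using \<sigma> \<Lambda> by simp
      finally show "\<epsilon>\<^sup>2 * (16 * \<Lambda>) \<le> \<sigma>" using \<Lambda> by (simp add: field_simps)
    qed
    from complex_representative[OF u eps(1) \<Lambda>]
    obtain f g where moll: "mollifiable A f g" and fz: "\<And>x. x \<notin> A \<Longrightarrow> f x = 0" and gl: "l2 (g 1) + l2 (g 2) \<le> 2 * \<Lambda>"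
      and Qi: "integrable lborel (\<lambda>x. indicator A x * ((norm (f x))\<^sup>2 - 1)\<^sup>2)"
      and Q: "(\<integral>x. indicator A x * ((norm (f x))\<^sup>2 - 1)\<^sup>2 \<partial>lborel) \<le> 4 * \<epsilon>\<^sup>2 * \<Lambda>"
      and ab: "abdeg A V u = 1 / (2 * pi) * (\<integral>x. Phi f g x \<partial>lborel)" by blast
    interpret mollifiable A f g by fact
    show "\<exists>k::int. \<bar>2 * pi * abdeg A V u + 2 * pi * of_int k\<bar> \<le> 2"
    proof (cases "integrable lborel (Phi f g)")
      case False
      \<comment> \<open>The Bochner integral of a function that is not integrable is 0.\<close>
      then have "abdeg A V u = 0" using ab by (simp add: not_integrable_integral_eq)
      then show ?thesis by (intro exI[of _ 0]) simp
    next
      case True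
      have bulk: "\<bar>2 * pi * abdeg A V u + flux ?\<psi> f g\<bar> \<le> 1/2"
      proof -
        have "\<bar>(\<integral>x. Phi f g x \<partial>lborel) + flux ?\<psi> f g\<bar> \<le> 12 * a * (l2 (g 1) + l2 (g 2))"
          by (rule flux_Psi_near_bulk[OF moll a(1,2) True])
        also have "\<dots> \<le> 12 * a * (2 * \<Lambda>)" using gl a by (intro mult_left_mono) auto
        finally show ?thesis using a12 by (simp add: ab)
      qed
      have half: "1/2 > (0::real)" by simp
      obtain d1 where d1: "d1 > 0" "\<And>h. 0 < h \<Longrightarrow> h < d1 \<Longrightarrow> \<bar>(\<integral>x. bform ?\<psi> (mol h f) x \<partial>lborel) - flux ?\<psi> f g\<bar> \<le> 1/2"
        using flux_limit[OF C\<psi> K Kset_sub pz half] by blast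
      have s4: "\<sigma> / 4 > 0" using \<sigma> by simp
      obtain d2 where d2: "d2 > 0" "\<And>h. 0 < h \<Longrightarrow> h < d2 \<Longrightarrow> l2 (\<lambda>x. mol h f x - f x) < \<sigma> / 4"
        using mol_tendsto_L2[OF f s4] by blast
      obtain d3 where d3: "d3 > 0" "\<And>h x. 0 < h \<Longrightarrow> h < d3 \<Longrightarrow> x \<in> nbhd ?K (3 * \<rho>) \<Longrightarrow> cball x h \<subseteq> A"
        by (rule small_cballs[OF cN N3]) blast
      define h where "h = min d1 (min d2 d3) / 2"
      have h: "0 < h" "h < d1" "h < d2" "h < d3" using d1(1) d2(1) d3(1) by (auto simp: h_def)
      define w where "w = mol h f"
      have Cw: "C1c w" unfolding w_def by (rule mol_C1c[OF h(1) f])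
      \<comment> \<open>The gradient of \<open>w\<close> is controlled only where the ball of radius
        \<open>h\<close> lies in \<open>A\<close>. The cutoff removes all other points and leaves
        \<open>w\<close> unchanged near \<open>?K\<close>, outside which \<open>?\<psi>\<close> has
        zero gradient.\<close>
      define U where "U x = \<zeta> x *\<^sub>R w x" for x
      have CU: "C1c U" unfolding U_def[abs_def]
        by (rule C1c_bilinear[OF bounded_bilinear_scaleR C1c_C1[OF \<zeta>(1)] C1c_C1[OF Cw]]) (use Cw in simp)
      have pU: "pd i U x = \<zeta> x *\<^sub>R pd i w x + pd i \<zeta> x *\<^sub>R w x" for i x
        unfolding U_def[abs_def] by (rule C1_bounded_bilinear(2)[OF bounded_bilinear_scaleR C1c_C1[OF \<zeta>(1)] C1c_C1[OF Cw]])
      have Lm: "L2b (mol h F)" if "L2b F" for F :: "real^2 \<Rightarrow> complex"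
        by (rule CC_L2b[OF C1c_CC[OF mol_C1c[OF h(1) that]]])
      have sq: "integrable lborel (\<lambda>x. (norm (mol h (g i) x))\<^sup>2)" "integrable lborel (\<lambda>x. (norm (w x))\<^sup>2)" for i
        using Lm[OF g[of i]] Lm[OF f] by (auto simp: L2b_def w_def)
      have Ab: "measure lborel A \<ge> 0" "integrable lborel (indicat_real A)"
        using integrable_indicator_bounded[OF A_borel bA] by auto
      have lf: "l2 f \<le> 2 * measure lborel A + 4 * \<Lambda>"
      proof -
        have "l2 f \<le> (\<integral>x. 2 * indicator A x + indicator A x * ((norm (f x))\<^sup>2 - 1)\<^sup>2 \<partial>lborel)"
          unfolding l2_def
        proof (rule integral_mono)
          show "integrable lborel (\<lambda>x. (norm (f x))\<^sup>2)" using f by (simp add: L2b_def)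
          show "integrable lborel (\<lambda>x. 2 * indicator A x + indicator A x * ((norm (f x))\<^sup>2 - 1)\<^sup>2)"
            by (intro Bochner_Integration.integrable_add integrable_mult_right Qi Ab)
          fix x
          have "s \<le> 2 + (s - 1)\<^sup>2" for s :: real
            using sum_power2_ge_zero[of "s - 3/2" 0] by (simp add: power2_eq_square algebra_simps)
          then show "(norm (f x))\<^sup>2 \<le> 2 * indicator A x + indicator A x * ((norm (f x))\<^sup>2 - 1)\<^sup>2"
            using fz[of x] by (auto simp: indicator_def)
        qed
        also have "\<dots> = 2 * measure lborel A + (\<integral>x. indicator A x * ((norm (f x))\<^sup>2 - 1)\<^sup>2 \<partial>lborel)"
          using Qi Ab A_borel by simp
        also have "\<dots> \<le> 2 * measure lborel A + 4 * \<Lambda>"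
        proof -
          have "\<epsilon>\<^sup>2 * (4 * \<Lambda>) \<le> 1 * (4 * \<Lambda>)" by (rule mult_right_mono) (use eps1(1) \<Lambda> in auto)
          then have "4 * \<epsilon>\<^sup>2 * \<Lambda> \<le> 4 * \<Lambda>" by (simp add: mult_ac)
          then show ?thesis using Q by linarith
        qed
        finally show ?thesis .
      qed
      have gU: "gsq U x \<le> 2 * ((norm (mol h (g 1) x))\<^sup>2 + (norm (mol h (g 2) x))\<^sup>2) + 2 * Z * (norm (w x))\<^sup>2" for x
      proof (cases "x \<in> nbhd ?K (3 * \<rho>)")
        case True
        have pw: "pd i w x = mol h (g i) x" for i unfolding w_def by (rule pd_mol[OF h(1) d3(2)[OF h(1,4) True]])
        have s1: "(\<zeta> x)\<^sup>2 \<le> 1" using \<zeta>(3)[of x] by (simp add: abs_square_le_1)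
        have "(norm (pd i U x))\<^sup>2 \<le> 2 * (norm (mol h (g i) x))\<^sup>2 + 2 * ((pd i \<zeta> x)\<^sup>2 * (norm (w x))\<^sup>2)" for i
        proof -
          have "(norm (pd i U x))\<^sup>2 \<le> 2 * (norm (\<zeta> x *\<^sub>R mol h (g i) x))\<^sup>2 + 2 * (norm (pd i \<zeta> x *\<^sub>R w x))\<^sup>2"
            unfolding pU pw by (rule norm_add_sq)
          also have "\<dots> = 2 * ((\<zeta> x)\<^sup>2 * (norm (mol h (g i) x))\<^sup>2) + 2 * ((pd i \<zeta> x)\<^sup>2 * (norm (w x))\<^sup>2)"
            by (simp add: power_mult_distrib)
          also have "\<dots> \<le> 2 * (1 * (norm (mol h (g i) x))\<^sup>2) + 2 * ((pd i \<zeta> x)\<^sup>2 * (norm (w x))\<^sup>2)"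
            using s1 by (intro add_mono mult_left_mono mult_right_mono) auto
          finally show ?thesis by simp
        qed
        from add_mono[OF this[of 1] this[of 2]]
        have "gsq U x \<le> 2 * ((norm (mol h (g 1) x))\<^sup>2 + (norm (mol h (g 2) x))\<^sup>2) + 2 * (((pd 1 \<zeta> x)\<^sup>2 + (pd 2 \<zeta> x)\<^sup>2) * (norm (w x))\<^sup>2)"
          by (simp add: gsq_def algebra_simps)
        also have "\<dots> \<le> 2 * ((norm (mol h (g 1) x))\<^sup>2 + (norm (mol h (g 2) x))\<^sup>2) + 2 * (Z * (norm (w x))\<^sup>2)"
          by (intro add_left_mono mult_left_mono mult_right_mono Z) auto
        finally show ?thesis by simp
      next
        case False
        have "pd i U x = 0" for i
          by (rule pd_zero_outside[OF compact_imp_closed[OF cN[of "3 * \<rho>"]] _ False]) (simp add: U_def \<zeta>0)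
        then show ?thesis using Z(1) by (simp add: gsq_def)
      qed
      have dU: "dir U \<le> \<Lambda>'"
      proof -
        have "dir U \<le> (\<integral>x. 2 * ((norm (mol h (g 1) x))\<^sup>2 + (norm (mol h (g 2) x))\<^sup>2) + 2 * Z * (norm (w x))\<^sup>2 \<partial>lborel)"
          unfolding dir_def
          by (rule integral_mono[OF gsq_integrable[OF CU] _ gU])
            (intro Bochner_Integration.integrable_add integrable_mult_right sq)
        also have "\<dots> = 2 * (l2 (mol h (g 1)) + l2 (mol h (g 2))) + 2 * Z * l2 w"
          unfolding l2_def using sq by simp
        also have "\<dots> \<le> 2 * (2 * \<Lambda>) + 2 * Z * (2 * measure lborel A + 4 * \<Lambda>)"
        proof (intro add_mono mult_left_mono)
          show "l2 (mol h (g 1)) + l2 (mol h (g 2)) \<le> 2 * \<Lambda>"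
            using mol_l2[OF h(1) g[of 1]] mol_l2[OF h(1) g[of 2]] gl by linarith
          show "l2 w \<le> 2 * measure lborel A + 4 * \<Lambda>" using mol_l2[OF h(1) f] lf by (simp add: w_def)
        qed (use Z in auto)
        finally show ?thesis by (simp add: \<Lambda>'_def)
      qed
      have NK: "nbhd ?K \<rho> \<subseteq> A" using N3 \<rho> unfolding nbhd_def by fastforce
      have mod: "(\<integral>x. indicator (nbhd ?K \<rho>) x * (1 - norm (U x))\<^sup>2 \<partial>lborel) \<le> \<sigma>"
      proof -
        have Ld: "integrable lborel (\<lambda>x. (norm (w x - f x))\<^sup>2)"
          using L2b_diff(1)[OF Lm[OF f] f] by (simp add: L2b_def w_def)
        have "(\<integral>x. indicator (nbhd ?K \<rho>) x * (1 - norm (U x))\<^sup>2 \<partial>lborel) \<le> (\<integral>x. 2 * (indicator A x * ((norm (f x))\<^sup>2 - 1)\<^sup>2) + 2 * (norm (w x - f x))\<^sup>2 \<partial>lborel)"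
        proof (rule integral_mono)
          have "continuous_on (nbhd ?K \<rho>) (\<lambda>x. (1 - norm (U x))\<^sup>2)" by (intro continuous_intros C1_cont C1c_C1 CU)
          from borel_integrable_compact[OF cN this]
          show "integrable lborel (\<lambda>x. indicator (nbhd ?K \<rho>) x * (1 - norm (U x))\<^sup>2)" by simp
          show "integrable lborel (\<lambda>x. 2 * (indicator A x * ((norm (f x))\<^sup>2 - 1)\<^sup>2) + 2 * (norm (w x - f x))\<^sup>2)"
            by (intro Bochner_Integration.integrable_add integrable_mult_right Qi Ld)
          fix x
          show "indicator (nbhd ?K \<rho>) x * (1 - norm (U x))\<^sup>2 \<le> 2 * (indicator A x * ((norm (f x))\<^sup>2 - 1)\<^sup>2) + 2 * (norm (w x - f x))\<^sup>2"
          proof (cases "x \<in> nbhd ?K \<rho>")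
            case True
            have Ux: "U x = w x" using \<zeta>(2)[OF True] by (simp add: U_def)
            let ?n = "norm (f x)"
            \<comment> \<open>The factor (1 + n)^2 >= 1 relates the defect of the modulus to the
              potential in the energy.\<close>
            have n: "(1 - ?n)\<^sup>2 \<le> (?n\<^sup>2 - 1)\<^sup>2"
            proof -
              have "(1 - ?n)\<^sup>2 * 1 \<le> (1 - ?n)\<^sup>2 * (1 + ?n)\<^sup>2" by (intro mult_left_mono one_le_power) auto
              also have "\<dots> = (?n\<^sup>2 - 1)\<^sup>2" by (simp add: power2_eq_square algebra_simps)
              finally show ?thesis by simp
            qed
            have "\<bar>1 - norm (w x)\<bar> \<le> \<bar>1 - ?n\<bar> + norm (w x - f x)" using norm_triangle_ineq3[of "w x" "f x"] by linarith
            then have "\<bar>1 - norm (w x)\<bar>\<^sup>2 \<le> (\<bar>1 - ?n\<bar> + norm (w x - f x))\<^sup>2" by (rule power_mono) simp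
            also have "\<dots> \<le> 2 * \<bar>1 - ?n\<bar>\<^sup>2 + 2 * (norm (w x - f x))\<^sup>2"
              using norm_add_sq[of "\<bar>1 - ?n\<bar>" "norm (w x - f x)"] by simp
            finally show ?thesis using n True NK by (auto simp: Ux)
          qed simp
        qed
        also have "\<dots> = 2 * (\<integral>x. indicator A x * ((norm (f x))\<^sup>2 - 1)\<^sup>2 \<partial>lborel) + 2 * l2 (\<lambda>x. w x - f x)"
          unfolding l2_def using Qi Ld by simp
        also have "\<dots> \<le> 2 * (4 * \<epsilon>\<^sup>2 * \<Lambda>) + 2 * (\<sigma> / 4)"
          using Q d2(2)[OF h(1,3)] unfolding w_def by (intro add_mono mult_left_mono) auto
        also have "\<dots> \<le> \<sigma>" using eps1(2) by simp
        finally show ?thesis .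
      qed
      obtain k :: int where k: "\<bar>(\<integral>x. bform ?\<psi> U x \<partial>lborel) - 2 * pi * of_int k\<bar> \<le> 1" using near[OF CU dU mod] by blast
      have "bform ?\<psi> U x = bform ?\<psi> w x" for x
      proof (cases "x \<in> ?K")
        case True
        have e: "U y = w y" if "y \<in> ball x \<rho>" for y
        proof -
          have "y \<in> nbhd ?K \<rho>" using True that by (force simp: nbhd_def)
          then show ?thesis using \<zeta>(2) by (simp add: U_def)
        qed
        have "pd i U x = pd i w x" for i by (rule pd_cong_nhd[of "ball x \<rho>"]) (use \<rho> e in auto)
        then show ?thesis using e[of x] \<rho> by (simp add: bform_def)
      qed (simp add: bform_def pz)
      then have "(\<integral>x. bform ?\<psi> U x \<partial>lborel) = (\<integral>x. bform ?\<psi> (mol h f) x \<partial>lborel)" by (simp add: w_def)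
      then have "\<bar>flux ?\<psi> f g - 2 * pi * of_int k\<bar> \<le> 3/2" using k d1(2)[OF h(1,2)] by linarith
      then have "\<bar>2 * pi * abdeg A V u + 2 * pi * of_int k\<bar> \<le> 2" using bulk by linarith
      then show ?thesis by blast
    qed
  qed
qed

end

theorem proposition2:
  fixes \<Omega> \<omega> A :: "(real^2) set" and V :: "real^2 \<Rightarrow> real" and \<Lambda> :: real
  assumes "smooth_domain \<Omega>" and "bounded \<Omega>" and "simply_connected \<Omega>"
    and "smooth_domain \<omega>" and "bounded \<omega>" and "simply_connected \<omega>"
    and "closure \<omega> \<subseteq> \<Omega>"
    and "A = \<Omega> - closure \<omega>"
    and "annulus_potential \<Omega> \<omega> V"
    and "\<Lambda> > 0"
  shows "\<exists>\<epsilon>\<^sub>0>0. \<forall>\<epsilon>. 0 < \<epsilon> \<and> \<epsilon> < \<epsilon>\<^sub>0 \<longrightarrow>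
    (\<forall>(d::int) (u::real^2 \<Rightarrow> real^2). H1_vec_on A u \<and> GL_energy A \<epsilon> u \<le> ennreal \<Lambda> \<longrightarrow>
      (of_int d - 1/2 \<le> abdeg A V u \<and> abdeg A V u \<le> of_int d + 1/2
       \<longleftrightarrow> of_int d - 1/2 < abdeg A V u \<and> abdeg A V u < of_int d + 1/2))"
proof -
  interpret annulus \<Omega> \<omega> A V
    by standard (use assms in \<open>auto simp: smooth_domain_def\<close>)
  obtain \<epsilon>0 where e: "\<epsilon>0 > 0" and near: "\<And>\<epsilon> u. 0 < \<epsilon> \<Longrightarrow> \<epsilon> < \<epsilon>0 \<Longrightarrow> H1_vec_on A u \<Longrightarrow> GL_energy A \<epsilon> u \<le> ennreal \<Lambda> \<Longrightarrow>
     \<exists>k::int. \<bar>2 * pi * abdeg A V u + 2 * pi * of_int k\<bar> \<le> 2"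
    using abdeg_near_integer[OF assms(10)] by blast
  show ?thesis
  proof (intro exI[of _ \<epsilon>0] conjI e allI impI)
    fix \<epsilon> and d :: int and u :: "real^2 \<Rightarrow> real^2"
    assume "0 < \<epsilon> \<and> \<epsilon> < \<epsilon>0" "H1_vec_on A u \<and> GL_energy A \<epsilon> u \<le> ennreal \<Lambda>"
    then obtain k :: int where "\<bar>2 * pi * abdeg A V u + 2 * pi * of_int k\<bar> \<le> 2" using near by blast
    from half_integer_excluded[OF this, of d]
    show "of_int d - 1/2 \<le> abdeg A V u \<and> abdeg A V u \<le> of_int d + 1/2
       \<longleftrightarrow> of_int d - 1/2 < abdeg A V u \<and> abdeg A V u < of_int d + 1/2" by auto
  qed
qed

end
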